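(* Let $n\ge1$ and let $T$ be one of $[a,b]$ ($a<b$ finite), $[a,\infty)$, or $(-\infty,\infty)$ with $n$ even. Let $\Sigma$ be a positive definite $(n+1)\times(n+1)$ matrix, $K_n=\{c\in\mathbb{R}^{n+1}:c^\top\psi_n(t)\ge0\ \forall t\in T\}$ with $\psi_n(t)=(1,t,\ldots,t^n)^\top$, and $\mathbb{S}^n=\{x\in\mathbb{R}^{n+1}:x^\top\Sigma^{-1}x=1\}$. Put $\alpha=(\cos\theta,\sin\theta)$; let $\zeta$ collect those of the variables $\theta,\gamma,\widetilde\gamma$ that appear in the integrand, and $d\zeta$ be Lebesgue measure. For a smooth map $g=g(\zeta)\in\mathbb{R}^{n+1}$ write $J[g]=\det\bigl\{(\partial g/\partial\zeta)^\top\Sigma^{-1}(\partial g/\partial\zeta)\bigr\}^{1/2}$. Then $$\mathrm{Vol}_n(K_n\cap\mathbb{S}^n)=\int_{(0,\frac\pi2)\times\Delta_{n-1}}J[\bar\varphi_n(\alpha,\gamma)]\,d\zeta,$$ and when $n\ge2$, $$\mathrm{Vol}_{n-1}(\partial K_n\cap\mathbb{S}^n)=I_1+I_2+I_3+I_4,$$ where $$I_1=\begin{cases}\int_{(0,\frac\pi2)\times\Delta_{n-3}\times T}J[\bar\varphi_n^{(2)}(\alpha,\gamma,\widetilde\gamma)]\,d\zeta&(n\ge3),\\ \int_TJ[\bar\varphi_2^{(2)}(\widetilde\gamma)]\,d\widetilde\gamma&(n=2),\end{cases}$$ $$I_2=\int_{(0,\frac\pi2)\times\Delta_{n-2}}J[\bar\varphi_n^{(1)}(\alpha,\gamma,a)]\,d\zeta\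 \text{ if }T=[a,b]\text{ or }[a,\infty),\qquad I_2=0\text{ if }T=(-\infty,\infty),$$ $$I_3=\int_{(0,\frac\pi2)\times\Delta_{n-2}}J[\bar\varphi_n^{(1)}(\alpha,\gamma,b)]\,d\zeta\ \text{ if }T=[a,b],\qquad I_3=0\text{ otherwise},$$ $$I_4=\int_{(0,\frac\pi2)\times\Delta_{n-2}}J[\bar\varphi_{n-1}(\alpha,\gamma)]\,d\zeta\ \text{ if }T=[a,\infty),\qquad I_4=0\text{ otherwise}.$$
   Context: $\mathrm{Vol}_d$ is the $d$-dimensional volume (Hausdorff measure) induced by the inner product $x^\top\Sigma^{-1}y$; $\Vert x\Vert_{\Sigma^{-1}}=\sqrt{x^\top\Sigma^{-1}x}$. $\Delta_m=\{(\gamma_1,\ldots,\gamma_m)\in(\mathrm{int}\,T)^m:\gamma_1<\cdots<\gamma_m\}$; a factor $\Delta_0$ is dropped together with the variable $\gamma$. $\prod_{j=1}^0=1$. $\mathbb{R}_+=(0,\infty)$. For $\alpha=(\alpha_1,\alpha_2)\in\mathbb{R}_+^2$ and $\gamma\in\Delta_{k-1}$ define polynomials $p_k(t;\alpha,\gamma)$, $k\ge1$: (i) $T=[a,b]$: $p_{2m}=\alpha_1\prod_{j=1}^m(t-\gamma_{2j-1})^2+\alpha_2(t-a)(b-t)\prod_{j=1}^{m-1}(t-\gamma_{2j})^2$; $\ p_{2m+1}=\alpha_1(t-a)\prod_{j=1}^m(t-\gamma_{2j})^2+\alpha_2(b-t)\prod_{j=1}^m(t-\gamma_{2j-1})^2$.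 (ii) $T=[a,\infty)$: $p_{2m}=\alpha_1\prod_{j=1}^m(t-\gamma_{2j-1})^2+\alpha_2(t-a)\prod_{j=1}^{m-1}(t-\gamma_{2j})^2$; $\ p_{2m+1}=\alpha_1(t-a)\prod_{j=1}^m(t-\gamma_{2j})^2+\alpha_2\prod_{j=1}^m(t-\gamma_{2j-1})^2$. (iii) $T=(-\infty,\infty)$ (only even degree): $p_{2m}=\alpha_1\prod_{j=1}^m(t-\gamma_{2j-1})^2+\alpha_2\prod_{j=1}^{m-1}(t-\gamma_{2j})^2$. Coefficient vectors: $p_k(t;\alpha,\gamma)=\varphi_k(\alpha,\gamma)^\top\psi_k(t)$. For $i=1,2$ with $n-i\ge1$, $\gamma\in\Delta_{n-1-i}$, $\widetilde\gamma\in T$: $(t-\widetilde\gamma)^ip_{n-i}(t;\alpha,\gamma)=\varphi^{(i)}_n(\alpha,\gamma,\widetilde\gamma)^\top\psi_n(t)$. For $n=2$: $\alpha_1(t-\widetilde\gamma)^2=\varphi^{(2)}_2(\alpha_1,\widetilde\gamma)^\top\psi_2(t)$. In $I_4$, $\varphi_{n-1}(\alpha,\gamma)\in\mathbb{R}^n$ is regarded as a vector of $\mathbb{R}^{n+1}$ by appending a last coordinate $0$ (the coefficient of $t^n$). Normalized maps: $\bar\varphi_n=\varphi_n/\Vert\varphi_n\Vert_{\Sigma^{-1}}$, $\bar\varphi_{n-1}=\varphi_{n-1}/\Vert\varphi_{n-1}\Vert_{\Sigma^{-1}}$ (after the embedding in $\mathbb{R}^{n+1}$), $\bar\varphi^{(i)}_n=\varphi^{(i)}_n/\Vert\varphi^{(i)}_n\Vert_{\Sigma^{-1}}$,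 and $\bar\varphi_2^{(2)}(\widetilde\gamma)=\varphi_2^{(2)}(1,\widetilde\gamma)/\Vert\varphi_2^{(2)}(1,\widetilde\gamma)\Vert_{\Sigma^{-1}}$. *)

theory Defs
  imports "HOL-Analysis.Analysis" "Jordan_Normal_Form.Gauss_Jordan_Elimination"
    "Jordan_Normal_Form.Determinant"
begin

(* A vector of R^N is a function nat => real that vanishes from index N on, i.e. a point of
   the library's Euclidean_space N; the coordinates are numbered 0, ..., N - 1.  The coefficient
   function of a polynomial of degree at most n is thus a vector of R^(n+1), and R^n is
   contained in R^(n+1) by appending a last coordinate 0. *)

subsection \<open>The inner product given by the inverse of a positive definite matrix\<close>

definition pos_def_mat :: "nat \<Rightarrow> real mat \<Rightarrow> bool" where
  "pos_def_mat N S \<longleftrightarrow> S \<in> carrier_mat N N \<and> transpose_mat S = S \<and>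
     (\<forall>v \<in> carrier_vec N. v \<noteq> 0\<^sub>v N \<longrightarrow> 0 < scalar_prod v (mult_mat_vec S v))"

definition inv_mat :: "real mat \<Rightarrow> real mat" where
  "inv_mat S = the (mat_inverse S)"

definition inner_inv :: "real mat \<Rightarrow> (nat \<Rightarrow> real) \<Rightarrow> (nat \<Rightarrow> real) \<Rightarrow> real" where
  "inner_inv S x y = (\<Sum>i<dim_row S. \<Sum>j<dim_row S. x i * inv_mat S $$ (i, j) * y j)"

definition norm_inv :: "real mat \<Rightarrow> (nat \<Rightarrow> real) \<Rightarrow> real" where
  "norm_inv S x = sqrt (inner_inv S x x)"

definition normalized :: "real mat \<Rightarrow> (nat \<Rightarrow> real) \<Rightarrow> nat \<Rightarrow> real" where
  "normalized S v = (\<lambda>i. v i / norm_inv S v)"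

definition unit_sphere :: "real mat \<Rightarrow> (nat \<Rightarrow> real) set" where
  "unit_sphere S = {x \<in> topspace (Euclidean_space (dim_row S)). inner_inv S x x = 1}"

subsection \<open>Hausdorff measure\<close>

definition diam_wrt :: "('a \<Rightarrow> 'a \<Rightarrow> real) \<Rightarrow> 'a set \<Rightarrow> ennreal" where
  "diam_wrt \<rho> U = (SUP x\<in>U. SUP y\<in>U. ennreal (\<rho> x y))"

(* The factor (volume of the d-dimensional unit ball) / 2^d is the usual normalization, which
   makes the measure agree with Lebesgue measure on a d-dimensional Euclidean space.  Empty
   covering sets are treated separately because of 0 ^ 0 = 1. *)
definition hausdorff_measure :: "('a \<Rightarrow> 'a \<Rightarrow> real) \<Rightarrow> nat \<Rightarrow> 'a set \<Rightarrow> ennreal" where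
  "hausdorff_measure \<rho> d A =
     (SUP \<delta>\<in>{0<..}.
       INF U\<in>{U :: nat \<Rightarrow> 'a set. A \<subseteq> (\<Union>i. U i) \<and> (\<forall>i. diam_wrt \<rho> (U i) \<le> ennreal \<delta>)}.
         \<Sum>i. if U i = {} then 0
             else ennreal (unit_ball_vol (real d) / 2 ^ d) * diam_wrt \<rho> (U i) ^ d)"

definition Vol :: "real mat \<Rightarrow> nat \<Rightarrow> (nat \<Rightarrow> real) set \<Rightarrow> ennreal" where
  "Vol S d = hausdorff_measure (\<lambda>x y. norm_inv S (\<lambda>i. x i - y i)) d"

subsection \<open>The cone of nonnegative polynomials\<close>

datatype poly_domain =
    Segment real real
  | Half_line real
  | Full_line

fun points :: "poly_domain \<Rightarrow> real set" where
  "points (Segment a b) = {a..b}"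
| "points (Half_line a) = {a..}"
| "points Full_line = UNIV"

fun admissible :: "nat \<Rightarrow> poly_domain \<Rightarrow> bool" where
  "admissible n (Segment a b) \<longleftrightarrow> a < b"
| "admissible n (Half_line a) \<longleftrightarrow> True"
| "admissible n Full_line \<longleftrightarrow> even n"

definition nonneg_cone :: "nat \<Rightarrow> poly_domain \<Rightarrow> (nat \<Rightarrow> real) set" where
  "nonneg_cone n T =
     {c \<in> topspace (Euclidean_space (n + 1)). \<forall>t \<in> points T. (\<Sum>i\<le>n. c i * t ^ i) \<ge> 0}"

subsection \<open>The parametrizing polynomials\<close>

(* A tuple (gamma_1, ..., gamma_m) is read off a function nat => real at the arguments
   1, ..., m; the values at other arguments are irrelevant. *)
definition Delta :: "poly_domain \<Rightarrow> nat \<Rightarrow> (nat \<Rightarrow> real) set" where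
  "Delta T m = {\<gamma>. (\<forall>j\<in>{1..m}. \<gamma> j \<in> interior (points T)) \<and> strict_mono_on {1..m} \<gamma>}"

(* par_poly T k x y g is p_k(t; (x, y), g) for k >= 1; on the full line it is meaningful
   for even k only. *)
fun par_poly :: "poly_domain \<Rightarrow> nat \<Rightarrow> real \<Rightarrow> real \<Rightarrow> (nat \<Rightarrow> real) \<Rightarrow> real poly" where
  "par_poly (Segment a b) k \<alpha>1 \<alpha>2 \<gamma> =
     (let m = k div 2 in
      if even k then
        Polynomial.smult \<alpha>1 (\<Prod>j=1..m. [:- \<gamma> (2 * j - 1), 1:] ^ 2)
        + Polynomial.smult \<alpha>2 ([:- a, 1:] * [:b, - 1:] * (\<Prod>j=1..m - 1. [:- \<gamma> (2 * j), 1:] ^ 2))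
      else
        Polynomial.smult \<alpha>1 ([:- a, 1:] * (\<Prod>j=1..m. [:- \<gamma> (2 * j), 1:] ^ 2))
        + Polynomial.smult \<alpha>2 ([:b, - 1:] * (\<Prod>j=1..m. [:- \<gamma> (2 * j - 1), 1:] ^ 2)))"
| "par_poly (Half_line a) k \<alpha>1 \<alpha>2 \<gamma> =
     (let m = k div 2 in
      if even k then
        Polynomial.smult \<alpha>1 (\<Prod>j=1..m. [:- \<gamma> (2 * j - 1), 1:] ^ 2)
        + Polynomial.smult \<alpha>2 ([:- a, 1:] * (\<Prod>j=1..m - 1. [:- \<gamma> (2 * j), 1:] ^ 2))
      else
        Polynomial.smult \<alpha>1 ([:- a, 1:] * (\<Prod>j=1..m. [:- \<gamma> (2 * j), 1:] ^ 2))
        + Polynomial.smult \<alpha>2 (\<Prod>j=1..m. [:- \<gamma> (2 * j - 1), 1:] ^ 2))"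
| "par_poly Full_line k \<alpha>1 \<alpha>2 \<gamma> =
     (let m = k div 2 in
        Polynomial.smult \<alpha>1 (\<Prod>j=1..m. [:- \<gamma> (2 * j - 1), 1:] ^ 2)
        + Polynomial.smult \<alpha>2 (\<Prod>j=1..m - 1. [:- \<gamma> (2 * j), 1:] ^ 2))"

definition phi :: "poly_domain \<Rightarrow> nat \<Rightarrow> real \<Rightarrow> real \<Rightarrow> (nat \<Rightarrow> real) \<Rightarrow> nat \<Rightarrow> real" where
  "phi T k \<alpha>1 \<alpha>2 \<gamma> = Polynomial.coeff (par_poly T k \<alpha>1 \<alpha>2 \<gamma>)"

definition phi_zero :: "poly_domain \<Rightarrow> nat \<Rightarrow> nat \<Rightarrow> real \<Rightarrow> real \<Rightarrow> (nat \<Rightarrow> real) \<Rightarrow> real \<Rightarrow> nat \<Rightarrow> real"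
  where
  "phi_zero T i n \<alpha>1 \<alpha>2 \<gamma> c = Polynomial.coeff ([:- c, 1:] ^ i * par_poly T (n - i) \<alpha>1 \<alpha>2 \<gamma>)"

definition phi2_double :: "real \<Rightarrow> real \<Rightarrow> nat \<Rightarrow> real" where
  "phi2_double \<alpha>1 c = Polynomial.coeff (Polynomial.smult \<alpha>1 ([:- c, 1:] ^ 2))"

subsection \<open>Jacobians and the integrals\<close>

(* The d real variables of a parametrization g are z 0, ..., z (d - 1). *)
definition jacobi_mat :: "nat \<Rightarrow> nat \<Rightarrow> ((nat \<Rightarrow> real) \<Rightarrow> nat \<Rightarrow> real) \<Rightarrow> (nat \<Rightarrow> real) \<Rightarrow> real mat" where
  "jacobi_mat N d g z = Matrix.mat N d (\<lambda>(i, j). deriv (\<lambda>s. g (z(j := s)) i) (z j))"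

definition J :: "real mat \<Rightarrow> nat \<Rightarrow> ((nat \<Rightarrow> real) \<Rightarrow> nat \<Rightarrow> real) \<Rightarrow> (nat \<Rightarrow> real) \<Rightarrow> real" where
  "J S d g z = (let D = jacobi_mat (dim_row S) d g z in
     sqrt (Determinant.det (transpose_mat D * inv_mat S * D)))"

definition J_integral ::
    "real mat \<Rightarrow> nat \<Rightarrow> (nat \<Rightarrow> real) set \<Rightarrow> ((nat \<Rightarrow> real) \<Rightarrow> nat \<Rightarrow> real) \<Rightarrow> ennreal" where
  "J_integral S d D g = (\<integral>\<^sup>+ z\<in>D. ennreal (J S d g z) \<partial>(\<Pi>\<^sub>M i\<in>{..<d}. lborel))"

(* In the integrals below theta = z 0, gamma_j = z j for j >= 1, and the double zero
   (tilde gamma), if present, is the last variable.  Hence z itself serves as gamma. *)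

definition I1 :: "real mat \<Rightarrow> nat \<Rightarrow> poly_domain \<Rightarrow> ennreal" where
  "I1 S n T =
     (if n = 2 then
        J_integral S 1 {z. z 0 \<in> points T} (\<lambda>z. normalized S (phi2_double 1 (z 0)))
      else
        J_integral S (n - 1)
          {z. z 0 \<in> {0<..<pi/2} \<and> z \<in> Delta T (n - 3) \<and> z (n - 2) \<in> points T}
          (\<lambda>z. normalized S (phi_zero T 2 n (cos (z 0)) (sin (z 0)) z (z (n - 2)))))"

definition I_end :: "real mat \<Rightarrow> nat \<Rightarrow> poly_domain \<Rightarrow> real \<Rightarrow> ennreal" where
  "I_end S n T e =
     J_integral S (n - 1) {z. z 0 \<in> {0<..<pi/2} \<and> z \<in> Delta T (n - 2)}
       (\<lambda>z. normalized S (phi_zero T 1 n (cos (z 0)) (sin (z 0)) z e))"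

definition I2 :: "real mat \<Rightarrow> nat \<Rightarrow> poly_domain \<Rightarrow> ennreal" where
  "I2 S n T = (case T of Segment a b \<Rightarrow> I_end S n T a | Half_line a \<Rightarrow> I_end S n T a | Full_line \<Rightarrow> 0)"

definition I3 :: "real mat \<Rightarrow> nat \<Rightarrow> poly_domain \<Rightarrow> ennreal" where
  "I3 S n T = (case T of Segment a b \<Rightarrow> I_end S n T b | Half_line a \<Rightarrow> 0 | Full_line \<Rightarrow> 0)"

definition I4 :: "real mat \<Rightarrow> nat \<Rightarrow> poly_domain \<Rightarrow> ennreal" where
  "I4 S n T =
     (case T of
        Segment a b \<Rightarrow> 0
      | Half_line a \<Rightarrow>
          J_integral S (n - 1) {z. z 0 \<in> {0<..<pi/2} \<and> z \<in> Delta T (n - 2)}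
            (\<lambda>z. normalized S (phi T (n - 1) (cos (z 0)) (sin (z 0)) z))
      | Full_line \<Rightarrow> 0)"

end

theory Submission
  imports Defs "HOL-Computational_Algebra.Fundamental_Theorem_Algebra"
begin

text \<open>
  Up to a positive factor, a polynomial of degree at most \<open>n\<close> that is strictly positive on \<open>T\<close>
  (including at infinity) is \<open>p\<^sub>n(t; \<alpha>, \<gamma>)\<close> for exactly one pair \<open>(\<alpha>, \<gamma>)\<close> with \<open>\<alpha>\<close> on the unit circle. On the
  full line this follows by splitting \<open>p = \<bar>h\<bar>\<^sup>2\<close> with \<open>h\<close> having its zeros in a half plane: the real and
  the imaginary part of \<open>h\<close> have interlacing zeros. The half line is reduced to the full line by a
  squaring substitution, the segment to the half line by a Moebius transformation; uniqueness is a sign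
  change argument. A point of the boundary of the cone is a polynomial with a double zero inside \<open>T\<close>,
  with a zero at an end of \<open>T\<close>, or with vanishing leading coefficient, and removing this factor gives a
  polynomial that is strictly positive again, except on finitely many families with fewer parameters,
  which have measure 0.

  The integrals arise from the area formula for injective \<open>C\<^sup>1\<close> maps into a space with a norm given by a
  quadratic form. Locally such a map is nearly an isometry for the pull-back quadratic form, so that the
  formula is reduced to linear maps, and there the isodiametric inequality, obtained from the
  Brunn-Minkowski (Prekopa-Leindler) inequality, relates the Hausdorff measure to Lebesgue measure.
\<close>

subsection \<open>Hausdorff measure\<close>

text \<open>The volume is treated as an outer measure: no measurability of images is established,
  and additivity is used only for sets at positive distance. Upper bounds therefore come from
  countable subadditivity over dyadic cubes, while lower bounds pass to finitely many compact pieces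
  of the parameter domains, whose disjoint images automatically have positive distance.

  The upper half of the area formula holds for every C1 map on an open set, also where the Jacobian
  vanishes. So it disposes of the degenerate families as well: a parametrization that ignores one of
  its variables has Jacobian 0, and its image is null. The lower half is restricted to the open set
  where the Jacobian is positive; there the Gram matrix itself defines a norm.

  The variables are counted as follows. Up to a positive factor, degree n gives one angle and n - 1
  nodes, that is n variables. Removing a double zero costs two degrees and gives back the position
  of the zero; removing a zero at an end, or the leading coefficient on the half line, costs one
  degree. So each boundary piece has n - 1 variables, and a second defect costs a further
  one.\<close>

definition hcost :: "('a \<Rightarrow> 'a \<Rightarrow> real) \<Rightarrow> nat \<Rightarrow> 'a set \<Rightarrow> ennreal" where
  "hcost \<rho> d V = (if V = {} then 0 else ennreal (unit_ball_vol (real d) / 2 ^ d) * diam_wrt \<rho> V ^ d)"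

text \<open>The bound \<delta> is an \<open>ennreal\<close> so that it may be infinite. With an
  infinite bound the covering sets are unrestricted; \<open>unit_content\<close> relies on
  this.\<close>

definition hcontent :: "('a \<Rightarrow> 'a \<Rightarrow> real) \<Rightarrow> nat \<Rightarrow> ennreal \<Rightarrow> 'a set \<Rightarrow> ennreal" where
  "hcontent \<rho> d \<delta> A =
     (INF U\<in>{U :: nat \<Rightarrow> 'a set. A \<subseteq> (\<Union>i. U i) \<and> (\<forall>i. diam_wrt \<rho> (U i) \<le> \<delta>)}. \<Sum>i. hcost \<rho> d (U i))"

lemma hausdorff_measure_eq: "hausdorff_measure \<rho> d A = (SUP \<delta>\<in>{0<..}. hcontent \<rho> d (ennreal \<delta>) A)"
  unfolding hausdorff_measure_def hcontent_def hcost_def by simp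

lemma diam_wrt_mono: "U \<subseteq> V \<Longrightarrow> diam_wrt \<rho> U \<le> diam_wrt \<rho> V"
  unfolding diam_wrt_def by (intro SUP_mono) (meson SUP_subset_mono order_refl subsetD)

lemma diam_wrt_empty [simp]: "diam_wrt \<rho> {} = 0"
  by (simp add: diam_wrt_def bot_ennreal)

lemma diam_wrt_upper: "x \<in> U \<Longrightarrow> y \<in> U \<Longrightarrow> ennreal (\<rho> x y) \<le> diam_wrt \<rho> U"
  unfolding diam_wrt_def by (meson SUP_upper2 SUP_upper)

lemma diam_wrt_least: "(\<And>x y. x \<in> U \<Longrightarrow> y \<in> U \<Longrightarrow> ennreal (\<rho> x y) \<le> D) \<Longrightarrow> diam_wrt \<rho> U \<le> D"
  unfolding diam_wrt_def by (intro SUP_least) auto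

lemma hcost_empty [simp]: "hcost \<rho> d {} = 0"
  by (simp add: hcost_def)

lemma hcost_mono: "U \<subseteq> V \<Longrightarrow> hcost \<rho> d U \<le> hcost \<rho> d V"
  unfolding hcost_def using diam_wrt_mono[of U V \<rho>]
  by (auto intro!: mult_left_mono power_mono)

lemma hcontent_upper:
  "A \<subseteq> (\<Union>i. U i) \<Longrightarrow> (\<And>i. diam_wrt \<rho> (U i) \<le> \<delta>) \<Longrightarrow> hcontent \<rho> d \<delta> A \<le> (\<Sum>i. hcost \<rho> d (U i))"
  unfolding hcontent_def by (intro INF_lower) auto

lemma hcontent_greatest:
  "(\<And>U. A \<subseteq> (\<Union>i. U i) \<Longrightarrow> (\<And>i. diam_wrt \<rho> (U i) \<le> \<delta>) \<Longrightarrow> c \<le> (\<Sum>i. hcost \<rho> d (U i))) \<Longrightarrow> c \<le> hcontent \<rho> d \<delta> A"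
  unfolding hcontent_def by (intro INF_greatest) auto

lemma hcontent_mono: "A \<subseteq> B \<Longrightarrow> hcontent \<rho> d \<delta> A \<le> hcontent \<rho> d \<delta> B"
  by (rule hcontent_greatest, rule hcontent_upper) auto

lemma hcontent_antimono: "\<delta> \<le> \<delta>' \<Longrightarrow> hcontent \<rho> d \<delta>' A \<le> hcontent \<rho> d \<delta> A"
  by (rule hcontent_greatest, rule hcontent_upper) (auto intro: order_trans)

lemma hcontent_single: "diam_wrt \<rho> A \<le> \<delta> \<Longrightarrow> hcontent \<rho> d \<delta> A \<le> hcost \<rho> d A"
proof -
  assume "diam_wrt \<rho> A \<le> \<delta>"
  then have "hcontent \<rho> d \<delta> A \<le> (\<Sum>i::nat. hcost \<rho> d (if i = 0 then A else {}))"
    by (intro hcontent_upper) (auto intro!: exI[of _ 0])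
  also have "\<dots> = (\<Sum>i\<in>{0::nat}. hcost \<rho> d (if i = 0 then A else {}))"
    by (rule suminf_finite) auto
  finally show ?thesis by simp
qed

lemma hcontent_empty [simp]: "hcontent \<rho> d \<delta> {} = 0"
  using hcontent_single[of \<rho> "{}" \<delta> d] by simp

text \<open>Intersecting the sets of a cover with \<open>A\<close> does not raise the cost and
  brings every diameter below that of \<open>A\<close>, so restricting to small sets costs nothing
  at scales above the diameter of \<open>A\<close>.\<close>

lemma hcontent_restrict_diam: "diam_wrt \<rho> A \<le> \<delta> \<Longrightarrow> hcontent \<rho> d \<delta> A \<le> hcontent \<rho> d \<delta>' A"
proof (rule hcontent_greatest)
  fix U :: "nat \<Rightarrow> 'a set" assume *: "diam_wrt \<rho> A \<le> \<delta>" "A \<subseteq> (\<Union>i. U i)"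
  have "hcontent \<rho> d \<delta> A \<le> (\<Sum>i. hcost \<rho> d (U i \<inter> A))"
  proof (rule hcontent_upper)
    fix i show "diam_wrt \<rho> (U i \<inter> A) \<le> \<delta>"
      using diam_wrt_mono[of "U i \<inter> A" A \<rho>] * by auto
  qed (use * in auto)
  also have "\<dots> \<le> (\<Sum>i. hcost \<rho> d (U i))" by (intro suminf_le hcost_mono) auto
  finally show "hcontent \<rho> d \<delta> A \<le> (\<Sum>i. hcost \<rho> d (U i))" .
qed

lemma hcontent_UN: "hcontent \<rho> d \<delta> (\<Union>n::nat. A n) \<le> (\<Sum>n. hcontent \<rho> d \<delta> (A n))"
proof (rule ennreal_le_epsilon)
  fix e :: real assume fin: "(\<Sum>n. hcontent \<rho> d \<delta> (A n)) < Orderings.top" and e: "0 < e"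
  have "\<exists>U. A n \<subseteq> (\<Union>i. U i) \<and> (\<forall>i. diam_wrt \<rho> (U i) \<le> \<delta>) \<and>
      (\<Sum>i. hcost \<rho> d (U i)) \<le> hcontent \<rho> d \<delta> (A n) + ennreal (e * (1/2) ^ Suc n)" for n
  proof -
    have "hcontent \<rho> d \<delta> (A n) \<noteq> Orderings.top"
      using fin by (metis ennreal_suminf_lessD top.extremum_strict)
    then have "hcontent \<rho> d \<delta> (A n) < hcontent \<rho> d \<delta> (A n) + ennreal (e * (1/2) ^ Suc n)"
      using e by (cases "hcontent \<rho> d \<delta> (A n)") (auto simp: ennreal_less_iff simp flip: ennreal_plus)
    then show ?thesis
      by (subst (asm) hcontent_def) (auto simp: INF_less_iff intro: less_imp_le)
  qed
  then obtain U where U: "\<And>n. A n \<subseteq> (\<Union>i. U n i)" "\<And>n i. diam_wrt \<rho> (U n i) \<le> \<delta>"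
      "\<And>n. (\<Sum>i. hcost \<rho> d (U n i)) \<le> hcontent \<rho> d \<delta> (A n) + ennreal (e * (1/2) ^ Suc n)" by metis
  define V where "V i = (case prod_decode i of (n, j) \<Rightarrow> U n j)" for i
  have "hcontent \<rho> d \<delta> (\<Union>n. A n) \<le> (\<Sum>i. hcost \<rho> d (V i))"
  proof (rule hcontent_upper)
    show "(\<Union>n. A n) \<subseteq> (\<Union>i. V i)"
    proof safe
      fix x n assume "x \<in> A n"
      with U(1) obtain j where "x \<in> U n j" by blast
      then have "x \<in> V (prod_encode (n, j))" by (simp add: V_def)
      then show "x \<in> (\<Union>i. V i)" by blast
    qed
  qed (auto simp: V_def U split: prod.split)
  also have "\<dots> = (\<Sum>i. (\<lambda>(n, j). hcost \<rho> d (U n j)) (prod_decode i))"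
    by (simp add: V_def case_prod_unfold)
  also have "\<dots> = (\<Sum>n. \<Sum>j. hcost \<rho> d (U n j))"
    by (rule suminf_ennreal_2dimen) simp
  also have "\<dots> \<le> (\<Sum>n. hcontent \<rho> d \<delta> (A n) + ennreal (e * (1/2) ^ Suc n))"
    by (intro suminf_le U(3)) auto
  also have "\<dots> = (\<Sum>n. hcontent \<rho> d \<delta> (A n)) + (\<Sum>n. ennreal (e * (1/2) ^ Suc n))"
    by (intro suminf_add[symmetric]) auto
  also have "(\<Sum>n. ennreal (e * (1/2) ^ Suc n)) = ennreal e"
    using sums_mult[OF power_half_series, of e] e
    by (subst suminf_ennreal_eq[where x=e]) (auto)
  finally show "hcontent \<rho> d \<delta> (\<Union>n. A n) \<le> (\<Sum>n. hcontent \<rho> d \<delta> (A n)) + ennreal e" .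
qed

lemma hcontent_UN_finite:
  assumes "finite I" shows "hcontent \<rho> d \<delta> (\<Union>i\<in>I. A i) \<le> (\<Sum>i\<in>I. hcontent \<rho> d \<delta> (A i))"
proof -
  from assms obtain f :: "nat \<Rightarrow> _" where f: "bij_betw f {..<card I} I"
    using bij_betw_from_nat_into_finite by blast
  let ?B = "\<lambda>n. if n < card I then A (f n) else {}"
  have "(\<Union>i\<in>I. A i) = (\<Union>n. ?B n)"
    using f unfolding bij_betw_def by (force split: if_splits)
  then have "hcontent \<rho> d \<delta> (\<Union>i\<in>I. A i) \<le> (\<Sum>n. hcontent \<rho> d \<delta> (?B n))"
    using hcontent_UN[of \<rho> d \<delta> ?B] by simp
  also have "\<dots> = (\<Sum>n\<in>{..<card I}. hcontent \<rho> d \<delta> (?B n))"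
    by (rule suminf_finite) auto
  also have "\<dots> = (\<Sum>i\<in>I. hcontent \<rho> d \<delta> (A i))"
    by (rule sum.reindex_bij_betw[OF f, THEN sym, THEN trans, symmetric]) auto
  finally show ?thesis .
qed

lemma hcontent_le_hausdorff: "0 < \<delta> \<Longrightarrow> hcontent \<rho> d (ennreal \<delta>) A \<le> hausdorff_measure \<rho> d A"
  unfolding hausdorff_measure_eq by (intro SUP_upper) auto

lemma hausdorff_mono: "A \<subseteq> B \<Longrightarrow> hausdorff_measure \<rho> d A \<le> hausdorff_measure \<rho> d B"
  unfolding hausdorff_measure_eq by (intro SUP_mono) (auto intro!: hcontent_mono)

lemma hausdorff_empty [simp]: "hausdorff_measure \<rho> d {} = 0"
  unfolding hausdorff_measure_eq by (auto simp: SUP_constant bot_ennreal)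

lemma hausdorff_UN: "hausdorff_measure \<rho> d (\<Union>n::nat. A n) \<le> (\<Sum>n. hausdorff_measure \<rho> d (A n))"
  unfolding hausdorff_measure_eq[of _ _ "\<Union>n. A n"]
proof (rule SUP_least)
  fix \<delta> :: real assume "\<delta> \<in> {0<..}"
  then show "hcontent \<rho> d (ennreal \<delta>) (\<Union>n. A n) \<le> (\<Sum>n. hausdorff_measure \<rho> d (A n))"
    by (intro order_trans[OF hcontent_UN] suminf_le hcontent_le_hausdorff) auto
qed

lemma hausdorff_Un: "hausdorff_measure \<rho> d (A \<union> B) \<le> hausdorff_measure \<rho> d A + hausdorff_measure \<rho> d B"
proof -
  let ?C = "\<lambda>n::nat. if n = 0 then A else if n = 1 then B else {}"
  have "A \<union> B = (\<Union>n. ?C n)" by (auto split: if_splits)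
  then have "hausdorff_measure \<rho> d (A \<union> B) \<le> (\<Sum>n. hausdorff_measure \<rho> d (?C n))"
    using hausdorff_UN[of \<rho> d ?C] by simp
  also have "\<dots> = (\<Sum>n\<in>{0,1}. hausdorff_measure \<rho> d (?C n))"
    by (rule suminf_finite) auto
  finally show ?thesis by simp
qed

lemma hausdorff_Un_null: "hausdorff_measure \<rho> d A = 0 \<Longrightarrow> hausdorff_measure \<rho> d B = 0 \<Longrightarrow> hausdorff_measure \<rho> d (A \<union> B) = 0"
  using hausdorff_Un[of \<rho> d A B] by simp

lemma hausdorff_UN_null:
  assumes "finite I" "\<And>i. i \<in> I \<Longrightarrow> hausdorff_measure \<rho> d (A i) = 0"
  shows "hausdorff_measure \<rho> d (\<Union>i\<in>I. A i) = 0"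
  using assms by (induction I) (auto simp: hausdorff_Un_null)

text \<open>A covering set of diameter less than \<open>s\<close> cannot meet both \<open>A\<close>
  and \<open>B\<close>, so every fine cover of the union splits into a cover of \<open>A\<close> and
  a cover of \<open>B\<close>.\<close>

lemma hausdorff_separated:
  assumes s: "0 < s" and sep: "\<And>x y. x \<in> A \<Longrightarrow> y \<in> B \<Longrightarrow> s \<le> \<rho> x y"
  shows "hausdorff_measure \<rho> d A + hausdorff_measure \<rho> d B \<le> hausdorff_measure \<rho> d (A \<union> B)"
proof -
  have small: "hcontent \<rho> d (ennreal \<delta>) A + hcontent \<rho> d (ennreal \<delta>) B \<le> hcontent \<rho> d (ennreal \<delta>) (A \<union> B)"
    if \<delta>: "0 < \<delta>" "\<delta> < s" for \<delta>
  proof (rule hcontent_greatest)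
    fix U :: "nat \<Rightarrow> 'a set"
    assume U: "A \<union> B \<subseteq> (\<Union>i. U i)" "\<And>i. diam_wrt \<rho> (U i) \<le> ennreal \<delta>"
    have dis: "U i \<inter> A = {} \<or> U i \<inter> B = {}" for i
    proof (rule ccontr)
      assume "\<not> ?thesis"
      then obtain x y where xy: "x \<in> U i" "x \<in> A" "y \<in> U i" "y \<in> B" by blast
      have "ennreal (\<rho> x y) \<le> ennreal \<delta>"
        using diam_wrt_upper[of x "U i" y \<rho>] xy U(2)[of i] by auto
      then show False using sep[OF xy(2,4)] \<delta> by (auto simp: ennreal_le_iff)
    qed
    have d: "diam_wrt \<rho> (U i \<inter> X) \<le> ennreal \<delta>" for i X
      using diam_wrt_mono[of "U i \<inter> X" "U i" \<rho>] U(2)[of i] by auto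
    have "hcontent \<rho> d (ennreal \<delta>) A + hcontent \<rho> d (ennreal \<delta>) B
        \<le> (\<Sum>i. hcost \<rho> d (U i \<inter> A)) + (\<Sum>i. hcost \<rho> d (U i \<inter> B))"
      using U d by (intro add_mono hcontent_upper) auto
    also have "\<dots> = (\<Sum>i. hcost \<rho> d (U i \<inter> A) + hcost \<rho> d (U i \<inter> B))"
      by (intro suminf_add) auto
    also have "\<dots> \<le> (\<Sum>i. hcost \<rho> d (U i))"
    proof (intro suminf_le)
      fix i show "hcost \<rho> d (U i \<inter> A) + hcost \<rho> d (U i \<inter> B) \<le> hcost \<rho> d (U i)"
        using dis[of i] by (auto intro: hcost_mono)
    qed auto
    finally show "hcontent \<rho> d (ennreal \<delta>) A + hcontent \<rho> d (ennreal \<delta>) B \<le> (\<Sum>i. hcost \<rho> d (U i))" .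
  qed
  \<comment> \<open>The two measures are suprema that are taken one after the other, hence the
    separate scales. A common finer scale below both, and below \<open>s\<close>, reduces this to
    \<open>small\<close>.\<close>
  have "hcontent \<rho> d (ennreal \<delta>1) A + hcontent \<rho> d (ennreal \<delta>2) B \<le> hausdorff_measure \<rho> d (A \<union> B)"
    if "0 < \<delta>1" "0 < \<delta>2" for \<delta>1 \<delta>2
  proof -
    define \<delta> where "\<delta> = min (min \<delta>1 \<delta>2) (s / 2)"
    have "0 < \<delta>" "\<delta> < s" "\<delta> \<le> \<delta>1" "\<delta> \<le> \<delta>2" using that s by (auto simp: \<delta>_def)
    then have "hcontent \<rho> d (ennreal \<delta>1) A + hcontent \<rho> d (ennreal \<delta>2) B
      \<le> hcontent \<rho> d (ennreal \<delta>) A + hcontent \<rho> d (ennreal \<delta>) B"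
      by (intro add_mono hcontent_antimono) (auto intro: ennreal_leI)
    also have "\<dots> \<le> hausdorff_measure \<rho> d (A \<union> B)"
      using small[of \<delta>] hcontent_le_hausdorff[of \<delta> \<rho> d "A \<union> B"] \<open>0 < \<delta>\<close> \<open>\<delta> < s\<close> by auto
    finally show ?thesis .
  qed
  note * = this
  have "hcontent \<rho> d (ennreal \<delta>1) A + hausdorff_measure \<rho> d B \<le> hausdorff_measure \<rho> d (A \<union> B)"
    if "0 < \<delta>1" for \<delta>1
    unfolding hausdorff_measure_eq[of _ _ B]
    by (subst ennreal_SUP_add_right) (auto intro!: SUP_least * that simp: greaterThan_def gt_ex)
  then show ?thesis
    unfolding hausdorff_measure_eq[of _ _ A]
    by (subst ennreal_SUP_add_left[symmetric]) (auto intro!: SUP_least)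
qed

lemma hcontent_lipschitz:
  assumes c: "0 < c" and lip: "\<And>x y. x \<in> A \<Longrightarrow> y \<in> A \<Longrightarrow> \<sigma> (f x) (f y) \<le> c * \<rho> x y"
  shows "hcontent \<sigma> d (ennreal c * \<delta>) (f ` A) \<le> ennreal (c ^ d) * hcontent \<rho> d \<delta> A"
proof -
  \<comment> \<open>The factor is moved to the left so that the right-hand side is a plain infimum
    over covers.\<close>
  have "hcontent \<sigma> d (ennreal c * \<delta>) (f ` A) / ennreal (c ^ d) \<le> hcontent \<rho> d \<delta> A"
  proof (rule hcontent_greatest)
    fix U :: "nat \<Rightarrow> 'a set"
    assume U: "A \<subseteq> (\<Union>i. U i)" "\<And>i. diam_wrt \<rho> (U i) \<le> \<delta>"
    have diam: "diam_wrt \<sigma> (f ` (U i \<inter> A)) \<le> ennreal c * diam_wrt \<rho> (U i)" for i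
    proof (rule diam_wrt_least)
      fix x y assume "x \<in> f ` (U i \<inter> A)" "y \<in> f ` (U i \<inter> A)"
      then obtain u v where uv: "u \<in> U i" "u \<in> A" "v \<in> U i" "v \<in> A" "x = f u" "y = f v" by auto
      have "ennreal (\<sigma> x y) \<le> ennreal (c * \<rho> u v)" using lip uv by (auto intro!: ennreal_leI)
      also have "\<dots> = ennreal c * ennreal (\<rho> u v)" using c by (simp add: ennreal_mult')
      also have "\<dots> \<le> ennreal c * diam_wrt \<rho> (U i)" by (intro mult_left_mono diam_wrt_upper uv) auto
      finally show "ennreal (\<sigma> x y) \<le> ennreal c * diam_wrt \<rho> (U i)" .
    qed
    have "hcontent \<sigma> d (ennreal c * \<delta>) (f ` A) \<le> (\<Sum>i. hcost \<sigma> d (f ` (U i \<inter> A)))"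
    proof (rule hcontent_upper)
      fix i show "diam_wrt \<sigma> (f ` (U i \<inter> A)) \<le> ennreal c * \<delta>"
        using diam[of i] U(2)[of i] by (meson mult_left_mono order_trans zero_le)
    qed (use U in blast)
    also have "\<dots> \<le> (\<Sum>i. ennreal (c ^ d) * hcost \<rho> d (U i))"
    proof (intro suminf_le)
      fix i
      show "hcost \<sigma> d (f ` (U i \<inter> A)) \<le> ennreal (c ^ d) * hcost \<rho> d (U i)"
      proof (cases "U i \<inter> A = {}")
        case False
        have "diam_wrt \<sigma> (f ` (U i \<inter> A)) ^ d \<le> (ennreal c * diam_wrt \<rho> (U i)) ^ d"
          by (intro power_mono diam) auto
        also have "\<dots> = ennreal (c ^ d) * diam_wrt \<rho> (U i) ^ d"
          using c by (simp add: power_mult_distrib ennreal_power)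
        finally have "ennreal (unit_ball_vol (real d) / 2 ^ d) * diam_wrt \<sigma> (f ` (U i \<inter> A)) ^ d
            \<le> ennreal (unit_ball_vol (real d) / 2 ^ d) * (ennreal (c ^ d) * diam_wrt \<rho> (U i) ^ d)"
          by (intro mult_left_mono) auto
        then show ?thesis using False
          by (auto simp: hcost_def mult.left_commute)
      qed auto
    qed auto
    also have "\<dots> = ennreal (c ^ d) * (\<Sum>i. hcost \<rho> d (U i))" by simp
    finally show "hcontent \<sigma> d (ennreal c * \<delta>) (f ` A) / ennreal (c ^ d) \<le> (\<Sum>i. hcost \<rho> d (U i))"
      using c by (intro divide_le_posI_ennreal) (auto simp: mult.commute)
  qed
  then have "hcontent \<sigma> d (ennreal c * \<delta>) (f ` A) / ennreal (c ^ d) * ennreal (c ^ d) \<le> hcontent \<rho> d \<delta> A * ennreal (c ^ d)"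
    by (intro mult_right_mono) auto
  also have "hcontent \<sigma> d (ennreal c * \<delta>) (f ` A) / ennreal (c ^ d) * ennreal (c ^ d) = hcontent \<sigma> d (ennreal c * \<delta>) (f ` A)"
    using c by (subst ennreal_divide_times) (auto simp: ennreal_mult_divide_eq mult.commute)
  finally show ?thesis by (simp add: mult.commute)
qed

lemma hausdorff_lipschitz:
  assumes c: "0 < c" and lip: "\<And>x y. x \<in> A \<Longrightarrow> y \<in> A \<Longrightarrow> \<sigma> (f x) (f y) \<le> c * \<rho> x y"
  shows "hausdorff_measure \<sigma> d (f ` A) \<le> ennreal (c ^ d) * hausdorff_measure \<rho> d A"
  unfolding hausdorff_measure_eq[of _ _ "f ` A"]
proof (rule SUP_least)
  fix \<delta> :: real assume \<delta>: "\<delta> \<in> {0<..}"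
  have "hcontent \<sigma> d (ennreal \<delta>) (f ` A) = hcontent \<sigma> d (ennreal c * ennreal (\<delta> / c)) (f ` A)"
    using c \<delta> by (simp flip: ennreal_mult)
  also have "\<dots> \<le> ennreal (c ^ d) * hcontent \<rho> d (ennreal (\<delta> / c)) A"
    using c lip by (intro hcontent_lipschitz) auto
  also have "\<dots> \<le> ennreal (c ^ d) * hausdorff_measure \<rho> d A"
    using c \<delta> by (intro mult_left_mono hcontent_le_hausdorff) auto
  finally show "hcontent \<sigma> d (ennreal \<delta>) (f ` A) \<le> ennreal (c ^ d) * hausdorff_measure \<rho> d A" .
qed

text \<open>Replaces a supremum over the points of \<open>A\<close>, which may be unbounded, by a
  monotone sequence inside \<open>A\<close>, so that continuity from below applies. A set with a
  maximum is treated separately: otherwise each point lies strictly below the supremum and is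
  overtaken by any sequence converging to it.\<close>

lemma cofinal_sequence:
  fixes A :: "real set"
  assumes "A \<noteq> {}"
  obtains a :: "nat \<Rightarrow> real" where "incseq a" "\<And>i. a i \<in> A" "\<And>x. x \<in> A \<Longrightarrow> \<exists>i. x \<le> a i"
proof (cases "\<exists>m\<in>A. \<forall>x\<in>A. x \<le> m")
  case True
  then obtain m where "m \<in> A" "\<And>x. x \<in> A \<Longrightarrow> x \<le> m" by blast
  then show ?thesis by (intro that[of "\<lambda>_. m"]) (auto simp: incseq_def)
next
  case False
  have "ereal ` A \<noteq> {}" using assms by simp
  from Sup_countable_SUP[OF this] obtain f :: "nat \<Rightarrow> ereal"
    where f: "incseq f" "range f \<subseteq> ereal ` A" "Sup (ereal ` A) = (SUP i. f i)" by auto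
  define a where "a i = real_of_ereal (f i)" for i
  have a: "f i = ereal (a i)" "a i \<in> A" for i
    using f(2) unfolding a_def by (metis imageE rangeI real_of_ereal.simps(1) subsetD)+
  show ?thesis
  proof (rule that[of a])
    show "incseq a" using f(1) by (simp add: a incseq_def)
    fix x assume "x \<in> A"
    with False obtain y where "y \<in> A" "x < y" by (meson not_le)
    then have "ereal x < Sup (ereal ` A)"
      by (metis SUP_upper less_ereal.simps(1) order_less_le_trans)
    then show "\<exists>i. x \<le> a i"
      by (auto simp: f(3) less_SUP_iff a intro: less_imp_le)
  qed (use a in auto)
qed

subsection \<open>The Prekopa-Leindler inequality\<close>

text \<open>The initial segments along a cofinal sequence increase to \<open>A\<close>, so a bound
  for all of them passes to \<open>A\<close> by continuity from below.\<close>

lemma emeasure_add_le_by_initial_segments: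
  fixes A :: "real set" and c K :: ennreal
  assumes [measurable]: "A \<in> sets lborel" and "A \<noteq> {}"
    and le: "\<And>a. a \<in> A \<Longrightarrow> emeasure lborel (A \<inter> {..a}) + c \<le> K"
  shows "emeasure lborel A + c \<le> K"
proof -
  obtain a where a: "incseq a" "\<And>i. a i \<in> A" "\<And>x. x \<in> A \<Longrightarrow> \<exists>i::nat. x \<le> a i"
    using cofinal_sequence[OF \<open>A \<noteq> {}\<close>] by metis
  have "A = (\<Union>i. A \<inter> {..a i})" using a by auto
  moreover have "(SUP i. emeasure lborel (A \<inter> {..a i})) = emeasure lborel (\<Union>i. A \<inter> {..a i})"
    using a(1) by (intro SUP_emeasure_incseq) (auto simp: incseq_def intro: order_trans)
  ultimately have "emeasure lborel A = (SUP i. emeasure lborel (A \<inter> {..a i}))" by simp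
  then show ?thesis using le[OF a(2)]
    by (simp flip: ennreal_SUP_add_left) (intro SUP_least, simp)
qed

text \<open>The sets \<open>(A \<inter> {..a}) - b\<close> and \<open>a - (B \<inter> {..b})\<close> lie in \<open>A - B\<close> and have at most the point
  \<open>a - b\<close> in common.\<close>

lemma brunn_minkowski_real:
  fixes A B C :: "real set"
  assumes [measurable]: "A \<in> sets lborel" "B \<in> sets lborel" "C \<in> sets lborel"
    and ne: "A \<noteq> {}" "B \<noteq> {}"
    and sub: "\<And>a b. a \<in> A \<Longrightarrow> b \<in> B \<Longrightarrow> (a - b) / 2 \<in> C"
  shows "emeasure lborel A + emeasure lborel B \<le> 2 * emeasure lborel C"
proof -
  have main: "emeasure lborel (A \<inter> {..a}) + emeasure lborel (B \<inter> {..b}) \<le> 2 * emeasure lborel C"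
    if ab: "a \<in> A" "b \<in> B" for a b
  proof -
    define m where "m = (a - b) / 2"
    have "emeasure lborel (A \<inter> {..a}) = (\<integral>\<^sup>+x. indicator (A \<inter> {..a}) x \<partial>lborel)" by simp
    \<comment> \<open>With x = b + 2 y the point y is (x - b) / 2, which belongs to \<open>C\<close>
      and lies to the left of \<open>m\<close> when x \<le> a.\<close>
    also have "\<dots> = 2 * (\<integral>\<^sup>+y. indicator (A \<inter> {..a}) (b + 2 * y) \<partial>lborel)"
      by (subst nn_integral_real_affine[where c=2 and t=b]) auto
    also have "\<dots> \<le> 2 * (\<integral>\<^sup>+y. indicator (C \<inter> {..m}) y \<partial>lborel)"
    proof (intro mult_left_mono nn_integral_mono)
      fix y show "(indicator (A \<inter> {..a}) (b + 2 * y)::ennreal) \<le> indicator (C \<inter> {..m}) y"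
        using sub[of "b + 2 * y" b] ab by (auto simp: m_def indicator_def)
    qed auto
    finally have 1: "emeasure lborel (A \<inter> {..a}) \<le> 2 * emeasure lborel (C \<inter> {..m})" by simp
    have "emeasure lborel (B \<inter> {..b}) = (\<integral>\<^sup>+x. indicator (B \<inter> {..b}) x \<partial>lborel)" by simp
    also have "\<dots> = 2 * (\<integral>\<^sup>+y. indicator (B \<inter> {..b}) (a + (-2) * y) \<partial>lborel)"
      by (subst nn_integral_real_affine[where c="-2" and t=a]) auto
    also have "\<dots> \<le> 2 * (\<integral>\<^sup>+y. indicator (C \<inter> {m..}) y \<partial>lborel)"
    proof (intro mult_left_mono nn_integral_mono)
      fix y show "(indicator (B \<inter> {..b}) (a + (-2) * y)::ennreal) \<le> indicator (C \<inter> {m..}) y"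
        using sub[of a "a - 2 * y"] ab by (auto simp: m_def indicator_def)
    qed auto
    finally have 2: "emeasure lborel (B \<inter> {..b}) \<le> 2 * emeasure lborel (C \<inter> {m..})" by simp
    have "emeasure lborel (C \<inter> {m..}) = emeasure lborel (C \<inter> {m<..})"
    proof (rule emeasure_eq_AE)
      have "AE x in lborel. x \<noteq> m" by (rule AE_lborel_singleton)
      then show "AE x in lborel. (x \<in> C \<inter> {m..}) = (x \<in> C \<inter> {m<..})"
        by eventually_elim auto
    qed auto
    moreover have "emeasure lborel (C \<inter> {..m}) + emeasure lborel (C \<inter> {m<..}) = emeasure lborel C"
      by (subst plus_emeasure) (auto intro!: arg_cong[where f="emeasure lborel"])
    ultimately show ?thesis using add_mono[OF 1 2]
      by (simp flip: distrib_left)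
  qed
  have "emeasure lborel B + emeasure lborel (A \<inter> {..a}) \<le> 2 * emeasure lborel C" if "a \<in> A" for a
    by (rule emeasure_add_le_by_initial_segments)
       (use assms(1,2) ne main[OF that] in \<open>auto simp: add.commute\<close>)
  note * = this
  show ?thesis
    by (rule emeasure_add_le_by_initial_segments)
       (use assms(1,2) ne * in \<open>auto simp: add.commute\<close>)
qed

text \<open>The levels are written as fractions t of \<open>S\<close>, so that functions with
  different suprema can be compared at the same relative level. Levels above \<open>S\<close> are
  not seen, whence the minimum.\<close>

lemma layer_cake:
  fixes f :: "real \<Rightarrow> ennreal" and S :: real
  assumes [measurable]: "f \<in> borel_measurable lborel" and S: "0 < S"
  shows "ennreal S * (\<integral>\<^sup>+t\<in>{0<..<1}. emeasure lborel {x. ennreal (t * S) < f x} \<partial>lborel)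
       = (\<integral>\<^sup>+x. min (f x) (ennreal S) \<partial>lborel)"
proof -
  have "(\<integral>\<^sup>+t\<in>{0<..<1}. emeasure lborel {x. ennreal (t * S) < f x} \<partial>lborel)
      = (\<integral>\<^sup>+t. (\<integral>\<^sup>+x. indicator {0<..<1} t * indicator {x. ennreal (t * S) < f x} x \<partial>lborel) \<partial>lborel)"
    by (intro nn_integral_cong) (auto simp: nn_integral_cmult mult.commute)
  also have "\<dots> = (\<integral>\<^sup>+x. (\<integral>\<^sup>+t. indicator {0<..<1} t * indicator {x. ennreal (t * S) < f x} x \<partial>lborel) \<partial>lborel)"
    by (intro lborel_pair.Fubini') measurable
  also have "\<dots> = (\<integral>\<^sup>+x. min (f x) (ennreal S) / ennreal S \<partial>lborel)"
  proof (intro nn_integral_cong)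
    fix x
    have "(\<integral>\<^sup>+t. indicator {0<..<1} t * indicator {x. ennreal (t * S) < f x} x \<partial>lborel)
      = (\<integral>\<^sup>+t. indicator {t \<in> {0<..<1}. ennreal (t * S) < f x} t \<partial>lborel)"
      by (intro nn_integral_cong) (auto simp: indicator_def)
    also have "\<dots> = emeasure lborel {t \<in> {0<..<1}. ennreal (t * S) < f x}" by simp
    also have "\<dots> = min (f x) (ennreal S) / ennreal S"
    proof (cases "f x < ennreal S")
      case True
      then obtain r where r: "f x = ennreal r" "0 \<le> r" by (cases "f x") auto
      have "{t \<in> {0<..<1}. ennreal (t * S) < f x} = {0<..<r / S}"
      proof safe
        fix t assume t: "t \<in> {0<..<1}" "ennreal (t * S) < f x"
        then show "t \<in> {0<..<r / S}" using r S by (auto simp: ennreal_less_iff field_simps)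
      next
        fix t assume t: "t \<in> {0<..<r / S}"
        have "r / S < 1" using r S True by (simp add: ennreal_less_iff)
        then show "t \<in> {0<..<1}" using t by auto
        show "ennreal (t * S) < f x" using t r S by (auto simp: ennreal_less_iff field_simps)
      qed
      then show ?thesis using True r S by (simp add: divide_ennreal)
    next
      case False
      have "{t \<in> {0<..<1}. ennreal (t * S) < f x} = {0<..<1}"
      proof safe
        fix t :: real assume "t \<in> {0<..<1}"
        then have "ennreal (t * S) < ennreal S" using S by (auto simp: ennreal_less_iff)
        then show "ennreal (t * S) < f x" using False by (meson not_le order_less_le_trans)
      qed
      then show ?thesis using False S by (simp add: min_absorb2 divide_ennreal)
    qed
    finally show "(\<integral>\<^sup>+t. indicator {0<..<1} t * indicator {x. ennreal (t * S) < f x} x \<partial>lborel)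
      = min (f x) (ennreal S) / ennreal S" .
  qed
  also have "\<dots> = (\<integral>\<^sup>+x. min (f x) (ennreal S) \<partial>lborel) / ennreal S"
    by (intro nn_integral_divide) auto
  finally show ?thesis using S
    by (simp add: ennreal_times_divide) (subst mult.commute, subst mult_divide_eq_ennreal, auto)
qed

lemma ennreal_mult_le_of_add_le:
  fixes a b c :: ennreal assumes "a + b \<le> 2 * c" shows "a * b \<le> c ^ 2"
proof (cases "c = Orderings.top")
  case False
  then obtain c' where c: "c = ennreal c'" "0 \<le> c'" by (cases c) auto
  have "a < Orderings.top \<and> b < Orderings.top" using assms c
    by (metis ennreal_add_eq_top ennreal_mult_eq_top_iff ennreal_neq_top ennreal_numeral neq_top_trans top.not_eq_extremum)
  then obtain a' b' where ab: "a = ennreal a'" "0 \<le> a'" "b = ennreal b'" "0 \<le> b'"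
    by (cases a; cases b) auto
  have "ennreal (a' + b') \<le> ennreal (2 * c')" using assms ab c
    by (simp add: ennreal_mult)
  then have "a' + b' \<le> 2 * c'" using c by (simp add: ennreal_le_iff)
  then have "(a' + b')\<^sup>2 \<le> (2 * c')\<^sup>2" using ab by (intro power_mono) auto
  moreover have "4 * (a' * b') \<le> (a' + b')\<^sup>2"
    using zero_le_power2[of "a' - b'"] by (simp add: power2_eq_square algebra_simps)
  ultimately have "a' * b' \<le> c' ^ 2" by (simp add: power2_eq_square)
  then show ?thesis using ab c by (simp add: ennreal_power ennreal_leI flip: ennreal_mult)
qed (simp add: power2_eq_square)

text \<open>Cut \<open>f\<close>, \<open>g\<close> and \<open>h\<close> at the fraction t of the
  suprema \<open>S\<close> and \<open>R\<close> and of their geometric mean \<open>Q\<close>. Half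
  differences of points from the first two superlevel sets lie in the third one, so the
  one-dimensional Brunn-Minkowski inequality applies for each t, to nonempty sets because t < 1.
  Integrating over t bounds a + b by 2 c, and the arithmetic-geometric mean inequality makes this
  multiplicative.\<close>

lemma prekopa_leindler_bounded:
  fixes f g h :: "real \<Rightarrow> ennreal"
  assumes [measurable]: "f \<in> borel_measurable lborel" "g \<in> borel_measurable lborel" "h \<in> borel_measurable lborel"
    and le: "\<And>x y. f x * g y \<le> h ((x - y) / 2) ^ 2"
    and bd: "\<And>x. f x \<le> ennreal M" "\<And>x. g x \<le> ennreal M'"
  shows "(\<integral>\<^sup>+x. f x \<partial>lborel) * (\<integral>\<^sup>+x. g x \<partial>lborel) \<le> (\<integral>\<^sup>+x. h x \<partial>lborel) ^ 2"
proof -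
  have "(SUP x. f x) \<le> ennreal M" "(SUP x. g x) \<le> ennreal M'" using bd by (auto intro: SUP_least)
  then obtain S R where S: "(SUP x. f x) = ennreal S" "0 \<le> S" and R: "(SUP x. g x) = ennreal R" "0 \<le> R"
    by (metis enn2real_nonneg ennreal_enn2real ennreal_less_top order_le_less_trans)
  have fS: "f x \<le> ennreal S" and gR: "g x \<le> ennreal R" for x
    using S(1) R(1) by (metis UNIV_I SUP_upper)+
  show ?thesis
  proof (cases "S = 0 \<or> R = 0")
    case True
    then have "(\<forall>x. f x = 0) \<or> (\<forall>x. g x = 0)" using fS gR by force
    then show ?thesis by auto
  next
    case False
    then have pos: "0 < S" "0 < R" using S R by auto
    define a where "a = (\<integral>\<^sup>+t\<in>{0<..<1}. emeasure lborel {x. ennreal (t * S) < f x} \<partial>lborel)"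
    define b where "b = (\<integral>\<^sup>+t\<in>{0<..<1}. emeasure lborel {x. ennreal (t * R) < g x} \<partial>lborel)"
    define Q where "Q = sqrt (S * R)"
    have Q: "0 < Q" "Q ^ 2 = S * R" using pos by (auto simp: Q_def)
    define c where "c = (\<integral>\<^sup>+t\<in>{0<..<1}. emeasure lborel {x. ennreal (t * Q) < h x} \<partial>lborel)"
    have f: "(\<integral>\<^sup>+x. f x \<partial>lborel) = ennreal S * a"
      unfolding a_def by (subst layer_cake) (auto simp: pos min_absorb1 fS)
    have g: "(\<integral>\<^sup>+x. g x \<partial>lborel) = ennreal R * b"
      unfolding b_def by (subst layer_cake) (auto simp: pos min_absorb1 gR)
    have h: "ennreal Q * c \<le> (\<integral>\<^sup>+x. h x \<partial>lborel)"
      unfolding c_def by (subst layer_cake) (auto simp: Q intro!: nn_integral_mono)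
    have "a + b = (\<integral>\<^sup>+t. (emeasure lborel {x. ennreal (t * S) < f x} + emeasure lborel {x. ennreal (t * R) < g x}) * indicator {0<..<1} t \<partial>lborel)"
      unfolding a_def b_def by (subst nn_integral_add[symmetric]) (auto simp: distrib_right)
    also have "\<dots> \<le> (\<integral>\<^sup>+t. 2 * (emeasure lborel {x. ennreal (t * Q) < h x} * indicator {0<..<1} t) \<partial>lborel)"
    proof (intro nn_integral_mono)
      fix t :: real
      have "emeasure lborel {x. ennreal (t * S) < f x} + emeasure lborel {x. ennreal (t * R) < g x} \<le> 2 * emeasure lborel {x. ennreal (t * Q) < h x}"
        if t: "t \<in> {0<..<1}"
      proof (rule brunn_minkowski_real)
        have "ennreal (t * S) < (SUP x. f x)" using t pos by (auto simp: S ennreal_less_iff)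
        then show "{x. ennreal (t * S) < f x} \<noteq> {}" by (auto simp: less_SUP_iff)
        have "ennreal (t * R) < (SUP x. g x)" using t pos by (auto simp: R ennreal_less_iff)
        then show "{x. ennreal (t * R) < g x} \<noteq> {}" by (auto simp: less_SUP_iff)
        fix x y assume "x \<in> {x. ennreal (t * S) < f x}" "y \<in> {x. ennreal (t * R) < g x}"
        then have "ennreal (t * S) * ennreal (t * R) < f x * g y"
          using t pos fS[of x] gR[of y]
          by (cases "f x"; cases "g y") (auto simp: ennreal_less_iff top_unique intro!: mult_strict_mono' simp flip: ennreal_mult)
        also have "\<dots> \<le> h ((x - y) / 2) ^ 2" by (rule le)
        finally have *: "ennreal (t * S) * ennreal (t * R) < h ((x - y) / 2) ^ 2" .
        have "ennreal (t * S) * ennreal (t * R) = ennreal (t * Q) ^ 2"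
          using t pos Q by (simp add: ennreal_power power_mult_distrib power2_eq_square mult_ac flip: ennreal_mult)
        with * have "\<not> h ((x - y) / 2) \<le> ennreal (t * Q)"
          by (metis power_mono zero_le not_less)
        then show "(x - y) / 2 \<in> {x. ennreal (t * Q) < h x}" by simp
      qed auto
      then show "(emeasure lborel {x. ennreal (t * S) < f x} + emeasure lborel {x. ennreal (t * R) < g x}) * indicator {0<..<1} t
        \<le> 2 * (emeasure lborel {x. ennreal (t * Q) < h x} * indicator {0<..<1} t)"
        by (auto simp: indicator_def)
    qed
    also have "\<dots> = 2 * c" unfolding c_def by (intro nn_integral_cmult) auto
    finally have "a * b \<le> c ^ 2" by (rule ennreal_mult_le_of_add_le)
    then have "ennreal (S * R) * (a * b) \<le> ennreal (S * R) * c ^ 2" by (intro mult_left_mono) auto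
    also have "\<dots> = (ennreal Q * c) ^ 2" using Q by (simp add: power_mult_distrib ennreal_power)
    also have "\<dots> \<le> (\<integral>\<^sup>+x. h x \<partial>lborel) ^ 2" by (intro power_mono h) auto
    finally show ?thesis using pos by (simp add: f g ennreal_mult mult_ac)
  qed
qed

lemma SUP_min_of_nat: "(SUP n. min (a::ennreal) (of_nat n)) = a"
proof -
  have "(SUP n. inf a (of_nat n)) = inf a (SUP n::nat. of_nat n)" by (simp add: inf_SUP)
  then show ?thesis by (simp add: ennreal_SUP_of_nat_eq_top inf_min)
qed

lemma nn_integral_truncate:
  assumes [measurable]: "f \<in> borel_measurable M"
  shows "(\<integral>\<^sup>+x. f x \<partial>M) = (SUP n::nat. \<integral>\<^sup>+x. min (f x) (of_nat n) \<partial>M)"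
  by (subst nn_integral_monotone_convergence_SUP[symmetric])
     (auto simp: SUP_min_of_nat incseq_def le_fun_def min_le_iff_disj)

text \<open>Truncation of \<open>f\<close> and \<open>g\<close> preserves the hypothesis, and
  monotone convergence removes it again.\<close>

lemma prekopa_leindler_real:
  fixes f g h :: "real \<Rightarrow> ennreal"
  assumes [measurable]: "f \<in> borel_measurable lborel" "g \<in> borel_measurable lborel" "h \<in> borel_measurable lborel"
    and le: "\<And>x y. f x * g y \<le> h ((x - y) / 2) ^ 2"
  shows "(\<integral>\<^sup>+x. f x \<partial>lborel) * (\<integral>\<^sup>+x. g x \<partial>lborel) \<le> (\<integral>\<^sup>+x. h x \<partial>lborel) ^ 2"
proof -
  have "(\<integral>\<^sup>+x. min (f x) (of_nat n) \<partial>lborel) * (\<integral>\<^sup>+x. min (g x) (of_nat m) \<partial>lborel) \<le> (\<integral>\<^sup>+x. h x \<partial>lborel) ^ 2" for n m :: nat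
  proof (rule prekopa_leindler_bounded)
    fix x y
    show "min (f x) (of_nat n) * min (g y) (of_nat m) \<le> h ((x - y) / 2) ^ 2"
      by (rule order_trans[OF _ le[of x y]]) (auto intro!: mult_mono)
  next
    fix x show "min (f x) (of_nat n) \<le> ennreal (real n)" "min (g x) (of_nat m) \<le> ennreal (real m)"
      by (simp_all add: ennreal_of_nat_eq_real_of_nat)
  qed auto
  then show ?thesis
    by (simp add: nn_integral_truncate[of f] nn_integral_truncate[of g] SUP_mult_left_ennreal SUP_mult_right_ennreal SUP_least)
qed

section \<open>Product Lebesgue measure and the Prekopa-Leindler inequality in several
  variables\<close>

abbreviation lb :: "nat \<Rightarrow> (nat \<Rightarrow> real) measure" where
  "lb d \<equiv> \<Pi>\<^sub>M i\<in>{..<d}. lborel"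

interpretation lbP: product_sigma_finite "\<lambda>_::nat. lborel::real measure" by standard

lemma sigma_finite_lb: "sigma_finite_measure (lb d)"
  by (rule lbP.sigma_finite) simp

lemma nn_integral_lb_Suc:
  assumes "f \<in> borel_measurable (lb (Suc d))"
  shows "(\<integral>\<^sup>+x. f x \<partial>lb (Suc d)) = (\<integral>\<^sup>+s. (\<integral>\<^sup>+x. f (x(d := s)) \<partial>lb d) \<partial>lborel)"
  using assms lbP.product_nn_integral_insert_rev[of "{..<d}" d f] by (simp add: lessThan_Suc)

lemma nn_integral_lb_Suc':
  assumes "f \<in> borel_measurable (lb (Suc d))"
  shows "(\<integral>\<^sup>+x. f x \<partial>lb (Suc d)) = (\<integral>\<^sup>+x. (\<integral>\<^sup>+s. f (x(d := s)) \<partial>lborel) \<partial>lb d)"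
  using assms lbP.product_nn_integral_insert[of "{..<d}" d f] by (simp add: lessThan_Suc)

lemma space_lb: "space (lb d) = {..<d} \<rightarrow>\<^sub>E UNIV"
  by (simp add: space_PiM)

lemma measurable_lb_upd: "(\<lambda>(s, x). x(d := s)) \<in> lborel \<Otimes>\<^sub>M lb d \<rightarrow>\<^sub>M lb (Suc d)"
proof -
  have "(\<lambda>(f, y). f(d := y)) \<in> lb d \<Otimes>\<^sub>M lborel \<rightarrow>\<^sub>M lb (Suc d)"
    using measurable_add_dim[of d "{..<d}" "\<lambda>_. lborel"] by (simp add: lessThan_Suc)
  from measurable_compose[OF measurable_pair_swap' this] show ?thesis
    by (simp add: case_prod_unfold)
qed

lemma measurable_lb_upd2: "(\<lambda>x. x(d := s)) \<in> lb d \<rightarrow>\<^sub>M lb (Suc d)"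
  using measurable_compose[OF measurable_Pair1' [of s lborel "lb d"] measurable_lb_upd] by simp

text \<open>Induction on the dimension: for fixed last coordinates s and t the slices satisfy the
  hypothesis, so the slice integrals satisfy the one-dimensional one. The inequality is stated with
  differences instead of sums, which is the form in which diameters enter.\<close>

lemma prekopa_leindler:
  fixes f g h :: "(nat \<Rightarrow> real) \<Rightarrow> ennreal"
  assumes "f \<in> borel_measurable (lb d)" "g \<in> borel_measurable (lb d)" "h \<in> borel_measurable (lb d)"
    and "\<And>x y. x \<in> space (lb d) \<Longrightarrow> y \<in> space (lb d) \<Longrightarrow> f x * g y \<le> h (\<lambda>i\<in>{..<d}. (x i - y i) / 2) ^ 2"
  shows "(\<integral>\<^sup>+x. f x \<partial>lb d) * (\<integral>\<^sup>+x. g x \<partial>lb d) \<le> (\<integral>\<^sup>+x. h x \<partial>lb d) ^ 2"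
  using assms
proof (induction d arbitrary: f g h)
  case 0
  have "f (\<lambda>_. undefined) * g (\<lambda>_. undefined) \<le> h (\<lambda>_. undefined) ^ 2"
    using 0(4)[of "\<lambda>_. undefined" "\<lambda>_. undefined"] by (simp add: space_PiM restrict_def)
  then show ?case by (simp add: PiM_empty nn_integral_count_space_finite)
next
  case (Suc d)
  interpret sigma_finite_measure "lb d" by (rule sigma_finite_lb)
  have m: "(\<lambda>s. \<integral>\<^sup>+x. F (x(d := s)) \<partial>lb d) \<in> borel_measurable lborel"
    if "F \<in> borel_measurable (lb (Suc d))" for F :: "_ \<Rightarrow> ennreal"
    using measurable_compose[OF measurable_lb_upd that]
    by (intro borel_measurable_nn_integral) (simp add: case_prod_unfold)
  show ?case
    unfolding nn_integral_lb_Suc[OF Suc.prems(1)] nn_integral_lb_Suc[OF Suc.prems(2)] nn_integral_lb_Suc[OF Suc.prems(3)]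
  proof (rule prekopa_leindler_real[OF m m m], goal_cases)
    case (4 s t)
    show ?case
    proof (rule Suc.IH, goal_cases)
      case (4 x y)
      have eq: "(\<lambda>i\<in>{..<Suc d}. ((x(d := s)) i - (y(d := t)) i) / 2) = (\<lambda>i\<in>{..<d}. (x i - y i) / 2)(d := (s - t) / 2)"
        by (auto simp: fun_eq_iff restrict_def)
      have sp: "x(d := s) \<in> space (lb (Suc d))" "y(d := t) \<in> space (lb (Suc d))"
        using 4 by (auto simp: space_PiM PiE_def extensional_def)
      from Suc.prems(4)[OF sp] show ?case unfolding eq .
    qed (rule measurable_compose[OF measurable_lb_upd2], rule Suc.prems)+
  qed (use Suc.prems in auto)
qed

subsection \<open>Quadratic forms and the isodiametric inequality\<close>

definition qform :: "nat \<Rightarrow> real mat \<Rightarrow> (nat \<Rightarrow> real) \<Rightarrow> real" where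
  "qform d G x = (\<Sum>i<d. \<Sum>j<d. x i * G $$ (i, j) * x j)"

definition qnorm :: "nat \<Rightarrow> real mat \<Rightarrow> (nat \<Rightarrow> real) \<Rightarrow> real" where
  "qnorm d G x = sqrt (qform d G x)"

text \<open>Forms act on coordinate functions instead of vectors, so that they apply directly to the
  points of the product measure.\<close>

definition pd :: "nat \<Rightarrow> real mat \<Rightarrow> bool" where
  "pd d G \<longleftrightarrow> G \<in> carrier_mat d d \<and> (\<forall>i<d. \<forall>j<d. G $$ (i, j) = G $$ (j, i)) \<and>
     (\<forall>x. (\<exists>i<d. x i \<noteq> 0) \<longrightarrow> 0 < qform d G x)"

lemma qform_cong: "(\<And>i. i < d \<Longrightarrow> x i = y i) \<Longrightarrow> qform d G x = qform d G y"
  unfolding qform_def by (intro sum.cong) auto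

lemma qnorm_cong: "(\<And>i. i < d \<Longrightarrow> x i = y i) \<Longrightarrow> qnorm d G x = qnorm d G y"
  unfolding qnorm_def by (metis qform_cong)

lemma qform_scale: "qform d G (\<lambda>i. c * x i) = c\<^sup>2 * qform d G x"
  unfolding qform_def by (simp add: sum_distrib_left power2_eq_square mult_ac)

lemma qnorm_scale: "qnorm d G (\<lambda>i. c * x i) = \<bar>c\<bar> * qnorm d G x"
  unfolding qnorm_def by (simp add: qform_scale real_sqrt_mult)

lemma qform_zero: "(\<And>i. i < d \<Longrightarrow> x i = 0) \<Longrightarrow> qform d G x = 0"
  unfolding qform_def by simp

lemma pd_nonneg: "pd d G \<Longrightarrow> 0 \<le> qform d G x"
  by (cases "\<exists>i<d. x i \<noteq> 0") (auto simp: pd_def qform_zero intro: less_imp_le)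

lemma pd_zero: "pd d G \<Longrightarrow> qform d G x = 0 \<Longrightarrow> i < d \<Longrightarrow> x i = 0"
  unfolding pd_def by (metis less_irrefl)

lemma qnorm_nonneg: "pd d G \<Longrightarrow> 0 \<le> qnorm d G x"
  by (simp add: qnorm_def pd_nonneg)

lemma qnorm_power2: "pd d G \<Longrightarrow> (qnorm d G x)\<^sup>2 = qform d G x"
  by (simp add: qnorm_def pd_nonneg)

lemma pd_carrier: "pd d G \<Longrightarrow> G \<in> carrier_mat d d" by (simp add: pd_def)

lemma qform_combine:
  assumes "pd d G"
  defines "B \<equiv> \<lambda>x y. \<Sum>i<d. \<Sum>j<d. x i * G $$ (i, j) * y j"
  shows "qform d G (\<lambda>i. a * x i + b * y i) = a\<^sup>2 * qform d G x + 2 * a * b * B x y + b\<^sup>2 * qform d G y"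
proof -
  have sym: "B y x = B x y"
    unfolding B_def using assms(1) unfolding pd_def
    by (subst sum.swap) (auto intro!: sum.cong simp: mult_ac)
  have "qform d G (\<lambda>i. a * x i + b * y i) =
     (\<Sum>i<d. \<Sum>j<d. a\<^sup>2 * (x i * G $$ (i, j) * x j) + a * b * (x i * G $$ (i, j) * y j)
        + a * b * (y i * G $$ (i, j) * x j) + b\<^sup>2 * (y i * G $$ (i, j) * y j))"
    unfolding qform_def by (intro sum.cong refl) (simp add: algebra_simps power2_eq_square)
  also have "\<dots> = a\<^sup>2 * qform d G x + a * b * B x y + a * b * B y x + b\<^sup>2 * qform d G y"
    unfolding qform_def B_def by (simp add: sum.distrib sum_distrib_left)
  finally show ?thesis by (simp add: sym)
qed

text \<open>The Cauchy-Schwarz inequality comes from evaluating the form at b x - a y, where a and b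
  are the norms of x and y: the value is 2 a b (a b - B), and a b can be cancelled unless one of the
  vectors vanishes.\<close>

lemma qnorm_triangle:
  assumes pd: "pd d G"
  shows "qnorm d G (\<lambda>i. x i + y i) \<le> qnorm d G x + qnorm d G y"
proof -
  define a b where "a = qnorm d G x" and "b = qnorm d G y"
  define B where "B = (\<Sum>i<d. \<Sum>j<d. x i * G $$ (i, j) * y j)"
  have ab: "0 \<le> a" "0 \<le> b" "qform d G x = a\<^sup>2" "qform d G y = b\<^sup>2"
    using pd by (auto simp: a_def b_def qnorm_nonneg qnorm_power2)
  have "B \<le> a * b"
  proof (cases "a = 0 \<or> b = 0")
    case True
    then have "(\<forall>i<d. x i = 0) \<or> (\<forall>i<d. y i = 0)" using ab pd pd_zero by fastforce
    then show ?thesis using True by (auto simp: B_def)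
  next
    case False
    have "0 \<le> qform d G (\<lambda>i. b * x i + (- a) * y i)" using pd by (rule pd_nonneg)
    also have "\<dots> = 2 * (a * b) * (a * b - B)"
      unfolding qform_combine[OF pd] B_def[symmetric] ab by (simp add: algebra_simps power2_eq_square)
    finally have "0 \<le> 2 * (a * b) * (a * b - B)" .
    moreover have "0 < a * b" using False ab by simp
    ultimately show ?thesis by (simp add: zero_le_mult_iff)
  qed
  then have "qform d G (\<lambda>i. 1 * x i + 1 * y i) \<le> (a + b)\<^sup>2"
    unfolding qform_combine[OF pd] B_def[symmetric] ab by (simp add: power2_sum)
  then show ?thesis using ab by (simp add: qnorm_def[of _ _ "\<lambda>i. x i + y i"] a_def b_def real_le_lsqrt)
qed

lemma qform_upper: "qform d G x \<le> (\<Sum>i<d. \<Sum>j<d. \<bar>G $$ (i, j)\<bar>) * (\<Sum>i<d. (x i)\<^sup>2)"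
proof -
  have "x i * G $$ (i, j) * x j \<le> \<bar>G $$ (i, j)\<bar> * (\<Sum>i<d. (x i)\<^sup>2)" if "i < d" "j < d" for i j
  proof -
    have "(x i)\<^sup>2 \<le> (\<Sum>i<d. (x i)\<^sup>2)" "(x j)\<^sup>2 \<le> (\<Sum>i<d. (x i)\<^sup>2)"
      using that by (auto intro!: member_le_sum)
    moreover have "2 * \<bar>x i * x j\<bar> \<le> (x i)\<^sup>2 + (x j)\<^sup>2"
      using sum_squares_bound[of "\<bar>x i\<bar>" "\<bar>x j\<bar>"] by (simp add: abs_mult)
    ultimately have "\<bar>x i * x j\<bar> \<le> (\<Sum>i<d. (x i)\<^sup>2)" by linarith
    then have "\<bar>G $$ (i, j)\<bar> * \<bar>x i * x j\<bar> \<le> \<bar>G $$ (i, j)\<bar> * (\<Sum>i<d. (x i)\<^sup>2)" by (intro mult_left_mono) auto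
    moreover have "x i * G $$ (i, j) * x j \<le> \<bar>G $$ (i, j)\<bar> * \<bar>x i * x j\<bar>"
      by (metis abs_ge_self abs_mult mult.assoc mult.commute)
    ultimately show ?thesis by linarith
  qed
  then show ?thesis unfolding qform_def sum_distrib_right by (intro sum_mono) auto
qed

text \<open>Schur complement: completing the square in the last variable reduces \<open>G\<close> to a form in \<open>d\<close> variables.\<close>

definition schur :: "nat \<Rightarrow> real mat \<Rightarrow> real mat" where
  "schur d G = Matrix.mat d d (\<lambda>(i, j). G $$ (i, j) - G $$ (i, d) * G $$ (d, j) / G $$ (d, d))"

text \<open>The shift of the last variable in the completed square.\<close>

definition schur_lin :: "nat \<Rightarrow> real mat \<Rightarrow> (nat \<Rightarrow> real) \<Rightarrow> real" where
  "schur_lin d G x = (\<Sum>i<d. G $$ (i, d) / G $$ (d, d) * x i)"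

lemma pd_diag_pos:
  assumes "pd (Suc d) G" shows "0 < G $$ (d, d)"
proof -
  have "qform (Suc d) G (\<lambda>i. if i = d then 1 else 0) = G $$ (d, d)"
    unfolding qform_def by (simp add: if_distrib sum.If_cases cong: if_cong)
  moreover have "0 < qform (Suc d) G (\<lambda>i. if i = d then 1 else 0)"
    using assms unfolding pd_def by auto
  ultimately show ?thesis by simp
qed

lemma qform_schur:
  assumes pd: "pd (Suc d) G"
  shows "qform (Suc d) G (x(d := y)) = G $$ (d, d) * (y + schur_lin d G x)\<^sup>2 + qform d (schur d G) x"
proof -
  define g l where "g = G $$ (d, d)" and "l = schur_lin d G x"
  have g: "g \<noteq> 0" using pd_diag_pos[OF pd] by (simp add: g_def)
  have s1: "(\<Sum>i<d. x i * G $$ (i, d)) = g * l"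
    unfolding l_def schur_lin_def g_def[symmetric] using g by (simp add: sum_distrib_left mult.commute)
  have s2: "(\<Sum>j<d. G $$ (d, j) * x j) = g * l"
    unfolding s1[symmetric] using pd unfolding pd_def by (intro sum.cong) (auto simp: mult.commute)
  have "(g * l) * (g * l) / g = (\<Sum>i<d. x i * G $$ (i, d)) * (\<Sum>j<d. G $$ (d, j) * x j) / g"
    by (simp only: s1 s2)
  also have "\<dots> = (\<Sum>i<d. \<Sum>j<d. (x i * G $$ (i, d)) * (G $$ (d, j) * x j) / g)"
    by (simp only: sum_product sum_divide_distrib)
  finally have s12: "(\<Sum>i<d. \<Sum>j<d. (x i * G $$ (i, d)) * (G $$ (d, j) * x j) / g) = (g * l) * (g * l) / g" ..
  have "qform d (schur d G) x = (\<Sum>i<d. \<Sum>j<d. x i * G $$ (i, j) * x j - (x i * G $$ (i, d)) * (G $$ (d, j) * x j) / g)"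
    unfolding qform_def schur_def g_def[symmetric] by (intro sum.cong) (auto simp: algebra_simps)
  also have "\<dots> = qform d G x - (g * l) * (g * l) / g"
    unfolding qform_def by (simp only: sum_subtractf s12)
  finally have *: "qform d (schur d G) x = qform d G x - g * l\<^sup>2" using g by (simp add: power2_eq_square)
  have "qform (Suc d) G (x(d := y)) = qform d G x + (\<Sum>i<d. x i * G $$ (i, d)) * y + y * (\<Sum>j<d. G $$ (d, j) * x j) + y * g * y"
    unfolding qform_def by (simp add: sum.distrib sum_distrib_right sum_distrib_left mult.assoc g_def)
  also have "\<dots> = g * (y + l)\<^sup>2 + qform d (schur d G) x"
    unfolding s1 s2 * by (simp add: algebra_simps power2_eq_square)
  finally show ?thesis by (simp add: g_def l_def)
qed

lemma pd_schur:
  assumes pd: "pd (Suc d) G" shows "pd d (schur d G)"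
  unfolding pd_def
proof (intro conjI allI impI)
  show "schur d G \<in> carrier_mat d d" by (simp add: schur_def)
  fix i j assume "i < d" "j < d"
  then show "schur d G $$ (i, j) = schur d G $$ (j, i)"
    using pd by (simp add: schur_def pd_def mult.commute)
next
  fix x :: "nat \<Rightarrow> real" assume "\<exists>i<d. x i \<noteq> 0"
  then have "0 < qform (Suc d) G (x(d := - schur_lin d G x))"
    using pd unfolding pd_def by (metis fun_upd_other less_Suc_eq less_irrefl)
  then show "0 < qform d (schur d G) x" by (simp add: qform_schur[OF pd])
qed

text \<open>The unit lower triangular matrix \<open>U\<close> encodes column operations that clear
  the last row of \<open>G\<close> to the left of the diagonal. What remains is block triangular
  with the Schur complement and the pivot as diagonal blocks.\<close>

lemma det_schur:
  assumes pd: "pd (Suc d) G"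
  shows "Determinant.det G = G $$ (d, d) * Determinant.det (schur d G)"
proof -
  define g where "g = G $$ (d, d)"
  have g: "g \<noteq> 0" using pd_diag_pos[OF pd] by (simp add: g_def)
  have G: "G \<in> carrier_mat (Suc d) (Suc d)" using pd by (rule pd_carrier)
  define U where "U = Matrix.mat (Suc d) (Suc d) (\<lambda>(i, j). if i = j then 1 else if i = d then - G $$ (d, j) / g else (0::real))"
  have U: "U \<in> carrier_mat (Suc d) (Suc d)" by (simp add: U_def)
  have "Determinant.det U = prod_list (diag_mat U)"
    by (rule det_lower_triangular[OF _ U]) (auto simp: U_def)
  also have "\<dots> = 1" unfolding prod_list_diag_prod by (simp add: U_def)
  finally have detU: "Determinant.det U = 1" .
  have "G * U = four_block_mat (schur d G) (Matrix.mat d 1 (\<lambda>(i, j). G $$ (i, d))) (0\<^sub>m 1 d) (Matrix.mat 1 1 (\<lambda>_. g))"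
    (is "_ = ?R")
  proof (rule eq_matI)
    fix i j assume "i < dim_row ?R" "j < dim_col ?R"
    then have ij: "i < Suc d" "j < Suc d" by (auto simp: schur_def)
    have "(G * U) $$ (i, j) = (\<Sum>k<Suc d. G $$ (i, k) * U $$ (k, j))"
      using ij G U by (simp add: scalar_prod_def lessThan_atLeast0)
    also have "\<dots> = (\<Sum>k<d. G $$ (i, k) * (if k = j then 1 else 0)) + G $$ (i, d) * (if j = d then 1 else - G $$ (d, j) / g)"
      using ij by (auto simp: U_def intro!: sum.cong)
    also have "\<dots> = (if j < d then G $$ (i, j) - G $$ (i, d) * G $$ (d, j) / g else G $$ (i, d))"
      using ij by (auto simp: if_distrib sum.If_cases cong: if_cong)
    also have "\<dots> = ?R $$ (i, j)"
    proof (cases "i < d")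
      case True
      then show ?thesis using ij by (auto simp: schur_def g_def)
    next
      case False
      then have "i = d" using ij by simp
      then show ?thesis using ij g by (auto simp: schur_def g_def)
    qed
    finally show "(G * U) $$ (i, j) = ?R $$ (i, j)" .
  qed (use G U in \<open>auto simp: schur_def\<close>)
  then have "Determinant.det (G * U) = Determinant.det (schur d G) * Determinant.det (Matrix.mat 1 1 (\<lambda>_. g))"
    by (simp add: det_four_block_mat_lower_left_zero[of _ d _ 1] schur_def)
  also have "Determinant.det (Matrix.mat 1 1 (\<lambda>_. g)) = g"
    by (subst det_single) auto
  finally show ?thesis using det_mult[OF G U] detU by (simp add: g_def mult.commute)
qed

lemma pd_det_pos: "pd d G \<Longrightarrow> 0 < Determinant.det G"
proof (induction d arbitrary: G)
  case 0
  then show ?case by (simp add: pd_def)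
next
  case (Suc d)
  then show ?case by (simp add: det_schur pd_diag_pos pd_schur)
qed

text \<open>The constant is built along the Schur complements, which avoids a compactness argument
  on the unit sphere.\<close>

lemma pd_coercive: "pd d G \<Longrightarrow> \<exists>\<mu>>0. \<forall>x. \<mu> * (\<Sum>i<d. (x i)\<^sup>2) \<le> qform d G x"
proof (induction d arbitrary: G)
  case 0
  then show ?case by (auto simp: qform_def intro: exI[of _ 1])
next
  case (Suc d)
  define g where "g = G $$ (d, d)"
  have g: "0 < g" using pd_diag_pos[OF Suc.prems] by (simp add: g_def)
  obtain \<mu> where \<mu>: "0 < \<mu>" "\<And>x. \<mu> * (\<Sum>i<d. (x i)\<^sup>2) \<le> qform d (schur d G) x"
    using Suc.IH[OF pd_schur[OF Suc.prems]] by blast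
  define L where "L = (\<Sum>i<d. (G $$ (i, d) / g)\<^sup>2)"
  \<comment> \<open>Both parts come from (x d)^2 \<le> 2 (x d + l)^2 + 2 l^2 with l^2 \<le> L |x|^2:
    the first summand pays for the first d coordinates, the second one for the completed
    square.\<close>
  define K where "K = (1 + 2 * L) / \<mu> + 2 / g"
  have L: "0 \<le> L" unfolding L_def by (intro sum_nonneg) auto
  have K: "0 < K" using L \<mu> g unfolding K_def by (intro add_nonneg_pos) auto
  have "(\<Sum>i<Suc d. (x i)\<^sup>2) \<le> K * qform (Suc d) G x" for x
  proof -
    define l q where "l = schur_lin d G x" and "q = qform d (schur d G) x"
    have q: "qform (Suc d) G x = g * (x d + l)\<^sup>2 + q"
      using qform_schur[OF Suc.prems, of x "x d"] by (simp add: g_def l_def q_def)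
    have q0: "0 \<le> q" unfolding q_def by (rule pd_nonneg[OF pd_schur[OF Suc.prems]])
    have "l\<^sup>2 \<le> L * (\<Sum>i<d. (x i)\<^sup>2)"
      unfolding l_def schur_lin_def L_def g_def[symmetric] by (rule Cauchy_Schwarz_ineq_sum)
    moreover have "(x d)\<^sup>2 \<le> 2 * (x d + l)\<^sup>2 + 2 * l\<^sup>2"
      using zero_le_power2[of "x d + 2 * l"] by (simp add: power2_eq_square algebra_simps)
    ultimately have "(\<Sum>i<Suc d. (x i)\<^sup>2) \<le> (1 + 2 * L) * (\<Sum>i<d. (x i)\<^sup>2) + 2 * (x d + l)\<^sup>2"
      by (simp add: algebra_simps)
    also have "(1 + 2 * L) * (\<Sum>i<d. (x i)\<^sup>2) \<le> (1 + 2 * L) * (q / \<mu>)"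
      using \<mu>(2)[of x] \<mu>(1) L by (intro mult_left_mono) (auto simp: q_def field_simps)
    also have "(1 + 2 * L) * (q / \<mu>) + 2 * (x d + l)\<^sup>2 \<le> K * (g * (x d + l)\<^sup>2 + q)"
      using L \<mu> g q0 unfolding K_def by (simp add: field_simps)
    finally show ?thesis using q by simp
  qed
  then show ?case using K by (intro exI[of _ "1 / K"]) (auto simp: field_simps)
qed

lemma lb_component: "i < d \<Longrightarrow> (\<lambda>x. x i) \<in> borel_measurable (lb d)"
  using measurable_component_singleton[of i "{..<d}" "\<lambda>_. lborel :: real measure"] by simp

lemma qform_measurable [measurable]: "qform d G \<in> borel_measurable (lb d)"
  unfolding qform_def
  by (intro borel_measurable_sum borel_measurable_times measurable_component_singleton) auto

lemma schur_lin_measurable: "schur_lin d G \<in> borel_measurable (lb d)"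
  unfolding schur_lin_def
  by (intro borel_measurable_sum borel_measurable_times measurable_component_singleton) auto

text \<open>This is the substitution by a square root of \<open>G\<close>, done one variable at a
  time: the completed square is a shift and a scaling of the last variable. After that the order of
  integration is exchanged, so that for a fixed last coordinate s the induction hypothesis applies
  to \<open>F\<close> shifted by s^2.\<close>

lemma nn_integral_qform:
  fixes F :: "real \<Rightarrow> ennreal"
  assumes "pd d G" "F \<in> borel_measurable borel"
  shows "ennreal (sqrt (Determinant.det G)) * (\<integral>\<^sup>+x. F (qform d G x) \<partial>lb d) = (\<integral>\<^sup>+x. F (\<Sum>i<d. (x i)\<^sup>2) \<partial>lb d)"
  using assms
proof (induction d arbitrary: G F)
  case 0
  then show ?case by (simp add: pd_def qform_def)
next
  case (Suc d)
  note [measurable] = Suc.prems(2)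
  note pd = Suc.prems(1)
  define g where "g = G $$ (d, d)"
  have g: "0 < g" using pd_diag_pos[OF pd] by (simp add: g_def)
  define G' where "G' = schur d G"
  have pd': "pd d G'" unfolding G'_def by (rule pd_schur[OF pd])
  have comp [measurable]: "(\<lambda>x. x d) \<in> borel_measurable (lb (Suc d))"
    by (rule lb_component) simp
  have restr: "(\<lambda>x. restrict x {..<d}) \<in> lb (Suc d) \<rightarrow>\<^sub>M lb d"
    by (rule measurable_restrict_subset) auto
  have q'_meas [measurable]: "(\<lambda>x. qform d G' x) \<in> borel_measurable (lb (Suc d))"
  proof -
    have eq: "(\<lambda>x. qform d G' x) = (\<lambda>x. qform d G' (restrict x {..<d}))"
      by (intro ext qform_cong) simp
    show ?thesis by (subst eq) (rule measurable_compose[OF restr qform_measurable])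
  qed
  have [measurable]: "(\<lambda>x. \<Sum>i<d. (x i)\<^sup>2) \<in> borel_measurable (lb (Suc d))"
    by (intro borel_measurable_sum borel_measurable_power lb_component) auto
  have inner: "ennreal (sqrt g) * (\<integral>\<^sup>+s. F (g * (s + l)\<^sup>2 + q) \<partial>lborel) = (\<integral>\<^sup>+s. F (s\<^sup>2 + q) \<partial>lborel)" for l q
  proof -
    have "(\<integral>\<^sup>+s. F (s\<^sup>2 + q) \<partial>lborel) = \<bar>sqrt g\<bar> * (\<integral>\<^sup>+s. F ((sqrt g * l + sqrt g * s)\<^sup>2 + q) \<partial>lborel)"
      using g by (intro nn_integral_real_affine) auto
    also have "(\<lambda>s. (sqrt g * l + sqrt g * s)\<^sup>2) = (\<lambda>s. g * (s + l)\<^sup>2)"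
      using g by (auto simp: fun_eq_iff power_mult_distrib add.commute simp flip: distrib_left)
    finally show ?thesis using g by (simp add: fun_eq_iff)
  qed
  have "(\<integral>\<^sup>+x. F (qform (Suc d) G x) \<partial>lb (Suc d)) = (\<integral>\<^sup>+x. (\<integral>\<^sup>+s. F (g * (s + schur_lin d G x)\<^sup>2 + qform d G' x) \<partial>lborel) \<partial>lb d)"
    by (subst nn_integral_lb_Suc') (auto simp: qform_schur[OF pd] g_def G'_def)
  then have "ennreal (sqrt g) * (\<integral>\<^sup>+x. F (qform (Suc d) G x) \<partial>lb (Suc d)) =
      (\<integral>\<^sup>+x. ennreal (sqrt g) * (\<integral>\<^sup>+s. F (g * (s + schur_lin d G x)\<^sup>2 + qform d G' x) \<partial>lborel) \<partial>lb d)"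
    using schur_lin_measurable[of d G, measurable]
    by (subst nn_integral_cmult) (auto intro!: lborel.borel_measurable_nn_integral)
  also have "\<dots> = (\<integral>\<^sup>+x. (\<integral>\<^sup>+s. F (s\<^sup>2 + qform d G' x) \<partial>lborel) \<partial>lb d)"
    by (simp add: inner)
  also have "\<dots> = (\<integral>\<^sup>+x. F ((x d)\<^sup>2 + qform d G' x) \<partial>lb (Suc d))"
    by (subst nn_integral_lb_Suc') (auto intro!: nn_integral_cong arg_cong[where f=F] qform_cong)
  also have "\<dots> = (\<integral>\<^sup>+s. (\<integral>\<^sup>+x. F (s\<^sup>2 + qform d G' x) \<partial>lb d) \<partial>lborel)"
    by (subst nn_integral_lb_Suc) (auto intro!: nn_integral_cong arg_cong[where f=F] qform_cong)
  finally have 1: "ennreal (sqrt g) * (\<integral>\<^sup>+x. F (qform (Suc d) G x) \<partial>lb (Suc d)) = (\<integral>\<^sup>+s. (\<integral>\<^sup>+x. F (s\<^sup>2 + qform d G' x) \<partial>lb d) \<partial>lborel)" .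
  interpret sigma_finite_measure "lb d" by (rule sigma_finite_lb)
  have "ennreal (sqrt (Determinant.det G')) * (\<integral>\<^sup>+s. (\<integral>\<^sup>+x. F (s\<^sup>2 + qform d G' x) \<partial>lb d) \<partial>lborel)
     = (\<integral>\<^sup>+s. ennreal (sqrt (Determinant.det G')) * (\<integral>\<^sup>+x. F (s\<^sup>2 + qform d G' x) \<partial>lb d) \<partial>lborel)"
    by (subst nn_integral_cmult) (auto intro!: borel_measurable_nn_integral)
  also have "\<dots> = (\<integral>\<^sup>+s. (\<integral>\<^sup>+x. F (s\<^sup>2 + (\<Sum>i<d. (x i)\<^sup>2)) \<partial>lb d) \<partial>lborel)"
    using Suc.IH[OF pd', of "\<lambda>t. F (s\<^sup>2 + t)" for s] by (intro nn_integral_cong) auto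
  also have "\<dots> = (\<integral>\<^sup>+x. F (\<Sum>i<Suc d. (x i)\<^sup>2) \<partial>lb (Suc d))"
    by (subst nn_integral_lb_Suc) (auto intro!: nn_integral_cong arg_cong[where f=F] sum.cong simp: add.commute)
  finally have 2: "ennreal (sqrt (Determinant.det G')) * (ennreal (sqrt g) * (\<integral>\<^sup>+x. F (qform (Suc d) G x) \<partial>lb (Suc d)))
     = (\<integral>\<^sup>+x. F (\<Sum>i<Suc d. (x i)\<^sup>2) \<partial>lb (Suc d))" by (simp only: 1)
  have "sqrt (Determinant.det G) = sqrt (Determinant.det G') * sqrt g"
    by (simp add: det_schur[OF pd] g_def G'_def real_sqrt_mult mult.commute)
  then show ?case using g pd_det_pos[OF pd'] unfolding 2[symmetric] by (simp add: ennreal_mult mult.assoc)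
qed

lemma ellipsoid_volume:
  assumes pd: "pd d G" and r: "0 < r"
  shows "ennreal (sqrt (Determinant.det G)) * emeasure (lb d) {x \<in> space (lb d). qform d G x \<le> r\<^sup>2}
    = ennreal (unit_ball_vol (real d) * r ^ d)"
proof -
  have "emeasure (lb d) {x \<in> space (lb d). qform d G x \<le> r\<^sup>2} = (\<integral>\<^sup>+x. indicator {..r\<^sup>2} (qform d G x) \<partial>lb d)"
  proof -
    have "emeasure (lb d) {x \<in> space (lb d). qform d G x \<le> r\<^sup>2} = (\<integral>\<^sup>+x. indicator {x \<in> space (lb d). qform d G x \<le> r\<^sup>2} x \<partial>lb d)"
      by (rule nn_integral_indicator[symmetric]) measurable
    also have "\<dots> = (\<integral>\<^sup>+x. indicator {..r\<^sup>2} (qform d G x) \<partial>lb d)"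
      by (intro nn_integral_cong) (auto simp: indicator_def)
    finally show ?thesis .
  qed
  then have "ennreal (sqrt (Determinant.det G)) * emeasure (lb d) {x \<in> space (lb d). qform d G x \<le> r\<^sup>2}
     = (\<integral>\<^sup>+x. indicator {..r\<^sup>2} (\<Sum>i<d. (x i)\<^sup>2) \<partial>lb d)"
    using nn_integral_qform[OF pd, of "indicator {..r\<^sup>2}"] by simp
  also have "\<dots> = (\<integral>\<^sup>+x. indicator ({x. sqrt (\<Sum>i<d. (x i)\<^sup>2) \<le> r} \<inter> space (lb d)) x \<partial>lb d)"
    using r by (intro nn_integral_cong) (auto simp: indicator_def real_sqrt_le_iff' sum_nonneg)
  also have "\<dots> = emeasure (lb d) ({x. sqrt (\<Sum>i<d. (x i)\<^sup>2) \<le> r} \<inter> space (lb d))"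
    by (rule nn_integral_indicator) auto
  also have "\<dots> = ennreal (unit_ball_vol (real d) * r ^ d)"
    using emeasure_cball_aux[of "{..<d}" r] r by simp
  finally show ?thesis .
qed

lemma ennreal_power2_le_imp_le: "(a::ennreal)\<^sup>2 \<le> b\<^sup>2 \<Longrightarrow> a \<le> b"
proof (cases "b = Orderings.top")
  case False
  assume le: "a\<^sup>2 \<le> b\<^sup>2"
  from False obtain s where s: "b = ennreal s" "0 \<le> s" by (cases b) auto
  have "a \<noteq> Orderings.top" using le s by (auto simp: ennreal_power top_unique power2_eq_square simp flip: ennreal_mult)
  then obtain r where r: "a = ennreal r" "0 \<le> r" by (cases a) auto
  have "r\<^sup>2 \<le> s\<^sup>2" using le r s by (simp add: ennreal_power ennreal_le_iff)
  then show ?thesis using r s power2_le_imp_le by (auto intro!: ennreal_leI)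
qed simp

text \<open>Half the difference of two points of \<open>A\<close> has norm at most D / 2. So
  Prekopa-Leindler applies to the indicator of \<open>A\<close>, taken twice, and the indicator of
  the ball of radius D / 2.\<close>

lemma isodiametric:
  assumes pd: "pd d G" and D: "0 < D" and A [measurable]: "A \<in> sets (lb d)"
    and diam: "\<And>x y. x \<in> A \<Longrightarrow> y \<in> A \<Longrightarrow> qnorm d G (\<lambda>i. x i - y i) \<le> D"
  shows "ennreal (sqrt (Determinant.det G)) * emeasure (lb d) A \<le> ennreal (unit_ball_vol (real d) * (D / 2) ^ d)"
proof -
  let ?E = "{x \<in> space (lb d). qform d G x \<le> (D / 2)\<^sup>2}"
  have "(\<integral>\<^sup>+x. indicator A x \<partial>lb d) * (\<integral>\<^sup>+x. indicator A x \<partial>lb d) \<le> (\<integral>\<^sup>+x. indicator ?E x \<partial>lb d) ^ 2"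
  proof (rule prekopa_leindler)
    fix x y assume xy: "x \<in> space (lb d)" "y \<in> space (lb d)"
    show "indicator A x * indicator A y \<le> (indicator ?E (\<lambda>i\<in>{..<d}. (x i - y i) / 2)::ennreal)\<^sup>2"
    proof (cases "x \<in> A \<and> y \<in> A")
      case True
      let ?z = "\<lambda>i\<in>{..<d}. (x i - y i) / 2"
      have "qform d G ?z = qform d G (\<lambda>i. (1/2) * (x i - y i))" by (rule qform_cong) simp
      also have "\<dots> = (qnorm d G (\<lambda>i. x i - y i))\<^sup>2 / 4"
        by (simp only: qform_scale) (simp add: qnorm_power2[OF pd] power_divide)
      also have "\<dots> \<le> D\<^sup>2 / 4" using diam True qnorm_nonneg[OF pd] by (intro divide_right_mono power_mono) auto
      finally have "?z \<in> ?E" by (auto simp: space_PiM power_divide)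
      then show ?thesis by (auto simp: indicator_def)
    qed auto
  qed auto
  then have "(emeasure (lb d) A)\<^sup>2 \<le> (emeasure (lb d) ?E)\<^sup>2" by (simp add: power2_eq_square)
  then have "emeasure (lb d) A \<le> emeasure (lb d) ?E" by (rule ennreal_power2_le_imp_le)
  then have "ennreal (sqrt (Determinant.det G)) * emeasure (lb d) A \<le> ennreal (sqrt (Determinant.det G)) * emeasure (lb d) ?E"
    by (intro mult_left_mono) auto
  also have "\<dots> = ennreal (unit_ball_vol (real d) * (D / 2) ^ d)" using ellipsoid_volume[OF pd, of "D / 2"] D by simp
  finally show ?thesis .
qed

section \<open>Hausdorff measure for the norm of a quadratic form\<close>

abbreviation qdist :: "nat \<Rightarrow> real mat \<Rightarrow> (nat \<Rightarrow> real) \<Rightarrow> (nat \<Rightarrow> real) \<Rightarrow> real" where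
  "qdist d G \<equiv> \<lambda>x y. qnorm d G (\<lambda>i. x i - y i)"

text \<open>Half-open, so that the dyadic cubes of one level are disjoint and fill the
  space.\<close>

definition cube :: "nat \<Rightarrow> (nat \<Rightarrow> real) \<Rightarrow> real \<Rightarrow> (nat \<Rightarrow> real) set" where
  "cube d c r = (\<Pi>\<^sub>E i\<in>{..<d}. {c i..<c i + r})"

lemma cube_sets [measurable]: "cube d c r \<in> sets (lb d)"
  unfolding cube_def by (intro sets_PiM_I_finite) auto

lemma cube_space: "cube d c r \<subseteq> space (lb d)"
  by (auto simp: cube_def space_PiM)

lemma emeasure_cube: "0 \<le> r \<Longrightarrow> emeasure (lb d) (cube d c r) = ennreal (r ^ d)"
  unfolding cube_def by (subst lbP.emeasure_PiM) (auto simp: ennreal_power)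

lemma cube_subdivide:
  assumes "0 < N" "0 < r"
  shows "cube d c r \<subseteq> (\<Union>k\<in>{..<d} \<rightarrow>\<^sub>E {..<N}. cube d (\<lambda>i. c i + r / real N * real (k i)) (r / real N))"
proof
  fix x assume x: "x \<in> cube d c r"
  define k where "k = (\<lambda>i\<in>{..<d}. nat \<lfloor>(x i - c i) * real N / r\<rfloor>)"
  have *: "k i < N \<and> c i + r / real N * real (k i) \<le> x i \<and> x i < c i + r / real N * real (k i) + r / real N" if i: "i < d" for i
  proof -
    define y where "y = (x i - c i) * real N / r"
    have xi: "c i \<le> x i" "x i < c i + r" using x i by (auto simp: cube_def PiE_def Pi_def)
    have "(x i - c i) * real N < r * real N" using xi assms by (intro mult_strict_right_mono) auto
    then have y: "0 \<le> y" "y < real N" using xi assms by (auto simp: y_def divide_simps mult.commute)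
    have k: "real (k i) \<le> y" "y < real (k i) + 1" "real (k i) = of_int \<lfloor>y\<rfloor>"
      using y i by (auto simp: k_def y_def[symmetric])
    have xy: "x i = c i + r / real N * y" using assms by (simp add: y_def)
    have "r / real N * real (k i) \<le> r / real N * y"
      using assms by (intro mult_left_mono[OF k(1)]) simp
    moreover have "r / real N * y < r / real N * (real (k i) + 1)"
      using assms by (intro mult_strict_left_mono[OF k(2)]) simp
    moreover have "real (k i) < real N" using k y by linarith
    ultimately show ?thesis by (simp add: xy distrib_left)
  qed
  then have "x \<in> cube d (\<lambda>i. c i + r / real N * real (k i)) (r / real N)"
    using x by (auto simp: cube_def PiE_def)
  moreover have "k \<in> {..<d} \<rightarrow>\<^sub>E {..<N}" using * by (auto simp: k_def)
  ultimately show "x \<in> (\<Union>k\<in>{..<d} \<rightarrow>\<^sub>E {..<N}. cube d (\<lambda>i. c i + r / real N * real (k i)) (r / real N))" by blast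
qed

lemma qnorm_le_sup_norm: "\<exists>C>0. \<forall>\<eta>\<ge>0. \<forall>x. (\<forall>i<d. \<bar>x i\<bar> \<le> \<eta>) \<longrightarrow> qnorm d G x \<le> C * \<eta>"
proof -
  define S where "S = (\<Sum>i<d. \<Sum>j<d. \<bar>G $$ (i, j)\<bar>)"
  have S: "0 \<le> S" unfolding S_def by (intro sum_nonneg) auto
  \<comment> \<open>The added 1 keeps the constant positive when the form or the dimension is
    zero.\<close>
  have "qnorm d G x \<le> (sqrt (S * real d) + 1) * \<eta>" if "0 \<le> \<eta>" "\<forall>i<d. \<bar>x i\<bar> \<le> \<eta>" for \<eta> x
  proof -
    have "(x i)\<^sup>2 \<le> \<eta>\<^sup>2" if "i < d" for i
      using that \<open>\<forall>i<d. \<bar>x i\<bar> \<le> \<eta>\<close> by (metis abs_ge_zero power2_abs power_mono)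
    then have "(\<Sum>i<d. (x i)\<^sup>2) \<le> real d * \<eta>\<^sup>2"
      using sum_bounded_above[of "{..<d}" "\<lambda>i. (x i)\<^sup>2" "\<eta>\<^sup>2"] by simp
    then have "S * (\<Sum>i<d. (x i)\<^sup>2) \<le> S * (real d * \<eta>\<^sup>2)" using S by (rule mult_left_mono)
    then have "qform d G x \<le> S * real d * \<eta>\<^sup>2" using qform_upper[of d G x] by (simp add: S_def mult.assoc)
    then have "qnorm d G x \<le> sqrt (S * real d * \<eta>\<^sup>2)" unfolding qnorm_def by simp
    also have "\<dots> = sqrt (S * real d) * \<eta>" using that by (simp add: real_sqrt_mult)
    also have "\<dots> \<le> (sqrt (S * real d) + 1) * \<eta>" using that by (simp add: distrib_right)
    finally show ?thesis .
  qed
  moreover have "0 < sqrt (S * real d) + 1" using S by (simp add: add_nonneg_pos)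
  ultimately show ?thesis by blast
qed

lemma qdist_triangle: "pd d G \<Longrightarrow> qdist d G x z \<le> qdist d G x y + qdist d G y z"
  using qnorm_triangle[of d G "\<lambda>i. x i - y i" "\<lambda>i. y i - z i"] by simp

text \<open>The sets of a cover are arbitrary, whereas the isodiametric inequality concerns
  measurable sets. The union of the grid cells that \<open>U\<close> meets is a countable union,
  hence measurable, and stays within \<eta> of \<open>U\<close>.\<close>

lemma grid_hull:
  assumes U: "U \<subseteq> space (lb d)" and \<eta>: "0 < \<eta>"
  obtains V where "V \<in> sets (lb d)" "U \<subseteq> V" "\<And>x. x \<in> V \<Longrightarrow> \<exists>u\<in>U. \<forall>i<d. \<bar>x i - u i\<bar> \<le> \<eta>"
proof -
  define \<kappa> where "\<kappa> u = (\<lambda>i\<in>{..<d}. \<lfloor>u i / \<eta>\<rfloor>)" for u :: "nat \<Rightarrow> real"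
  define cell where "cell k = (\<Pi>\<^sub>E i\<in>{..<d}. {x. \<lfloor>x / \<eta>\<rfloor> = k i})" for k
  define V where "V = (\<Union>k\<in>\<kappa> ` U. cell k)"
  show ?thesis
  proof (rule that[of V])
    have "\<kappa> ` U \<subseteq> {..<d} \<rightarrow>\<^sub>E UNIV" unfolding \<kappa>_def by (intro image_subsetI) (simp add: PiE_iff)
    then have "countable (\<kappa> ` U)" by (rule countable_subset) (intro countable_PiE; simp)
    moreover have "cell k \<in> sets (lb d)" for k
      unfolding cell_def by (intro sets_PiM_I_finite) auto
    ultimately show "V \<in> sets (lb d)" unfolding V_def by (intro sets.countable_UN') auto
    show "U \<subseteq> V"
    proof
      fix u assume "u \<in> U"
      then have "u \<in> cell (\<kappa> u)" using U by (auto simp: cell_def \<kappa>_def space_PiM PiE_def)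
      then show "u \<in> V" using \<open>u \<in> U\<close> by (auto simp: V_def)
    qed
    fix x assume "x \<in> V"
    then obtain u where u: "u \<in> U" "x \<in> cell (\<kappa> u)" by (auto simp: V_def)
    have "\<bar>x i - u i\<bar> \<le> \<eta>" if "i < d" for i
    proof -
      have "\<lfloor>x i / \<eta>\<rfloor> = \<lfloor>u i / \<eta>\<rfloor>" using u(2) that by (auto simp: cell_def \<kappa>_def PiE_def Pi_def)
      then have "\<bar>x i / \<eta> - u i / \<eta>\<bar> \<le> 1" by linarith
      then have "\<bar>(x i - u i) / \<eta>\<bar> \<le> 1" by (simp add: diff_divide_distrib)
      then show ?thesis using \<eta> by (simp add: abs_divide)
    qed
    then show "\<exists>u\<in>U. \<forall>i<d. \<bar>x i - u i\<bar> \<le> \<eta>" using u by blast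
  qed
qed

text \<open>The hull enlarges a finite diameter \<open>D\<close> by at most 2 C \<eta> = t, and
  continuity of the cost as a function of the diameter makes the resulting error smaller than
  \<open>e\<close>. A set of infinite diameter has infinite cost, so the whole space serves as its
  hull.\<close>

lemma measurable_hull_hcost:
  assumes pd: "pd d G" and d: "0 < d" and e: "0 < e"
  obtains V where "V \<in> sets (lb d)" "U \<inter> space (lb d) \<subseteq> V"
    "ennreal (sqrt (Determinant.det G)) * emeasure (lb d) V \<le> hcost (qdist d G) d U + ennreal e"
proof -
  define w where "w = unit_ball_vol (real d) / 2 ^ d"
  have w: "0 < w" by (simp add: w_def)
  consider "U \<inter> space (lb d) = {}" | "diam_wrt (qdist d G) U = Orderings.top" "U \<noteq> {}"
    | "U \<inter> space (lb d) \<noteq> {}" "diam_wrt (qdist d G) U \<noteq> Orderings.top" by blast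
  then show ?thesis
  proof cases
    case 1
    then show ?thesis by (intro that[of "{}"]) auto
  next
    case 2
    then have "hcost (qdist d G) d U = Orderings.top"
      using w d by (simp add: hcost_def w_def[symmetric] ennreal_mult_top)
    then show ?thesis by (intro that[of "space (lb d)"]) auto
  next
    case 3
    then obtain D where D: "diam_wrt (qdist d G) U = ennreal D" "0 \<le> D" by (cases "diam_wrt (qdist d G) U") auto
    have dD: "qdist d G x y \<le> D" if "x \<in> U" "y \<in> U" for x y
      using diam_wrt_upper[of x U y "qdist d G"] that D by (simp add: ennreal_le_iff)
    obtain C where C: "0 < C" "\<And>\<eta> x. 0 \<le> \<eta> \<Longrightarrow> \<forall>i<d. \<bar>x i\<bar> \<le> \<eta> \<Longrightarrow> qnorm d G x \<le> C * \<eta>"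
      using qnorm_le_sup_norm[of d G] by metis
    have "((\<lambda>t. w * (D + t) ^ d) \<longlongrightarrow> w * (D + 0) ^ d) (at_right 0)"
      by (intro tendsto_intros)
    then have "eventually (\<lambda>t. w * (D + t) ^ d < w * D ^ d + e) (at_right 0)"
      using e by (intro order_tendstoD(2)[where y="w * (D + 0) ^ d"]) auto
    then have "eventually (\<lambda>t. w * (D + t) ^ d < w * D ^ d + e \<and> 0 < t) (at_right 0)"
      by (intro eventually_conj) (simp_all add: eventually_at_right_less)
    then obtain t where t: "w * (D + t) ^ d < w * D ^ d + e" "0 < t"
      using eventually_happens[of _ "at_right (0::real)"] by (auto simp: trivial_limit_at_right_real)
    define \<eta> where "\<eta> = t / (2 * C)"
    have \<eta>: "0 < \<eta>" "2 * (C * \<eta>) = t" using t C by (auto simp: \<eta>_def)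
    obtain V where V: "V \<in> sets (lb d)" "U \<inter> space (lb d) \<subseteq> V"
      "\<And>x. x \<in> V \<Longrightarrow> \<exists>u\<in>U \<inter> space (lb d). \<forall>i<d. \<bar>x i - u i\<bar> \<le> \<eta>"
      using grid_hull[of "U \<inter> space (lb d)" d \<eta>] \<eta> by (metis inf_le2)
    have "ennreal (sqrt (Determinant.det G)) * emeasure (lb d) V \<le> ennreal (unit_ball_vol (real d) * ((D + t) / 2) ^ d)"
    proof (rule isodiametric[OF pd _ V(1)])
      fix x y assume "x \<in> V" "y \<in> V"
      then obtain u v where uv: "u \<in> U" "\<forall>i<d. \<bar>x i - u i\<bar> \<le> \<eta>" "v \<in> U" "\<forall>i<d. \<bar>y i - v i\<bar> \<le> \<eta>"
        using V(3) by blast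
      have "qdist d G x y \<le> qdist d G x u + (qdist d G u v + qdist d G v y)"
        using qdist_triangle[OF pd, of x y u] qdist_triangle[OF pd, of u y v] by linarith
      moreover have "qdist d G x u \<le> C * \<eta>" using C(2)[of \<eta> "\<lambda>i. x i - u i"] uv \<eta> by auto
      moreover have "qdist d G v y \<le> C * \<eta>" using C(2)[of \<eta> "\<lambda>i. v i - y i"] uv \<eta> by (auto simp: abs_minus_commute)
      ultimately show "qdist d G x y \<le> D + t" using dD uv \<eta> by fastforce
    qed (use D t in auto)
    also have "unit_ball_vol (real d) * ((D + t) / 2) ^ d = w * (D + t) ^ d" by (simp add: w_def power_divide)
    also have "ennreal (w * (D + t) ^ d) \<le> ennreal (w * D ^ d + e)" using t by (intro ennreal_leI) auto
    also have "\<dots> = hcost (qdist d G) d U + ennreal e"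
      using 3 D w e by (auto simp: hcost_def w_def[symmetric] ennreal_plus ennreal_mult ennreal_power)
    finally show ?thesis using V by (intro that[of V])
  qed
qed

text \<open>By the isodiametric inequality every single covering set costs at least the volume of
  its hull up to a small error, whatever its size. So the content at one scale already gives the
  bound.\<close>

lemma hausdorff_qdist_lower:
  assumes pd: "pd d G" and d: "0 < d" and K: "K \<in> sets (lb d)"
  shows "ennreal (sqrt (Determinant.det G)) * emeasure (lb d) K \<le> hausdorff_measure (qdist d G) d K"
proof -
  let ?s = "ennreal (sqrt (Determinant.det G))"
  have "?s * emeasure (lb d) K \<le> hcontent (qdist d G) d (ennreal 1) K"
  proof (rule hcontent_greatest)
    fix U :: "nat \<Rightarrow> _ set" assume U: "K \<subseteq> (\<Union>i. U i)"
    show "?s * emeasure (lb d) K \<le> (\<Sum>i. hcost (qdist d G) d (U i))"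
    proof (rule ennreal_le_epsilon)
      fix e :: real assume e: "0 < e"
      have "\<exists>V. V \<in> sets (lb d) \<and> U i \<inter> space (lb d) \<subseteq> V \<and> ?s * emeasure (lb d) V \<le> hcost (qdist d G) d (U i) + ennreal (e * (1/2) ^ Suc i)" for i
      proof -
        from e have "0 < e * (1/2) ^ Suc i" by simp
        then show ?thesis
          by (rule measurable_hull_hcost[OF pd d, of _ "U i"]) (rule exI, intro conjI)
      qed
      from choice[OF allI[OF this]] obtain V where "\<forall>i. V i \<in> sets (lb d) \<and> U i \<inter> space (lb d) \<subseteq> V i \<and>
        ?s * emeasure (lb d) (V i) \<le> hcost (qdist d G) d (U i) + ennreal (e * (1/2) ^ Suc i)" ..
      then have V: "V i \<in> sets (lb d)" "U i \<inter> space (lb d) \<subseteq> V i"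
        "?s * emeasure (lb d) (V i) \<le> hcost (qdist d G) d (U i) + ennreal (e * (1/2) ^ Suc i)" for i
        by simp_all
      have "K \<subseteq> (\<Union>i. V i)" using U V(2) sets.sets_into_space[OF K] by blast
      then have "emeasure (lb d) K \<le> emeasure (lb d) (\<Union>i. V i)" using V(1) by (intro emeasure_mono) auto
      also have "\<dots> \<le> (\<Sum>i. emeasure (lb d) (V i))" using V(1) by (intro emeasure_subadditive_countably) auto
      finally have "?s * emeasure (lb d) K \<le> ?s * (\<Sum>i. emeasure (lb d) (V i))" by (intro mult_left_mono) auto
      also have "\<dots> = (\<Sum>i. ?s * emeasure (lb d) (V i))" by simp
      also have "\<dots> \<le> (\<Sum>i. hcost (qdist d G) d (U i) + ennreal (e * (1/2) ^ Suc i))"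
        by (intro suminf_le V(3)) auto
      also have "\<dots> = (\<Sum>i. hcost (qdist d G) d (U i)) + (\<Sum>i. ennreal (e * (1/2) ^ Suc i))"
        by (intro suminf_add[symmetric]) auto
      also have "(\<Sum>n. ennreal (e * (1/2) ^ Suc n)) = ennreal e"
        using sums_mult[OF power_half_series, of e] e by (subst suminf_ennreal_eq[where x=e]) auto
      finally show "?s * emeasure (lb d) K \<le> (\<Sum>i. hcost (qdist d G) d (U i)) + ennreal e" .
    qed
  qed
  also have "\<dots> \<le> hausdorff_measure (qdist d G) d K" by (rule hcontent_le_hausdorff) simp
  finally show ?thesis .
qed

lemma hcontent_cube_scale:
  assumes t: "0 < t"
  shows "hcontent (qdist d G) d (ennreal t * \<delta>) (cube d c' (t * r)) \<le> ennreal (t ^ d) * hcontent (qdist d G) d \<delta> (cube d c r)"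
proof -
  define f where "f x = (\<lambda>i\<in>{..<d}. c' i + t * (x i - c i))" for x :: "nat \<Rightarrow> real"
  have "cube d c' (t * r) \<subseteq> f ` cube d c r"
  proof
    fix y assume y: "y \<in> cube d c' (t * r)"
    define x where "x = (\<lambda>i\<in>{..<d}. c i + (y i - c' i) / t)"
    have "x \<in> cube d c r" using y t by (auto simp: x_def cube_def PiE_def Pi_def field_simps)
    moreover have "y = f x" using y t by (auto simp: f_def x_def cube_def fun_eq_iff PiE_def extensional_def)
    ultimately show "y \<in> f ` cube d c r" by blast
  qed
  then have "hcontent (qdist d G) d (ennreal t * \<delta>) (cube d c' (t * r)) \<le> hcontent (qdist d G) d (ennreal t * \<delta>) (f ` cube d c r)"
    by (rule hcontent_mono)
  also have "\<dots> \<le> ennreal (t ^ d) * hcontent (qdist d G) d \<delta> (cube d c r)"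
  proof (rule hcontent_lipschitz[OF t])
    fix x y
    have "qnorm d G (\<lambda>i. f x i - f y i) = qnorm d G (\<lambda>i. t * (x i - y i))"
      by (rule qnorm_cong) (simp add: f_def algebra_simps)
    then show "qdist d G (f x) (f y) \<le> t * qdist d G x y" using t by (simp add: qnorm_scale)
  qed
  finally show ?thesis .
qed

text \<open>The cube is centred at the origin in order to contain a small ball of the norm.\<close>

definition unit_content :: "nat \<Rightarrow> real mat \<Rightarrow> ennreal" where
  "unit_content d G = hcontent (qdist d G) d Orderings.top (cube d (\<lambda>_. - 1/2) 1)"

lemma diam_cube_le:
  assumes C: "\<And>\<eta> x. 0 \<le> \<eta> \<Longrightarrow> \<forall>i<d. \<bar>x i\<bar> \<le> \<eta> \<Longrightarrow> qnorm d G x \<le> C * \<eta>" and r: "0 \<le> r"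
  shows "diam_wrt (qdist d G) (cube d c r) \<le> ennreal (C * r)"
proof (rule diam_wrt_least)
  fix x y assume xy: "x \<in> cube d c r" "y \<in> cube d c r"
  have "\<bar>x i - y i\<bar> \<le> r" if "i < d" for i
  proof -
    have "x i \<in> {c i..<c i + r}" "y i \<in> {c i..<c i + r}"
      using PiE_mem[OF xy(1)[unfolded cube_def], of i] PiE_mem[OF xy(2)[unfolded cube_def], of i] that by simp_all
    then show ?thesis by (simp add: abs_le_iff)
  qed
  then show "ennreal (qdist d G x y) \<le> ennreal (C * r)" using C[of r "\<lambda>i. x i - y i"] r by (intro ennreal_leI) auto
qed

text \<open>The cube is cut into N^d scaled copies of the unit cube with diameters below \<delta>.
  For each copy the bound on the diameters is no restriction, so its content is at most t^d times
  the unrestricted content of the unit cube.\<close>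

lemma hcontent_cube_le:
  assumes \<delta>: "0 < \<delta>" and r: "0 < r"
  shows "hcontent (qdist d G) d (ennreal \<delta>) (cube d c r) \<le> ennreal (r ^ d) * unit_content d G"
proof -
  obtain C where C: "0 < C" "\<And>\<eta> x. 0 \<le> \<eta> \<Longrightarrow> \<forall>i<d. \<bar>x i\<bar> \<le> \<eta> \<Longrightarrow> qnorm d G x \<le> C * \<eta>"
    using qnorm_le_sup_norm[of d G] by metis
  obtain N where N: "C * r / \<delta> < real N" using reals_Archimedean2 by blast
  have N0: "0 < N" using N C r \<delta> by (metis divide_pos_pos gr0I less_asym mult_pos_pos of_nat_0)
  define t where "t = r / real N"
  have t: "0 < t" "C \<le> \<delta> / t" using N N0 r \<delta> C by (auto simp: t_def field_simps)
  have sub: "hcontent (qdist d G) d (ennreal \<delta>) (cube d c' t) \<le> ennreal (t ^ d) * unit_content d G" for c'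
  proof -
    have "hcontent (qdist d G) d (ennreal t * ennreal (\<delta> / t)) (cube d c' (t * 1)) \<le> ennreal (t ^ d) * hcontent (qdist d G) d (ennreal (\<delta> / t)) (cube d (\<lambda>_. - 1/2) 1)"
      by (rule hcontent_cube_scale[OF t(1)])
    also have "\<dots> \<le> ennreal (t ^ d) * unit_content d G"
      unfolding unit_content_def
    proof (intro mult_left_mono hcontent_restrict_diam)
      have "diam_wrt (qdist d G) (cube d (\<lambda>_. - 1/2) 1) \<le> ennreal (C * 1)" using C(2) by (rule diam_cube_le) auto
      also have "\<dots> \<le> ennreal (\<delta> / t)" using t by (intro ennreal_leI) auto
      finally show "diam_wrt (qdist d G) (cube d (\<lambda>_. - 1/2) 1) \<le> ennreal (\<delta> / t)" .
    qed auto
    finally show ?thesis using t \<delta> by (simp flip: ennreal_mult)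
  qed
  let ?I = "{..<d} \<rightarrow>\<^sub>E {..<N}"
  have fin: "finite ?I" by (intro finite_PiE) auto
  have card: "card ?I = N ^ d" by (simp add: card_PiE)
  have "hcontent (qdist d G) d (ennreal \<delta>) (cube d c r) \<le> hcontent (qdist d G) d (ennreal \<delta>) (\<Union>k\<in>?I. cube d (\<lambda>i. c i + t * real (k i)) t)"
    using cube_subdivide[OF N0 r] unfolding t_def by (intro hcontent_mono)
  also have "\<dots> \<le> (\<Sum>k\<in>?I. hcontent (qdist d G) d (ennreal \<delta>) (cube d (\<lambda>i. c i + t * real (k i)) t))"
    by (rule hcontent_UN_finite[OF fin])
  also have "\<dots> \<le> (\<Sum>k\<in>?I. ennreal (t ^ d) * unit_content d G)" by (intro sum_mono sub)
  also have "\<dots> = ennreal (real N ^ d) * (ennreal (t ^ d) * unit_content d G)"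
    by (simp add: card ennreal_of_nat_eq_real_of_nat ennreal_power)
  also have "\<dots> = ennreal (real N ^ d * t ^ d) * unit_content d G"
    using t by (simp add: ennreal_mult mult.assoc)
  also have "real N ^ d * t ^ d = r ^ d" using N0 by (simp add: t_def power_divide)
  finally show ?thesis .
qed

text \<open>Cover the unit cube by one inscribed ellipsoid and by the small cubes not contained in it.
  By scaling the small cubes have the same content to volume ratio as the unit cube, whence this
  ratio is at most that of the ellipsoid.\<close>

lemma unit_content_le:
  assumes pd: "pd d G" and d: "0 < d"
  shows "unit_content d G \<le> ennreal (sqrt (Determinant.det G))"
proof -
  let ?\<rho> = "qdist d G" and ?Q = "cube d (\<lambda>_. - 1/2) 1"
  define \<omega> where "\<omega> = unit_ball_vol (real d)"
  have \<omega>: "0 < \<omega>" by (simp add: \<omega>_def)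
  obtain C where C: "0 < C" "\<And>\<eta> x. 0 \<le> \<eta> \<Longrightarrow> \<forall>i<d. \<bar>x i\<bar> \<le> \<eta> \<Longrightarrow> qnorm d G x \<le> C * \<eta>"
    using qnorm_le_sup_norm[of d G] by metis
  have "unit_content d G \<le> hcost ?\<rho> d ?Q" unfolding unit_content_def by (rule hcontent_single) simp
  also have "\<dots> < Orderings.top"
  proof -
    have "diam_wrt ?\<rho> ?Q \<le> ennreal (C * 1)" by (rule diam_cube_le[OF C(2)]) auto
    also have "\<dots> < Orderings.top" by simp
    finally have "diam_wrt ?\<rho> ?Q < Orderings.top" .
    then show ?thesis by (auto simp: hcost_def ennreal_mult_less_top power_less_top_ennreal)
  qed
  finally obtain H where H: "unit_content d G = ennreal H" "0 \<le> H"
    by (cases "unit_content d G") auto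
  obtain \<mu> where \<mu>: "0 < \<mu>" "\<And>x. \<mu> * (\<Sum>i<d. (x i)\<^sup>2) \<le> qform d G x" using pd_coercive[OF pd] by blast
  \<comment> \<open>Points whose norm is at most \<open>s\<close> have all coordinates between -1/4
    and 1/4, so the ellipsoid lies inside the unit cube.\<close>
  define s where "s = sqrt \<mu> / 4"
  have s: "0 < s" "s\<^sup>2 = \<mu> / 16" using \<mu> by (auto simp: s_def power_divide)
  define E where "E = (\<lambda>u. {x \<in> space (lb d). qform d G x \<le> (u * s)\<^sup>2})"
  have E_iff: "x \<in> E u \<longleftrightarrow> x \<in> space (lb d) \<and> qnorm d G x \<le> u * s" if "0 < u" for x u
    using s that by (simp add: E_def qnorm_def real_sqrt_le_iff' pd_nonneg[OF pd])
  have costE: "hcost ?\<rho> d (E 1) \<le> ennreal (\<omega> * s ^ d)"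
  proof -
    have "diam_wrt ?\<rho> (E 1) \<le> ennreal (2 * s)"
    proof (rule diam_wrt_least)
      fix x y assume "x \<in> E 1" "y \<in> E 1"
      then have "qnorm d G x \<le> s" "qnorm d G y \<le> s" by (auto simp: E_iff)
      moreover have "qdist d G x y \<le> qnorm d G x + qnorm d G y"
        using qnorm_triangle[OF pd, of x "\<lambda>i. - y i"] qnorm_scale[of d G "-1" y] by simp
      ultimately show "ennreal (qdist d G x y) \<le> ennreal (2 * s)" by (intro ennreal_leI) linarith
    qed
    then have "hcost ?\<rho> d (E 1) \<le> ennreal (\<omega> / 2 ^ d) * ennreal (2 * s) ^ d"
      unfolding hcost_def \<omega>_def by (auto intro!: mult_left_mono power_mono)
    also have "\<dots> = ennreal (\<omega> * s ^ d)" using s \<omega> by (simp add: ennreal_power power_mult_distrib flip: ennreal_mult)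
    finally show ?thesis .
  qed
  \<comment> \<open>The factor u < 1 leaves a margin between the two ellipsoids: a small cube that
    meets \<open>E u\<close> is contained in \<open>E 1\<close>.\<close>
  have main: "u ^ d * H \<le> sqrt (Determinant.det G)" if u: "0 < u" "u < 1" for u
  proof -
    have gap: "0 < (1 - u) * s" using u s by simp
    obtain N where N: "C / ((1 - u) * s) < real N" using reals_Archimedean2 by blast
    have N0: "0 < N" using N C gap by (metis divide_pos_pos gr0I less_asym of_nat_0)
    have CN: "C * (1 / real N) \<le> (1 - u) * s" using N N0 gap by (simp add: field_simps)
    let ?I = "{..<d} \<rightarrow>\<^sub>E {..<N}"
    let ?c = "\<lambda>k. cube d (\<lambda>i. - 1/2 + 1 / real N * real (k i)) (1 / real N)"
    have fin: "finite ?I" by (intro finite_PiE) auto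
    have card: "card ?I = N ^ d" by (simp add: card_PiE)
    have cover: "?Q \<subseteq> (\<Union>k\<in>?I. ?c k)" using cube_subdivide[OF N0, of 1 d "\<lambda>_. - 1/2"] by simp
    \<comment> \<open>\<open>A\<close> indexes the small cubes inside the ellipsoid and
      \<open>m\<close> is their total volume, which is at least the volume of
      \<open>E u\<close>.\<close>
    define A where "A = {k \<in> ?I. ?c k \<subseteq> E 1}"
    have A: "A \<subseteq> ?I" "finite A" using fin by (auto simp: A_def)
    define m where "m = real (card A) / real N ^ d"
    have EQ: "E u \<subseteq> ?Q"
    proof
      fix x assume x: "x \<in> E u"
      have "- 1/2 \<le> x i \<and> x i < 1/2" if "i < d" for i
      proof -
        have "\<mu> * (x i)\<^sup>2 \<le> \<mu> * (\<Sum>i<d. (x i)\<^sup>2)" using that \<mu> by (intro mult_left_mono member_le_sum) auto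
        also have "\<dots> \<le> (u * s)\<^sup>2" using \<mu>(2)[of x] x by (auto simp: E_def)
        also have "\<dots> \<le> s\<^sup>2" using u s by (intro power_mono) auto
        finally have "\<mu> * (x i)\<^sup>2 \<le> \<mu> * (1/4)\<^sup>2" by (simp add: s(2) power_divide)
        then have "(x i)\<^sup>2 \<le> (1/4)\<^sup>2" using \<mu>(1) by (simp only: mult_le_cancel_left_pos)
        then have "\<bar>x i\<bar> \<le> 1/4" by (subst (asm) power2_le_iff_abs_le) auto
        then show ?thesis by linarith
      qed
      then show "x \<in> ?Q" using x by (auto simp: cube_def E_def space_PiM PiE_def)
    qed
    have inA: "k \<in> A" if x: "x \<in> E u" "k \<in> ?I" "x \<in> ?c k" for x k
    proof -
      have "y \<in> E 1" if y: "y \<in> ?c k" for y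
      proof -
        have "ennreal (qdist d G y x) \<le> ennreal (C * (1 / real N))"
          using diam_wrt_upper[OF y x(3), of ?\<rho>] diam_cube_le[OF C(2), of "1 / real N"] by (meson order_trans zero_le_divide_1_iff of_nat_0_le_iff)
        then have "qdist d G y x \<le> C * (1 / real N)" using C N0 by (subst (asm) ennreal_le_iff) auto
        moreover have "qnorm d G y \<le> qdist d G y x + qnorm d G x"
          using qnorm_triangle[OF pd, of "\<lambda>i. y i - x i" x] by simp
        moreover have "qnorm d G x \<le> u * s" using x(1) u by (simp add: E_iff)
        ultimately have "qnorm d G y \<le> 1 * s" using CN by (simp add: algebra_simps)
        then show ?thesis using y cube_space by (auto simp: E_iff)
      qed
      then show ?thesis using x by (auto simp: A_def)
    qed
    have "E u \<subseteq> (\<Union>k\<in>A. ?c k)"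
    proof
      fix x assume x: "x \<in> E u"
      then have "x \<in> (\<Union>k\<in>?I. ?c k)" using EQ cover by (meson subsetD)
      then obtain k where "k \<in> ?I" "x \<in> ?c k" by (rule UN_E)
      then show "x \<in> (\<Union>k\<in>A. ?c k)" using inA[OF x] by (intro UN_I)
    qed
    then have "emeasure (lb d) (E u) \<le> emeasure (lb d) (\<Union>k\<in>A. ?c k)"
      using A by (intro emeasure_mono) auto
    also have "\<dots> \<le> (\<Sum>k\<in>A. emeasure (lb d) (?c k))"
      using A by (intro emeasure_subadditive_finite) auto
    also have "\<dots> = ennreal m"
      using N0 by (simp add: emeasure_cube m_def ennreal_of_nat_eq_real_of_nat power_divide flip: ennreal_mult)
    finally have "ennreal (sqrt (Determinant.det G)) * emeasure (lb d) (E u) \<le> ennreal (sqrt (Determinant.det G)) * ennreal m"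
      by (intro mult_left_mono) auto
    moreover have "ennreal (sqrt (Determinant.det G)) * emeasure (lb d) (E u) = ennreal (\<omega> * (u * s) ^ d)"
      unfolding E_def \<omega>_def using u s by (intro ellipsoid_volume[OF pd]) auto
    ultimately have 1: "\<omega> * (u * s) ^ d \<le> sqrt (Determinant.det G) * m"
      using pd_det_pos[OF pd] by (simp add: m_def ennreal_le_iff flip: ennreal_mult)
    have "unit_content d G \<le> hcontent ?\<rho> d Orderings.top (E 1 \<union> (\<Union>k\<in>?I - A. ?c k))"
      unfolding unit_content_def
    proof (rule hcontent_mono, rule subsetI)
      fix x assume "x \<in> ?Q"
      then have "x \<in> (\<Union>k\<in>?I. ?c k)" using cover by (meson subsetD)
      then obtain k where "k \<in> ?I" "x \<in> ?c k" by (rule UN_E)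
      then show "x \<in> E 1 \<union> (\<Union>k\<in>?I - A. ?c k)" by (cases "k \<in> A") (auto simp: A_def)
    qed
    also have "\<dots> = hcontent ?\<rho> d Orderings.top (\<Union>i\<in>{True, False}. if i then E 1 else (\<Union>k\<in>?I - A. ?c k))"
      by (simp add: Un_commute)
    also have "\<dots> \<le> hcontent ?\<rho> d Orderings.top (E 1) + hcontent ?\<rho> d Orderings.top (\<Union>k\<in>?I - A. ?c k)"
      by (rule order_trans[OF hcontent_UN_finite]) auto
    also have "\<dots> \<le> ennreal (\<omega> * s ^ d) + (\<Sum>k\<in>?I - A. hcontent ?\<rho> d Orderings.top (?c k))"
      using fin by (intro add_mono hcontent_UN_finite order_trans[OF hcontent_single costE]) auto
    also have "\<dots> \<le> ennreal (\<omega> * s ^ d) + (\<Sum>k\<in>?I - A. ennreal ((1 / real N) ^ d) * unit_content d G)"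
    proof (intro add_mono sum_mono order_refl)
      fix k
      have "hcontent ?\<rho> d (ennreal (1 / real N) * Orderings.top) (cube d (\<lambda>i. - 1/2 + 1 / real N * real (k i)) (1 / real N * 1)) \<le> ennreal ((1 / real N) ^ d) * unit_content d G"
        unfolding unit_content_def using N0 by (intro hcontent_cube_scale) auto
      then show "hcontent ?\<rho> d Orderings.top (?c k) \<le> ennreal ((1 / real N) ^ d) * unit_content d G"
        using N0 by (simp add: ennreal_mult_top)
    qed
    also have "\<dots> = ennreal (\<omega> * s ^ d) + ennreal ((1 - m) * H)"
    proof -
      have "card (?I - A) = N ^ d - card A" using A fin card by (simp add: card_Diff_subset)
      moreover have "card A \<le> N ^ d" using A fin card card_mono[of ?I A] by simp
      ultimately have "real (card (?I - A)) * ((1 / real N) ^ d * H) = (1 - m) * H"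
        using N0 by (simp add: m_def field_simps of_nat_diff)
      note eq = this
      have "(\<Sum>k\<in>?I - A. ennreal ((1 / real N) ^ d) * unit_content d G) = ennreal (real (card (?I - A)) * ((1 / real N) ^ d * H))"
        using H by (simp add: ennreal_of_nat_eq_real_of_nat flip: ennreal_mult)
      then show ?thesis by (simp only: eq)
    qed
    finally have "ennreal H \<le> ennreal (\<omega> * s ^ d) + ennreal ((1 - m) * H)" by (simp add: H)
    moreover have "m \<le> 1"
    proof -
      have "card A \<le> N ^ d" using A fin card card_mono[of ?I A] by simp
      then have "real (card A) \<le> real N ^ d" by (metis of_nat_le_iff of_nat_power)
      then show ?thesis using N0 by (simp add: m_def)
    qed
    ultimately have "0 \<le> \<omega> * s ^ d" "0 \<le> (1 - m) * H" "ennreal H \<le> ennreal (\<omega> * s ^ d + (1 - m) * H)"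
      using \<omega> s H by (simp_all add: ennreal_plus)
    then have "H \<le> \<omega> * s ^ d + (1 - m) * H" by (subst (asm) ennreal_le_iff) auto
    \<comment> \<open>The finiteness of \<open>H\<close> permits cancelling (1 - m) H: content is
      saved on the fraction \<open>m\<close> of the cube that the ellipsoid covers.\<close>
    then have 2: "m * H \<le> \<omega> * s ^ d" by (simp add: algebra_simps)
    have "(\<omega> * (u * s) ^ d) * H \<le> (sqrt (Determinant.det G) * m) * H" using 1 H by (intro mult_right_mono) auto
    also have "\<dots> \<le> sqrt (Determinant.det G) * (\<omega> * s ^ d)"
      using 2 pd_det_pos[OF pd] by (simp add: mult.assoc)
    finally have "(\<omega> * s ^ d) * (u ^ d * H) \<le> (\<omega> * s ^ d) * sqrt (Determinant.det G)"
      by (simp add: power_mult_distrib mult_ac)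
    then show ?thesis using \<omega> s by simp
  qed
  have "((\<lambda>u. u ^ d * H) \<longlongrightarrow> 1 ^ d * H) (at_left 1)" by (intro tendsto_intros)
  moreover have "eventually (\<lambda>u::real. 0 < u \<and> u < 1) (at_left 1)"
    by (auto simp: eventually_at_left_field intro!: exI[of _ 0])
  then have "eventually (\<lambda>u. u ^ d * H \<le> sqrt (Determinant.det G)) (at_left 1)"
    by eventually_elim (use main in auto)
  ultimately have "1 ^ d * H \<le> sqrt (Determinant.det G)"
    by (intro tendsto_upperbound) auto
  then show ?thesis by (simp add: H ennreal_leI)
qed

lemma hausdorff_qdist_cube_le:
  assumes pd: "pd d G" and d: "0 < d" and r: "0 < r"
  shows "hausdorff_measure (qdist d G) d (cube d c r) \<le> ennreal (sqrt (Determinant.det G)) * emeasure (lb d) (cube d c r)"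
  unfolding hausdorff_measure_eq
proof (rule SUP_least)
  fix \<delta> :: real assume "\<delta> \<in> {0<..}"
  then have "hcontent (qdist d G) d (ennreal \<delta>) (cube d c r) \<le> ennreal (r ^ d) * unit_content d G"
    using r by (intro hcontent_cube_le) auto
  also have "\<dots> \<le> ennreal (r ^ d) * ennreal (sqrt (Determinant.det G))"
    by (intro mult_left_mono unit_content_le[OF pd d]) auto
  finally show "hcontent (qdist d G) d (ennreal \<delta>) (cube d c r) \<le> ennreal (sqrt (Determinant.det G)) * emeasure (lb d) (cube d c r)"
    using r by (simp add: emeasure_cube mult.commute)
qed

abbreviation lin :: "real \<Rightarrow> real poly" where "lin c \<equiv> [:- c, 1:]"

subsection \<open>Canonical representation of positive polynomials\<close>

text \<open>The coefficient of \<open>x\<^sup>N\<^sup>-\<^sup>1\<close> of the Lagrange interpolation polynomial of \<open>w\<close> at \<open>N\<close> nodes is a sum of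
  terms of the same sign.\<close>

lemma alternating_poly_eq_0:
  fixes w :: "real poly" and t :: "nat \<Rightarrow> real"
  assumes t: "\<And>i j. i < j \<Longrightarrow> j < N \<Longrightarrow> t i < t j"
    and alt: "\<And>i. i < N \<Longrightarrow> 0 \<le> (-1) ^ i * poly w (t i)"
    and deg: "degree w + 1 < N"
  shows "w = 0"
proof -
  define P where "P i = (\<Prod>j\<in>{..<N} - {i}. lin (t j))" for i
  define c where "c i = poly (P i) (t i)" for i
  define L where "L = (\<Sum>i<N. Polynomial.smult (poly w (t i) / c i) (P i))"
  have inj: "t i \<noteq> t j" if "i < N" "j < N" "i \<noteq> j" for i j
    using that t[of i j] t[of j i] by (cases "i < j") auto
  have c: "c i \<noteq> 0" if "i < N" for i
    using inj that by (auto simp: c_def P_def poly_prod)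
  have degP: "degree (P i) = N - 1" if "i < N" for i
    unfolding P_def using that by (subst degree_prod_eq_sum_degree) auto
  have leadP: "coeff (P i) (N - 1) = 1" if "i < N" for i
  proof -
    have "lead_coeff (P i) = 1" unfolding P_def by (simp add: lead_coeff_prod)
    then show ?thesis using degP[OF that] by simp
  qed
  have evalP: "poly (P i) (t k) = (if k = i then c i else 0)" if "i < N" "k < N" for i k
    using that by (auto simp: c_def P_def poly_prod)
  have evalL: "poly L (t k) = poly w (t k)" if "k < N" for k
  proof -
    have "poly L (t k) = (\<Sum>i<N. if i = k then poly w (t k) else 0)"
      unfolding L_def poly_sum using that by (intro sum.cong) (auto simp: evalP c)
    then show ?thesis using that by simp
  qed
  have degL: "degree L \<le> N - 1"
    unfolding L_def by (intro degree_sum_le) (auto intro!: order_trans[OF degree_smult_le] simp: degP)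
  have "L - w = 0"
  proof (rule ccontr)
    assume ne: "L - w \<noteq> 0"
    have "t ` {..<N} \<subseteq> {x. poly (L - w) x = 0}" using evalL by auto
    then have "card (t ` {..<N}) \<le> card {x. poly (L - w) x = 0}" using poly_roots_finite[OF ne] by (rule card_mono[rotated])
    also have "\<dots> \<le> degree (L - w)" using ne by (rule card_poly_roots_bound)
    also have "\<dots> \<le> N - 1" using degL deg by (intro degree_diff_le) auto
    finally show False using deg inj by (subst (asm) card_image) (auto intro!: inj_onI)
  qed
  then have "coeff L (N - 1) = 0" using deg by (simp add: coeff_eq_0)
  moreover have "coeff L (N - 1) = (\<Sum>i<N. poly w (t i) / c i)"
    unfolding L_def coeff_sum by (intro sum.cong) (auto simp: leadP[simplified])
  ultimately have "(\<Sum>i<N. poly w (t i) / c i) = 0" by simp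
  then have sum0: "(\<Sum>i<N. (-1) ^ (N - 1) * (poly w (t i) / c i)) = 0"
    by (simp only: mult_zero_right flip: sum_distrib_left)
  \<comment> \<open>Exactly N - 1 - i of the nodes lie to the right of \<open>t i\<close>, and each
    contributes one negative factor.\<close>
  have sgn: "0 < (-1) ^ (N - 1 - i) * c i" if i: "i < N" for i
  proof -
    have "{..<N} - {i} = {..<i} \<union> {i<..<N}" using i by auto
    then have "c i = (\<Prod>j\<in>{..<i} \<union> {i<..<N}. t i - t j)"
      unfolding c_def P_def poly_prod by (simp add: add.commute)
    also have "\<dots> = (\<Prod>j<i. t i - t j) * (\<Prod>j\<in>{i<..<N}. t i - t j)"
      by (rule prod.union_disjoint) auto
    also have "(\<Prod>j\<in>{i<..<N}. t i - t j) = (\<Prod>j\<in>{i<..<N}. (-1) * (t j - t i))" by simp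
    also have "\<dots> = (-1) ^ (N - 1 - i) * (\<Prod>j\<in>{i<..<N}. t j - t i)" unfolding prod.distrib by simp
    finally have "(-1) ^ (N - 1 - i) * c i = (\<Prod>j<i. t i - t j) * (\<Prod>j\<in>{i<..<N}. t j - t i)"
      by (simp add: mult_ac flip: power_add mult_2_right)
    also have "\<dots> > 0" using t i by (intro mult_pos_pos prod_pos) auto
    finally show ?thesis .
  qed
  have nonneg: "0 \<le> (-1) ^ (N - 1) * (poly w (t i) / c i)" if i: "i < N" for i
  proof -
    have "(-1) ^ (N - 1) * (poly w (t i) / c i) = ((-1) ^ i * poly w (t i)) / ((-1) ^ (N - 1 - i) * c i)"
    proof -
      have "(-1::real) ^ (N - 1) = (-1) ^ i * (-1) ^ (N - 1 - i)" using i by (simp flip: power_add)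
      moreover have "(-1::real) ^ (N - 1 - i) * (-1) ^ (N - 1 - i) = 1" by (simp flip: power_add mult_2)
      ultimately show ?thesis by (cases "even (N - 1 - i)") auto
    qed
    then show ?thesis using alt[OF i] sgn[OF i] by (simp add: divide_nonneg_pos)
  qed
  \<comment> \<open>A vanishing sum of terms of one sign has only zero terms, so all N nodes are
    zeros of \<open>w\<close>, more than its degree allows.\<close>
  have roots: "poly w (t i) = 0" if "i < N" for i
    using sum0 nonneg c that by (subst (asm) sum_nonneg_eq_0_iff) auto
  show "w = 0"
  proof (rule ccontr)
    assume ne: "w \<noteq> 0"
    have "card (t ` {..<N}) \<le> card {x. poly w x = 0}" using poly_roots_finite[OF ne] roots by (intro card_mono) auto
    also have "\<dots> \<le> degree w" using ne by (rule card_poly_roots_bound)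
    finally show False using deg inj by (subst (asm) card_image) (auto intro!: inj_onI)
  qed
qed

section \<open>The canonical polynomials and their uniqueness\<close>

definition Pod :: "nat \<Rightarrow> (nat \<Rightarrow> real) \<Rightarrow> real poly" where
  "Pod k \<gamma> = (\<Prod>j\<in>{j \<in> {1..<k}. odd j}. lin (\<gamma> j) ^ 2)"

definition Pev :: "nat \<Rightarrow> (nat \<Rightarrow> real) \<Rightarrow> real poly" where
  "Pev k \<gamma> = (\<Prod>j\<in>{j \<in> {1..<k}. even j}. lin (\<gamma> j) ^ 2)"

text \<open>The weights are nonnegative on T and vanish at most at its ends, hence are positive
  where the nodes lie; no point is a zero of both.\<close>

fun wod :: "poly_domain \<Rightarrow> nat \<Rightarrow> real poly" where
  "wod (Segment a b) k = (if even k then 1 else [:b, - 1:])"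
| "wod (Half_line a) k = 1"
| "wod Full_line k = 1"

fun wev :: "poly_domain \<Rightarrow> nat \<Rightarrow> real poly" where
  "wev (Segment a b) k = (if even k then [:- a, 1:] * [:b, - 1:] else [:- a, 1:])"
| "wev (Half_line a) k = [:- a, 1:]"
| "wev Full_line k = 1"

text \<open>\<open>kpoly\<close> is \<open>par_poly\<close> with the two terms ordered by the parity of the indices of the \<open>\<gamma>\<^sub>j\<close> in them
  instead of by the index of \<open>\<alpha>\<close>, which makes even and odd degree uniform.\<close>

definition kpoly :: "poly_domain \<Rightarrow> nat \<Rightarrow> real \<Rightarrow> real \<Rightarrow> (nat \<Rightarrow> real) \<Rightarrow> real poly" where
  "kpoly T k x y \<gamma> = Polynomial.smult x (wod T k * Pod k \<gamma>) + Polynomial.smult y (wev T k * Pev k \<gamma>)"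

lemma odd_indices: fixes k :: nat shows "{j \<in> {1..<k}. odd j} = (\<lambda>j. 2 * j - 1) ` {1..k div 2}"
proof
  show "{j \<in> {1..<k}. odd j} \<subseteq> (\<lambda>j. 2 * j - 1) ` {1..k div 2}"
  proof
    fix j assume "j \<in> {j \<in> {1..<k}. odd j}"
    then obtain i where "j = 2 * i + 1" "j < k" by (auto elim: oddE)
    then show "j \<in> (\<lambda>j. 2 * j - 1) ` {1..k div 2}" by (intro image_eqI[of _ _ "i + 1"]) auto
  qed
qed auto

lemma even_indices: fixes k :: nat shows "{j \<in> {1..<k}. even j} = (\<lambda>j. 2 * j) ` {1..(k - 1) div 2}"
proof
  show "{j \<in> {1..<k}. even j} \<subseteq> (\<lambda>j. 2 * j) ` {1..(k - 1) div 2}"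
  proof
    fix j assume "j \<in> {j \<in> {1..<k}. even j}"
    then obtain i where "j = 2 * i" "j < k" "1 \<le> j" by (auto elim: evenE)
    then show "j \<in> (\<lambda>j. 2 * j) ` {1..(k - 1) div 2}" by (intro image_eqI[of _ _ i]) auto
  qed
qed auto

lemma Pod_eq: "Pod k \<gamma> = (\<Prod>j=1..k div 2. lin (\<gamma> (2 * j - 1)) ^ 2)"
  unfolding Pod_def odd_indices by (subst prod.reindex) (auto intro!: inj_onI simp: o_def)

lemma Pev_eq: "Pev k \<gamma> = (\<Prod>j=1..(k - 1) div 2. lin (\<gamma> (2 * j)) ^ 2)"
  unfolding Pev_def even_indices by (subst prod.reindex) (auto intro!: inj_onI simp: o_def)

lemma card_odd_indices: "card {j \<in> {1..<k}. odd j} = k div 2"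
  unfolding odd_indices by (subst card_image) (auto intro!: inj_onI)

lemma card_even_indices: "card {j \<in> {1..<k}. even j} = (k - 1) div 2"
  unfolding even_indices by (subst card_image) (auto intro!: inj_onI)

lemma par_poly_eq_kpoly:
  assumes "T = Full_line \<longrightarrow> even k"
  shows "par_poly T k \<alpha>1 \<alpha>2 \<gamma> = kpoly T k (if even k then \<alpha>1 else \<alpha>2) (if even k then \<alpha>2 else \<alpha>1) \<gamma>"
proof -
  have "(k - 1) div 2 = (if even k then k div 2 - 1 else k div 2)" by (cases "even k") (auto elim!: evenE oddE)
  then show ?thesis using assms
    by (cases T) (auto simp: kpoly_def Pod_eq Pev_eq Let_def)
qed

lemma poly_Pod: "poly (Pod k \<gamma>) x = (\<Prod>j\<in>{j \<in> {1..<k}. odd j}. (x - \<gamma> j)\<^sup>2)"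
  unfolding Pod_def by (simp add: poly_prod)

lemma poly_Pev: "poly (Pev k \<gamma>) x = (\<Prod>j\<in>{j \<in> {1..<k}. even j}. (x - \<gamma> j)\<^sup>2)"
  unfolding Pev_def by (simp add: poly_prod)

lemma monic_Pod: "lead_coeff (Pod k \<gamma>) = 1" unfolding Pod_def by (simp add: lead_coeff_prod lead_coeff_power)
lemma monic_Pev: "lead_coeff (Pev k \<gamma>) = 1" unfolding Pev_def by (simp add: lead_coeff_prod lead_coeff_power)

lemma degree_lin_power2: "degree (lin c ^ 2) = 2" by (simp add: degree_power_eq)

lemma degree_Pod: "degree (Pod k \<gamma>) = 2 * (k div 2)"
  unfolding Pod_def by (subst degree_prod_eq_sum_degree) (auto simp: degree_lin_power2 card_odd_indices[simplified])

lemma degree_Pev: "degree (Pev k \<gamma>) = 2 * ((k - 1) div 2)"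
  unfolding Pev_def by (subst degree_prod_eq_sum_degree) (auto simp: degree_lin_power2 card_even_indices[simplified])

lemma Pod_roots: "poly (Pod k \<gamma>) x = 0 \<longleftrightarrow> (\<exists>j\<in>{1..<k}. odd j \<and> x = \<gamma> j)"
  unfolding poly_Pod by auto
lemma Pev_roots: "poly (Pev k \<gamma>) x = 0 \<longleftrightarrow> (\<exists>j\<in>{1..<k}. even j \<and> x = \<gamma> j)"
  unfolding poly_Pev by auto
lemma Pod_nonneg: "0 \<le> poly (Pod k \<gamma>) x" unfolding poly_Pod by (intro prod_nonneg) auto
lemma Pev_nonneg: "0 \<le> poly (Pev k \<gamma>) x" unfolding poly_Pev by (intro prod_nonneg) auto

lemma Pev_nz: "Pev k \<gamma> \<noteq> 0" using monic_Pev[of k \<gamma>] by auto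

lemma interior_points:
  "interior (points (Segment a b)) = {a<..<b}" "interior (points (Half_line a)) = {a<..}"
  "interior (points Full_line) = UNIV"
  by (simp_all add: interior_atLeastAtMost_real)

text \<open>The coefficient of t^n stands for the value at infinity. It is tested whenever T is
  unbounded; on the full line one test serves both directions, because admissible n are
  even.\<close>

definition spos :: "poly_domain \<Rightarrow> nat \<Rightarrow> real poly \<Rightarrow> bool" where
  "spos T n p \<longleftrightarrow> degree p \<le> n \<and> (\<forall>t\<in>points T. 0 < poly p t) \<and>
     (case T of Segment a b \<Rightarrow> True | _ \<Rightarrow> 0 < coeff p n)"

lemma Delta_less: "\<gamma> \<in> Delta T (k - 1) \<Longrightarrow> 1 \<le> i \<Longrightarrow> i < j \<Longrightarrow> j < k \<Longrightarrow> \<gamma> i < \<gamma> j"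
  unfolding Delta_def by (auto elim!: strict_mono_onD)

lemma Delta_inj: "\<gamma> \<in> Delta T (k - 1) \<Longrightarrow> i \<in> {1..<k} \<Longrightarrow> j \<in> {1..<k} \<Longrightarrow> \<gamma> i = \<gamma> j \<Longrightarrow> i = j"
  using Delta_less[of \<gamma> T k i j] Delta_less[of \<gamma> T k j i] by (cases i j rule: linorder_cases) auto

lemma Delta_interior: "\<gamma> \<in> Delta T (k - 1) \<Longrightarrow> i \<in> {1..<k} \<Longrightarrow> \<gamma> i \<in> interior (points T)"
  unfolding Delta_def by auto

lemma wod_pos: "t \<in> interior (points T) \<Longrightarrow> 0 < poly (wod T k) t"
  by (cases T) (auto simp: interior_points)
lemma wev_pos: "t \<in> interior (points T) \<Longrightarrow> 0 < poly (wev T k) t"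
  by (cases T) (auto simp: interior_points zero_less_mult_iff simp del: mult_pCons_left mult_pCons_right)
lemma wod_nonneg: "t \<in> points T \<Longrightarrow> 0 \<le> poly (wod T k) t"
  by (cases T) auto
lemma wev_nonneg: "t \<in> points T \<Longrightarrow> 0 \<le> poly (wev T k) t"
  by (cases T) (auto simp: zero_le_mult_iff simp del: mult_pCons_left mult_pCons_right)

text \<open>Both terms are nonnegative on T and never vanish together: the nodes are distinct
  interior points, where the weights are positive, and at an end only one of the weights vanishes.
  On an unbounded T one term is of degree k with leading coefficient 1 before scaling, and the other
  has smaller degree.\<close>

lemma kpoly_spos:
  assumes adm: "admissible k T" "1 \<le> k" and xy: "0 < x" "0 < y" and \<gamma>: "\<gamma> \<in> Delta T (k - 1)"
  shows "spos T k (kpoly T k x y \<gamma>)"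
proof -
  let ?A = "wod T k * Pod k \<gamma>" and ?B = "wev T k * Pev k \<gamma>"
  have deg: "degree ?A \<le> k" "degree ?B \<le> k"
  proof -
    show "degree ?A \<le> k"
      by (rule order_trans[OF degree_mult_le], cases T) (auto simp: degree_Pod elim!: oddE)
    have "degree (wev T k) \<le> 2" "degree (wev T k) \<le> 1 \<or> even k"
      by (cases T; auto intro: order_trans[OF degree_mult_le])+
    then show "degree ?B \<le> k"
      using adm(2) by (intro order_trans[OF degree_mult_le]) (cases "even k", auto simp: degree_Pev elim!: evenE oddE)
  qed
  have pos: "0 < poly (kpoly T k x y \<gamma>) t" if t: "t \<in> points T" for t
  proof -
    have nn: "0 \<le> x * poly ?A t" "0 \<le> y * poly ?B t"
      using xy t by (auto intro!: mult_nonneg_nonneg wod_nonneg wev_nonneg Pod_nonneg Pev_nonneg)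
    have "poly ?A t \<noteq> 0 \<or> poly ?B t \<noteq> 0"
    proof (rule ccontr)
      assume "\<not> ?thesis"
      then have z: "poly ?A t = 0" "poly ?B t = 0" by auto
      have int: "t \<in> interior (points T)" if "poly (Pod k \<gamma>) t = 0 \<or> poly (Pev k \<gamma>) t = 0"
        using that \<gamma> by (auto simp: Pod_roots Pev_roots intro: Delta_interior)
      have no: "\<not> (poly (Pod k \<gamma>) t = 0 \<and> poly (Pev k \<gamma>) t = 0)"
      proof
        assume "poly (Pod k \<gamma>) t = 0 \<and> poly (Pev k \<gamma>) t = 0"
        then obtain i j where ij: "i \<in> {1..<k}" "odd i" "t = \<gamma> i" "j \<in> {1..<k}" "even j" "t = \<gamma> j"
          by (auto simp: Pod_roots Pev_roots)
        then have "i = j" by (intro Delta_inj[OF \<gamma>]) auto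
        then show False using ij by simp
      qed
      then have "t \<notin> interior (points T)" using z wod_pos[of t T k] wev_pos[of t T k] by auto
      then have "poly (wod T k) t = 0" "poly (wev T k) t = 0" using int z by auto
      then show False using adm by (cases T) (auto split: if_splits)
    qed
    moreover have "poly (kpoly T k x y \<gamma>) t = x * poly ?A t + y * poly ?B t" by (simp add: kpoly_def)
    ultimately show ?thesis using nn xy by (metis add_nonneg_eq_0_iff add_nonneg_nonneg less_eq_real_def mult_eq_0_iff less_irrefl)
  qed
  have lead: "0 < coeff (kpoly T k x y \<gamma>) k" if noseg: "\<forall>a b. T \<noteq> Segment a b"
  proof -
    have m: "lead_coeff ?A = 1" "lead_coeff ?B = 1" using noseg
      by (cases T; simp add: monic_Pod monic_Pev lead_coeff_mult del: mult_pCons_left)+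
    have dB: "degree (lin a * Pev k \<gamma>) = Suc (2 * ((k - 1) div 2))" for a
      by (subst degree_mult_eq) (auto simp: Pev_nz degree_Pev)
    show ?thesis
    proof (cases "even k")
      case True
      then have "degree ?A = k" using noseg by (cases T) (auto simp: degree_Pod)
      moreover have "degree ?B < k" using True adm(2) noseg
        by (cases T) (auto simp: degree_Pev dB simp del: mult_pCons_left elim!: evenE)
      ultimately show ?thesis using m xy by (simp add: kpoly_def coeff_eq_0)
    next
      case False
      then obtain a where T: "T = Half_line a" using noseg adm by (cases T) auto
      have "degree ?B = k" using False T by (auto simp: dB simp del: mult_pCons_left elim!: oddE)
      moreover have "degree ?A < k" using False T by (auto simp: degree_Pod elim!: oddE)
      ultimately show ?thesis using m xy by (simp add: kpoly_def coeff_eq_0)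
    qed
  qed
  have "degree (kpoly T k x y \<gamma>) \<le> k"
    unfolding kpoly_def using deg by (intro degree_add_le order_trans[OF degree_smult_le])
  then show ?thesis using pos lead unfolding spos_def by (cases T) auto
qed

text \<open>Subtracting two representations gives U D = V F. As the weights \<open>U\<close> and
  \<open>V\<close> have no common zero, D = V w and F = U w for one polynomial \<open>w\<close>, and
  the degrees of \<open>D\<close> and \<open>F\<close> bound that of \<open>w\<close>. At \<gamma>_j
  one of the subtracted squares vanishes, which fixes the sign of \<open>w\<close> there; these
  signs alternate in j, and at \<gamma>'_j they are opposite. One further sign makes k alternations,
  too many for \<open>w\<close>.\<close>

lemma kpoly_unique:
  assumes adm: "admissible k T" "1 \<le> k"
    and xy: "0 < x" "0 < y" "0 < x'" "0 < y'" and \<gamma>: "\<gamma> \<in> Delta T (k - 1)" "\<gamma>' \<in> Delta T (k - 1)"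
    and eq: "kpoly T k x y \<gamma> = kpoly T k x' y' \<gamma>'"
  shows "x = x' \<and> y = y' \<and> (\<forall>j\<in>{1..<k}. \<gamma> j = \<gamma>' j)"
proof -
  define U V where "U = wod T k" and "V = wev T k"
  define D where "D = Polynomial.smult x (Pod k \<gamma>) - Polynomial.smult x' (Pod k \<gamma>')"
  define F where "F = Polynomial.smult y' (Pev k \<gamma>') - Polynomial.smult y (Pev k \<gamma>)"
  have UV: "U * D = V * F"
    using eq by (simp add: kpoly_def D_def F_def U_def V_def algebra_simps)
  have dD: "degree D \<le> 2 * (k div 2)" and dF: "degree F \<le> 2 * ((k - 1) div 2)"
    unfolding D_def F_def
    by (intro degree_diff_le order_trans[OF degree_smult_le]; simp add: degree_Pod degree_Pev)+
  obtain w where w: "D = V * w" "F = U * w" "w = 0 \<or> degree w + 1 < k"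
  proof (cases "U = 1")
    case True
    show ?thesis
    proof (cases "V = 1 \<or> even k")
      case True
      have "even k" using True adm by (cases T) (auto simp: V_def one_pCons split: if_splits)
      then have "degree F + 1 < k" using dF adm(2) by (auto elim!: evenE)
      then show ?thesis using UV \<open>U = 1\<close> by (intro that[of F]) auto
    next
      case False
      then obtain a where V: "V = lin a" by (cases T) (auto simp: V_def split: if_splits)
      have "F = 0 \<or> degree F + 1 < k"
      proof (cases "F = 0")
        case False
        have "degree D = degree F + 1"
          using UV False unfolding \<open>U = 1\<close> V by (simp add: degree_mult_eq del: mult_pCons_left)
        then show ?thesis using dD \<open>\<not> (V = 1 \<or> even k)\<close> by (auto elim!: oddE)
      qed simp
      then show ?thesis using UV \<open>U = 1\<close> by (intro that[of F]) auto
    qed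
  next
    case False
    then obtain a b where T: "T = Segment a b" "odd k" "U = [:b, -1:]" "V = lin a"
      by (cases T) (auto simp: U_def V_def split: if_splits)
    have ab: "a < b" using adm T by simp
    have "poly V a = 0" by (simp add: T(4))
    then have "poly U a * poly D a = 0" using arg_cong[OF UV, of "\<lambda>p. poly p a"] by (simp only: poly_mult mult_zero_left)
    moreover have "poly U a = b - a" by (simp add: T(3))
    ultimately have "poly D a = 0" using ab by simp
    then obtain w where w: "D = V * w" unfolding T by (metis dvdE poly_eq_0_iff_dvd)
    have "V * F = V * (U * w)" unfolding UV[symmetric] w by (rule mult.left_commute)
    moreover have "V \<noteq> 0" by (simp add: T(4))
    ultimately have F: "F = U * w" by (metis mult_left_cancel)
    have "w = 0 \<or> degree w + 1 < k"
    proof (cases "w = 0")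
      case False
      have "degree D = degree w + 1"
        using w False unfolding T by (simp add: degree_mult_eq del: mult_pCons_left)
      then show ?thesis using dD T(2) by (auto elim!: oddE)
    qed simp
    then show ?thesis using w F by (intro that[of w])
  qed
  have alt: "0 \<le> (-1) ^ j * poly w (\<gamma> j)" "(-1) ^ j * poly w (\<gamma>' j) \<le> 0" if j: "j \<in> {1..<k}" for j
  proof -
    have pos: "0 < poly U (\<gamma> j)" "0 < poly V (\<gamma> j)" "0 < poly U (\<gamma>' j)" "0 < poly V (\<gamma>' j)"
      using j \<gamma> by (auto simp: U_def V_def intro!: wod_pos wev_pos Delta_interior)
    have V: "poly V t * poly w t = x * poly (Pod k \<gamma>) t - x' * poly (Pod k \<gamma>') t" for t
      using w(1) by (metis D_def poly_diff poly_mult poly_smult)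
    have U: "poly U t * poly w t = y' * poly (Pev k \<gamma>') t - y * poly (Pev k \<gamma>) t" for t
      using w(2) by (metis F_def poly_diff poly_mult poly_smult)
    show "0 \<le> (-1) ^ j * poly w (\<gamma> j)"
    proof (cases "odd j")
      case True
      then have "poly (Pod k \<gamma>) (\<gamma> j) = 0" using j by (auto simp: Pod_roots)
      then have "poly V (\<gamma> j) * poly w (\<gamma> j) \<le> 0"
        unfolding V using xy Pod_nonneg[of k \<gamma>' "\<gamma> j"] by simp
      then show ?thesis using True pos by (simp add: mult_le_0_iff)
    next
      case False
      then have "poly (Pev k \<gamma>) (\<gamma> j) = 0" using j by (auto simp: Pev_roots)
      then have "0 \<le> poly U (\<gamma> j) * poly w (\<gamma> j)"
        unfolding U using xy Pev_nonneg[of k \<gamma>' "\<gamma> j"] by simp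
      then show ?thesis using False pos by (simp add: zero_le_mult_iff)
    qed
    show "(-1) ^ j * poly w (\<gamma>' j) \<le> 0"
    proof (cases "odd j")
      case True
      then have "poly (Pod k \<gamma>') (\<gamma>' j) = 0" using j by (auto simp: Pod_roots)
      then have "0 \<le> poly V (\<gamma>' j) * poly w (\<gamma>' j)"
        unfolding V using xy Pod_nonneg[of k \<gamma> "\<gamma>' j"] by simp
      then show ?thesis using True pos by (simp add: zero_le_mult_iff)
    next
      case False
      then have "poly (Pev k \<gamma>') (\<gamma>' j) = 0" using j by (auto simp: Pev_roots)
      then have "poly U (\<gamma>' j) * poly w (\<gamma>' j) \<le> 0"
        unfolding U using xy Pev_nonneg[of k \<gamma> "\<gamma>' j"] by simp
      then show ?thesis using False pos by (simp add: mult_le_0_iff)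
    qed
  qed
  have w0: "w = 0"
  proof (rule ccontr)
    assume "w \<noteq> 0"
    then have deg: "degree w + 1 < k" using w by auto
    define X where "X = insert 0 (\<gamma> ` {1..<k} \<union> \<gamma>' ` {1..<k})"
    \<comment> \<open>A point to the right of all nodes supplies the missing alternation. Its sign
      decides whether it extends the sequence of \<gamma>, with \<open>w\<close>, or that of
      \<gamma>', with \<open>- w\<close>.\<close>
    define M where "M = Max X + 1"
    have M: "\<gamma> j < M" "\<gamma>' j < M" if "j \<in> {1..<k}" for j
    proof -
      have "finite X" "\<gamma> j \<in> X" "\<gamma>' j \<in> X" using that by (auto simp: X_def)
      then have "\<gamma> j \<le> Max X" "\<gamma>' j \<le> Max X" by auto
      then show "\<gamma> j < M" "\<gamma>' j < M" by (simp_all add: M_def)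
    qed
    have *: "v = 0" if "\<delta> \<in> Delta T (k - 1)" "\<And>j. j \<in> {1..<k} \<Longrightarrow> \<delta> j < M"
      "\<And>j. j \<in> {1..<k} \<Longrightarrow> 0 \<le> (-1) ^ j * poly v (\<delta> j)" "0 \<le> (-1) ^ k * poly v M" "degree v + 1 < k" for v \<delta>
    proof -
      \<comment> \<open>The nodes are numbered from 1 here and from 0 in the lemma, which turns the
        sign of \<open>v\<close> around.\<close>
      have "- v = 0"
      proof (rule alternating_poly_eq_0[where t="\<lambda>i. if Suc i < k then \<delta> (Suc i) else M" and N=k])
        fix i j :: nat assume "i < j" "j < k"
        then show "(if Suc i < k then \<delta> (Suc i) else M) < (if Suc j < k then \<delta> (Suc j) else M)"
          using that(2)[of "Suc i"] Delta_less[OF that(1), of "Suc i" "Suc j"] by auto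
      next
        fix i assume "i < k"
        then show "0 \<le> (-1) ^ i * poly (- v) (if Suc i < k then \<delta> (Suc i) else M)"
          using that(3)[of "Suc i"] that(4) by (cases "Suc i < k") (auto simp: Suc_le_eq not_less dest!: antisym)
      qed (use that in simp)
      then show ?thesis by simp
    qed
    show False
    proof (cases "0 \<le> (-1) ^ k * poly w M")
      case True
      then show ?thesis using *[OF \<gamma>(1) M(1) alt(1)] deg \<open>w \<noteq> 0\<close> by auto
    next
      case False
      have "- w = 0"
        using alt(2) False deg by (intro *[OF \<gamma>(2) M(2)]) auto
      then show ?thesis using \<open>w \<noteq> 0\<close> by simp
    qed
  qed
  have D: "Polynomial.smult x (Pod k \<gamma>) = Polynomial.smult x' (Pod k \<gamma>')"
    and F: "Polynomial.smult y' (Pev k \<gamma>') = Polynomial.smult y (Pev k \<gamma>)"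
    using w w0 by (auto simp: D_def F_def)
  have x: "x = x'" using arg_cong[OF D, of lead_coeff] unfolding lead_coeff_smult monic_Pod by simp
  have y: "y = y'" using arg_cong[OF F, of lead_coeff] unfolding lead_coeff_smult monic_Pev by simp
  have P: "Pod k \<gamma> = Pod k \<gamma>'" using D x xy by (simp add: smult_eq_iff)
  have R: "Pev k \<gamma> = Pev k \<gamma>'" using F y xy by (simp add: smult_eq_iff)
  \<comment> \<open>The nodes are recovered as the increasing list of the common set of
    zeros.\<close>
  have im: "\<gamma> ` {1..<k} = {t. poly (Pod k \<gamma>) t = 0 \<or> poly (Pev k \<gamma>) t = 0}" for \<gamma>
    by (auto simp: Pod_roots Pev_roots)
  have srt: "sorted (map \<gamma> [1..<k]) \<and> distinct (map \<gamma> [1..<k])" if "\<gamma> \<in> Delta T (k - 1)" for \<gamma>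
    using Delta_less[OF that] Delta_inj[OF that]
    by (auto simp: sorted_map sorted_wrt_iff_nth_less distinct_map inj_on_def intro!: less_imp_le)
  have "map \<gamma> [1..<k] = map \<gamma>' [1..<k]"
    using srt[OF \<gamma>(1)] srt[OF \<gamma>(2)] im[of \<gamma>] im[of \<gamma>'] P R
    by (intro sorted_distinct_set_unique) (simp_all del: set_upt add: set_upt)
  then have "\<forall>j\<in>{1..<k}. \<gamma> j = \<gamma>' j" by (auto simp: map_eq_conv)
  then show ?thesis using x y by simp
qed

section \<open>Positive polynomials on the line as squared moduli\<close>

lemma poly_map_of_real: "poly (map_poly of_real p) (of_real x :: complex) = of_real (poly p x)"
  by (induction p) (auto simp: map_poly_pCons)

lemma poly_map_of_real_add:
  "poly (map_poly of_real (p + q)) z = poly (map_poly of_real p) z + (poly (map_poly of_real q) z :: complex)"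
  by (induction p q rule: poly_induct2) (auto simp: map_poly_pCons algebra_simps)

lemma poly_map_of_real_smult:
  "poly (map_poly of_real (Polynomial.smult c p)) z = of_real c * (poly (map_poly of_real p) z :: complex)"
  by (induction p) (auto simp: map_poly_pCons algebra_simps)

lemma poly_map_of_real_mult:
  "poly (map_poly of_real (p * q)) z = poly (map_poly of_real p) z * (poly (map_poly of_real q) z :: complex)"
  by (induction p) (auto simp: map_poly_pCons algebra_simps poly_map_of_real_add poly_map_of_real_smult)

text \<open>The remainder modulo the quadratic is linear with real coefficients and vanishes at a
  nonreal point, so it is 0.\<close>

lemma quadratic_factor:
  fixes p :: "real poly" and z :: complex
  assumes z: "poly (map_poly of_real p) z = 0" and im: "Im z \<noteq> 0"
  shows "[:(Re z)\<^sup>2 + (Im z)\<^sup>2, - 2 * Re z, 1:] dvd p"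
proof -
  define D where "D = [:(Re z)\<^sup>2 + (Im z)\<^sup>2, - 2 * Re z, 1:]"
  have D: "D \<noteq> 0" "degree D = 2" by (auto simp: D_def)
  obtain r0 r1 where r: "p mod D = [:r0, r1:]"
  proof -
    have "degree (p mod D) < 2 \<or> p mod D = 0" using degree_mod_less[of D p] D by auto
    then have "degree (p mod D) \<le> 1" by auto
    then have "p mod D = [:coeff (p mod D) 0, coeff (p mod D) 1:]"
      by (intro poly_eqI) (auto simp: coeff_pCons coeff_eq_0 split: nat.split)
    then show ?thesis by (rule that)
  qed
  have "poly (map_poly of_real D) z = 0"
    by (simp add: D_def complex_eq_iff power2_eq_square algebra_simps map_poly_pCons)
  moreover have "poly (map_poly of_real p) z = poly (map_poly of_real (p div D)) z * poly (map_poly of_real D) z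
      + poly (map_poly of_real (p mod D)) z"
    unfolding poly_map_of_real_mult[symmetric] poly_map_of_real_add[symmetric] by simp
  ultimately have "poly (map_poly of_real (p mod D)) z = 0" using z by simp
  then have "of_real r0 + z * of_real r1 = 0" by (simp add: r map_poly_pCons)
  then have "r1 = 0" "r0 = 0" using im by (auto simp: complex_eq_iff)
  then have "p mod D = 0" using r by simp
  then show ?thesis by (simp add: D_def mod_eq_0_iff_dvd)
qed

lemma positive_poly_factor:
  fixes p :: "real poly"
  assumes "\<And>t. 0 < poly p t"
  shows "\<exists>c m u v. 0 < c \<and> degree p = 2 * m \<and> (\<forall>i<m. 0 < v i) \<and>
     p = Polynomial.smult c (\<Prod>i<m. [:(u i)\<^sup>2 + (v i)\<^sup>2, - 2 * u i, 1:])"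
  using assms
proof (induction "degree p" arbitrary: p rule: less_induct)
  case less
  show ?case
  proof (cases "degree p = 0")
    case True
    then obtain c where p: "p = [:c:]" by (metis degree_eq_zeroE)
    then have "0 < c" using less.prems[of 0] by simp
    then show ?thesis using p by (intro exI[of _ c] exI[of _ "0::nat"]) auto
  next
    case False
    have "degree (map_poly of_real p :: complex poly) = degree p" by (intro degree_map_poly) auto
    then have "\<not> constant (poly (map_poly of_real p :: complex poly))" using False by (simp add: constant_degree)
    then obtain z :: complex where z: "poly (map_poly of_real p) z = 0"
      using fundamental_theorem_of_algebra by blast
    have im: "Im z \<noteq> 0"
    proof
      assume "Im z = 0"
      then have "z = of_real (Re z)" by (simp add: complex_eq_iff)
      then have "poly p (Re z) = 0" using z by (metis of_real_eq_0_iff poly_map_of_real)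
      then show False using less.prems[of "Re z"] by simp
    qed
    define D where "D = [:(Re z)\<^sup>2 + (Im z)\<^sup>2, - 2 * Re z, 1:]"
    have D: "degree D = 2" by (simp add: D_def)
    obtain q where q: "p = D * q" using quadratic_factor[OF z im] unfolding D_def[symmetric] by (rule dvdE)
    have Dpos: "0 < poly D t" for t
    proof -
      have "poly D t = (t - Re z)\<^sup>2 + (Im z)\<^sup>2" by (simp add: D_def power2_eq_square algebra_simps)
      then show ?thesis using im by (simp add: add_nonneg_pos)
    qed
    have qpos: "0 < poly q t" for t
      using less.prems[of t] Dpos[of t] by (simp add: q zero_less_mult_iff)
    have "q \<noteq> 0" using qpos[of 0] by auto
    then have deg: "degree p = degree q + 2" using D unfolding q by (subst degree_mult_eq) (auto simp: D_def)
    obtain c m u v where IH: "0 < c" "degree q = 2 * m" "\<forall>i<m. 0 < v i"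
      "q = Polynomial.smult c (\<Prod>i<m. [:(u i)\<^sup>2 + (v i)\<^sup>2, - 2 * u i, 1:])"
    proof -
      have "degree q < degree p" using deg by simp
      from less.hyps[OF this qpos] show ?thesis using that by blast
    qed
    \<comment> \<open>The absolute value selects the zeros on the same side of the real axis from
      all conjugate pairs.\<close>
    have "p = Polynomial.smult c (\<Prod>i<Suc m. [:((u(m := Re z)) i)\<^sup>2 + ((v(m := \<bar>Im z\<bar>)) i)\<^sup>2, - 2 * (u(m := Re z)) i, 1:])"
      unfolding q IH(4) lessThan_Suc by (simp add: D_def mult.commute)
    moreover have "\<forall>i<Suc m. 0 < (v(m := \<bar>Im z\<bar>)) i" using IH(3) im by (simp add: less_Suc_eq)
    moreover have "degree p = 2 * Suc m" using deg IH(2) by simp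
    ultimately show ?thesis using IH(1) by blast
  qed
qed

text \<open>Real and imaginary part of \<open>s (\<Prod>i<m. x - u i + \<i> v i)\<close>.\<close>

fun hb :: "real \<Rightarrow> (nat \<Rightarrow> real) \<Rightarrow> (nat \<Rightarrow> real) \<Rightarrow> nat \<Rightarrow> real poly \<times> real poly" where
  "hb s u v 0 = ([:s:], 0)"
| "hb s u v (Suc m) = (case hb s u v m of (A, B) \<Rightarrow>
     (lin (u m) * A - Polynomial.smult (v m) B, lin (u m) * B + Polynomial.smult (v m) A))"

text \<open>Multiplicativity of the squared modulus for (L + \<i> V)(A + \<i> B).\<close>

lemma two_squares_identity:
  fixes L V A B :: "'a :: comm_ring_1"
  shows "(L * A - V * B)\<^sup>2 + (L * B + V * A)\<^sup>2 = (L\<^sup>2 + V\<^sup>2) * (A\<^sup>2 + B\<^sup>2)"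
  by (simp add: power2_eq_square algebra_simps)

lemma hb_norm:
  "(fst (hb s u v m))\<^sup>2 + (snd (hb s u v m))\<^sup>2 = Polynomial.smult (s\<^sup>2) (\<Prod>i<m. [:(u i)\<^sup>2 + (v i)\<^sup>2, - 2 * u i, 1:])"
proof (induction m)
  case 0
  then show ?case by (simp add: power2_eq_square)
next
  case (Suc m)
  obtain A B where AB: "hb s u v m = (A, B)" by fastforce
  have L: "lin (u m) ^ 2 + [:(v m)\<^sup>2:] = [:(u m)\<^sup>2 + (v m)\<^sup>2, - 2 * u m, 1:]"
    by (simp add: power2_eq_square)
  have S: "Polynomial.smult (v m) P = [:v m:] * P" for P by simp
  have "(fst (hb s u v (Suc m)))\<^sup>2 + (snd (hb s u v (Suc m)))\<^sup>2 = (lin (u m) ^ 2 + [:v m:] ^ 2) * (A\<^sup>2 + B\<^sup>2)"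
    unfolding hb.simps AB prod.case fst_conv snd_conv S by (rule two_squares_identity)
  also have "[:v m:] ^ 2 = [:(v m)\<^sup>2:]" by (simp add: power2_eq_square)
  finally have "(fst (hb s u v (Suc m)))\<^sup>2 + (snd (hb s u v (Suc m)))\<^sup>2 = [:(u m)\<^sup>2 + (v m)\<^sup>2, - 2 * u m, 1:] * (A\<^sup>2 + B\<^sup>2)"
    unfolding L .
  also have "A\<^sup>2 + B\<^sup>2 = Polynomial.smult (s\<^sup>2) (\<Prod>i<m. [:(u i)\<^sup>2 + (v i)\<^sup>2, - 2 * u i, 1:])"
    using Suc AB by simp
  finally show ?case unfolding lessThan_Suc by (simp only: finite_lessThan lessThan_iff less_irrefl not_False_eq_True prod.insert mult_smult_right)
qed

lemma hb_degree:
  "degree (fst (hb s u v m)) \<le> m \<and> coeff (fst (hb s u v m)) m = s \<and> (\<forall>i\<ge>m. coeff (snd (hb s u v m)) i = 0)"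
proof (induction m)
  case (Suc m)
  obtain A B where AB: "hb s u v m = (A, B)" by fastforce
  have 1: "degree A \<le> m" "coeff A m = s" "\<And>i. m \<le> i \<Longrightarrow> coeff B i = 0" using Suc AB by auto
  have 2: "coeff A i = 0" if "m < i" for i using 1(1) that by (simp add: coeff_eq_0)
  have "degree (lin (u m) * A - Polynomial.smult (v m) B) \<le> Suc m"
    using 1 2 by (intro degree_le) (auto simp: coeff_pCons split: nat.split)
  then show ?case using 1 2 AB by (auto simp: coeff_pCons split: nat.split)
qed simp

text \<open>Each summand is the argument, between 0 and pi, of the factor x - u i + \<i> v i. The
  sum is thus a continuous branch of the argument of the product, without reduction modulo 2
  pi.\<close>

definition hb_phase :: "(nat \<Rightarrow> real) \<Rightarrow> (nat \<Rightarrow> real) \<Rightarrow> nat \<Rightarrow> real \<Rightarrow> real" where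
  "hb_phase u v m x = (\<Sum>i<m. pi / 2 - arctan ((x - u i) / v i))"

lemma hb_polar:
  assumes "\<forall>i<m. 0 < v i" "0 < s"
  shows "\<exists>r>0. poly (fst (hb s u v m)) x = r * cos (hb_phase u v m x) \<and> poly (snd (hb s u v m)) x = r * sin (hb_phase u v m x)"
  using assms(1)
proof (induction m)
  case 0
  then show ?case using assms by (auto simp: hb_phase_def)
next
  case (Suc m)
  obtain A B where AB: "hb s u v m = (A, B)" by fastforce
  obtain r where r: "0 < r" "poly A x = r * cos (hb_phase u v m x)" "poly B x = r * sin (hb_phase u v m x)"
    using Suc AB by auto
  define y where "y = (x - u m) / v m"
  define \<phi> where "\<phi> = pi / 2 - arctan y"
  have v: "0 < v m" using Suc.prems by simp
  define q where "q = sqrt (1 + y\<^sup>2)"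
  have q: "0 < q" by (simp add: q_def add_pos_nonneg)
  have c: "cos \<phi> = y / q" "sin \<phi> = 1 / q"
    by (simp_all add: \<phi>_def cos_diff sin_diff sin_arctan cos_arctan q_def)
  have vq: "v m * q * cos \<phi> = x - u m" "v m * q * sin \<phi> = v m"
    using q v by (simp_all add: c y_def)
  have ph: "hb_phase u v (Suc m) x = hb_phase u v m x + \<phi>" by (simp add: hb_phase_def \<phi>_def y_def)
  have "poly (fst (hb s u v (Suc m))) x = (x - u m) * poly A x - v m * poly B x" by (simp add: AB algebra_simps)
  also have "\<dots> = (v m * q * cos \<phi>) * poly A x - (v m * q * sin \<phi>) * poly B x" by (simp only: vq)
  also have "\<dots> = (v m * q * r) * cos (hb_phase u v (Suc m) x)"
    unfolding ph r cos_add by (simp add: algebra_simps)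
  finally have 1: "poly (fst (hb s u v (Suc m))) x = (v m * q * r) * cos (hb_phase u v (Suc m) x)" .
  have "poly (snd (hb s u v (Suc m))) x = (x - u m) * poly B x + v m * poly A x" by (simp add: AB algebra_simps)
  also have "\<dots> = (v m * q * cos \<phi>) * poly B x + (v m * q * sin \<phi>) * poly A x" by (simp only: vq)
  also have "\<dots> = (v m * q * r) * sin (hb_phase u v (Suc m) x)"
    unfolding ph r sin_add by (simp add: algebra_simps)
  finally show ?case using 1 q v r by (intro exI[of _ "v m * q * r"]) auto
qed

lemma hb_phase_antimono:
  assumes "\<forall>i<m. 0 < v i" "x \<le> y" shows "hb_phase u v m y \<le> hb_phase u v m x"
  unfolding hb_phase_def using assms
  by (intro sum_mono) (auto simp: arctan_le_iff intro!: divide_right_mono)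

lemma hb_phase_limits:
  assumes "\<forall>i<m. 0 < v i"
  shows "(hb_phase u v m \<longlongrightarrow> real m * pi) at_bot" "(hb_phase u v m \<longlongrightarrow> 0) at_top"
proof -
  have bot: "((\<lambda>x. arctan ((x - u i) / v i)) \<longlongrightarrow> - (pi/2)) at_bot" if "i < m" for i
  proof -
    have "filterlim (\<lambda>x. (x - u i) / v i) at_bot at_bot"
      unfolding filterlim_at_bot eventually_at_bot_linorder
    proof
      fix Z show "\<exists>N. \<forall>x\<le>N. (x - u i) / v i \<le> Z"
        using assms that by (intro exI[of _ "u i + Z * v i"]) (auto simp: pos_divide_le_eq)
    qed
    from filterlim_compose[OF tendsto_arctan_at_bot this] show ?thesis .
  qed
  have top: "((\<lambda>x. arctan ((x - u i) / v i)) \<longlongrightarrow> pi/2) at_top" if "i < m" for i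
  proof -
    have "filterlim (\<lambda>x. (x - u i) / v i) at_top at_top"
      unfolding filterlim_at_top eventually_at_top_linorder
    proof
      fix Z show "\<exists>N. \<forall>x\<ge>N. Z \<le> (x - u i) / v i"
        using assms that by (intro exI[of _ "u i + Z * v i"]) (auto simp: pos_le_divide_eq)
    qed
    from filterlim_compose[OF tendsto_arctan_at_top this] show ?thesis .
  qed
  have "(hb_phase u v m \<longlongrightarrow> (\<Sum>i<m. pi/2 - (- (pi/2)))) at_bot"
    unfolding hb_phase_def by (intro tendsto_intros bot) auto
  then show "(hb_phase u v m \<longlongrightarrow> real m * pi) at_bot" by simp
  have "(hb_phase u v m \<longlongrightarrow> (\<Sum>i<m. pi/2 - pi/2)) at_top"
    unfolding hb_phase_def by (intro tendsto_intros top) auto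
  then show "(hb_phase u v m \<longlongrightarrow> 0) at_top" by simp
qed

lemma hb_phase_surj:
  assumes v: "\<forall>i<m. 0 < v i" and y: "0 < y" "y < real m * pi"
  shows "\<exists>x. hb_phase u v m x = y"
proof -
  have "eventually (\<lambda>x. y < hb_phase u v m x) at_bot"
    by (rule order_tendstoD(1)[OF hb_phase_limits(1)[OF v] y(2)])
  then obtain a where a: "y < hb_phase u v m a"
    unfolding eventually_at_bot_linorder by blast
  have "eventually (\<lambda>x. hb_phase u v m x < y) at_top"
    by (rule order_tendstoD(2)[OF hb_phase_limits(2)[OF v] y(1)])
  then obtain b where b: "hb_phase u v m b < y"
    unfolding eventually_at_top_linorder by blast
  note ab = a b
  have "a \<le> b" using hb_phase_antimono[OF v, of b a u] ab by linarith
  have "continuous_on {a..b} (hb_phase u v m)"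
    unfolding hb_phase_def using v by (intro continuous_intros) auto
  then show ?thesis using IVT2'[of "hb_phase u v m" b y a] ab \<open>a \<le> b\<close> by auto
qed

lemma poly_eq_prod_roots:
  fixes p :: "real poly"
  assumes deg: "degree p \<le> card S" and S: "finite S" and roots: "\<And>x. x \<in> S \<Longrightarrow> poly p x = 0"
  shows "p = Polynomial.smult (coeff p (card S)) (\<Prod>x\<in>S. lin x)"
proof -
  let ?Q = "\<Prod>x\<in>S. lin x"
  have dQ: "degree ?Q = card S" by (subst degree_prod_eq_sum_degree) auto
  have lQ: "coeff ?Q (card S) = 1"
    using lead_coeff_prod[of lin S] dQ by simp
  define w where "w = p - Polynomial.smult (coeff p (card S)) ?Q"
  have "w = 0"
  proof (rule ccontr)
    assume ne: "w \<noteq> 0"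
    have "degree w \<le> card S" unfolding w_def using deg dQ
      by (intro degree_diff_le order_trans[OF degree_smult_le]) auto
    moreover have "coeff w (card S) = 0" by (simp add: w_def lQ)
    ultimately have "degree w < card S" using ne by (metis leading_coeff_0_iff le_neq_implies_less)
    moreover have "card S \<le> card {x. poly w x = 0}"
      using poly_roots_finite[OF ne] roots S by (intro card_mono) (auto simp: w_def poly_prod)
    moreover have "card {x. poly w x = 0} \<le> degree w" using ne by (rule card_poly_roots_bound)
    ultimately show False by simp
  qed
  then show ?thesis by (simp add: w_def)
qed

text \<open>The zeros of the two parts interlace because the phase is strictly monotone.\<close>

lemma kpoly_exists_full:
  assumes m: "1 \<le> m" and p: "spos Full_line (2 * m) p"
  shows "\<exists>x y \<gamma>. 0 < x \<and> 0 < y \<and> \<gamma> \<in> Delta Full_line (2 * m - 1) \<and> p = kpoly Full_line (2 * m) x y \<gamma>"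
proof -
  have pos: "0 < poly p t" for t using p by (simp add: spos_def)
  have "degree p = 2 * m" using p by (intro antisym le_degree) (auto simp: spos_def)
  with positive_poly_factor[of p] pos obtain c u v where c: "0 < c" "\<forall>i<m. 0 < v i"
     "p = Polynomial.smult c (\<Prod>i<m. [:(u i)\<^sup>2 + (v i)\<^sup>2, - 2 * u i, 1:])" by auto
  define s where "s = sqrt c"
  have s: "0 < s" "s\<^sup>2 = c" using c by (auto simp: s_def)
  define A B where "A = fst (hb s u v m)" and "B = snd (hb s u v m)"
  have pAB: "p = A\<^sup>2 + B\<^sup>2" using hb_norm[of s u v m] c(3) s by (simp add: A_def B_def)
  have dA: "degree A \<le> m" "coeff A m = s" and dB: "\<And>i. m \<le> i \<Longrightarrow> coeff B i = 0"
    using hb_degree[of s u v m] by (auto simp: A_def B_def)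
  define \<theta> where "\<theta> = hb_phase u v m"
  have polar: "\<exists>r>0. poly A x = r * cos (\<theta> x) \<and> poly B x = r * sin (\<theta> x)" for x
    unfolding A_def B_def \<theta>_def by (rule hb_polar[OF c(2) s(1)])
  \<comment> \<open>The multiples of pi / 2 strictly between m pi and 0, in decreasing order because
    the phase decreases. Odd j give zeros of the cosine, hence of \<open>A\<close>; even j give
    zeros of the sine, hence of \<open>B\<close>.\<close>
  define val where "val j = (real m - real j / 2) * pi" for j
  have "\<exists>x. \<theta> x = val j" if "j \<in> {1..<2 * m}" for j
    unfolding \<theta>_def using that by (intro hb_phase_surj[OF c(2)]) (auto simp: val_def)
  then obtain \<gamma> where \<gamma>: "\<And>j. j \<in> {1..<2 * m} \<Longrightarrow> \<theta> (\<gamma> j) = val j" by metis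
  have less: "\<gamma> i < \<gamma> j" if "i \<in> {1..<2 * m}" "j \<in> {1..<2 * m}" "i < j" for i j
  proof (rule ccontr)
    assume "\<not> \<gamma> i < \<gamma> j"
    then have "\<theta> (\<gamma> i) \<le> \<theta> (\<gamma> j)" unfolding \<theta>_def by (intro hb_phase_antimono[OF c(2)]) auto
    then show False using that \<gamma> by (simp add: val_def)
  qed
  have inj: "inj_on \<gamma> {1..<2 * m}"
    by (rule linorder_inj_onI') (use less in fastforce)
  have Delta: "\<gamma> \<in> Delta Full_line (2 * m - 1)"
    using less unfolding Delta_def by (auto intro!: strict_mono_onI)
  have A0: "poly A (\<gamma> j) = 0" if j: "j \<in> {1..<2 * m}" "odd j" for j
  proof -
    obtain i where i: "j = 2 * i + 1" using j by (elim oddE)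
    have "cos (val j) = cos (of_int (2 * (int m - int i - 1) + 1) * (pi / 2))"
      by (rule arg_cong[where f=cos]) (simp add: val_def i field_simps)
    also have "\<dots> = 0" unfolding cos_zero_iff_int by (intro exI[of _ "2 * (int m - int i - 1) + 1"]) simp
    finally show ?thesis using polar[of "\<gamma> j"] \<gamma>[OF j(1)] by auto
  qed
  have B0: "poly B (\<gamma> j) = 0" if j: "j \<in> {1..<2 * m}" "even j" for j
  proof -
    obtain i where i: "j = 2 * i" using j by (elim evenE)
    have "sin (val j) = sin (of_int (int m - int i) * pi)"
      by (rule arg_cong[where f=sin]) (simp add: val_def i field_simps)
    also have "\<dots> = 0" unfolding sin_zero_iff_int2 by blast
    finally show ?thesis using polar[of "\<gamma> j"] \<gamma>[OF j(1)] by auto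
  qed
  let ?O = "{j \<in> {1..<2 * m}. odd j}" and ?E = "{j \<in> {1..<2 * m}. even j}"
  have injO: "inj_on \<gamma> ?O" "inj_on \<gamma> ?E" by (rule inj_on_subset[OF inj], auto)+
  have cO: "card (\<gamma> ` ?O) = m" "card (\<gamma> ` ?E) = m - 1"
    using card_odd_indices[of "2 * m"] card_even_indices[of "2 * m"] injO m by (auto simp: card_image)
  have "A = Polynomial.smult s (\<Prod>x\<in>\<gamma> ` ?O. lin x)"
    using poly_eq_prod_roots[of A "\<gamma> ` ?O"] A0 dA cO by auto
  also have "(\<Prod>x\<in>\<gamma> ` ?O. lin x) = (\<Prod>j\<in>?O. lin (\<gamma> j))" using injO by (simp add: prod.reindex)
  finally have A': "A = Polynomial.smult s (\<Prod>j\<in>?O. lin (\<gamma> j))" .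
  have A: "A\<^sup>2 = Polynomial.smult c (Pod (2 * m) \<gamma>)"
    unfolding A' smult_power s(2) Pod_def prod_power_distrib ..
  define b where "b = coeff B (m - 1)"
  have "degree B \<le> m - 1" using dB m by (intro degree_le) auto
  then have "B = Polynomial.smult b (\<Prod>x\<in>\<gamma> ` ?E. lin x)"
    using poly_eq_prod_roots[of B "\<gamma> ` ?E"] B0 cO by (auto simp: b_def)
  also have "(\<Prod>x\<in>\<gamma> ` ?E. lin x) = (\<Prod>j\<in>?E. lin (\<gamma> j))" using injO by (simp add: prod.reindex)
  finally have B': "B = Polynomial.smult b (\<Prod>j\<in>?E. lin (\<gamma> j))" .
  have B: "B\<^sup>2 = Polynomial.smult (b\<^sup>2) (Pev (2 * m) \<gamma>)"
    unfolding B' smult_power Pev_def prod_power_distrib ..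
  \<comment> \<open>Otherwise p = A^2 would vanish at the first node.\<close>
  have "b \<noteq> 0"
  proof
    assume "b = 0"
    then have "poly p (\<gamma> 1) = 0" using pAB A0[of 1] m B' by simp
    then show False using pos[of "\<gamma> 1"] by simp
  qed
  moreover have "p = kpoly Full_line (2 * m) c (b\<^sup>2) \<gamma>" unfolding pAB A B kpoly_def by simp
  ultimately show ?thesis using c(1) Delta by (intro exI[of _ c] exI[of _ "b\<^sup>2"] exI[of _ \<gamma>]) auto
qed

section \<open>The half line by the substitution t = a + x^2\<close>

lemma prod_reflect:
  assumes "\<And>j. j \<in> S \<Longrightarrow> j < 2 * k \<and> 2 * k - j \<in> S'" "\<And>j. j \<in> S' \<Longrightarrow> j < 2 * k \<and> 2 * k - j \<in> S"
  shows "(\<Prod>j\<in>S. f (2 * k - j)) = (\<Prod>j\<in>S'. f (j::nat))"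
  by (rule prod.reindex_bij_witness[of _ "\<lambda>j. 2 * k - j" "\<lambda>j. 2 * k - j"])
     (use assms in \<open>auto simp: less_imp_le\<close>)

text \<open>The indices j and 2 k - j are paired, and (x - g)^2 (x + g)^2 = (x^2 - g^2)^2. The
  middle index is its own partner, so its node is 0 and it contributes x^2.\<close>

lemma symmetric_prod:
  fixes \<gamma> :: "nat \<Rightarrow> real"
  assumes S: "S \<subseteq> {1..<2 * k}" "\<And>j. j \<in> S \<Longrightarrow> 2 * k - j \<in> S"
    and anti: "\<And>j. j \<in> {1..<2 * k} \<Longrightarrow> \<gamma> (2 * k - j) = - \<gamma> j"
  shows "(\<Prod>j\<in>S. (x - \<gamma> j)\<^sup>2) = (if k \<in> S then x\<^sup>2 else 1) * (\<Prod>i\<in>{i \<in> {1..<k}. k + i \<in> S}. (x\<^sup>2 - (\<gamma> (k + i))\<^sup>2)\<^sup>2)"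
proof -
  let ?L = "{j \<in> S. j < k}" and ?R = "{j \<in> S. k < j}" and ?C = "S \<inter> {k}"
  have fin: "finite S" using S(1) finite_subset by blast
  have "S = ?L \<union> ?R \<union> ?C" by auto
  then have "(\<Prod>j\<in>S. (x - \<gamma> j)\<^sup>2) = (\<Prod>j\<in>?L \<union> ?R \<union> ?C. (x - \<gamma> j)\<^sup>2)" by simp
  also have "\<dots> = (\<Prod>j\<in>?L. (x - \<gamma> j)\<^sup>2) * (\<Prod>j\<in>?R. (x - \<gamma> j)\<^sup>2) * (\<Prod>j\<in>?C. (x - \<gamma> j)\<^sup>2)"
  proof -
    have "(\<Prod>j\<in>?L \<union> ?R \<union> ?C. (x - \<gamma> j)\<^sup>2) = (\<Prod>j\<in>?L \<union> ?R. (x - \<gamma> j)\<^sup>2) * (\<Prod>j\<in>?C. (x - \<gamma> j)\<^sup>2)"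
      by (rule prod.union_disjoint) (use fin in auto)
    also have "(\<Prod>j\<in>?L \<union> ?R. (x - \<gamma> j)\<^sup>2) = (\<Prod>j\<in>?L. (x - \<gamma> j)\<^sup>2) * (\<Prod>j\<in>?R. (x - \<gamma> j)\<^sup>2)"
      by (rule prod.union_disjoint) (use fin in auto)
    finally show ?thesis .
  qed
  also have "(\<Prod>j\<in>?C. (x - \<gamma> j)\<^sup>2) = (if k \<in> S then x\<^sup>2 else 1)"
  proof (cases "k \<in> S")
    case True
    then have "\<gamma> (2 * k - k) = - \<gamma> k" using S(1) by (intro anti) auto
    then have "\<gamma> k = 0" by simp
    then show ?thesis using True by (simp add: Int_insert_right)
  qed simp
  also have "(\<Prod>j\<in>?L. (x - \<gamma> j)\<^sup>2) = (\<Prod>j\<in>?L. (x + \<gamma> (2 * k - j))\<^sup>2)"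
    using S(1) anti by (intro prod.cong refl) auto
  also have "\<dots> = (\<Prod>j\<in>?R. (x + \<gamma> j)\<^sup>2)"
    using S by (intro prod_reflect[where f="\<lambda>j. (x + \<gamma> j)\<^sup>2"]) auto
  also have "(\<Prod>j\<in>?R. (x + \<gamma> j)\<^sup>2) * (\<Prod>j\<in>?R. (x - \<gamma> j)\<^sup>2) = (\<Prod>j\<in>?R. (x\<^sup>2 - (\<gamma> j)\<^sup>2)\<^sup>2)"
    by (simp add: power2_eq_square algebra_simps flip: prod.distrib)
  also have "\<dots> = (\<Prod>i\<in>{i \<in> {1..<k}. k + i \<in> S}. (x\<^sup>2 - (\<gamma> (k + i))\<^sup>2)\<^sup>2)"
  proof (rule prod.reindex_bij_witness[of _ "\<lambda>i. k + i" "\<lambda>j. j - k"])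
    fix j assume j: "j \<in> ?R"
    then have "j < 2 * k" using S(1) by auto
    then show "j - k \<in> {i \<in> {1..<k}. k + i \<in> S}" using j by auto
  qed auto
  finally show ?thesis by (simp only: mult.commute)
qed

lemma poly_eqI_interval:
  fixes p q :: "real poly"
  assumes "a < b" "\<And>t. a < t \<Longrightarrow> t < b \<Longrightarrow> poly p t = poly q t"
  shows "p = q"
proof (rule ccontr)
  assume "p \<noteq> q"
  then have "finite {t. poly (p - q) t = 0}" by (intro poly_roots_finite) simp
  then have "finite {a<..<b}" by (rule finite_subset[rotated]) (use assms(2) in auto)
  then show False using infinite_Ioo[OF assms(1)] by simp
qed

text \<open>The polynomial p(a + x^2) is positive on the line, and reflecting its representation
  gives another one. By uniqueness the nodes are symmetric about 0, so the representation is one in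
  x^2 = t - a. The middle node produces the factor t - a, in the term that its parity
  determines.\<close>

lemma kpoly_exists_half:
  assumes k: "1 \<le> k" and p: "spos (Half_line a) k p"
  shows "\<exists>x y \<gamma>. 0 < x \<and> 0 < y \<and> \<gamma> \<in> Delta (Half_line a) (k - 1) \<and> p = kpoly (Half_line a) k x y \<gamma>"
proof -
  have dp: "degree p = k" using p by (intro antisym le_degree) (auto simp: spos_def)
  define q where "q = pcompose p [:a, 0, 1:]"
  have eq: "poly q x = poly p (a + x\<^sup>2)" for x by (simp add: q_def poly_pcompose power2_eq_square)
  have dq: "degree q = 2 * k" unfolding q_def degree_pcompose by (simp add: dp)
  have "lead_coeff q = lead_coeff p" unfolding q_def by (subst lead_coeff_comp) auto
  then have q: "spos Full_line (2 * k) q" using p dp dq by (simp add: spos_def eq)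
  then obtain X Y \<gamma> where XY: "0 < X" "0 < Y" "\<gamma> \<in> Delta Full_line (2 * k - 1)" "q = kpoly Full_line (2 * k) X Y \<gamma>"
    using kpoly_exists_full[OF k] by blast
  define \<gamma>' where "\<gamma>' j = - \<gamma> (2 * k - j)" for j
  have \<gamma>': "\<gamma>' \<in> Delta Full_line (2 * k - 1)"
    unfolding Delta_def
  proof (clarsimp, rule strict_mono_onI)
    fix i j assume "i \<in> {Suc 0..2 * k - Suc 0}" "j \<in> {Suc 0..2 * k - Suc 0}" "i < j"
    then show "\<gamma>' i < \<gamma>' j" using Delta_less[OF XY(3), of "2 * k - j" "2 * k - i"] by (auto simp: \<gamma>'_def)
  qed
  have evq: "poly (kpoly Full_line (2 * k) X Y \<delta>) x = X * (\<Prod>j\<in>{j \<in> {1..<2 * k}. odd j}. (x - \<delta> j)\<^sup>2) + Y * (\<Prod>j\<in>{j \<in> {1..<2 * k}. even j}. (x - \<delta> j)\<^sup>2)" for \<delta> x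
    by (simp add: kpoly_def poly_Pod poly_Pev)
  have refl: "(\<Prod>j\<in>S. (x - \<gamma>' j)\<^sup>2) = (\<Prod>j\<in>S. (- x - \<gamma> j)\<^sup>2)" if "S \<subseteq> {1..<2 * k}" "\<And>j. j \<in> S \<Longrightarrow> 2 * k - j \<in> S" for S x
  proof -
    have "(\<Prod>j\<in>S. (x - \<gamma>' j)\<^sup>2) = (\<Prod>j\<in>S. (- x - \<gamma> (2 * k - j))\<^sup>2)"
      by (intro prod.cong refl) (simp add: \<gamma>'_def power2_eq_square algebra_simps)
    also have "\<dots> = (\<Prod>j\<in>S. (- x - \<gamma> j)\<^sup>2)" using that by (intro prod_reflect[where f="\<lambda>j. (- x - \<gamma> j)\<^sup>2"]) auto
    finally show ?thesis .
  qed
  have "poly (kpoly Full_line (2 * k) X Y \<gamma>') x = poly (kpoly Full_line (2 * k) X Y \<gamma>) (- x)" for x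
    unfolding evq by (subst (1 2) refl) auto
  then have "poly (kpoly Full_line (2 * k) X Y \<gamma>') x = poly (kpoly Full_line (2 * k) X Y \<gamma>) x" for x
    unfolding XY(4)[symmetric] eq by simp
  then have "kpoly Full_line (2 * k) X Y \<gamma> = kpoly Full_line (2 * k) X Y \<gamma>'"
    by (intro poly_eqI_interval[of 0 1]) auto
  then have "\<forall>j\<in>{1..<2 * k}. \<gamma> j = \<gamma>' j"
    using kpoly_unique[of "2 * k" Full_line X Y X Y \<gamma> \<gamma>'] XY \<gamma>' k by auto
  then have anti: "\<gamma> (2 * k - j) = - \<gamma> j" if "j \<in> {1..<2 * k}" for j
    using that by (auto simp: \<gamma>'_def)
  define \<delta> where "\<delta> i = a + (\<gamma> (k + i))\<^sup>2" for i
  have \<gamma>k: "\<gamma> k = 0" using anti[of k] k by simp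
  have \<gamma>pos: "0 < \<gamma> (k + i)" if "1 \<le> i" "i < k" for i
    using Delta_less[OF XY(3), of k "k + i"] that k \<gamma>k by simp
  have \<delta>: "\<delta> \<in> Delta (Half_line a) (k - 1)"
    unfolding Delta_def
  proof (clarsimp simp: interior_points simp del: points.simps, intro conjI ballI strict_mono_onI)
    fix i assume "i \<in> {Suc 0..k - Suc 0}"
    then have "1 \<le> i" "i < k" using k by auto
    then show "a < \<delta> i" using \<gamma>pos[of i] by (simp add: \<delta>_def)
  next
    fix i j assume "i \<in> {Suc 0..k - Suc 0}" "j \<in> {Suc 0..k - Suc 0}" "i < j"
    then have "1 \<le> i" "i < j" "j < k" using k by auto
    then show "\<delta> i < \<delta> j" using \<gamma>pos[of i] Delta_less[OF XY(3), of "k + i" "k + j"] by (auto simp: \<delta>_def intro!: power_strict_mono)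
  qed
  \<comment> \<open>The surviving nodes have indices k + i, whose parity agrees with that of i
    exactly for even k; for odd k the two terms change places.\<close>
  define x' y' where "x' = (if even k then X else Y)" and "y' = (if even k then Y else X)"
  have val: "poly p (a + x\<^sup>2) = poly (kpoly (Half_line a) k x' y' \<delta>) (a + x\<^sup>2)" for x
  proof -
    have o: "{i \<in> {1..<k}. k + i \<in> {j \<in> {1..<2 * k}. odd j}} = (if even k then {i \<in> {1..<k}. odd i} else {i \<in> {1..<k}. even i})"
      and e: "{i \<in> {1..<k}. k + i \<in> {j \<in> {1..<2 * k}. even j}} = (if even k then {i \<in> {1..<k}. even i} else {i \<in> {1..<k}. odd i})"
      by auto
    have "poly p (a + x\<^sup>2) = X * (\<Prod>j\<in>{j \<in> {1..<2 * k}. odd j}. (x - \<gamma> j)\<^sup>2) + Y * (\<Prod>j\<in>{j \<in> {1..<2 * k}. even j}. (x - \<gamma> j)\<^sup>2)"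
      unfolding eq[symmetric] XY(4) evq ..
    also have "(\<Prod>j\<in>{j \<in> {1..<2 * k}. odd j}. (x - \<gamma> j)\<^sup>2) = (if odd k then x\<^sup>2 * poly (Pev k \<delta>) (a + x\<^sup>2) else poly (Pod k \<delta>) (a + x\<^sup>2))"
      using k by (subst symmetric_prod[of _ k \<gamma>]) (auto simp: anti o[simplified] poly_Pod poly_Pev \<delta>_def)
    also have "(\<Prod>j\<in>{j \<in> {1..<2 * k}. even j}. (x - \<gamma> j)\<^sup>2) = (if even k then x\<^sup>2 * poly (Pev k \<delta>) (a + x\<^sup>2) else poly (Pod k \<delta>) (a + x\<^sup>2))"
      using k by (subst symmetric_prod[of _ k \<gamma>]) (auto simp: anti e[simplified] poly_Pod poly_Pev \<delta>_def)
    finally show ?thesis by (auto simp: kpoly_def x'_def y'_def distrib_right)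
  qed
  have "p = kpoly (Half_line a) k x' y' \<delta>"
  proof (rule poly_eqI_interval[of a "a + 1"])
    fix t assume "a < t"
    then show "poly p t = poly (kpoly (Half_line a) k x' y' \<delta>) t" using val[of "sqrt (t - a)"] by simp
  qed simp
  then show ?thesis using \<delta> XY by (intro exI[of _ x'] exI[of _ y'] exI[of _ \<delta>]) (auto simp: x'_def y'_def)
qed

section \<open>The segment by a Moebius transformation\<close>

lemma coeff_mult_bound:
  assumes "degree p \<le> i" "degree q \<le> j"
  shows "coeff (p * q) (i + j) = coeff p i * coeff q j"
proof (cases "degree p = i \<and> degree q = j")
  case True
  then show ?thesis using coeff_mult_degree_sum[of p q] by simp
next
  case False
  then have "degree p + degree q < i + j" using assms by linarith
  then have "coeff (p * q) (i + j) = 0" using degree_mult_le[of p q] by (intro coeff_eq_0) linarith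
  moreover have "coeff p i * coeff q j = 0" using False assms by (auto simp: coeff_eq_0)
  ultimately show ?thesis by simp
qed

lemma linear_power_coeff:
  fixes a b :: real
  shows "degree ([:a, b:] ^ i) \<le> i \<and> coeff ([:a, b:] ^ i) i = b ^ i"
proof (induction i)
  case (Suc i)
  have "degree ([:a, b:] * [:a, b:] ^ i) \<le> 1 + i"
    using Suc by (intro order_trans[OF degree_mult_le] add_mono) auto
  moreover have "coeff ([:a, b:] * [:a, b:] ^ i) (1 + i) = coeff [:a, b:] 1 * coeff ([:a, b:] ^ i) i"
    using Suc by (intro coeff_mult_bound) auto
  ultimately show ?case using Suc by simp
qed simp

lemma poly_sum_coeff: "degree p \<le> n \<Longrightarrow> poly p t = (\<Sum>i\<le>n. coeff p i * t ^ i)" for t :: real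
  unfolding poly_altdef by (rule sum.mono_neutral_left) (auto simp: coeff_eq_0)

text \<open>The Moebius transformation \<open>t = (a + b s) / (1 + s)\<close> maps the half line to the segment.\<close>

lemma kpoly_exists_segment:
  assumes n: "1 \<le> n" and ab: "a < b" and p: "spos (Segment a b) n p"
  shows "\<exists>x y \<gamma>. 0 < x \<and> 0 < y \<and> \<gamma> \<in> Delta (Segment a b) (n - 1) \<and> p = kpoly (Segment a b) n x y \<gamma>"
proof -
  have dp: "degree p \<le> n" using p by (simp add: spos_def)
  \<comment> \<open>The transformed polynomial (1 + s)^n p((a + b s) / (1 + s)), with the
    denominators cleared term by term. This works for any degree of p up to n.\<close>
  define P where "P = (\<Sum>i\<le>n. Polynomial.smult (coeff p i) ([:a, b:] ^ i * [:1, 1:] ^ (n - i)))"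
  have evP: "poly P s = (1 + s) ^ n * poly p ((a + b * s) / (1 + s))" if "0 \<le> s" for s
  proof -
    have "poly P s = (\<Sum>i\<le>n. (1 + s) ^ n * (coeff p i * ((a + b * s) / (1 + s)) ^ i))"
      unfolding P_def poly_sum
    proof (intro sum.cong refl)
      fix i assume "i \<in> {..n}"
      then have "(1 + s) ^ n = (1 + s) ^ i * (1 + s) ^ (n - i)" by (simp flip: power_add)
      then show "poly (Polynomial.smult (coeff p i) ([:a, b:] ^ i * [:1, 1:] ^ (n - i))) s = (1 + s) ^ n * (coeff p i * ((a + b * s) / (1 + s)) ^ i)"
        using that by (simp add: poly_power power_divide mult_ac)
    qed
    then show ?thesis unfolding poly_sum_coeff[OF dp] by (simp add: sum_distrib_left)
  qed
  have "spos (Half_line 0) n P"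
    unfolding spos_def
  proof (intro conjI ballI)
    have "degree ([:a, b:] ^ i * [:1, 1:] ^ (n - i)) \<le> n" if "i \<le> n" for i
      using linear_power_coeff[of a b i] linear_power_coeff[of 1 1 "n - i"] that
      by (intro order_trans[OF degree_mult_le]) linarith
    then show "degree P \<le> n" unfolding P_def by (intro degree_sum_le) (auto intro: order_trans[OF degree_smult_le])
    fix s assume "s \<in> points (Half_line 0)"
    then have s: "0 \<le> s" by simp
    have "(a + b * s) / (1 + s) \<in> {a..b}" using s ab by (auto simp: field_simps mult_right_mono)
    then show "0 < poly P s" using p s by (simp add: evP spos_def)
  next
    \<comment> \<open>The end b corresponds to infinity: the leading coefficient of the transform is
      p(b).\<close>
    have "coeff P n = (\<Sum>i\<le>n. coeff p i * b ^ i)"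
      unfolding P_def coeff_sum
    proof (intro sum.cong refl)
      fix i assume "i \<in> {..n}"
      then show "coeff (Polynomial.smult (coeff p i) ([:a, b:] ^ i * [:1, 1:] ^ (n - i))) n = coeff p i * b ^ i"
        using coeff_mult_bound[of "[:a, b:] ^ i" i "[:1, 1:] ^ (n - i)" "n - i"] linear_power_coeff[of a b i] linear_power_coeff[of 1 1 "n - i"]
        by simp
    qed
    also have "\<dots> = poly p b" by (rule poly_sum_coeff[OF dp, symmetric])
    also have "\<dots> > 0" using p ab by (simp add: spos_def)
    finally show "case Half_line 0 of Segment a b \<Rightarrow> True | _ \<Rightarrow> 0 < coeff P n" by simp
  qed
  then obtain X Y \<sigma> where XY: "0 < X" "0 < Y" "\<sigma> \<in> Delta (Half_line 0) (n - 1)" "P = kpoly (Half_line 0) n X Y \<sigma>"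
    using kpoly_exists_half[OF n] by blast
  have \<sigma>: "0 < \<sigma> i" if "i \<in> {1..<n}" for i using Delta_interior[OF XY(3) that] by (simp add: interior_points del: points.simps)
  define \<gamma> where "\<gamma> i = (a + b * \<sigma> i) / (1 + \<sigma> i)" for i
  have \<gamma>_alt: "\<gamma> i = b - (b - a) / (1 + \<sigma> i)" if "i \<in> {1..<n}" for i
    using \<sigma>[OF that] by (simp add: \<gamma>_def field_simps)
  have \<gamma>: "\<gamma> \<in> Delta (Segment a b) (n - 1)"
    unfolding Delta_def
  proof (clarsimp simp: interior_points simp del: points.simps, intro conjI ballI strict_mono_onI)
    fix i assume i: "i \<in> {Suc 0..n - Suc 0}"
    then have s: "0 < \<sigma> i" by (intro \<sigma>) auto
    then show "a < \<gamma> i" "\<gamma> i < b" using ab by (auto simp: \<gamma>_def field_simps)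
  next
    fix i j assume ij: "i \<in> {Suc 0..n - Suc 0}" "j \<in> {Suc 0..n - Suc 0}" "i < j"
    then have "0 < \<sigma> i" "\<sigma> i < \<sigma> j" using Delta_less[OF XY(3), of i j] by (auto intro!: \<sigma>)
    then have "(b - a) / (1 + \<sigma> j) < (b - a) / (1 + \<sigma> i)" using ab by (intro divide_strict_left_mono) auto
    then show "\<gamma> i < \<gamma> j" using ij by (subst (1 2) \<gamma>_alt) auto
  qed
  \<comment> \<open>These constants collect the factors of \<open>key\<close>, w (s - \<sigma>_j) =
    (1 + \<sigma>_j) / (b - a) (t - \<gamma>_j), where w = 1 / (1 + s).\<close>
  define cO where "cO = (\<Prod>j\<in>{j \<in> {1..<n}. odd j}. ((1 + \<sigma> j) / (b - a))\<^sup>2)"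
  define cE where "cE = (\<Prod>j\<in>{j \<in> {1..<n}. even j}. ((1 + \<sigma> j) / (b - a))\<^sup>2)"
  have c: "0 < cO" "0 < cE" unfolding cO_def cE_def using \<sigma> ab
    by (auto intro!: prod_pos zero_less_power divide_pos_pos add_pos_pos)
  define x where "x = X * cO * (if even n then 1 else 1 / (b - a))"
  define y where "y = Y * cE * (if even n then 1 / (b - a)\<^sup>2 else 1 / (b - a))"
  have "p = kpoly (Segment a b) n x y \<gamma>"
  proof (rule poly_eqI_interval[OF ab])
    fix t assume t: "a < t" "t < b"
    define s w where "s = (t - a) / (b - t)" and "w = (b - t) / (b - a)"
    have "1 + s = (b - a) / (b - t)" using t by (simp add: s_def field_simps)
    then have s: "0 < s" "(1 + s) * w = 1" and w: "0 < w" using t ab by (auto simp: s_def w_def)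
    have "a + b * s = t * (1 + s)" using t by (simp add: s_def field_simps)
    then have ts: "(a + b * s) / (1 + s) = t" using s by simp
    have key: "w * (s - \<sigma> j) = (1 + \<sigma> j) / (b - a) * (t - \<gamma> j)" if "j \<in> {1..<n}" for j
    proof -
      have "(1 + \<sigma> j) * (t - \<gamma> j) = (1 + \<sigma> j) * t - (a + b * \<sigma> j)"
        using \<sigma>[OF that] unfolding right_diff_distrib by (simp add: \<gamma>_def)
      moreover have "w * (s - \<sigma> j) = ((t - a) - \<sigma> j * (b - t)) / (b - a)"
      proof -
        have "w * s = (t - a) / (b - a)" using t ab by (simp add: w_def s_def)
        then have e: "w * (s - \<sigma> j) = (t - a) / (b - a) - \<sigma> j * w" by (simp add: right_diff_distrib mult.commute)
        show ?thesis unfolding e diff_divide_distrib[of "t - a"] by (simp add: w_def)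
      qed
      ultimately show ?thesis by (simp add: algebra_simps)
    qed
    have prodw: "(w\<^sup>2) ^ card S * (\<Prod>j\<in>S. (s - \<sigma> j)\<^sup>2) = (\<Prod>j\<in>S. ((1 + \<sigma> j) / (b - a))\<^sup>2) * (\<Prod>j\<in>S. (t - \<gamma> j)\<^sup>2)" if "S \<subseteq> {1..<n}" for S
    proof -
      have "(w\<^sup>2) ^ card S * (\<Prod>j\<in>S. (s - \<sigma> j)\<^sup>2) = (\<Prod>j\<in>S. (w * (s - \<sigma> j))\<^sup>2)"
        by (simp add: power_mult_distrib prod.distrib)
      also have "\<dots> = (\<Prod>j\<in>S. ((1 + \<sigma> j) / (b - a) * (t - \<gamma> j))\<^sup>2)" using that key by (intro prod.cong refl) auto
      finally show ?thesis by (simp only: power_mult_distrib prod.distrib)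
    qed
    have O: "(w\<^sup>2) ^ (n div 2) * poly (Pod n \<sigma>) s = cO * poly (Pod n \<gamma>) t"
      unfolding poly_Pod cO_def card_odd_indices[symmetric] by (rule prodw) auto
    have E: "(w\<^sup>2) ^ ((n - 1) div 2) * poly (Pev n \<sigma>) s = cE * poly (Pev n \<gamma>) t"
      unfolding poly_Pev cE_def card_even_indices[symmetric] by (rule prodw) auto
    have "poly p t = w ^ n * poly P s"
    proof -
      have "poly P s = (1 + s) ^ n * poly p t" using evP[OF less_imp_le[OF s(1)]] unfolding ts .
      then have "w ^ n * poly P s = ((1 + s) * w) ^ n * poly p t" by (simp only: power_mult_distrib mult_ac)
      then show ?thesis unfolding s(2) by simp
    qed
    also have "\<dots> = X * (w ^ n * poly (Pod n \<sigma>) s) + Y * (s * (w ^ n * poly (Pev n \<sigma>) s))"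
      unfolding XY(4) by (simp add: kpoly_def algebra_simps)
    also have "\<dots> = poly (kpoly (Segment a b) n x y \<gamma>) t"
    proof (cases "even n")
      case True
      then obtain m where m: "n = 2 * m" by (elim evenE)
      then obtain l where l: "m = Suc l" using n by (cases m) auto
      have h: "n div 2 = Suc l" "(n - 1) div 2 = l" by (simp_all add: m l)
      have wn: "w ^ n = (w\<^sup>2) ^ (n div 2)" "w ^ n = w\<^sup>2 * (w\<^sup>2) ^ ((n - 1) div 2)"
        unfolding h unfolding m l power_mult by simp_all
      have 1: "w ^ n * poly (Pod n \<sigma>) s = cO * poly (Pod n \<gamma>) t" unfolding wn(1) by (rule O)
      have 2: "w ^ n * poly (Pev n \<sigma>) s = w\<^sup>2 * (cE * poly (Pev n \<gamma>) t)" unfolding wn(2) E[symmetric] by (simp only: mult.assoc)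
      have "s * w\<^sup>2 = (s * (b - t)) * (b - t) / (b - a)\<^sup>2" by (simp add: w_def power2_eq_square)
      also have "s * (b - t) = t - a" using t by (simp add: s_def)
      finally have 3: "s * (w\<^sup>2 * (cE * poly (Pev n \<gamma>) t)) = (t - a) * (b - t) / (b - a)\<^sup>2 * (cE * poly (Pev n \<gamma>) t)"
        by (simp only: mult.assoc[symmetric])
      have "poly (wod (Segment a b) n) t = 1" "poly (wev (Segment a b) n) t = (t - a) * (b - t)"
        using True by (simp_all add: algebra_simps)
      then have "poly (kpoly (Segment a b) n x y \<gamma>) t = x * poly (Pod n \<gamma>) t + y * ((t - a) * (b - t) * poly (Pev n \<gamma>) t)"
        by (simp only: kpoly_def poly_add poly_smult poly_mult mult_1)
      then show ?thesis unfolding 1 2 3 using True by (simp add: x_def y_def)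
    next
      case False
      then obtain m where m: "n = 2 * m + 1" by (elim oddE)
      have h: "n div 2 = m" "(n - 1) div 2 = m" by (simp_all add: m)
      have wn: "w ^ n = w * (w\<^sup>2) ^ (n div 2)" "w ^ n = w * (w\<^sup>2) ^ ((n - 1) div 2)"
        unfolding h unfolding m by (simp_all add: power_mult)
      have 1: "w ^ n * poly (Pod n \<sigma>) s = w * (cO * poly (Pod n \<gamma>) t)" unfolding wn(1) O[symmetric] by (simp only: mult.assoc)
      have 2: "w ^ n * poly (Pev n \<sigma>) s = w * (cE * poly (Pev n \<gamma>) t)" unfolding wn(2) E[symmetric] by (simp only: mult.assoc)
      have "s * w = (t - a) / (b - a)" using t ab by (simp add: s_def w_def)
      then have 3: "s * (w * (cE * poly (Pev n \<gamma>) t)) = (t - a) / (b - a) * (cE * poly (Pev n \<gamma>) t)" by (simp only: mult.assoc[symmetric])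
      have "poly (wod (Segment a b) n) t = b - t" "poly (wev (Segment a b) n) t = t - a"
        using False by simp_all
      then have "poly (kpoly (Segment a b) n x y \<gamma>) t = x * ((b - t) * poly (Pod n \<gamma>) t) + y * ((t - a) * poly (Pev n \<gamma>) t)"
        by (simp only: kpoly_def poly_add poly_smult poly_mult)
      then show ?thesis unfolding 1 2 3 unfolding w_def using False by (simp add: x_def y_def mult_ac)
    qed
    finally show "poly p t = poly (kpoly (Segment a b) n x y \<gamma>) t" .
  qed
  moreover have "0 < x" "0 < y" using XY c ab by (auto simp: x_def y_def)
  ultimately show ?thesis using \<gamma> by (intro exI[of _ x] exI[of _ y] exI[of _ \<gamma>]) auto
qed

lemma kpoly_exists:
  assumes "1 \<le> n" "admissible n T" "spos T n p"
  shows "\<exists>x y \<gamma>. 0 < x \<and> 0 < y \<and> \<gamma> \<in> Delta T (n - 1) \<and> p = kpoly T n x y \<gamma>"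
proof (cases T)
  case (Segment a b)
  then show ?thesis using kpoly_exists_segment assms by auto
next
  case (Half_line a)
  then show ?thesis using kpoly_exists_half assms by auto
next
  case Full_line
  with assms obtain m where m: "n = 2 * m" by (auto elim: evenE)
  with assms have "1 \<le> m" by simp
  then show ?thesis using kpoly_exists_full[of m p] assms m Full_line by simp
qed

subsection \<open>The area formula\<close>

definition dyc :: "nat \<Rightarrow> nat \<Rightarrow> (nat \<Rightarrow> int) \<Rightarrow> (nat \<Rightarrow> real) set" where
  "dyc d k v = cube d (\<lambda>i. of_int (v i) / 2 ^ k) (1 / 2 ^ k)"

text \<open>Restricted to the first d indices, so that points of the same cube have equal index
  functions and there are only countably many of these.\<close>

definition dyi :: "nat \<Rightarrow> nat \<Rightarrow> (nat \<Rightarrow> real) \<Rightarrow> nat \<Rightarrow> int" where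
  "dyi d k x = (\<lambda>i\<in>{..<d}. \<lfloor>2 ^ k * x i\<rfloor>)"

lemma dyc_iff: "x \<in> dyc d k v \<longleftrightarrow> x \<in> space (lb d) \<and> (\<forall>i<d. \<lfloor>2 ^ k * x i\<rfloor> = v i)"
proof -
  have "x i \<in> {of_int (v i) / 2 ^ k..<of_int (v i) / 2 ^ k + 1 / 2 ^ k} \<longleftrightarrow> \<lfloor>2 ^ k * x i\<rfloor> = v i" for i
  proof -
    have "x i \<in> {of_int (v i) / 2 ^ k..<of_int (v i) / 2 ^ k + 1 / 2 ^ k} \<longleftrightarrow> of_int (v i) \<le> 2 ^ k * x i \<and> 2 ^ k * x i < of_int (v i) + 1"
      by (auto simp: field_simps)
    then show ?thesis by (simp only: floor_eq_iff)
  qed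
  then show ?thesis unfolding dyc_def cube_def space_lb by (auto simp: PiE_iff)
qed

lemma dyc_dyi: "x \<in> space (lb d) \<Longrightarrow> x \<in> dyc d k (dyi d k x)"
  by (simp add: dyc_iff dyi_def)

lemma dyi_eq: "y \<in> dyc d k (dyi d k x) \<Longrightarrow> dyi d k y = dyi d k x"
  by (auto simp: dyc_iff dyi_def fun_eq_iff)

lemma dyi_coarser: assumes "dyi d k y = dyi d k x" "j \<le> k" shows "dyi d j y = dyi d j x"
proof -
  have "\<lfloor>2 ^ j * z\<rfloor> = \<lfloor>2 ^ k * z\<rfloor> div 2 ^ (k - j)" for z :: real
  proof -
    have "(2::real) ^ k = 2 ^ j * 2 ^ (k - j)" using assms(2) by (simp flip: power_add)
    then have "2 ^ j * z = 2 ^ k * z / of_int (2 ^ (k - j))" by simp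
    then show ?thesis using floor_divide_real_eq_div[of "2 ^ (k - j)" "2 ^ k * z"] by simp
  qed
  then show ?thesis using assms(1) by (simp add: dyi_def fun_eq_iff) metis
qed

lemma dyc_nested: "j \<le> k \<Longrightarrow> dyc d k (dyi d k x) \<subseteq> dyc d j (dyi d j x)"
proof
  fix y assume "j \<le> k" "y \<in> dyc d k (dyi d k x)"
  moreover from this have "dyi d j y = dyi d j x" using dyi_eq dyi_coarser by blast
  ultimately show "y \<in> dyc d j (dyi d j x)" using dyc_dyi[of y d j] by (auto simp: dyc_iff)
qed

lemma dyc_near:
  assumes "y \<in> dyc d k (dyi d k x)" "x \<in> space (lb d)" "i < d"
  shows "\<bar>y i - x i\<bar> < 1 / 2 ^ k"
proof -
  have "\<lfloor>2 ^ k * y i\<rfloor> = \<lfloor>2 ^ k * x i\<rfloor>" using assms by (simp add: dyc_iff dyi_def)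
  then have "\<bar>2 ^ k * y i - 2 ^ k * x i\<bar> < 1" by linarith
  then have "2 ^ k * \<bar>y i - x i\<bar> < 1" by (simp add: abs_mult flip: right_diff_distrib)
  then show ?thesis by (simp add: field_simps)
qed

lemma dyc_sets [measurable]: "dyc d k v \<in> sets (lb d)" by (simp add: dyc_def)

lemma dyc_space: "dyc d k v \<subseteq> space (lb d)" unfolding dyc_def by (rule cube_space)

lemma emeasure_dyc: "emeasure (lb d) (dyc d k v) = ennreal ((1 / 2 ^ k) ^ d)"
  unfolding dyc_def by (subst emeasure_cube) auto

text \<open>Every point chooses the coarsest level at which its cube satisfies \<open>P\<close>.
  Because dyadic cubes are nested, all points of a chosen cube choose that same cube, so distinct
  chosen cubes are disjoint. Any local estimate may be put into \<open>P\<close>.\<close>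

lemma dyadic_partition:
  assumes D: "D \<subseteq> space (lb d)" and ex: "\<And>x. x \<in> D \<Longrightarrow> \<exists>k. P k (dyi d k x)"
    and sub: "\<And>k v. P k v \<Longrightarrow> dyc d k v \<subseteq> D"
  obtains Q :: "nat \<Rightarrow> (nat \<Rightarrow> real) set" where "disjoint_family Q" "(\<Union>n. Q n) = D"
    "\<And>n. Q n = {} \<or> (\<exists>k v. P k v \<and> Q n = dyc d k v)"
proof -
  define \<kappa> where "\<kappa> x = (LEAST k. P k (dyi d k x))" for x
  define F where "F x = (\<kappa> x, dyi d (\<kappa> x) x)" for x
  define I where "I = F ` D"
  have P\<kappa>: "P (\<kappa> x) (dyi d (\<kappa> x) x)" if "x \<in> D" for x
    unfolding \<kappa>_def using ex[OF that] by (rule LeastI_ex)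
  have \<kappa>_le: "\<kappa> x \<le> k" if "P k (dyi d k x)" for x k
    unfolding \<kappa>_def using that by (rule Least_le)
  have "I \<subseteq> UNIV \<times> ({..<d} \<rightarrow>\<^sub>E UNIV)"
    unfolding I_def F_def dyi_def by (intro image_subsetI) (simp add: PiE_iff)
  moreover have "countable ((UNIV :: nat set) \<times> ({..<d} \<rightarrow>\<^sub>E (UNIV :: int set)))"
    by (intro countable_SIGMA countable_PiE) auto
  ultimately have cI: "countable I" by (rule countable_subset)
  have key: "F y = F x" if x: "x \<in> D" and y: "y \<in> dyc d (\<kappa> x) (dyi d (\<kappa> x) x)" for x y
  proof -
    have e: "dyi d (\<kappa> x) y = dyi d (\<kappa> x) x" by (rule dyi_eq[OF y])
    then have 1: "\<kappa> y \<le> \<kappa> x" using P\<kappa>[OF x] by (intro \<kappa>_le) simp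
    have yD: "y \<in> D" using sub[OF P\<kappa>[OF x]] y by auto
    have "dyi d (\<kappa> y) y = dyi d (\<kappa> y) x" by (rule dyi_coarser[OF e 1])
    then have "\<kappa> x \<le> \<kappa> y" using P\<kappa>[OF yD] by (intro \<kappa>_le) simp
    then show ?thesis using 1 e by (simp add: F_def)
  qed
  define R where "R p = dyc d (fst p) (snd p)" for p
  \<comment> \<open>An enumeration of the countable set of chosen cubes, filled up with empty
    sets.\<close>
  define Q where "Q n = (if n \<in> to_nat_on I ` I then R (from_nat_into I n) else {})" for n
  have Rin: "F y = p" if "p \<in> I" "y \<in> R p" for p y
  proof -
    from that(1) obtain x where "x \<in> D" "p = F x" unfolding I_def by (rule imageE)
    moreover from this have "y \<in> dyc d (\<kappa> x) (dyi d (\<kappa> x) x)" using that(2) by (simp add: R_def F_def)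
    ultimately show ?thesis using key by metis
  qed
  have QI: "\<exists>p\<in>I. n = to_nat_on I p \<and> Q n = R p" if "Q n \<noteq> {}" for n
  proof -
    from that have "n \<in> to_nat_on I ` I" "Q n = R (from_nat_into I n)" by (auto simp: Q_def split: if_split_asm)
    then obtain p where "p \<in> I" "n = to_nat_on I p" by (elim imageE) simp
    then show ?thesis using cI \<open>Q n = R (from_nat_into I n)\<close> by (intro bexI[of _ p]) simp_all
  qed
  show ?thesis
  proof (rule that[of Q])
    show "disjoint_family Q"
      unfolding disjoint_family_on_def
    proof (intro ballI impI)
      fix m n :: nat assume "m \<noteq> n"
      show "Q m \<inter> Q n = {}"
      proof (rule ccontr)
        assume "Q m \<inter> Q n \<noteq> {}"
        then obtain y where y: "y \<in> Q m" "y \<in> Q n" by blast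
        then obtain p q where pq: "p \<in> I" "m = to_nat_on I p" "y \<in> R p" "q \<in> I" "n = to_nat_on I q" "y \<in> R q"
          using QI[of m] QI[of n] by blast
        then have "p = q" using Rin by metis
        then show False using pq \<open>m \<noteq> n\<close> by simp
      qed
    qed
    show "(\<Union>n. Q n) = D"
    proof
      show "(\<Union>n. Q n) \<subseteq> D"
      proof safe
        fix n y assume y: "y \<in> Q n"
        then obtain p where p: "p \<in> I" "y \<in> R p" using QI[of n] by blast
        from p(1) obtain x where x: "x \<in> D" "p = F x" unfolding I_def by (rule imageE)
        have "dyc d (\<kappa> x) (dyi d (\<kappa> x) x) \<subseteq> D" by (rule sub[OF P\<kappa>[OF x(1)]])
        then show "y \<in> D" using p(2) x(2) by (auto simp: R_def F_def)
      qed
      show "D \<subseteq> (\<Union>n. Q n)"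
      proof
        fix x assume x: "x \<in> D"
        then have "F x \<in> I" by (simp add: I_def)
        then have "Q (to_nat_on I (F x)) = R (F x)" using cI by (simp add: Q_def)
        moreover have "x \<in> R (F x)" using D x dyc_dyi by (auto simp: R_def F_def)
        ultimately show "x \<in> (\<Union>n. Q n)" by blast
      qed
    qed
    fix n show "Q n = {} \<or> (\<exists>k v. P k v \<and> Q n = dyc d k v)"
    proof (cases "Q n = {}")
      case False
      then obtain p where p: "p \<in> I" "Q n = R p" using QI by blast
      from p(1) obtain x where x: "x \<in> D" "p = F x" unfolding I_def by (rule imageE)
      have "P (\<kappa> x) (dyi d (\<kappa> x) x)" by (rule P\<kappa>[OF x(1)])
      moreover have "Q n = dyc d (\<kappa> x) (dyi d (\<kappa> x) x)" using p(2) x(2) by (simp add: R_def F_def)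
      ultimately show ?thesis by blast
    qed simp
  qed
qed

text \<open>The coordinates from d on are kept fixed: points of the product space are
  \<open>undefined\<close> there, so the box around such a point stays in the space.\<close>

definition coord_box :: "nat \<Rightarrow> (nat \<Rightarrow> real) \<Rightarrow> real \<Rightarrow> (nat \<Rightarrow> real) set" where
  "coord_box d z r = {y. (\<forall>i<d. \<bar>y i - z i\<bar> < r) \<and> (\<forall>i\<ge>d. y i = z i)}"

lemma coord_box_mono: "r \<le> s \<Longrightarrow> coord_box d z r \<subseteq> coord_box d z s"
  by (auto simp: coord_box_def intro: less_le_trans)

lemma open_contains_box:
  assumes "open D" "z \<in> D"
  shows "\<exists>r>0. coord_box d z r \<subseteq> D"
proof -
  have "openin (product_topology (\<lambda>i. euclidean) UNIV) D"
    unfolding euclidean_product_topology using assms(1) by (simp only: open_openin)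
  from bspec[OF this[unfolded openin_product_topology_alt] assms(2)]
  obtain U where UU: "finite {i \<in> UNIV. U i \<noteq> topspace euclidean} \<and> (\<forall>i\<in>UNIV. openin euclidean (U i)) \<and>
      z \<in> Pi\<^sub>E UNIV U \<and> Pi\<^sub>E UNIV U \<subseteq> D" ..
  note U0 = UU[THEN conjunct2, THEN conjunct1] and U1 = UU[THEN conjunct2, THEN conjunct2, THEN conjunct1]
    UU[THEN conjunct2, THEN conjunct2, THEN conjunct2]
  have U: "open (U i)" "z \<in> Pi\<^sub>E UNIV U" "Pi\<^sub>E UNIV U \<subseteq> D" for i
    using U0[THEN bspec, OF UNIV_I, of i] by (rule open_openin[THEN iffD2]) (rule U1)+
  have "\<forall>i. \<exists>e. 0 < e \<and> ball (z i) e \<subseteq> U i"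
  proof
    fix i
    have "z i \<in> U i" using U(2) by (auto simp: PiE_iff)
    then show "\<exists>e. 0 < e \<and> ball (z i) e \<subseteq> U i" using U(1)[of i] unfolding open_contains_ball by blast
  qed
  from choice[OF this] obtain e where e: "\<And>i. 0 < e i" "\<And>i. ball (z i) (e i) \<subseteq> U i" by blast
  define r where "r = Min (insert 1 (e ` {..<d}))"
  have r: "0 < r" "\<And>i. i < d \<Longrightarrow> r \<le> e i" using e(1) by (auto simp: r_def)
  have "coord_box d z r \<subseteq> Pi\<^sub>E UNIV U"
  proof
    fix y assume y: "y \<in> coord_box d z r"
    have "y i \<in> U i" for i
    proof (cases "i < d")
      case True
      then have "y i \<in> ball (z i) (e i)" using y r(2)[of i] by (auto simp: coord_box_def dist_real_def abs_minus_commute)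
      then show ?thesis using e by blast
    next
      case False
      then show ?thesis using y U(2) by (auto simp: coord_box_def PiE_iff)
    qed
    then show "y \<in> Pi\<^sub>E UNIV U" by (simp add: PiE_iff)
  qed
  then show ?thesis using U(3) r(1) by blast
qed

lemma continuous_on_box:
  fixes f :: "(nat \<Rightarrow> real) \<Rightarrow> real"
  assumes "open D" "continuous_on D f" "z \<in> D" "0 < e"
  shows "\<exists>r>0. \<forall>x\<in>coord_box d z r. x \<in> D \<and> \<bar>f x - f z\<bar> < e"
proof -
  have "open (D \<inter> f -` ball (f z) e)" using assms by (intro continuous_open_preimage) auto
  moreover have "z \<in> D \<inter> f -` ball (f z) e" using assms by simp
  ultimately obtain r where "r > 0" "coord_box d z r \<subseteq> D \<inter> f -` ball (f z) e" using open_contains_box by blast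
  then show ?thesis by (intro exI[of _ r]) (auto simp: dist_real_def abs_minus_commute subset_iff)
qed

lemma coord_box_finite:
  assumes "finite I" "\<And>i. i \<in> I \<Longrightarrow> \<exists>r>0. \<forall>x\<in>coord_box d z r. P i x"
  shows "\<exists>r>0. \<forall>i\<in>I. \<forall>x\<in>coord_box d z r. P i x"
  using assms
proof (induction I)
  case empty
  then show ?case by (auto intro: exI[of _ 1])
next
  case (insert i I)
  have "\<exists>r>0. \<forall>x\<in>coord_box d z r. P i x" by (rule insert.prems) simp
  then obtain r where r: "r > 0" "\<forall>x\<in>coord_box d z r. P i x" by blast
  have "\<exists>r>0. \<forall>i\<in>I. \<forall>x\<in>coord_box d z r. P i x" by (rule insert.IH, rule insert.prems) simp
  then obtain s where s: "s > 0" "\<forall>i\<in>I. \<forall>x\<in>coord_box d z s. P i x" by blast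
  have "coord_box d z (min r s) \<subseteq> coord_box d z r" "coord_box d z (min r s) \<subseteq> coord_box d z s" by (auto intro!: coord_box_mono)
  then show ?case using r s by (intro exI[of _ "min r s"]) auto
qed

lemma dyc_subset_box:
  assumes "x \<in> space (lb d)" "1 / 2 ^ k \<le> r"
  shows "dyc d k (dyi d k x) \<subseteq> coord_box d x r"
proof
  fix y assume y: "y \<in> dyc d k (dyi d k x)"
  then have "y \<in> space (lb d)" using dyc_space by blast
  then show "y \<in> coord_box d x r" using dyc_near[OF y assms(1)] assms
    by (auto simp: coord_box_def space_PiM PiE_def extensional_def intro: less_le_trans)
qed

lemma ex_dyadic_level: "0 < r \<Longrightarrow> \<exists>k\<ge>k0. 1 / 2 ^ k \<le> (r::real)"
proof -
  assume "0 < r"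
  then obtain m where "(1/2) ^ m < r" using real_arch_pow_inv[of r "1/2"] by auto
  moreover have "(1/2::real) ^ max m k0 \<le> (1/2) ^ m" by (intro power_decreasing) auto
  ultimately show ?thesis by (intro exI[of _ "max m k0"]) (auto simp: power_one_over)
qed

section \<open>C1 functions of finitely many coordinates\<close>

definition pder :: "nat \<Rightarrow> ((nat \<Rightarrow> real) \<Rightarrow> real) \<Rightarrow> (nat \<Rightarrow> real) \<Rightarrow> real" where
  "pder j f z = deriv (\<lambda>s. f (z(j := s))) (z j)"

text \<open>Formulated with partial derivatives in the first d coordinates, because the product
  topology on all sequences does not come from a norm. Continuity in all coordinates is part of the
  definition.\<close>

definition C1_on :: "nat \<Rightarrow> (nat \<Rightarrow> real) set \<Rightarrow> ((nat \<Rightarrow> real) \<Rightarrow> real) \<Rightarrow> bool" where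
  "C1_on d D f \<longleftrightarrow> continuous_on D f \<and> (\<forall>j<d. continuous_on D (pder j f) \<and>
     (\<forall>z\<in>D. (\<lambda>s. f (z(j := s))) field_differentiable at (z j)))"

text \<open>The coordinates are changed from those of y to those of x one at a time, and each change
  is a mean value estimate for the function minus its linear part at z. Both points are free, not
  only one of them; this is what later gives Lipschitz bounds in both directions.\<close>

lemma C1_linear_approx1:
  assumes D: "open D" and f: "C1_on d D f" and z: "z \<in> D" and e: "0 < e"
  shows "\<exists>r>0. \<forall>x\<in>coord_box d z r. \<forall>y\<in>coord_box d z r.
     \<bar>f x - f y - (\<Sum>j<d. pder j f z * (x j - y j))\<bar> \<le> e * (\<Sum>j<d. \<bar>x j - y j\<bar>)"
proof -
  have "\<exists>r>0. \<forall>j\<in>{..<d}. \<forall>x\<in>coord_box d z r. x \<in> D \<and> \<bar>pder j f x - pder j f z\<bar> < e"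
    using f unfolding C1_on_def by (intro coord_box_finite continuous_on_box[OF D _ z e]) auto
  then obtain r where r: "0 < r" "\<And>j x. j < d \<Longrightarrow> x \<in> coord_box d z r \<Longrightarrow> x \<in> D \<and> \<bar>pder j f x - pder j f z\<bar> < e" by blast
  have "\<bar>f x - f y - (\<Sum>j<d. pder j f z * (x j - y j))\<bar> \<le> e * (\<Sum>j<d. \<bar>x j - y j\<bar>)"
    if x: "x \<in> coord_box d z r" and y: "y \<in> coord_box d z r" for x y
  proof -
    define h where "h m = (\<lambda>i. if i < m then x i else y i)" for m
    have "\<bar>f (h m) - f y - (\<Sum>j<m. pder j f z * (x j - y j))\<bar> \<le> e * (\<Sum>j<m. \<bar>x j - y j\<bar>)" if "m \<le> d" for m
      using that
    proof (induction m)
      case 0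
      have "h 0 = y" by (simp add: h_def)
      then show ?case by simp
    next
      case (Suc m)
      define \<phi> where "\<phi> s = f ((h m)(m := s))" for s
      have hx: "(h m)(m := x m) = h (Suc m)" and hy: "(h m)(m := y m) = h m"
        by (auto simp: h_def fun_eq_iff less_Suc_eq)
      have seg: "(h m)(m := s) \<in> coord_box d z r" if s: "s \<in> closed_segment (y m) (x m)" for s
      proof -
        have "\<bar>y m - z m\<bar> < r" "\<bar>x m - z m\<bar> < r" using x y Suc.prems by (auto simp: coord_box_def)
        then have "\<bar>s - z m\<bar> < r" using s by (auto simp: closed_segment_eq_real_ivl split: if_splits)
        then show ?thesis using x y Suc.prems by (auto simp: coord_box_def h_def)
      qed
      have der: "(\<phi> has_field_derivative pder m f ((h m)(m := s))) (at s)" if s: "s \<in> closed_segment (y m) (x m)" for s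
      proof -
        let ?w = "(h m)(m := s)"
        have "?w \<in> D" using r(2)[of m ?w] seg[OF s] Suc.prems by simp
        then have "(\<lambda>t. f (?w(m := t))) field_differentiable at (?w m)"
        proof -
          have "\<forall>z\<in>D. (\<lambda>s. f (z(m := s))) field_differentiable at (z m)"
            using f[unfolded C1_on_def, THEN conjunct2, rule_format, of m] Suc.prems by simp
          from bspec[OF this \<open>?w \<in> D\<close>] show ?thesis .
        qed
        then have "((\<lambda>t. f (?w(m := t))) has_field_derivative pder m f ?w) (at (?w m))"
          unfolding pder_def by (simp only: DERIV_deriv_iff_field_differentiable)
        then show ?thesis by (simp add: \<phi>_def[abs_def])
      qed
      have "norm ((\<phi> (x m) - pder m f z * x m) - (\<phi> (y m) - pder m f z * y m)) \<le> e * norm (x m - y m)"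
      proof (rule field_differentiable_bound[where S="closed_segment (y m) (x m)" and f="\<lambda>s. \<phi> s - pder m f z * s"
          and f'="\<lambda>s. pder m f ((h m)(m := s)) - pder m f z"])
        fix s assume s: "s \<in> closed_segment (y m) (x m)"
        have "((\<lambda>s. \<phi> s - pder m f z * s) has_field_derivative pder m f ((h m)(m := s)) - pder m f z * 1) (at s)"
          by (intro DERIV_diff der[OF s] DERIV_cmult DERIV_ident)
        then show "((\<lambda>s. \<phi> s - pder m f z * s) has_field_derivative pder m f ((h m)(m := s)) - pder m f z) (at s within closed_segment (y m) (x m))"
          unfolding mult_1_right by (rule has_field_derivative_at_within)
        show "norm (pder m f ((h m)(m := s)) - pder m f z) \<le> e"
          using r(2)[of m "(h m)(m := s)"] seg[OF s] Suc.prems by simp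
      qed auto
      then have "\<bar>f (h (Suc m)) - f (h m) - pder m f z * (x m - y m)\<bar> \<le> e * \<bar>x m - y m\<bar>"
        unfolding \<phi>_def hx hy real_norm_def right_diff_distrib by (simp only: diff_diff_eq2 diff_add_eq diff_diff_add add.commute)
      moreover have "\<bar>f (h m) - f y - (\<Sum>j<m. pder j f z * (x j - y j))\<bar> \<le> e * (\<Sum>j<m. \<bar>x j - y j\<bar>)"
        using Suc.prems by (intro Suc.IH) simp
      ultimately show ?case unfolding sum.lessThan_Suc distrib_left by linarith
    qed
    moreover have "h d = x" using x y by (auto simp: h_def coord_box_def fun_eq_iff)
    ultimately show ?thesis by fastforce
  qed
  then show ?thesis using r(1) by blast
qed

section \<open>Gram matrices and local linearization\<close>

lemma sum_swap3: "(\<Sum>j\<in>K. \<Sum>a\<in>A. \<Sum>b\<in>B. f j a b) = (\<Sum>a\<in>A. \<Sum>b\<in>B. \<Sum>j\<in>K. f j a b)"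
proof -
  have "(\<Sum>j\<in>K. \<Sum>a\<in>A. \<Sum>b\<in>B. f j a b) = (\<Sum>a\<in>A. \<Sum>j\<in>K. \<Sum>b\<in>B. f j a b)" by (rule sum.swap)
  also have "\<dots> = (\<Sum>a\<in>A. \<Sum>b\<in>B. \<Sum>j\<in>K. f j a b)" by (rule sum.cong[OF refl], rule sum.swap)
  finally show ?thesis .
qed

lemma norm_inv_eq_qnorm: "norm_inv S x = qnorm (dim_row S) (inv_mat S) x"
  unfolding norm_inv_def qnorm_def qform_def inner_inv_def ..

definition gram :: "real mat \<Rightarrow> nat \<Rightarrow> ((nat \<Rightarrow> real) \<Rightarrow> nat \<Rightarrow> real) \<Rightarrow> (nat \<Rightarrow> real) \<Rightarrow> real mat" where
  "gram S d g z = transpose_mat (jacobi_mat (dim_row S) d g z) * inv_mat S * jacobi_mat (dim_row S) d g z"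

lemma J_eq: "J S d g z = sqrt (Determinant.det (gram S d g z))"
  unfolding J_def gram_def Let_def ..

lemma jacobi_mat_index: "i < N \<Longrightarrow> j < d \<Longrightarrow> jacobi_mat N d g z $$ (i, j) = pder j (\<lambda>w. g w i) z"
  by (simp add: jacobi_mat_def pder_def)

lemma jacobi_carrier: "jacobi_mat N d g z \<in> carrier_mat N d" by (simp add: jacobi_mat_def)

locale metric_mat =
  fixes S :: "real mat" and N :: nat
  assumes dim: "dim_row S = N" and pdM: "pd N (inv_mat S)"
begin

abbreviation "M \<equiv> inv_mat S"

lemma gram_carrier: "gram S d g z \<in> carrier_mat d d"
  unfolding gram_def using pd_carrier[OF pdM] jacobi_carrier[of N d g z] dim by auto

lemma gram_index:
  assumes "a < d" "b < d"
  shows "gram S d g z $$ (a, b) = (\<Sum>i<N. \<Sum>j<N. pder a (\<lambda>w. g w i) z * M $$ (i, j) * pder b (\<lambda>w. g w j) z)"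
proof -
  let ?D = "jacobi_mat N d g z"
  have D: "?D \<in> carrier_mat N d" by (rule jacobi_carrier)
  have M: "M \<in> carrier_mat N N" by (rule pd_carrier[OF pdM])
  have "gram S d g z $$ (a, b) = (\<Sum>i<N. ?D $$ (i, a) * (\<Sum>j<N. M $$ (i, j) * ?D $$ (j, b)))"
    unfolding gram_def dim using D M assms by (simp add: scalar_prod_def lessThan_atLeast0)
  also have "\<dots> = (\<Sum>i<N. \<Sum>j<N. pder a (\<lambda>w. g w i) z * M $$ (i, j) * pder b (\<lambda>w. g w j) z)"
    using assms by (simp add: sum_distrib_left jacobi_mat_index mult.assoc)
  finally show ?thesis .
qed

lemma gram_sym: "a < d \<Longrightarrow> b < d \<Longrightarrow> gram S d g z $$ (a, b) = gram S d g z $$ (b, a)"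
proof -
  assume "a < d" "b < d"
  have "M $$ (i, j) = M $$ (j, i)" if "i < N" "j < N" for i j using pdM that by (simp add: pd_def)
  then show ?thesis unfolding gram_index[OF \<open>a < d\<close> \<open>b < d\<close>] gram_index[OF \<open>b < d\<close> \<open>a < d\<close>]
    by (subst sum.swap) (auto intro!: sum.cong)
qed

lemma qform_gram: "qform d (gram S d g z) w = qform N M (\<lambda>i. \<Sum>j<d. pder j (\<lambda>w. g w i) z * w j)"
proof -
  let ?p = "\<lambda>i a. pder a (\<lambda>w. g w i) z"
  have "qform N M (\<lambda>i. \<Sum>j<d. ?p i j * w j) = (\<Sum>i<N. \<Sum>j<N. \<Sum>a<d. \<Sum>b<d. w a * (?p i a * M $$ (i, j) * ?p j b) * w b)"
    unfolding qform_def by (simp add: sum_distrib_left sum_distrib_right mult_ac)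
  also have "\<dots> = (\<Sum>i<N. \<Sum>a<d. \<Sum>b<d. \<Sum>j<N. w a * (?p i a * M $$ (i, j) * ?p j b) * w b)"
    by (rule sum.cong[OF refl], rule sum_swap3)
  also have "\<dots> = (\<Sum>a<d. \<Sum>b<d. \<Sum>i<N. \<Sum>j<N. w a * (?p i a * M $$ (i, j) * ?p j b) * w b)"
    by (rule sum_swap3)
  also have "\<dots> = qform d (gram S d g z) w"
    unfolding qform_def by (intro sum.cong refl) (simp add: gram_index sum_distrib_left sum_distrib_right)
  finally show ?thesis ..
qed

lemma gram_psd: "0 \<le> qform d (gram S d g z) w"
  unfolding qform_gram by (rule pd_nonneg[OF pdM])

text \<open>The Gram matrix plus \<eta>^2 times the identity is positive definite even where the
  Jacobian vanishes, so it can serve as a norm on the parameter space there.\<close>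

definition greg :: "nat \<Rightarrow> ((nat \<Rightarrow> real) \<Rightarrow> nat \<Rightarrow> real) \<Rightarrow> (nat \<Rightarrow> real) \<Rightarrow> real \<Rightarrow> real mat" where
  "greg d g z \<eta> = Matrix.mat d d (\<lambda>(a, b). gram S d g z $$ (a, b) + (if a = b then \<eta>\<^sup>2 else 0))"

lemma qform_greg: "qform d (greg d g z \<eta>) w = qform d (gram S d g z) w + \<eta>\<^sup>2 * (\<Sum>i<d. (w i)\<^sup>2)"
proof -
  have "qform d (greg d g z \<eta>) w = (\<Sum>i<d. \<Sum>j<d. w i * gram S d g z $$ (i, j) * w j + (if i = j then \<eta>\<^sup>2 * (w i * w j) else 0))"
    unfolding qform_def greg_def by (intro sum.cong refl) (auto simp: algebra_simps)
  also have "\<dots> = qform d (gram S d g z) w + (\<Sum>i<d. \<eta>\<^sup>2 * (w i * w i))"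
    unfolding qform_def by (simp add: sum.distrib)
  finally show ?thesis by (simp add: sum_distrib_left power2_eq_square)
qed

lemma pd_greg: assumes "\<eta> \<noteq> 0" shows "pd d (greg d g z \<eta>)"
  unfolding pd_def
proof (intro conjI allI impI)
  show "greg d g z \<eta> \<in> carrier_mat d d" by (simp add: greg_def)
  fix i j assume "i < d" "j < d"
  then show "greg d g z \<eta> $$ (i, j) = greg d g z \<eta> $$ (j, i)" using gram_sym[of i d j g z] by (simp add: greg_def)
next
  fix x :: "nat \<Rightarrow> real" assume "\<exists>i<d. x i \<noteq> 0"
  then obtain i where i: "i < d" "x i \<noteq> 0" by blast
  have "0 < (\<Sum>i<d. (x i)\<^sup>2)" using i by (intro sum_pos2[of _ i]) auto
  then show "0 < qform d (greg d g z \<eta>) x" unfolding qform_greg using assms gram_psd[of d g z x]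
    by (intro add_nonneg_pos) auto
qed

text \<open>By the Leibniz formula the determinant is a polynomial in \<eta>.\<close>

lemma det_greg_tendsto: "((\<lambda>\<eta>. Determinant.det (greg d g z \<eta>)) \<longlongrightarrow> Determinant.det (gram S d g z)) (at_right 0)"
proof -
  have c: "greg d g z \<eta> \<in> carrier_mat d d" for \<eta> by (simp add: greg_def)
  have lim: "((\<lambda>\<eta>. \<Sum>p\<in>{p. p permutes {0..<d}}. signof p * (\<Prod>i = 0..<d. gram S d g z $$ (i, p i) + (if i = p i then \<eta>\<^sup>2 else 0))) \<longlongrightarrow>
     (\<Sum>p\<in>{p. p permutes {0..<d}}. signof p * (\<Prod>i = 0..<d. gram S d g z $$ (i, p i) + (if i = p i then 0\<^sup>2 else 0)))) (at_right 0)"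
    by (intro tendsto_sum tendsto_mult tendsto_const tendsto_prod tendsto_add) (auto intro!: tendsto_eq_intros)
  have e: "(\<Sum>p\<in>{p. p permutes {0..<d}}. signof p * (\<Prod>i = 0..<d. gram S d g z $$ (i, p i) + (if i = p i then \<eta>\<^sup>2 else 0)))
     = Determinant.det (greg d g z \<eta>)" for \<eta> :: real
    unfolding det_def'[OF c] by (intro sum.cong refl arg_cong2[where f="(*)"] prod.cong) (auto simp: greg_def permutes_in_image)
  have "greg d g z 0 = gram S d g z"
    using gram_carrier[of d g z] by (intro eq_matI) (auto simp: greg_def)
  then show ?thesis using lim unfolding e by simp
qed

text \<open>A vector on which the form vanishes is annihilated by the Jacobi matrix, since the
  ambient form is definite. It is then in the kernel of the Gram matrix, whose determinant would be
  0.\<close>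

lemma gram_pd_if_det: assumes "Determinant.det (gram S d g z) \<noteq> 0" shows "pd d (gram S d g z)"
  unfolding pd_def
proof (intro conjI allI impI)
  let ?G = "gram S d g z"
  show G: "?G \<in> carrier_mat d d" by (rule gram_carrier)
  fix i j assume "i < d" "j < d"
  then show "?G $$ (i, j) = ?G $$ (j, i)" by (rule gram_sym)
next
  let ?G = "gram S d g z"
  fix x :: "nat \<Rightarrow> real" assume x: "\<exists>i<d. x i \<noteq> 0"
  show "0 < qform d ?G x"
  proof (rule ccontr)
    assume "\<not> ?thesis"
    then have "qform N M (\<lambda>i. \<Sum>j<d. pder j (\<lambda>w. g w i) z * x j) = 0"
      using gram_psd[of d g z x] by (simp add: qform_gram)
    then have 0: "(\<Sum>j<d. pder j (\<lambda>w. g w i) z * x j) = 0" if "i < N" for i using pd_zero[OF pdM] that by blast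
    define v where "v = Matrix.vec d x"
    have "?G *\<^sub>v v = 0\<^sub>v d"
    proof (rule eq_vecI)
      fix a assume "a < dim_vec (0\<^sub>v d)"
      then have a: "a < d" by simp
      have "(?G *\<^sub>v v) $ a = (\<Sum>b<d. ?G $$ (a, b) * x b)"
        using a gram_carrier[of d g z] by (simp add: v_def scalar_prod_def lessThan_atLeast0)
      also have "\<dots> = (\<Sum>b<d. \<Sum>i<N. \<Sum>j<N. pder a (\<lambda>w. g w i) z * M $$ (i, j) * (pder b (\<lambda>w. g w j) z * x b))"
        using a by (intro sum.cong refl) (simp add: gram_index sum_distrib_right mult.assoc)
      also have "\<dots> = (\<Sum>i<N. \<Sum>j<N. \<Sum>b<d. pder a (\<lambda>w. g w i) z * M $$ (i, j) * (pder b (\<lambda>w. g w j) z * x b))"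
        by (rule sum_swap3)
      also have "\<dots> = 0" by (simp add: 0 flip: sum_distrib_left)
      finally show "(?G *\<^sub>v v) $ a = 0\<^sub>v d $ a" using a by simp
    qed (use gram_carrier[of d g z] in auto)
    moreover have "v \<in> carrier_vec d" by (simp add: v_def)
    moreover have "v \<noteq> 0\<^sub>v d"
    proof
      assume v0: "v = 0\<^sub>v d"
      from x obtain i where i: "i < d" "x i \<noteq> 0" by blast
      then show False using arg_cong[OF v0, of "\<lambda>u. u $ i"] by (simp add: v_def)
    qed
    ultimately have "Determinant.det ?G = 0" using det_0_iff_vec_prod_zero_field[OF gram_carrier] by blast
    then show False using assms by simp
  qed
qed

lemma sum_abs_le_qnorm:
  assumes K: "pd d K" and \<mu>: "0 < \<mu>" "\<And>x. \<mu> * (\<Sum>i<d. (x i)\<^sup>2) \<le> qform d K x"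
  shows "(\<Sum>j<d. \<bar>w j\<bar>) \<le> (real d / sqrt \<mu>) * qnorm d K w"
proof -
  have "\<bar>w j\<bar> \<le> qnorm d K w / sqrt \<mu>" if "j < d" for j
  proof -
    have "\<mu> * (w j)\<^sup>2 \<le> \<mu> * (\<Sum>i<d. (w i)\<^sup>2)" using that \<mu> by (intro mult_left_mono member_le_sum) auto
    then have "\<mu> * (w j)\<^sup>2 \<le> qform d K w" using \<mu>(2)[of w] by linarith
    then have "sqrt (\<mu> * (w j)\<^sup>2) \<le> qnorm d K w" unfolding qnorm_def by simp
    then show ?thesis using \<mu>(1) by (simp add: real_sqrt_mult field_simps)
  qed
  then have "(\<Sum>j<d. \<bar>w j\<bar>) \<le> (\<Sum>j<d. qnorm d K w / sqrt \<mu>)" by (intro sum_mono) auto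
  then show ?thesis by simp
qed

text \<open>The coordinatewise error of the linear approximation is bounded by the sum of the |x j -
  y j|, which any positive definite \<open>K\<close> controls. The upper estimate takes the
  regularized Gram matrix for \<open>K\<close>, the lower one the Gram matrix itself.\<close>

lemma local_linearization:
  assumes D: "open D" and g: "\<And>i. i < N \<Longrightarrow> C1_on d D (\<lambda>w. g w i)" and z: "z \<in> D"
    and K: "pd d K" and t: "0 < t"
  shows "\<exists>r>0. \<forall>x\<in>coord_box d z r. \<forall>y\<in>coord_box d z r.
     \<bar>norm_inv S (\<lambda>i. g x i - g y i) - qnorm d (gram S d g z) (\<lambda>i. x i - y i)\<bar> \<le> t * qdist d K x y"
proof -
  obtain \<mu> where \<mu>: "0 < \<mu>" "\<And>x. \<mu> * (\<Sum>i<d. (x i)\<^sup>2) \<le> qform d K x" using pd_coercive[OF K] by blast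
  obtain C where C: "0 < C" "\<And>\<eta> x. 0 \<le> \<eta> \<Longrightarrow> \<forall>i<N. \<bar>x i\<bar> \<le> \<eta> \<Longrightarrow> qnorm N M x \<le> C * \<eta>"
    using qnorm_le_sup_norm[of N M] by metis
  \<comment> \<open>\<open>C\<close> bounds the ambient norm by the maximum norm, and d / sqrt \<mu>
    bounds the sum of the coordinates by the norm of \<open>K\<close>.\<close>
  define e where "e = t / (C * (real d / sqrt \<mu> + 1))"
  have e: "0 < e" unfolding e_def using t C \<mu> by (intro divide_pos_pos mult_pos_pos add_nonneg_pos) auto
  have "\<exists>r>0. \<forall>i\<in>{..<N}. \<forall>x\<in>coord_box d z r. \<forall>y\<in>coord_box d z r.
     \<bar>g x i - g y i - (\<Sum>j<d. pder j (\<lambda>w. g w i) z * (x j - y j))\<bar> \<le> e * (\<Sum>j<d. \<bar>x j - y j\<bar>)"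
  proof -
    have "\<exists>r>0. \<forall>i\<in>{..<m}. \<forall>x\<in>coord_box d z r. \<forall>y\<in>coord_box d z r.
       \<bar>g x i - g y i - (\<Sum>j<d. pder j (\<lambda>w. g w i) z * (x j - y j))\<bar> \<le> e * (\<Sum>j<d. \<bar>x j - y j\<bar>)" if "m \<le> N" for m
      using that
    proof (induction m)
      case 0
      then show ?case by (auto intro: exI[of _ 1])
    next
      case (Suc m)
      from Suc obtain r where r: "0 < r" "\<forall>i\<in>{..<m}. \<forall>x\<in>coord_box d z r. \<forall>y\<in>coord_box d z r.
        \<bar>g x i - g y i - (\<Sum>j<d. pder j (\<lambda>w. g w i) z * (x j - y j))\<bar> \<le> e * (\<Sum>j<d. \<bar>x j - y j\<bar>)" by auto
      have "C1_on d D (\<lambda>w. g w m)" using Suc.prems by (intro g) simp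
      from C1_linear_approx1[OF D this z e] obtain s where s: "0 < s" "\<forall>x\<in>coord_box d z s. \<forall>y\<in>coord_box d z s.
        \<bar>g x m - g y m - (\<Sum>j<d. pder j (\<lambda>w. g w m) z * (x j - y j))\<bar> \<le> e * (\<Sum>j<d. \<bar>x j - y j\<bar>)" by blast
      have sub: "coord_box d z (min r s) \<subseteq> coord_box d z r" "coord_box d z (min r s) \<subseteq> coord_box d z s" by (auto intro!: coord_box_mono)
      show ?case
      proof (intro exI[of _ "min r s"] conjI ballI)
        fix i x y assume i: "i \<in> {..<Suc m}" and xy: "x \<in> coord_box d z (min r s)" "y \<in> coord_box d z (min r s)"
        show "\<bar>g x i - g y i - (\<Sum>j<d. pder j (\<lambda>w. g w i) z * (x j - y j))\<bar> \<le> e * (\<Sum>j<d. \<bar>x j - y j\<bar>)"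
        proof (cases "i = m")
          case True
          then show ?thesis using s(2) sub(2) xy by blast
        next
          case False
          then have "i \<in> {..<m}" using i by simp
          then show ?thesis using r(2) sub(1) xy by blast
        qed
      qed (use r s in simp)
    qed
    then show ?thesis by blast
  qed
  then obtain r where r: "0 < r" "\<And>i x y. i < N \<Longrightarrow> x \<in> coord_box d z r \<Longrightarrow> y \<in> coord_box d z r \<Longrightarrow>
     \<bar>g x i - g y i - (\<Sum>j<d. pder j (\<lambda>w. g w i) z * (x j - y j))\<bar> \<le> e * (\<Sum>j<d. \<bar>x j - y j\<bar>)" by blast
  have "\<bar>norm_inv S (\<lambda>i. g x i - g y i) - qnorm d (gram S d g z) (\<lambda>i. x i - y i)\<bar> \<le> t * qdist d K x y"
    if xy: "x \<in> coord_box d z r" "y \<in> coord_box d z r" for x y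
  proof -
    define L where "L i = (\<Sum>j<d. pder j (\<lambda>w. g w i) z * (x j - y j))" for i
    define E where "E i = g x i - g y i - L i" for i
    have L: "qnorm d (gram S d g z) (\<lambda>i. x i - y i) = qnorm N M L"
      unfolding qnorm_def qform_gram L_def ..
    have n: "norm_inv S (\<lambda>i. g x i - g y i) = qnorm N M (\<lambda>i. L i + E i)"
      unfolding norm_inv_eq_qnorm dim by (simp add: E_def)
    have 1: "qnorm N M (\<lambda>i. L i + E i) \<le> qnorm N M L + qnorm N M E" by (rule qnorm_triangle[OF pdM])
    have "qnorm N M (\<lambda>i. (L i + E i) + - E i) \<le> qnorm N M (\<lambda>i. L i + E i) + qnorm N M (\<lambda>i. - E i)" by (rule qnorm_triangle[OF pdM])
    then have 2: "qnorm N M L \<le> qnorm N M (\<lambda>i. L i + E i) + qnorm N M E"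
      using qnorm_scale[of N M "-1" E] by simp
    have s0: "0 \<le> (\<Sum>j<d. \<bar>x j - y j\<bar>)" by (intro sum_nonneg) auto
    have "qnorm N M E \<le> C * (e * (\<Sum>j<d. \<bar>x j - y j\<bar>))"
      using r(2)[OF _ xy] e s0 by (intro C(2)) (auto simp: E_def L_def)
    also have "\<dots> \<le> C * (e * ((real d / sqrt \<mu>) * qdist d K x y))"
      using sum_abs_le_qnorm[OF K \<mu>, of "\<lambda>j. x j - y j"] C e by (intro mult_left_mono) auto
    also have "\<dots> \<le> C * (e * ((real d / sqrt \<mu> + 1) * qdist d K x y))"
      using C e qnorm_nonneg[OF K] by (intro mult_left_mono mult_right_mono) auto
    also have "\<dots> = t * qdist d K x y"
    proof -
      have "0 < real d / sqrt \<mu> + 1" using \<mu> by (intro add_nonneg_pos) auto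
      then show ?thesis using C by (simp add: e_def)
    qed
    finally show ?thesis unfolding n L using 1 2 by linarith
  qed
  then show ?thesis using r(1) by blast
qed

end

section \<open>Upper bound in the area formula\<close>

lemma suminf_nn_integral_disjoint:
  assumes [measurable]: "f \<in> borel_measurable M" and Q: "\<And>n::nat. Q n \<in> sets M" "disjoint_family Q"
  shows "(\<Sum>n. \<integral>\<^sup>+x\<in>Q n. f x \<partial>M) = (\<integral>\<^sup>+x\<in>(\<Union>n. Q n). f x \<partial>M)"
proof -
  have "(\<Sum>n. emeasure (density M f) (Q n)) = emeasure (density M f) (\<Union>n. Q n)"
    using Q by (intro suminf_emeasure) auto
  moreover have "(\<Union>n. Q n) \<in> sets M" using Q by auto
  ultimately show ?thesis using Q by (simp add: emeasure_density)
qed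

lemma dyadic_partition_ex:
  assumes "D \<subseteq> space (lb d)" "\<And>x. x \<in> D \<Longrightarrow> \<exists>k. P k (dyi d k x)" "\<And>k v. P k v \<Longrightarrow> dyc d k v \<subseteq> D"
  shows "\<exists>q :: nat \<Rightarrow> (nat \<Rightarrow> real) set. disjoint_family q \<and> (\<Union>n. q n) = D \<and> (\<forall>n. q n = {} \<or> (\<exists>k v. P k v \<and> q n = dyc d k v))"
proof (rule dyadic_partition[of D d P])
  fix q :: "nat \<Rightarrow> (nat \<Rightarrow> real) set"
  assume "disjoint_family q" "(\<Union>n. q n) = D" "\<And>n. q n = {} \<or> (\<exists>k v. P k v \<and> q n = dyc d k v)"
  then show ?thesis by (intro exI[of _ q] conjI allI)
qed (use assms in auto)

text \<open>\<open>D\<close> is open in the space of all sequences. The coordinates from d on are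
  constant on the product space, so the identity from there into all sequences is Borel
  measurable.\<close>

lemma measurable_continuous_indicator:
  fixes f :: "(nat \<Rightarrow> real) \<Rightarrow> real"
  assumes D: "open D" and f: "continuous_on D f"
  shows "(\<lambda>z. ennreal (f z) * indicator D z) \<in> borel_measurable (lb d)"
proof -
  have "(\<lambda>z. z i) \<in> borel_measurable (lb d)" for i
  proof (cases "i < d")
    case True
    then show ?thesis by (rule lb_component)
  next
    case False
    have "(\<lambda>z. z i) \<in> borel_measurable (lb d) \<longleftrightarrow> (\<lambda>z. undefined::real) \<in> borel_measurable (lb d)"
      using False by (intro measurable_cong) (auto simp: space_PiM PiE_def extensional_def)
    then show ?thesis by simp
  qed
  then have id: "(\<lambda>z. z) \<in> borel_measurable (lb d)" by (rule measurable_coordinatewise_then_product)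
  have D': "D \<in> sets borel" using D by simp
  have m: "(\<lambda>z. indicator D z *\<^sub>R f z) \<in> borel_measurable borel"
    using D' f by (rule borel_measurable_continuous_on_indicator)
  have "(\<lambda>z. ennreal (indicator D z *\<^sub>R f z)) \<in> borel_measurable (lb d)"
    using measurable_compose[OF id m] by measurable
  moreover have "(\<lambda>z. ennreal (indicator D z *\<^sub>R f z)) = (\<lambda>z. ennreal (f z) * indicator D z)"
    by (auto simp: fun_eq_iff indicator_def)
  ultimately show ?thesis by simp
qed

lemma eventually_at_right_ex:
  fixes f :: "real \<Rightarrow> real"
  assumes "(f \<longlongrightarrow> l) (at_right 0)" "l < c"
  shows "\<exists>t>0. t < 1 \<and> f t < c"
proof -
  have "eventually (\<lambda>t. f t < c) (at_right 0)" using assms by (rule order_tendstoD(2))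
  moreover have "eventually (\<lambda>t::real. t \<in> {0<..<1}) (at_right 0)" by (rule eventually_at_right_real) simp
  ultimately have "eventually (\<lambda>t. f t < c \<and> t \<in> {0<..<1}) (at_right 0)" by (rule eventually_conj)
  then show ?thesis using eventually_happens[of _ "at_right (0::real)"] by (auto simp: trivial_limit_at_right_real)
qed

lemma const_nn_integral_le:
  assumes "C \<in> sets M" "0 \<le> c" "\<And>y. y \<in> C \<Longrightarrow> ennreal c \<le> f y"
  shows "ennreal c * emeasure M C \<le> (\<integral>\<^sup>+y\<in>C. f y \<partial>M)"
proof -
  have "ennreal c * emeasure M C = (\<integral>\<^sup>+y. ennreal c * indicator C y \<partial>M)"
    using assms(1) by (simp add: nn_integral_cmult)
  also have "\<dots> \<le> (\<integral>\<^sup>+y\<in>C. f y \<partial>M)"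
    using assms(3) by (intro nn_integral_mono) (auto simp: indicator_def)
  finally show ?thesis .
qed

lemma nn_integral_le_const:
  assumes "C \<in> sets M" "0 \<le> c" "\<And>y. y \<in> C \<Longrightarrow> f y \<le> ennreal c"
  shows "(\<integral>\<^sup>+y\<in>C. f y \<partial>M) \<le> ennreal c * emeasure M C"
proof -
  have "(\<integral>\<^sup>+y\<in>C. f y \<partial>M) \<le> (\<integral>\<^sup>+y. ennreal c * indicator C y \<partial>M)"
    using assms(3) by (intro nn_integral_mono) (auto simp: indicator_def)
  also have "\<dots> = ennreal c * emeasure M C" using assms(1) by (simp add: nn_integral_cmult)
  finally show ?thesis .
qed

context metric_mat
begin

abbreviation "dS \<equiv> (\<lambda>x y. norm_inv S (\<lambda>i. x i - y i))"

lemma det_gram_continuous: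
  assumes "\<And>i. i < N \<Longrightarrow> C1_on d D (\<lambda>w. g w i)"
  shows "continuous_on D (\<lambda>z. Determinant.det (gram S d g z))"
proof -
  have p: "continuous_on D (pder j (\<lambda>w. g w i))" if "i < N" "j < d" for i j
    using assms[OF that(1)] that(2) by (simp add: C1_on_def)
  have "Determinant.det (gram S d g z) = (\<Sum>p\<in>{p. p permutes {0..<d}}. signof p *
      (\<Prod>a = 0..<d. \<Sum>i<N. \<Sum>j<N. pder a (\<lambda>w. g w i) z * M $$ (i, j) * pder (p a) (\<lambda>w. g w j) z))" for z
    unfolding det_def'[OF gram_carrier]
    by (intro sum.cong refl arg_cong2[where f="(*)"] prod.cong gram_index) (auto simp: permutes_in_image)
  then have "continuous_on D (\<lambda>z. Determinant.det (gram S d g z)) \<longleftrightarrow> continuous_on D (\<lambda>z. \<Sum>p\<in>{p. p permutes {0..<d}}. signof p *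
      (\<Prod>a = 0..<d. \<Sum>i<N. \<Sum>j<N. pder a (\<lambda>w. g w i) z * M $$ (i, j) * pder (p a) (\<lambda>w. g w j) z))" by simp
  also have "\<dots>"
    by (intro continuous_on_sum continuous_on_mult continuous_on_const continuous_on_prod p) (auto simp: permutes_in_image)
  finally show ?thesis .
qed

lemma J_continuous:
  assumes "\<And>i. i < N \<Longrightarrow> C1_on d D (\<lambda>w. g w i)"
  shows "continuous_on D (J S d g)"
proof -
  have "J S d g = (\<lambda>z. sqrt (Determinant.det (gram S d g z)))" by (simp add: fun_eq_iff J_eq)
  then show ?thesis using continuous_on_real_sqrt[OF det_gram_continuous[where g=g, OF assms]] by simp
qed

lemma gram_det_nonneg: "0 \<le> Determinant.det (gram S d g z)"
proof (rule tendsto_lowerbound[OF det_greg_tendsto])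
  have "eventually (\<lambda>\<eta>::real. 0 < \<eta>) (at_right 0)" by (simp add: eventually_at_right_less)
  then show "eventually (\<lambda>\<eta>. 0 \<le> Determinant.det (greg d g z \<eta>)) (at_right 0)"
    by eventually_elim (use pd_det_pos[OF pd_greg] in \<open>auto intro: less_imp_le\<close>)
qed (simp add: trivial_limit_at_right_real)

lemma J_nonneg: "0 \<le> J S d g z" by (simp add: J_eq gram_det_nonneg)

text \<open>Near z the map is (1 + t)-Lipschitz for the regularized norm, so the image of a small
  cube has measure at most (1 + t)^d sqrt(det K) times its volume. The choices of \<eta> and t use
  up half of \<open>e\<close>, and the continuity of \<open>J\<close> uses the other half. The error
  is additive because \<open>J\<close> may vanish at z.\<close>

lemma local_upper:
  assumes d: "0 < d" and D: "open D" and g: "\<And>i. i < N \<Longrightarrow> C1_on d D (\<lambda>w. g w i)"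
    and z: "z \<in> D" "z \<in> space (lb d)" and e: "0 < e"
  shows "\<exists>r>(0::real). \<forall>k. 1 / 2 ^ k \<le> r \<longrightarrow>
    hausdorff_measure dS d (g ` dyc d k (dyi d k z)) \<le> (\<integral>\<^sup>+y\<in>dyc d k (dyi d k z). ennreal (J S d g y + e) \<partial>lb d)"
proof -
  let ?j = "J S d g z"
  have "((\<lambda>\<eta>. sqrt (Determinant.det (greg d g z \<eta>))) \<longlongrightarrow> ?j) (at_right 0)"
    unfolding J_eq by (intro tendsto_real_sqrt det_greg_tendsto)
  then obtain \<eta> where \<eta>: "0 < \<eta>" "sqrt (Determinant.det (greg d g z \<eta>)) < ?j + e / 4"
    using eventually_at_right_ex[of _ ?j "?j + e / 4"] e by auto
  define K where "K = greg d g z \<eta>"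
  have K: "pd d K" unfolding K_def using \<eta> by (intro pd_greg) simp
  have "((\<lambda>t. (1 + t) ^ d * (?j + e / 4)) \<longlongrightarrow> (1 + 0) ^ d * (?j + e / 4)) (at_right 0)" by (intro tendsto_intros)
  then obtain t where t: "0 < t" "(1 + t) ^ d * (?j + e / 4) < ?j + e / 2"
    using eventually_at_right_ex[of _ "(1 + 0) ^ d * (?j + e / 4)" "?j + e / 2"] e by auto
  obtain r1 where r1: "0 < r1" "\<And>x y. x \<in> coord_box d z r1 \<Longrightarrow> y \<in> coord_box d z r1 \<Longrightarrow>
     \<bar>norm_inv S (\<lambda>i. g x i - g y i) - qnorm d (gram S d g z) (\<lambda>i. x i - y i)\<bar> \<le> t * qdist d K x y"
    using local_linearization[where g=g, OF D g z(1) K t(1)] by blast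
  obtain r2 where r2: "0 < r2" "\<And>x. x \<in> coord_box d z r2 \<Longrightarrow> x \<in> D \<and> \<bar>J S d g x - ?j\<bar> < e / 2"
    using continuous_on_box[OF D J_continuous[where g=g, OF g] z(1), of "e / 2" d] e by auto
  have "hausdorff_measure dS d (g ` dyc d k (dyi d k z)) \<le> (\<integral>\<^sup>+y\<in>dyc d k (dyi d k z). ennreal (J S d g y + e) \<partial>lb d)"
    if k: "1 / 2 ^ k \<le> min r1 r2" for k
  proof -
    let ?C = "dyc d k (dyi d k z)"
    have sub: "?C \<subseteq> coord_box d z r1" "?C \<subseteq> coord_box d z r2" using dyc_subset_box[OF z(2), of k r1] dyc_subset_box[OF z(2), of k r2] k by simp_all
    have "hausdorff_measure dS d (g ` ?C) \<le> ennreal ((1 + t) ^ d) * hausdorff_measure (qdist d K) d ?C"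
    proof (rule hausdorff_lipschitz)
      fix x y assume xy: "x \<in> ?C" "y \<in> ?C"
      have "qnorm d (gram S d g z) (\<lambda>i. x i - y i) \<le> qdist d K x y"
        unfolding qnorm_def K_def qform_greg by (simp add: sum_nonneg)
      moreover have "x \<in> coord_box d z r1" "y \<in> coord_box d z r1" using xy sub by blast+
      from r1(2)[OF this] have "norm_inv S (\<lambda>i. g x i - g y i) \<le> qnorm d (gram S d g z) (\<lambda>i. x i - y i) + t * qdist d K x y"
        by linarith
      ultimately show "norm_inv S (\<lambda>i. g x i - g y i) \<le> (1 + t) * qdist d K x y"
        unfolding distrib_right mult_1_left by linarith
    qed (use t in simp)
    also have "\<dots> \<le> ennreal ((1 + t) ^ d) * (ennreal (sqrt (Determinant.det K)) * emeasure (lb d) ?C)"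
      unfolding dyc_def by (intro mult_left_mono hausdorff_qdist_cube_le[OF K d]) auto
    also have "\<dots> = ennreal ((1 + t) ^ d * sqrt (Determinant.det K)) * emeasure (lb d) ?C"
      using t pd_det_pos[OF K] by (simp add: ennreal_mult mult.assoc)
    also have "\<dots> \<le> ennreal (?j + e / 2) * emeasure (lb d) ?C"
    proof (intro mult_right_mono ennreal_leI)
      have "(1 + t) ^ d * sqrt (Determinant.det K) \<le> (1 + t) ^ d * (?j + e / 4)"
        using t \<eta> by (intro mult_left_mono) (auto simp: K_def)
      then show "(1 + t) ^ d * sqrt (Determinant.det K) \<le> ?j + e / 2" using t by linarith
    qed simp
    also have "\<dots> \<le> (\<integral>\<^sup>+y\<in>?C. ennreal (J S d g y + e) \<partial>lb d)"
    proof (intro const_nn_integral_le ennreal_leI)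
      fix y assume "y \<in> ?C"
      then have "y \<in> coord_box d z r2" using sub by blast
      then have "\<bar>J S d g y - ?j\<bar> < e / 2" using r2(2) by blast
      then show "?j + e / 2 \<le> J S d g y + e" by linarith
    qed (use J_nonneg[of d g z] e in auto)
    finally show ?thesis .
  qed
  then show ?thesis using r1(1) r2(1) by (intro exI[of _ "min r1 r2"]) auto
qed

text \<open>The additive error is multiplied by the volume, so it is absorbed inside one dyadic
  cube, whose volume is at most 1, before the domain of possibly infinite volume is
  decomposed.\<close>

lemma area_upper_cube:
  assumes d: "0 < d" and D: "open D" and g: "\<And>i. i < N \<Longrightarrow> C1_on d D (\<lambda>w. g w i)"
    and Q: "dyc d k0 v0 \<subseteq> D"
  shows "hausdorff_measure dS d (g ` dyc d k0 v0) \<le> (\<integral>\<^sup>+y\<in>dyc d k0 v0. ennreal (J S d g y) \<partial>lb d)"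
proof (rule ennreal_le_epsilon)
  fix e :: real assume e: "0 < e"
  let ?Q = "dyc d k0 v0"
  define P where "P k v \<longleftrightarrow> dyc d k v \<subseteq> ?Q \<and>
     hausdorff_measure dS d (g ` dyc d k v) \<le> (\<integral>\<^sup>+y\<in>dyc d k v. ennreal (J S d g y + e) \<partial>lb d)" for k v
  have "\<exists>k. P k (dyi d k x)" if x: "x \<in> ?Q" for x
  proof -
    have xs: "x \<in> space (lb d)" "x \<in> D" using x Q dyc_space by blast+
    obtain r :: real where r: "0 < r" "\<And>k. 1 / 2 ^ k \<le> r \<Longrightarrow>
      hausdorff_measure dS d (g ` dyc d k (dyi d k x)) \<le> (\<integral>\<^sup>+y\<in>dyc d k (dyi d k x). ennreal (J S d g y + e) \<partial>lb d)"
      using local_upper[where g=g, OF d D g xs(2,1) e] by blast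
    obtain k where k: "k0 \<le> k" "1 / 2 ^ k \<le> r" using ex_dyadic_level[OF r(1)] by blast
    have "dyc d k (dyi d k x) \<subseteq> dyc d k0 (dyi d k0 x)" using k(1) by (rule dyc_nested)
    also have "\<dots> = ?Q" using x by (auto simp: dyc_iff dyi_def)
    finally show ?thesis using r(2)[OF k(2)] by (auto simp: P_def)
  qed
  note ex = this
  have "\<exists>q :: nat \<Rightarrow> (nat \<Rightarrow> real) set. disjoint_family q \<and> (\<Union>n. q n) = ?Q \<and> (\<forall>n. q n = {} \<or> (\<exists>k v. P k v \<and> q n = dyc d k v))"
    by (rule dyadic_partition_ex[where P=P and d=d, OF dyc_space ex]) (simp_all add: P_def)
  then obtain q :: "nat \<Rightarrow> (nat \<Rightarrow> real) set" where q: "disjoint_family q" "(\<Union>n. q n) = ?Q" "\<And>n. q n = {} \<or> (\<exists>k v. P k v \<and> q n = dyc d k v)"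
    by blast
  have qs: "q n \<in> sets (lb d)" for n using q(3)[of n] by auto
  define f where "f y = ennreal (J S d g y + e) * indicator D y" for y
  have f: "f \<in> borel_measurable (lb d)"
    unfolding f_def by (intro measurable_continuous_indicator D continuous_on_add continuous_on_const J_continuous g)
  have "hausdorff_measure dS d (g ` ?Q) = hausdorff_measure dS d (\<Union>n. g ` q n)" by (simp add: image_UN flip: q(2))
  also have "\<dots> \<le> (\<Sum>n. hausdorff_measure dS d (g ` q n))" by (rule hausdorff_UN)
  also have "\<dots> \<le> (\<Sum>n. \<integral>\<^sup>+y\<in>q n. f y \<partial>lb d)"
  proof (intro suminf_le)
    fix n
    show "hausdorff_measure dS d (g ` q n) \<le> (\<integral>\<^sup>+y\<in>q n. f y \<partial>lb d)"
    proof (cases "q n = {}")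
      case False
      then have "hausdorff_measure dS d (g ` q n) \<le> (\<integral>\<^sup>+y\<in>q n. ennreal (J S d g y + e) \<partial>lb d)" using q(3)[of n] by (auto simp: P_def)
      also have "\<dots> = (\<integral>\<^sup>+y\<in>q n. f y \<partial>lb d)"
        using q(2) Q by (intro nn_integral_cong) (auto simp: f_def indicator_def)
      finally show ?thesis .
    qed simp
  qed auto
  also have "\<dots> = (\<integral>\<^sup>+y\<in>?Q. f y \<partial>lb d)" unfolding q(2)[symmetric] by (rule suminf_nn_integral_disjoint[OF f qs q(1)])
  also have "\<dots> = (\<integral>\<^sup>+y. ennreal (J S d g y) * indicator D y * indicator ?Q y + ennreal e * indicator ?Q y \<partial>lb d)"
    using Q e J_nonneg by (intro nn_integral_cong) (auto simp: f_def indicator_def ennreal_plus)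
  also have "\<dots> = (\<integral>\<^sup>+y. ennreal (J S d g y) * indicator D y * indicator ?Q y \<partial>lb d) + ennreal e * emeasure (lb d) ?Q"
    using measurable_continuous_indicator[OF D J_continuous[where g=g, OF g]]
    by (subst nn_integral_add) (auto simp: nn_integral_cmult)
  also have "\<dots> \<le> (\<integral>\<^sup>+y\<in>?Q. ennreal (J S d g y) \<partial>lb d) + ennreal e"
  proof (intro add_mono)
    show "(\<integral>\<^sup>+y. ennreal (J S d g y) * indicator D y * indicator ?Q y \<partial>lb d) \<le> (\<integral>\<^sup>+y\<in>?Q. ennreal (J S d g y) \<partial>lb d)"
      by (intro nn_integral_mono) (auto simp: indicator_def)
    have "e * (1 / 2 ^ k0) ^ d \<le> e * 1" using e by (intro mult_left_mono power_le_one) (auto simp: divide_le_eq)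
    then show "ennreal e * emeasure (lb d) ?Q \<le> ennreal e" using e by (simp add: emeasure_dyc ennreal_leI flip: ennreal_mult)
  qed
  finally show "hausdorff_measure dS d (g ` ?Q) \<le> (\<integral>\<^sup>+y\<in>?Q. ennreal (J S d g y) \<partial>lb d) + ennreal e" .
qed

lemma open_dyadic_cubes:
  assumes D: "open D"
  shows "\<exists>q :: nat \<Rightarrow> (nat \<Rightarrow> real) set. disjoint_family q \<and> (\<Union>n. q n) = D \<inter> space (lb d) \<and>
    (\<forall>n. q n = {} \<or> (\<exists>k v. dyc d k v \<subseteq> D \<and> q n = dyc d k v))"
proof -
  define P where "P k v \<longleftrightarrow> dyc d k v \<subseteq> D \<inter> space (lb d)" for k v
  have "\<exists>k. P k (dyi d k x)" if x: "x \<in> D \<inter> space (lb d)" for x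
  proof -
    obtain r where r: "0 < r" "coord_box d x r \<subseteq> D" using open_contains_box[OF D, of x d] x by blast
    obtain k where "1 / 2 ^ k \<le> r" using ex_dyadic_level[OF r(1)] by blast
    then have "dyc d k (dyi d k x) \<subseteq> coord_box d x r" using x by (intro dyc_subset_box) auto
    then show ?thesis using r(2) dyc_space unfolding P_def by blast
  qed
  note ex = this
  have "\<exists>q :: nat \<Rightarrow> (nat \<Rightarrow> real) set. disjoint_family q \<and> (\<Union>n. q n) = D \<inter> space (lb d) \<and> (\<forall>n. q n = {} \<or> (\<exists>k v. P k v \<and> q n = dyc d k v))"
    by (rule dyadic_partition_ex[where P=P and d=d, OF inf_le2 ex]) (simp_all add: P_def)
  then obtain q :: "nat \<Rightarrow> (nat \<Rightarrow> real) set" where q: "disjoint_family q \<and> (\<Union>n. q n) = D \<inter> space (lb d) \<and>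
    (\<forall>n. q n = {} \<or> (\<exists>k v. P k v \<and> q n = dyc d k v))" ..
  have "\<forall>n. q n = {} \<or> (\<exists>k v. dyc d k v \<subseteq> D \<and> q n = dyc d k v)"
  proof
    fix n
    from q have "q n = {} \<or> (\<exists>k v. P k v \<and> q n = dyc d k v)" by simp
    then show "q n = {} \<or> (\<exists>k v. dyc d k v \<subseteq> D \<and> q n = dyc d k v)"
    proof (elim disjE exE conjE)
      fix k v assume "P k v" "q n = dyc d k v"
      moreover from this have "dyc d k v \<subseteq> D" by (simp add: P_def)
      ultimately show ?thesis by blast
    qed simp
  qed
  with q show ?thesis by (intro exI[of _ q]) simp
qed

theorem area_upper:
  assumes d: "0 < d" and D: "open D" and g: "\<And>i. i < N \<Longrightarrow> C1_on d D (\<lambda>w. g w i)"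
  shows "hausdorff_measure dS d (g ` (D \<inter> space (lb d))) \<le> (\<integral>\<^sup>+y\<in>D. ennreal (J S d g y) \<partial>lb d)"
proof -
  from open_dyadic_cubes[OF D, of d] obtain q :: "nat \<Rightarrow> (nat \<Rightarrow> real) set" where q0: "disjoint_family q \<and> (\<Union>n. q n) = D \<inter> space (lb d) \<and>
    (\<forall>n. q n = {} \<or> (\<exists>k v. dyc d k v \<subseteq> D \<and> q n = dyc d k v))" ..
  then have q: "disjoint_family q" "(\<Union>n. q n) = D \<inter> space (lb d)"
    "q n = {} \<or> (\<exists>k v. dyc d k v \<subseteq> D \<and> q n = dyc d k v)" for n
    by simp_all
  have qs: "q n \<in> sets (lb d)" for n using q(3)[of n] by auto
  define f where "f y = ennreal (J S d g y) * indicator D y" for y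
  have f: "f \<in> borel_measurable (lb d)"
    unfolding f_def by (intro measurable_continuous_indicator D J_continuous g)
  have "hausdorff_measure dS d (g ` (D \<inter> space (lb d))) = hausdorff_measure dS d (\<Union>n. g ` q n)" by (simp add: image_UN flip: q(2))
  also have "\<dots> \<le> (\<Sum>n. hausdorff_measure dS d (g ` q n))" by (rule hausdorff_UN)
  also have "\<dots> \<le> (\<Sum>n. \<integral>\<^sup>+y\<in>q n. f y \<partial>lb d)"
  proof (intro suminf_le)
    fix n
    show "hausdorff_measure dS d (g ` q n) \<le> (\<integral>\<^sup>+y\<in>q n. f y \<partial>lb d)"
    proof (cases "q n = {}")
      case False
      then have "hausdorff_measure dS d (g ` q n) \<le> (\<integral>\<^sup>+y\<in>q n. ennreal (J S d g y) \<partial>lb d)"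
        using q(3)[of n] area_upper_cube[where g=g, OF d D g] by auto
      also have "\<dots> = (\<integral>\<^sup>+y\<in>q n. f y \<partial>lb d)"
        using q(2) by (intro nn_integral_cong) (auto simp: f_def indicator_def)
      finally show ?thesis .
    qed simp
  qed auto
  also have "\<dots> = (\<integral>\<^sup>+y\<in>D \<inter> space (lb d). f y \<partial>lb d)" unfolding q(2)[symmetric] by (rule suminf_nn_integral_disjoint[OF f qs q(1)])
  also have "\<dots> = (\<integral>\<^sup>+y\<in>D. ennreal (J S d g y) \<partial>lb d)"
    by (intro nn_integral_cong) (auto simp: f_def indicator_def)
  finally show ?thesis .
qed

end

section \<open>Lower bound in the area formula\<close>

lemma compact_PiE_lb:
  assumes "\<And>i. i < d \<Longrightarrow> compact (B i)"
  shows "compact ((\<Pi>\<^sub>E i\<in>{..<d}. B i) :: (nat \<Rightarrow> real) set)"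
proof -
  have eq: "(\<Pi>\<^sub>E i\<in>{..<d}. B i) = (\<Pi>\<^sub>E i\<in>UNIV. if i < d then B i else {undefined})"
  proof (intro equalityI subsetI)
    fix x :: "nat \<Rightarrow> real"
    assume x: "x \<in> (\<Pi>\<^sub>E i\<in>{..<d}. B i)"
    have "x i \<in> (if i < d then B i else {undefined})" for i
      using PiE_mem[OF x, of i] PiE_arb[OF x, of i] by simp
    then show "x \<in> (\<Pi>\<^sub>E i\<in>UNIV. if i < d then B i else {undefined})" by (intro PiE_I) simp_all
  next
    fix x :: "nat \<Rightarrow> real"
    assume x: "x \<in> (\<Pi>\<^sub>E i\<in>UNIV. if i < d then B i else {undefined})"
    have "x i \<in> (if i < d then B i else {undefined})" for i using PiE_mem[OF x, of i] by simp
    note h = this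
    show "x \<in> (\<Pi>\<^sub>E i\<in>{..<d}. B i)"
    proof (rule PiE_I)
      fix i assume "i \<in> {..<d}" then show "x i \<in> B i" using h[of i] by simp
    next
      fix i assume "i \<notin> {..<d}" then show "x i = undefined" using h[of i] by simp
    qed
  qed
  have "compactin (product_topology (\<lambda>i. euclidean) UNIV) (\<Pi>\<^sub>E i\<in>UNIV. if i < d then B i else {undefined})"
    unfolding compactin_PiE using assms by simp
  then show ?thesis unfolding eq euclidean_product_topology compactin_euclidean_iff .
qed

lemma pd_pos: "pd d G \<Longrightarrow> i < d \<Longrightarrow> x i \<noteq> 0 \<Longrightarrow> 0 < qform d G x"
  by (auto simp: pd_def)

context metric_mat
begin

text \<open>The distance is continuous and positive on the compact product, so it has a positive
  minimum. Two maps are allowed because the boundary is parametrized by several pieces.\<close>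

lemma positive_distance:
  assumes K: "compact K" "compact L"
    and g: "\<And>i. i < N \<Longrightarrow> continuous_on K (\<lambda>x. g x i)" and h: "\<And>i. i < N \<Longrightarrow> continuous_on L (\<lambda>x. h x i)"
    and ne: "\<And>x y. x \<in> K \<Longrightarrow> y \<in> L \<Longrightarrow> \<exists>i<N. g x i \<noteq> h y i"
  shows "\<exists>s>0. \<forall>x\<in>g ` K. \<forall>y\<in>h ` L. s \<le> dS x y"
proof (cases "K \<times> L = {}")
  case True
  then show ?thesis by (auto intro: exI[of _ 1])
next
  case False
  define \<phi> where "\<phi> = (\<lambda>p. dS (g (fst p)) (h (snd p)))"
  have c1: "continuous_on (K \<times> L) (\<lambda>p. g (fst p) i)" if "i < N" for i
    by (rule continuous_on_compose2[OF g[OF that] continuous_on_fst[OF continuous_on_id]]) auto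
  have c2: "continuous_on (K \<times> L) (\<lambda>p. h (snd p) i)" if "i < N" for i
    by (rule continuous_on_compose2[OF h[OF that] continuous_on_snd[OF continuous_on_id]]) auto
  have "continuous_on (K \<times> L) \<phi>"
    unfolding \<phi>_def norm_inv_eq_qnorm qnorm_def qform_def dim
    by (intro continuous_on_real_sqrt continuous_on_sum continuous_on_mult continuous_on_diff continuous_on_const c1 c2) auto
  moreover have "compact (K \<times> L)" using K by (rule compact_Times)
  ultimately obtain p where p: "p \<in> K \<times> L" "\<And>q. q \<in> K \<times> L \<Longrightarrow> \<phi> p \<le> \<phi> q"
    using continuous_attains_inf[of "K \<times> L" \<phi>] False by blast
  have "0 < \<phi> p"
  proof -
    obtain i where "i < N" "g (fst p) i \<noteq> h (snd p) i" using ne[of "fst p" "snd p"] p(1) by auto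
    then have "0 < qform N M (\<lambda>i. g (fst p) i - h (snd p) i)" by (intro pd_pos[OF pdM]) auto
    then show ?thesis by (simp add: \<phi>_def norm_inv_eq_qnorm qnorm_def dim)
  qed
  moreover have "\<phi> p \<le> dS x y" if "x \<in> g ` K" "y \<in> h ` L" for x y
  proof -
    from that obtain a b where "a \<in> K" "b \<in> L" "x = g a" "y = h b" by blast
    then show ?thesis using p(2)[of "(a, b)"] by (simp add: \<phi>_def)
  qed
  ultimately show ?thesis by blast
qed

lemma hausdorff_compact_pieces:
  assumes "finite I" and "\<And>i. i \<in> I \<Longrightarrow> compact (K i)"
    and "\<And>i l. i \<in> I \<Longrightarrow> l < N \<Longrightarrow> continuous_on (K i) (\<lambda>x. g i x l)"
    and "\<And>i j x y. i \<in> I \<Longrightarrow> j \<in> I \<Longrightarrow> i \<noteq> j \<Longrightarrow> x \<in> K i \<Longrightarrow> y \<in> K j \<Longrightarrow> \<exists>l<N. g i x l \<noteq> g j y l"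
  shows "(\<Sum>i\<in>I. hausdorff_measure dS d (g i ` K i)) \<le> hausdorff_measure dS d (\<Union>i\<in>I. g i ` K i)"
  using assms
proof (induction I)
  case (insert a I)
  have "\<forall>i\<in>I. \<exists>s>0. \<forall>x\<in>g a ` K a. \<forall>y\<in>g i ` K i. s \<le> dS x y"
  proof
    fix i assume i: "i \<in> I"
    show "\<exists>s>0. \<forall>x\<in>g a ` K a. \<forall>y\<in>g i ` K i. s \<le> dS x y"
    proof (rule positive_distance)
      fix x y assume "x \<in> K a" "y \<in> K i"
      then show "\<exists>l<N. g a x l \<noteq> g i y l" using insert.hyps i by (intro insert.prems(3)) auto
    qed (use insert.prems i in auto)
  qed
  from bchoice[OF this] obtain s where s: "\<forall>i\<in>I. 0 < s i \<and> (\<forall>x\<in>g a ` K a. \<forall>y\<in>g i ` K i. s i \<le> dS x y)" by blast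
  define m where "m = Min (insert 1 (s ` I))"
  have m: "0 < m" "\<And>i. i \<in> I \<Longrightarrow> m \<le> s i" using s insert.hyps(1) by (auto simp: m_def)
  have "hausdorff_measure dS d (g a ` K a) + hausdorff_measure dS d (\<Union>i\<in>I. g i ` K i)
      \<le> hausdorff_measure dS d (g a ` K a \<union> (\<Union>i\<in>I. g i ` K i))"
  proof (rule hausdorff_separated[OF m(1)])
    fix x y assume x: "x \<in> g a ` K a" and "y \<in> (\<Union>i\<in>I. g i ` K i)"
    then obtain i where i: "i \<in> I" "y \<in> g i ` K i" by blast
    then have "s i \<le> dS x y" using s x by blast
    then show "m \<le> dS x y" using m(2)[OF i(1)] by linarith
  qed
  moreover have "(\<Sum>i\<in>I. hausdorff_measure dS d (g i ` K i)) \<le> hausdorff_measure dS d (\<Union>i\<in>I. g i ` K i)"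
    by (rule insert.IH) (use insert.prems in auto)
  ultimately show ?case using insert.hyps
    by (simp add: add_left_mono order_trans[of _ "hausdorff_measure dS d (g a ` K a) + hausdorff_measure dS d (\<Union>i\<in>I. g i ` K i)"])
qed simp

text \<open>Since \<open>J\<close> is positive at z, the Gram matrix is a norm, and on a small cube
  the map has an inverse that is Lipschitz with constant 1 / (1 - t). A slightly smaller compact
  cube is used. The choice of t balances three losses: (1 - t)^d for the inverse, (1 - t)^d for
  shrinking the cube, and 1 + t for the variation of \<open>J\<close>.\<close>

lemma local_lower:
  assumes d: "0 < d" and D: "open D" and g: "\<And>i. i < N \<Longrightarrow> C1_on d D (\<lambda>w. g w i)"
    and z: "z \<in> D" "z \<in> space (lb d)" and J: "0 < J S d g z" and e: "0 < e" "e < 1"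
  shows "\<exists>r>(0::real). \<forall>k. 1 / 2 ^ k \<le> r \<longrightarrow> (\<exists>K. compact K \<and> K \<subseteq> dyc d k (dyi d k z) \<and>
    ennreal (1 - e) * (\<integral>\<^sup>+y\<in>dyc d k (dyi d k z). ennreal (J S d g y) \<partial>lb d) \<le> hausdorff_measure dS d (g ` K))"
proof -
  let ?j = "J S d g z" and ?G = "gram S d g z"
  have G: "pd d ?G" using J by (intro gram_pd_if_det) (auto simp: J_eq)
  have lim: "((\<lambda>t. (1 - e) * (1 + t) - (1 - t) ^ d * (1 - t) ^ d) \<longlongrightarrow> (1 - e) * (1 + 0) - (1 - 0) ^ d * (1 - 0) ^ d) (at_right 0)"
    by (intro tendsto_intros)
  have "\<exists>t>0. t < 1 \<and> (1 - e) * (1 + t) - (1 - t) ^ d * (1 - t) ^ d < 0"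
    by (rule eventually_at_right_ex[OF lim]) (use e in simp)
  then obtain t where "0 < t" "t < 1" "(1 - e) * (1 + t) - (1 - t) ^ d * (1 - t) ^ d < 0" by blast
  then have t: "0 < t" "t < 1" "(1 - e) * (1 + t) \<le> (1 - t) ^ d * (1 - t) ^ d" by simp_all
  obtain r1 where r1: "0 < r1" "\<And>x y. x \<in> coord_box d z r1 \<Longrightarrow> y \<in> coord_box d z r1 \<Longrightarrow>
     \<bar>norm_inv S (\<lambda>i. g x i - g y i) - qnorm d (gram S d g z) (\<lambda>i. x i - y i)\<bar> \<le> t * qdist d ?G x y"
    using local_linearization[where g=g, OF D g z(1) G t(1)] by blast
  have "0 < t * ?j" using t J by simp
  then obtain r2 where r2: "0 < r2" "\<And>x. x \<in> coord_box d z r2 \<Longrightarrow> x \<in> D \<and> \<bar>J S d g x - ?j\<bar> < t * ?j"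
    using continuous_on_box[OF D J_continuous[where g=g, OF g] z(1), of "t * ?j" d] by auto
  have "\<exists>K. compact K \<and> K \<subseteq> dyc d k (dyi d k z) \<and>
    ennreal (1 - e) * (\<integral>\<^sup>+y\<in>dyc d k (dyi d k z). ennreal (J S d g y) \<partial>lb d) \<le> hausdorff_measure dS d (g ` K)"
    if k: "1 / 2 ^ k \<le> min r1 r2" for k
  proof -
    let ?C = "dyc d k (dyi d k z)"
    define c where "c i = real_of_int (dyi d k z i) / 2 ^ k" for i
    \<comment> \<open>Half of the total shrinkage on each side, which leaves a closed cube inside
      the half-open one with sides 1 - t times as long.\<close>
    define \<tau> where "\<tau> = t / 2 / 2 ^ k"
    define K where "K = (\<Pi>\<^sub>E i\<in>{..<d}. {c i + \<tau>..c i + 1 / 2 ^ k - \<tau>})"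
    have sub: "?C \<subseteq> coord_box d z r1" "?C \<subseteq> coord_box d z r2"
      using dyc_subset_box[OF z(2), of k r1] dyc_subset_box[OF z(2), of k r2] k by simp_all
    have \<tau>: "0 < \<tau>" "2 * \<tau> < 1 / 2 ^ k" using t by (auto simp: \<tau>_def divide_strict_right_mono)
    have cK: "compact K" unfolding K_def by (rule compact_PiE_lb) simp
    have KC: "K \<subseteq> ?C"
      unfolding K_def dyc_def cube_def c_def[symmetric] using \<tau> by (intro PiE_mono) auto
    have Ks: "K \<in> sets (lb d)" unfolding K_def by (intro sets_PiM_I_finite) auto
    have "1 / 2 ^ k - 2 * \<tau> = (1 - t) * (1 / 2 ^ k)" by (simp add: \<tau>_def field_simps)
    then have mK: "emeasure (lb d) K = ennreal (((1 - t) * (1 / 2 ^ k)) ^ d)"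
      unfolding K_def using \<tau> t by (subst lbP.emeasure_PiM) (auto simp: ennreal_power)
    have lipK: "(1 - t) * qdist d ?G x y \<le> dS (g x) (g y)" if "x \<in> K" "y \<in> K" for x y
    proof -
      have "x \<in> coord_box d z r1" "y \<in> coord_box d z r1" using that KC sub by blast+
      from r1(2)[OF this] show ?thesis unfolding left_diff_distrib mult_1_left by linarith
    qed
    have injK: "x = y" if xy: "x \<in> K" "y \<in> K" "g x = g y" for x y
    proof -
      have "norm_inv S (\<lambda>i. g x i - g y i) = 0" by (simp add: xy(3) norm_inv_eq_qnorm qnorm_def qform_def)
      then have "(1 - t) * qdist d ?G x y \<le> 0" using lipK[OF xy(1,2)] by simp
      then have "qdist d ?G x y \<le> 0" using t by (simp add: mult_le_0_iff)
      then have "qdist d ?G x y = 0" using qnorm_nonneg[OF G] by (intro antisym)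
      then have "qform d ?G (\<lambda>i. x i - y i) = 0" by (simp add: qnorm_def)
      then have "x i = y i" if "i < d" for i using pd_zero[OF G _ that] by fastforce
      moreover have "x i = y i" if "\<not> i < d" for i
        using xy(1,2) that by (auto simp: K_def PiE_iff extensional_def)
      ultimately show ?thesis by (intro ext) blast
    qed
    define f where "f = inv_into K g"
    have fg: "f (g x) = x" if "x \<in> K" for x
      unfolding f_def using that injK by (intro inv_into_f_f) (auto intro: inj_onI)
    have "f ` (g ` K) = K" using fg by force
    then have "hausdorff_measure (qdist d ?G) d K = hausdorff_measure (qdist d ?G) d (f ` (g ` K))" by simp
    also have "\<dots> \<le> ennreal ((1 / (1 - t)) ^ d) * hausdorff_measure dS d (g ` K)"
    proof (rule hausdorff_lipschitz)
      show "0 < 1 / (1 - t)" using t by simp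
      fix u v assume "u \<in> g ` K" "v \<in> g ` K"
      then obtain x y where xy: "x \<in> K" "u = g x" "y \<in> K" "v = g y" by blast
      have "(1 - t) * qdist d ?G x y \<le> dS u v" using lipK xy by simp
      then have "qdist d ?G x y \<le> dS u v / (1 - t)" using t by (simp add: pos_le_divide_eq mult.commute)
      then show "qdist d ?G (f u) (f v) \<le> 1 / (1 - t) * dS u v" using xy fg by simp
    qed
    finally have up: "hausdorff_measure (qdist d ?G) d K \<le> ennreal ((1 / (1 - t)) ^ d) * hausdorff_measure dS d (g ` K)" .
    have low: "ennreal ?j * emeasure (lb d) K \<le> hausdorff_measure (qdist d ?G) d K"
      unfolding J_eq by (rule hausdorff_qdist_lower[OF G d Ks])
    have "ennreal ((1 - t) ^ d) * (ennreal ?j * emeasure (lb d) K) \<le> ennreal ((1 - t) ^ d) * (ennreal ((1 / (1 - t)) ^ d) * hausdorff_measure dS d (g ` K))"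
      by (intro mult_left_mono order_trans[OF low up]) auto
    also have "\<dots> = ennreal ((1 - t) ^ d * (1 / (1 - t)) ^ d) * hausdorff_measure dS d (g ` K)"
      using t by (simp add: ennreal_mult mult.assoc)
    also have "(1 - t) ^ d * (1 / (1 - t)) ^ d = 1" using t by (simp flip: power_mult_distrib)
    finally have HK: "ennreal ((1 - t) ^ d) * (ennreal ?j * emeasure (lb d) K) \<le> hausdorff_measure dS d (g ` K)" by simp
    have "(\<integral>\<^sup>+y\<in>?C. ennreal (J S d g y) \<partial>lb d) \<le> ennreal ((1 + t) * ?j) * emeasure (lb d) ?C"
    proof (intro nn_integral_le_const ennreal_leI)
      fix y assume "y \<in> ?C"
      then have "y \<in> coord_box d z r2" using sub by blast
      then have "\<bar>J S d g y - ?j\<bar> < t * ?j" using r2(2) by blast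
      then show "J S d g y \<le> (1 + t) * ?j" by (simp add: distrib_right)
    qed (use t J in auto)
    then have "ennreal (1 - e) * (\<integral>\<^sup>+y\<in>?C. ennreal (J S d g y) \<partial>lb d) \<le> ennreal (1 - e) * (ennreal ((1 + t) * ?j) * emeasure (lb d) ?C)"
      by (intro mult_left_mono) auto
    also have "\<dots> = ennreal (((1 - e) * (1 + t)) * (?j * (1 / 2 ^ k) ^ d))"
      using e t J by (simp add: emeasure_dyc mult_ac flip: ennreal_mult)
    also have "\<dots> \<le> ennreal (((1 - t) ^ d * (1 - t) ^ d) * (?j * (1 / 2 ^ k) ^ d))"
      using t J by (intro ennreal_leI mult_right_mono) auto
    also have "\<dots> = ennreal ((1 - t) ^ d) * (ennreal ?j * emeasure (lb d) K)"
      unfolding mK power_mult_distrib using t J by (simp add: mult_ac flip: ennreal_mult)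
    also note HK
    finally show ?thesis using cK KC by blast
  qed
  then show ?thesis using r1(1) r2(1) by (intro exI[of _ "min r1 r2"]) auto
qed

text \<open>Only the open set where \<open>J\<close> is positive contributes to the integral. It is
  decomposed into cubes satisfying the local estimate; finitely many of their compact parts form one
  compact set, on whose disjoint pieces the measure is superadditive. The error is relative, so it
  survives the summation.\<close>

lemma area_lower_approx:
  assumes d: "0 < d" and D: "open D" and g: "\<And>i. i < N \<Longrightarrow> C1_on d D (\<lambda>w. g w i)"
    and inj: "\<And>x y. x \<in> D \<inter> space (lb d) \<Longrightarrow> y \<in> D \<inter> space (lb d) \<Longrightarrow> \<forall>i<N. g x i = g y i \<Longrightarrow> x = y"
    and e: "0 < e" "e < 1"
  shows "ennreal (1 - e) * (\<integral>\<^sup>+y\<in>D. ennreal (J S d g y) \<partial>lb d)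
    \<le> (SUP K\<in>{K. compact K \<and> K \<subseteq> D \<inter> space (lb d)}. hausdorff_measure dS d (g ` K))" (is "_ \<le> ?R")
proof -
  define D' where "D' = D \<inter> J S d g -` {0<..}"
  have D': "open D'" unfolding D'_def by (intro continuous_open_preimage J_continuous g D) auto
  define P where "P k v \<longleftrightarrow> dyc d k v \<subseteq> D' \<inter> space (lb d) \<and> (\<exists>K. compact K \<and> K \<subseteq> dyc d k v \<and>
    ennreal (1 - e) * (\<integral>\<^sup>+y\<in>dyc d k v. ennreal (J S d g y) \<partial>lb d) \<le> hausdorff_measure dS d (g ` K))" for k v
  have ex: "\<exists>k. P k (dyi d k x)" if x: "x \<in> D' \<inter> space (lb d)" for x
  proof -
    have xD: "x \<in> D" "x \<in> space (lb d)" "0 < J S d g x" using x by (auto simp: D'_def)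
    obtain r1 :: real where r1: "0 < r1" "\<forall>k. 1 / 2 ^ k \<le> r1 \<longrightarrow> (\<exists>K. compact K \<and> K \<subseteq> dyc d k (dyi d k x) \<and>
      ennreal (1 - e) * (\<integral>\<^sup>+y\<in>dyc d k (dyi d k x). ennreal (J S d g y) \<partial>lb d) \<le> hausdorff_measure dS d (g ` K))"
      using local_lower[where g=g, OF d D g xD e] by blast
    obtain r2 where r2: "0 < r2" "coord_box d x r2 \<subseteq> D'" using open_contains_box[OF D', of x d] x by blast
    obtain k where k: "1 / 2 ^ k \<le> min r1 r2" using ex_dyadic_level[of "min r1 r2" 0] r1 r2 by auto
    have "dyc d k (dyi d k x) \<subseteq> coord_box d x r2" using k xD by (intro dyc_subset_box) auto
    then have "dyc d k (dyi d k x) \<subseteq> D' \<inter> space (lb d)" using r2(2) dyc_space by blast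
    moreover have "1 / 2 ^ k \<le> r1" using k by simp
    ultimately show ?thesis using r1(2) unfolding P_def by blast
  qed
  have "\<exists>q :: nat \<Rightarrow> (nat \<Rightarrow> real) set. disjoint_family q \<and> (\<Union>n. q n) = D' \<inter> space (lb d) \<and>
      (\<forall>n. q n = {} \<or> (\<exists>k v. P k v \<and> q n = dyc d k v))"
    by (rule dyadic_partition_ex[where P=P and d=d, OF inf_le2 ex]) (simp_all add: P_def)
  then obtain q :: "nat \<Rightarrow> (nat \<Rightarrow> real) set" where q0: "disjoint_family q \<and> (\<Union>n. q n) = D' \<inter> space (lb d) \<and>
      (\<forall>n. q n = {} \<or> (\<exists>k v. P k v \<and> q n = dyc d k v))" ..
  then have q: "disjoint_family q" "(\<Union>n. q n) = D' \<inter> space (lb d)" by simp_all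
  define f where "f y = ennreal (J S d g y) * indicator D y" for y
  have f: "f \<in> borel_measurable (lb d)"
    unfolding f_def by (intro measurable_continuous_indicator D J_continuous g)
  have qK: "q n \<in> sets (lb d) \<and> (\<exists>K. compact K \<and> K \<subseteq> q n \<and> ennreal (1 - e) * (\<integral>\<^sup>+y\<in>q n. f y \<partial>lb d) \<le> hausdorff_measure dS d (g ` K))" for n
  proof (cases "q n = {}")
    case True
    then show ?thesis by (intro conjI exI[of _ "{}"]) auto
  next
    case False
    from q0 have "q n = {} \<or> (\<exists>k v. P k v \<and> q n = dyc d k v)" by simp
    with False obtain k v where kv: "P k v" "q n = dyc d k v" by blast
    then obtain K where K: "compact K" "K \<subseteq> dyc d k v"
      "ennreal (1 - e) * (\<integral>\<^sup>+y\<in>dyc d k v. ennreal (J S d g y) \<partial>lb d) \<le> hausdorff_measure dS d (g ` K)" unfolding P_def by blast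
    have "dyc d k v \<subseteq> D" using kv(1) by (auto simp: P_def D'_def)
    then have "(\<integral>\<^sup>+y\<in>q n. f y \<partial>lb d) = (\<integral>\<^sup>+y\<in>dyc d k v. ennreal (J S d g y) \<partial>lb d)"
      unfolding kv(2) by (intro nn_integral_cong) (auto simp: f_def indicator_def)
    then show ?thesis using K kv(2) by (intro conjI exI[of _ K]) auto
  qed
  then have "\<forall>n. \<exists>K. compact K \<and> K \<subseteq> q n \<and> ennreal (1 - e) * (\<integral>\<^sup>+y\<in>q n. f y \<partial>lb d) \<le> hausdorff_measure dS d (g ` K)" by blast
  from choice[OF this] obtain K where "\<forall>n. compact (K n) \<and> K n \<subseteq> q n \<and> ennreal (1 - e) * (\<integral>\<^sup>+y\<in>q n. f y \<partial>lb d) \<le> hausdorff_measure dS d (g ` K n)" ..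
  then have K: "compact (K n)" "K n \<subseteq> q n" "ennreal (1 - e) * (\<integral>\<^sup>+y\<in>q n. f y \<partial>lb d) \<le> hausdorff_measure dS d (g ` K n)" for n by simp_all
  have KD: "K n \<subseteq> D \<inter> space (lb d)" for n
  proof -
    have "q n \<subseteq> D' \<inter> space (lb d)" unfolding q(2)[symmetric] by blast
    then show ?thesis using K(2)[of n] unfolding D'_def by blast
  qed
  have "(\<integral>\<^sup>+y\<in>D. ennreal (J S d g y) \<partial>lb d) = (\<integral>\<^sup>+y\<in>D' \<inter> space (lb d). f y \<partial>lb d)"
    using J_nonneg[of d g] by (intro nn_integral_cong) (auto simp: f_def indicator_def D'_def not_less dest: antisym)
  also have "\<dots> = (\<Sum>n. \<integral>\<^sup>+y\<in>q n. f y \<partial>lb d)"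
    unfolding q(2)[symmetric] using qK q(1) by (intro suminf_nn_integral_disjoint[symmetric] f) auto
  finally have "ennreal (1 - e) * (\<integral>\<^sup>+y\<in>D. ennreal (J S d g y) \<partial>lb d) = (\<Sum>n. ennreal (1 - e) * (\<integral>\<^sup>+y\<in>q n. f y \<partial>lb d))" by simp
  also have "\<dots> \<le> (\<Sum>n. hausdorff_measure dS d (g ` K n))" by (intro suminf_le K(3)) auto
  also have "\<dots> = (SUP m. \<Sum>n<m. hausdorff_measure dS d (g ` K n))" by (rule suminf_eq_SUP)
  also have "\<dots> \<le> ?R"
  proof (rule SUP_least)
    fix m :: nat
    have "(\<Sum>n<m. hausdorff_measure dS d (g ` K n)) \<le> hausdorff_measure dS d (\<Union>n<m. g ` K n)"
    proof (rule hausdorff_compact_pieces)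
      fix i l :: nat assume "l < N"
      then have "continuous_on D (\<lambda>x. g x l)" using g by (simp add: C1_on_def)
      then show "continuous_on (K i) (\<lambda>x. g x l)" by (rule continuous_on_subset) (use KD[of i] in auto)
    next
      fix i j :: nat and x y assume ij: "i \<noteq> j" "x \<in> K i" "y \<in> K j"
      have "q i \<inter> q j = {}" using q(1) ij(1) by (simp add: disjoint_family_on_def)
      then have "x \<noteq> y" using K(2) ij by blast
      then show "\<exists>l<N. g x l \<noteq> g y l" using inj[of x y] KD[of i] KD[of j] ij by blast
    qed (use K in auto)
    also have "(\<Union>n<m. g ` K n) = g ` (\<Union>n<m. K n)" by blast
    also have "hausdorff_measure dS d (g ` (\<Union>n<m. K n)) \<le> ?R"
    proof (rule SUP_upper, intro CollectI conjI)
      show "compact (\<Union>n<m. K n)" using K(1) by (intro compact_UN) auto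
      show "(\<Union>n<m. K n) \<subseteq> D \<inter> space (lb d)" using KD by blast
    qed
    finally show "(\<Sum>n<m. hausdorff_measure dS d (g ` K n)) \<le> ?R" .
  qed
  finally show ?thesis .
qed

theorem area_lower:
  assumes d: "0 < d" and D: "open D" and g: "\<And>i. i < N \<Longrightarrow> C1_on d D (\<lambda>w. g w i)"
    and inj: "\<And>x y. x \<in> D \<inter> space (lb d) \<Longrightarrow> y \<in> D \<inter> space (lb d) \<Longrightarrow> \<forall>i<N. g x i = g y i \<Longrightarrow> x = y"
  shows "(\<integral>\<^sup>+y\<in>D. ennreal (J S d g y) \<partial>lb d)
    \<le> (SUP K\<in>{K. compact K \<and> K \<subseteq> D \<inter> space (lb d)}. hausdorff_measure dS d (g ` K))" (is "?I \<le> ?R")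
proof -
  have "(SUP n::nat. ennreal (1 - (1/2) ^ Suc n)) = 1"
  proof (rule antisym)
    show "(SUP n::nat. ennreal (1 - (1/2) ^ Suc n)) \<le> 1" by (intro SUP_least) (simp add: ennreal_le_1)
    have "(\<lambda>n. ennreal (1 - (1/2) ^ Suc n)) \<longlonglongrightarrow> ennreal (1 - 0)"
      by (intro tendsto_ennrealI tendsto_diff tendsto_const LIMSEQ_Suc LIMSEQ_realpow_zero) auto
    then show "1 \<le> (SUP n::nat. ennreal (1 - (1/2) ^ Suc n))"
      by (intro LIMSEQ_le_const2[of "\<lambda>n. ennreal (1 - (1/2) ^ Suc n)" 1] exI[of _ 0] allI impI SUP_upper UNIV_I) simp
  qed
  then have "?I = (SUP n::nat. ennreal (1 - (1/2) ^ Suc n)) * ?I" by simp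
  also have "\<dots> = (SUP n::nat. ennreal (1 - (1/2) ^ Suc n) * ?I)" by (rule SUP_mult_right_ennreal)
  also have "\<dots> \<le> ?R"
  proof (rule SUP_least)
    fix n :: nat
    have "(1/2::real) ^ Suc n \<le> (1/2) ^ 1" by (intro power_decreasing) auto
    then show "ennreal (1 - (1/2) ^ Suc n) * ?I \<le> ?R"
      by (intro area_lower_approx[where g=g, OF d D g inj]) auto
  qed
  finally show ?thesis .
qed

text \<open>Disjoint compact subsets of the images have positive distance, so their measures add up.\<close>

theorem area_lower_pieces:
  assumes d: "0 < d" and I: "finite I" and D: "\<And>i. i \<in> I \<Longrightarrow> open (D i)"
    and g: "\<And>i l. i \<in> I \<Longrightarrow> l < N \<Longrightarrow> C1_on d (D i) (\<lambda>w. g i w l)"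
    and inj: "\<And>i j x y. i \<in> I \<Longrightarrow> j \<in> I \<Longrightarrow> x \<in> D i \<inter> space (lb d) \<Longrightarrow> y \<in> D j \<inter> space (lb d) \<Longrightarrow> \<forall>l<N. g i x l = g j y l \<Longrightarrow> i = j \<and> x = y"
  shows "(\<Sum>i\<in>I. \<integral>\<^sup>+y\<in>D i. ennreal (J S d (g i) y) \<partial>lb d) \<le> hausdorff_measure dS d (\<Union>i\<in>I. g i ` (D i \<inter> space (lb d)))"
proof (rule ennreal_le_epsilon)
  let ?I = "\<lambda>i. \<integral>\<^sup>+y\<in>D i. ennreal (J S d (g i) y) \<partial>lb d" and ?H = "hausdorff_measure dS d (\<Union>i\<in>I. g i ` (D i \<inter> space (lb d)))"
  fix e :: real assume fin: "?H < Orderings.top" and e: "0 < e"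
  \<comment> \<open>The error is shared among the pieces; the added 1 avoids division by
    zero.\<close>
  define c where "c = e / real (card I + 1)"
  have c: "0 < c" using e by (simp add: c_def)
  have "\<exists>K. compact K \<and> K \<subseteq> D i \<inter> space (lb d) \<and> ?I i \<le> hausdorff_measure dS d (g i ` K) + ennreal c" if i: "i \<in> I" for i
  proof -
    define R where "R = (SUP K\<in>{K. compact K \<and> K \<subseteq> D i \<inter> space (lb d)}. hausdorff_measure dS d (g i ` K))"
    have IR: "?I i \<le> R" unfolding R_def using inj[OF i i] by (intro area_lower[where g="g i", OF d D[OF i] g[OF i]]) auto
    have "R \<le> ?H" unfolding R_def using i by (intro SUP_least hausdorff_mono) auto
    then have Rfin: "R < Orderings.top" using fin by simp
    show ?thesis
    proof (cases "R = 0")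
      case True
      then show ?thesis using IR by (intro exI[of _ "{}"]) auto
    next
      case False
      then have "R - ennreal c < R" using c Rfin by (intro ennreal_between) (auto simp: zero_less_iff_neq_zero)
      then obtain K where K: "compact K" "K \<subseteq> D i \<inter> space (lb d)" "R - ennreal c < hausdorff_measure dS d (g i ` K)"
        unfolding R_def less_SUP_iff by blast
      have "R \<le> hausdorff_measure dS d (g i ` K) + ennreal c"
        using K(3) by (metis ennreal_minus_le_iff add.commute less_imp_le ennreal_neq_top)
      then show ?thesis using K IR by (intro exI[of _ K]) auto
    qed
  qed
  then have "\<forall>i\<in>I. \<exists>K. compact K \<and> K \<subseteq> D i \<inter> space (lb d) \<and> ?I i \<le> hausdorff_measure dS d (g i ` K) + ennreal c" by blast
  from bchoice[OF this] obtain K where "\<forall>i\<in>I. compact (K i) \<and> K i \<subseteq> D i \<inter> space (lb d) \<and> ?I i \<le> hausdorff_measure dS d (g i ` K i) + ennreal c" ..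
  then have K: "compact (K i)" "K i \<subseteq> D i \<inter> space (lb d)" "?I i \<le> hausdorff_measure dS d (g i ` K i) + ennreal c" if "i \<in> I" for i
    using that by simp_all
  have "(\<Sum>i\<in>I. ?I i) \<le> (\<Sum>i\<in>I. hausdorff_measure dS d (g i ` K i) + ennreal c)" by (intro sum_mono K(3))
  also have "\<dots> = (\<Sum>i\<in>I. hausdorff_measure dS d (g i ` K i)) + ennreal (real (card I) * c)"
    using c by (simp add: sum.distrib ennreal_of_nat_eq_real_of_nat ennreal_mult)
  also have "\<dots> \<le> ?H + ennreal e"
  proof (intro add_mono ennreal_leI)
    have "(\<Sum>i\<in>I. hausdorff_measure dS d (g i ` K i)) \<le> hausdorff_measure dS d (\<Union>i\<in>I. g i ` K i)"
    proof (rule hausdorff_compact_pieces[OF I K(1)])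
      fix i l assume i: "i \<in> I" "l < N"
      then have "continuous_on (D i) (\<lambda>x. g i x l)" using g[OF i] by (simp add: C1_on_def)
      then show "continuous_on (K i) (\<lambda>x. g i x l)" by (rule continuous_on_subset) (use K(2)[OF i(1)] in auto)
    next
      fix i j x y assume ij: "i \<in> I" "j \<in> I" "i \<noteq> j" "x \<in> K i" "y \<in> K j"
      show "\<exists>l<N. g i x l \<noteq> g j y l"
      proof (rule ccontr)
        assume "\<not> ?thesis"
        then have "\<forall>l<N. g i x l = g j y l" by blast
        then show False using inj[OF ij(1,2)] K(2)[OF ij(1)] K(2)[OF ij(2)] ij by blast
      qed
    qed
    also have "\<dots> \<le> ?H" using K(2) by (intro hausdorff_mono UN_mono image_mono) auto
    finally show "(\<Sum>i\<in>I. hausdorff_measure dS d (g i ` K i)) \<le> ?H" .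
    show "real (card I) * c \<le> e" using e by (simp add: c_def field_simps)
  qed
  finally show "(\<Sum>i\<in>I. ?I i) \<le> ?H + ennreal e" .
qed

end

subsection \<open>Normalized coefficient vectors\<close>

lemma C1_onI:
  assumes "continuous_on D f"
    and "\<And>j. j < d \<Longrightarrow> \<exists>f'. continuous_on D f' \<and> (\<forall>z\<in>D. ((\<lambda>s. f (z(j := s))) has_field_derivative f' z) (at (z j)))"
  shows "C1_on d D f"
  unfolding C1_on_def
proof (intro conjI allI impI assms(1))
  fix j assume "j < d"
  from assms(2)[OF this] obtain f' where f': "continuous_on D f'"
    "\<And>z. z \<in> D \<Longrightarrow> ((\<lambda>s. f (z(j := s))) has_field_derivative f' z) (at (z j))" by blast
  have "pder j f z = f' z" if "z \<in> D" for z unfolding pder_def using f'(2)[OF that] by (rule DERIV_imp_deriv)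
  then show "continuous_on D (pder j f)" using f'(1) continuous_on_cong[of D D "pder j f" f'] by simp
  show "\<forall>z\<in>D. (\<lambda>s. f (z(j := s))) field_differentiable at (z j)"
    using f'(2) unfolding field_differentiable_def by blast
qed

lemma C1_onD:
  assumes "C1_on d D f"
  shows "continuous_on D f" "j < d \<Longrightarrow> continuous_on D (pder j f)"
    "j < d \<Longrightarrow> z \<in> D \<Longrightarrow> ((\<lambda>s. f (z(j := s))) has_field_derivative pder j f z) (at (z j))"
  using assms by (auto simp: C1_on_def pder_def DERIV_deriv_iff_field_differentiable)

lemma C1_const: "C1_on d D (\<lambda>z. c)"
  by (rule C1_onI) (auto intro!: exI[of _ "\<lambda>_. 0"])

lemma continuous_on_coord: "continuous_on D (\<lambda>z. z i :: real)"
  by (rule continuous_on_subset[OF continuous_on_product_coordinates]) simp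

lemma C1_coord: "C1_on d D (\<lambda>z. z i)"
proof (rule C1_onI)
  fix j
  show "\<exists>f'. continuous_on D f' \<and> (\<forall>z\<in>D. ((\<lambda>s. (z(j := s)) i) has_field_derivative f' z) (at (z j)))"
    by (cases "i = j") (auto intro!: exI[of _ "\<lambda>_. if i = j then 1 else 0"])
qed (rule continuous_on_coord)

lemma C1_add:
  assumes f: "C1_on d D f" and g: "C1_on d D g" shows "C1_on d D (\<lambda>z. f z + g z)"
proof (rule C1_onI)
  show "continuous_on D (\<lambda>z. f z + g z)" by (intro continuous_on_add C1_onD(1)[OF f] C1_onD(1)[OF g])
  fix j assume j: "j < d"
  show "\<exists>f'. continuous_on D f' \<and> (\<forall>z\<in>D. ((\<lambda>s. f (z(j := s)) + g (z(j := s))) has_field_derivative f' z) (at (z j)))"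
    by (intro exI[of _ "\<lambda>z. pder j f z + pder j g z"] conjI ballI continuous_on_add DERIV_add C1_onD[OF f] C1_onD[OF g] j)
qed

lemma C1_mult:
  assumes f: "C1_on d D f" and g: "C1_on d D g" shows "C1_on d D (\<lambda>z. f z * g z)"
proof (rule C1_onI)
  show "continuous_on D (\<lambda>z. f z * g z)" by (intro continuous_on_mult C1_onD(1)[OF f] C1_onD(1)[OF g])
  fix j assume j: "j < d"
  have "((\<lambda>s. f (z(j := s)) * g (z(j := s))) has_field_derivative pder j f z * g z + pder j g z * f z) (at (z j))" if "z \<in> D" for z
    using DERIV_mult[OF C1_onD(3)[OF f j that] C1_onD(3)[OF g j that]] by simp
  then show "\<exists>f'. continuous_on D f' \<and> (\<forall>z\<in>D. ((\<lambda>s. f (z(j := s)) * g (z(j := s))) has_field_derivative f' z) (at (z j)))"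
    by (intro exI[of _ "\<lambda>z. pder j f z * g z + pder j g z * f z"] conjI ballI continuous_on_add continuous_on_mult C1_onD[OF f] C1_onD[OF g] j)
qed

lemma C1_sum: "(\<And>i. i \<in> I \<Longrightarrow> C1_on d D (f i)) \<Longrightarrow> C1_on d D (\<lambda>z. \<Sum>i\<in>I. f i z)"
  by (induction I rule: infinite_finite_induct) (auto intro: C1_const C1_add)

lemma C1_compose:
  assumes f: "C1_on d D f" and \<phi>: "\<And>z. z \<in> D \<Longrightarrow> (\<phi> has_field_derivative \<phi>' (f z)) (at (f z))"
    and c: "continuous_on D (\<lambda>z. \<phi>' (f z))"
  shows "C1_on d D (\<lambda>z. \<phi> (f z))"
proof (rule C1_onI)
  have "continuous_on (f ` D) \<phi>"
    using \<phi> by (intro continuous_at_imp_continuous_on) (auto intro: DERIV_isCont)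
  then show "continuous_on D (\<lambda>z. \<phi> (f z))" by (rule continuous_on_compose2[OF _ C1_onD(1)[OF f]]) auto
  fix j assume j: "j < d"
  have "((\<lambda>s. \<phi> (f (z(j := s)))) has_field_derivative \<phi>' (f z) * pder j f z) (at (z j))" if z: "z \<in> D" for z
    using DERIV_chain2[of \<phi> "\<phi>' (f z)" "\<lambda>s. f (z(j := s))" "z j"] \<phi>[OF z] C1_onD(3)[OF f j z] by simp
  then show "\<exists>f'. continuous_on D f' \<and> (\<forall>z\<in>D. ((\<lambda>s. \<phi> (f (z(j := s)))) has_field_derivative f' z) (at (z j)))"
    by (intro exI[of _ "\<lambda>z. \<phi>' (f z) * pder j f z"] conjI ballI continuous_on_mult c C1_onD[OF f] j)
qed

lemma C1_cos: "C1_on d D f \<Longrightarrow> C1_on d D (\<lambda>z. cos (f z))"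
  by (rule C1_compose[where f=f and \<phi>=cos and \<phi>'="\<lambda>x. - sin x"])
    (assumption, rule DERIV_cos, intro continuous_on_minus continuous_on_sin C1_onD(1))

lemma C1_sin: "C1_on d D f \<Longrightarrow> C1_on d D (\<lambda>z. sin (f z))"
  by (rule C1_compose[where f=f and \<phi>=sin and \<phi>'=cos])
    (assumption, rule DERIV_sin, intro continuous_on_cos C1_onD(1))

lemma C1_inverse_sqrt:
  assumes f: "C1_on d D f" and pos: "\<And>z. z \<in> D \<Longrightarrow> 0 < f z"
  shows "C1_on d D (\<lambda>z. inverse (sqrt (f z)))"
proof (rule C1_compose[OF f, where \<phi>'="\<lambda>x. - (inverse (sqrt x) ^ 3 / 2)"])
  fix z assume "z \<in> D"
  then have x: "0 < f z" by (rule pos)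
  show "((\<lambda>x. inverse (sqrt x)) has_field_derivative - (inverse (sqrt (f z)) ^ 3 / 2)) (at (f z))"
    using x by (auto intro!: derivative_eq_intros simp: power3_eq_cube)
next
  show "continuous_on D (\<lambda>z. - (inverse (sqrt (f z)) ^ 3 / 2))"
    using pos by (intro continuous_intros C1_onD(1)[OF f]) (auto dest: pos)
qed

definition polyC1 :: "nat \<Rightarrow> (nat \<Rightarrow> real) set \<Rightarrow> ((nat \<Rightarrow> real) \<Rightarrow> real poly) \<Rightarrow> bool" where
  "polyC1 d D P \<longleftrightarrow> (\<forall>i. C1_on d D (\<lambda>z. coeff (P z) i))"

lemma polyC1_const: "polyC1 d D (\<lambda>z. p)" by (simp add: polyC1_def C1_const)
lemma polyC1_add: "polyC1 d D P \<Longrightarrow> polyC1 d D Q \<Longrightarrow> polyC1 d D (\<lambda>z. P z + Q z)"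
  by (simp add: polyC1_def C1_add)
lemma polyC1_mult: "polyC1 d D P \<Longrightarrow> polyC1 d D Q \<Longrightarrow> polyC1 d D (\<lambda>z. P z * Q z)"
  by (simp add: polyC1_def coeff_mult C1_sum C1_mult)
lemma polyC1_smult: "C1_on d D f \<Longrightarrow> polyC1 d D P \<Longrightarrow> polyC1 d D (\<lambda>z. Polynomial.smult (f z) (P z))"
  by (simp add: polyC1_def C1_mult)
lemma polyC1_power: "polyC1 d D P \<Longrightarrow> polyC1 d D (\<lambda>z. P z ^ n)"
  by (induction n) (auto intro: polyC1_const polyC1_mult)
lemma polyC1_prod: "(\<And>i. i \<in> I \<Longrightarrow> polyC1 d D (P i)) \<Longrightarrow> polyC1 d D (\<lambda>z. \<Prod>i\<in>I. P i z)"
  by (induction I rule: infinite_finite_induct) (auto intro: polyC1_const polyC1_mult)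
lemma polyC1_sum: "(\<And>i. i \<in> I \<Longrightarrow> polyC1 d D (P i)) \<Longrightarrow> polyC1 d D (\<lambda>z. \<Sum>i\<in>I. P i z)"
  by (induction I rule: infinite_finite_induct) (auto intro: polyC1_const polyC1_add)
lemma polyC1_monom: "C1_on d D f \<Longrightarrow> polyC1 d D (\<lambda>z. monom (f z) k)"
  unfolding polyC1_def
proof
  fix i assume "C1_on d D f"
  then show "C1_on d D (\<lambda>z. coeff (monom (f z) k) i)" by (cases "k = i") (simp_all add: C1_const)
qed
lemma polyC1_lin: "polyC1 d D (\<lambda>z. lin (z i))"
proof -
  have "(\<lambda>z::nat \<Rightarrow> real. lin (z i)) = (\<lambda>z. Polynomial.smult (z i) [:- 1:] + [:0, 1:])" by simp
  then show ?thesis by (simp only:) (intro polyC1_add polyC1_smult polyC1_const C1_coord)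
qed

lemma polyC1_kpoly:
  "C1_on d D x \<Longrightarrow> C1_on d D y \<Longrightarrow> polyC1 d D (\<lambda>z. kpoly T k (x z) (y z) z)"
  unfolding kpoly_def Pod_def Pev_def
  by (intro polyC1_add polyC1_smult polyC1_mult polyC1_const polyC1_prod polyC1_power polyC1_lin)

text \<open>With w the product of the inverse of \<open>S\<close> and x, the inverse form at x
  equals the form of \<open>S\<close> at w, and w is nonzero when x is. Symmetry of the inverse
  follows by transposing.\<close>

lemma pos_def_metric_mat:
  assumes "pos_def_mat N S" shows "metric_mat S N"
proof
  have S: "S \<in> carrier_mat N N" "transpose_mat S = S"
    and pos: "\<And>v. v \<in> carrier_vec N \<Longrightarrow> v \<noteq> 0\<^sub>v N \<Longrightarrow> 0 < scalar_prod v (mult_mat_vec S v)"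
    using assms by (auto simp: pos_def_mat_def)
  show "dim_row S = N" using S by simp
  have "Determinant.det S \<noteq> 0"
  proof
    assume "Determinant.det S = 0"
    then obtain v where v: "v \<in> carrier_vec N" "v \<noteq> 0\<^sub>v N" "S *\<^sub>v v = 0\<^sub>v N"
      using det_0_iff_vec_prod_zero_field[OF S(1)] by blast
    then show False using pos[OF v(1,2)] by simp
  qed
  then have "S \<in> Units (ring_mat TYPE(real) N ())" by (rule det_non_zero_imp_unit[OF S(1)])
  then obtain B where B0: "mat_inverse S = Some B" using mat_inverse(1)[OF S(1), where b="()"] by (cases "mat_inverse S") auto
  then have B: "S * B = 1\<^sub>m N" "B * S = 1\<^sub>m N" "B \<in> carrier_mat N N" using mat_inverse(2)[OF S(1)] by auto
  have inv: "inv_mat S = B" by (simp add: inv_mat_def B0)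
  have "transpose_mat B * S = 1\<^sub>m N"
    using transpose_mult[OF S(1) B(3)] B(1) S(2) by simp
  then have "transpose_mat B = transpose_mat B * (S * B)" using B by simp
  also have "\<dots> = (transpose_mat B * S) * B" using B S by (intro assoc_mult_mat[symmetric]) auto
  also have "\<dots> = B" using \<open>transpose_mat B * S = 1\<^sub>m N\<close> B by simp
  finally have sym: "transpose_mat B = B" .
  show "pd N (inv_mat S)"
    unfolding inv pd_def
  proof (intro conjI allI impI)
    fix i j assume "i < N" "j < N"
    then show "B $$ (i, j) = B $$ (j, i)" using arg_cong[OF sym, of "\<lambda>A. A $$ (j, i)"] B(3) by simp
  next
    fix x :: "nat \<Rightarrow> real" assume x: "\<exists>i<N. x i \<noteq> 0"
    define v where "v = Matrix.vec N x"
    define w where "w = B *\<^sub>v v"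
    have v: "v \<in> carrier_vec N" and w: "w \<in> carrier_vec N" using B(3) by (auto simp: v_def w_def)
    have Sw: "S *\<^sub>v w = v"
    proof -
      have "S *\<^sub>v w = (S * B) *\<^sub>v v" unfolding w_def by (rule assoc_mult_mat_vec[symmetric, OF S(1) B(3) v])
      then show ?thesis using B v by simp
    qed
    have "v \<noteq> 0\<^sub>v N"
    proof
      assume v0: "v = 0\<^sub>v N"
      from x obtain i where "i < N" "x i \<noteq> 0" by blast
      then show False using arg_cong[OF v0, of "\<lambda>u. u $ i"] by (simp add: v_def)
    qed
    then have "w \<noteq> 0\<^sub>v N" using Sw S(1) by auto
    then have "0 < scalar_prod w (S *\<^sub>v w)" using pos[OF w] by simp
    also have "\<dots> = scalar_prod v w" unfolding Sw by (rule comm_scalar_prod[OF w v])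
    also have "\<dots> = qform N B x"
      using B(3) unfolding w_def qform_def v_def
      by (simp add: scalar_prod_def lessThan_atLeast0 sum_distrib_left mult.assoc)
    finally show "0 < qform N B x" .
  qed (rule B(3))
qed

context metric_mat
begin

lemma norm_inv_pos: "i < N \<Longrightarrow> v i \<noteq> 0 \<Longrightarrow> 0 < norm_inv S v"
  unfolding norm_inv_eq_qnorm qnorm_def dim using pd_pos[OF pdM, of i v] by simp

lemma norm_inv_poly_pos:
  assumes "p \<noteq> 0" "degree p < N" shows "0 < norm_inv S (coeff p)"
  using assms by (intro norm_inv_pos[of "degree p"]) auto

lemma norm_inv_scale: "norm_inv S (\<lambda>i. c * v i) = \<bar>c\<bar> * norm_inv S v"
  unfolding norm_inv_eq_qnorm by (rule qnorm_scale)

lemma normalized_eq: "normalized S v = (\<lambda>i. inverse (norm_inv S v) * v i)"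
  by (simp add: normalized_def divide_inverse mult.commute)

lemma normalized_smult: "0 < c \<Longrightarrow> normalized S (coeff (Polynomial.smult c p)) = normalized S (coeff p)"
proof -
  assume "0 < c"
  moreover have "coeff (Polynomial.smult c p) = (\<lambda>i. c * coeff p i)" by auto
  ultimately show ?thesis unfolding normalized_def by (simp only: norm_inv_scale) (simp add: fun_eq_iff)
qed

lemma normalized_C1:
  assumes P: "polyC1 d D P" and nz: "\<And>z. z \<in> D \<Longrightarrow> P z \<noteq> 0 \<and> degree (P z) < N"
  shows "C1_on d D (\<lambda>z. normalized S (coeff (P z)) i)"
proof -
  have c: "C1_on d D (\<lambda>z. coeff (P z) i)" for i using P by (simp add: polyC1_def)
  have "C1_on d D (\<lambda>z. qform N M (coeff (P z)))"
    unfolding qform_def by (intro C1_sum C1_mult c C1_const)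
  moreover have "0 < qform N M (coeff (P z))" if "z \<in> D" for z
    using nz[OF that] by (intro pd_pos[OF pdM, of "degree (P z)"]) auto
  ultimately have "C1_on d D (\<lambda>z. inverse (sqrt (qform N M (coeff (P z)))) * coeff (P z) i)"
    by (intro C1_mult C1_inverse_sqrt c)
  then show ?thesis unfolding normalized_eq norm_inv_eq_qnorm qnorm_def dim .
qed

lemma unit_sphere_iff: "c \<in> unit_sphere S \<longleftrightarrow> (\<forall>i\<ge>N. c i = 0) \<and> norm_inv S c = 1"
  by (auto simp: unit_sphere_def topspace_Euclidean_space dim norm_inv_def)

lemma unit_sphere_normalized: "c \<in> unit_sphere S \<Longrightarrow> normalized S c = c"
  by (simp add: unit_sphere_iff normalized_def)

lemma normalized_in_sphere:
  assumes "p \<noteq> 0" "degree p < N" shows "normalized S (coeff p) \<in> unit_sphere S"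
proof -
  have pos: "0 < norm_inv S (coeff p)" using assms by (rule norm_inv_poly_pos)
  then have "norm_inv S (normalized S (coeff p)) = 1" unfolding normalized_eq norm_inv_scale by simp
  then show ?thesis using assms by (simp add: unit_sphere_iff normalized_def coeff_eq_0)
qed

lemma normalized_eqD:
  assumes "p \<noteq> 0" "degree p < N" "q \<noteq> 0" "degree q < N" "\<forall>i<N. normalized S (coeff p) i = normalized S (coeff q) i"
  shows "\<exists>c>0. p = Polynomial.smult c q"
proof -
  define a b where "a = norm_inv S (coeff p)" and "b = norm_inv S (coeff q)"
  have ab: "0 < a" "0 < b" using assms norm_inv_poly_pos by (auto simp: a_def b_def)
  have "p = Polynomial.smult (a / b) q"
  proof (rule poly_eqI)
    fix i
    show "coeff p i = coeff (Polynomial.smult (a / b) q) i"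
    proof (cases "i < N")
      case True
      then have "coeff p i / a = coeff q i / b" using assms(5) by (simp add: normalized_def a_def b_def)
      then show ?thesis using ab by (simp add: field_simps)
    next
      case False
      then show ?thesis using assms by (simp add: coeff_eq_0)
    qed
  qed
  then show ?thesis using ab by (intro exI[of _ "a / b"]) auto
qed

text \<open>A family with fewer than \<open>d\<close> effective parameters: one coefficient of \<open>r\<close> can be normalized to
  \<open>1\<close> or \<open>-1\<close>, so that the parametrization does not depend on the corresponding variable and its
  Jacobian vanishes.\<close>

lemma null_family:
  assumes d: "0 < d" and U: "polyC1 d UNIV U" and dep: "\<And>z z'. (\<forall>i<e. z i = z' i) \<Longrightarrow> U z = U z'"
    and U0: "\<And>z. U z \<noteq> 0" and deg: "\<And>z. degree (U z) + K \<le> N" and eK: "K = 0 \<or> e + K \<le> d"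
  shows "hausdorff_measure dS d {c \<in> unit_sphere S. \<exists>z r. degree r < K \<and> c = coeff (U z * r)} = 0"
proof -
  let ?H = "hausdorff_measure dS d" and ?X = "{c \<in> unit_sphere S. \<exists>z r. degree r < K \<and> c = coeff (U z * r)}"
  \<comment> \<open>The coefficients of r are read off the variables from index e on, except that
    the j-th one is the constant \<sigma>. The variable with index e + j is thereby left without
    influence.\<close>
  define R where "R j \<sigma> w = (\<Sum>i<K. monom (if i = j then \<sigma> else w (e + i)) i)" for j \<sigma> and w :: "nat \<Rightarrow> real"
  define F where "F j \<sigma> w = U w * R j \<sigma> w" for j \<sigma> w
  define g where "g j \<sigma> w = normalized S (coeff (F j \<sigma> w))" for j \<sigma> w
  have coeffR: "coeff (R j \<sigma> w) i = (if i < K then (if i = j then \<sigma> else w (e + i)) else 0)" for j \<sigma> w i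
    by (simp add: R_def coeff_sum)
  have null: "?H (g j \<sigma> ` (UNIV \<inter> space (lb d))) = 0" if j: "j < K" and \<sigma>: "\<sigma> \<noteq> 0" for j \<sigma>
  proof -
    have ej: "e + j < d" using eK j by auto
    have Rnz: "R j \<sigma> w \<noteq> 0" for w using coeffR[of j \<sigma> w j] j \<sigma> by auto
    have Fnz: "F j \<sigma> w \<noteq> 0" for w using Rnz U0 by (simp add: F_def)
    have Rdeg: "degree (R j \<sigma> w) \<le> K - 1" for w by (rule degree_le) (auto simp: coeffR)
    have Fdeg: "degree (F j \<sigma> w) < N" for w
      unfolding F_def using degree_mult_le[of "U w" "R j \<sigma> w"] Rdeg[of w] deg[of w] j by linarith
    have C1R: "polyC1 d UNIV (R j \<sigma>)"
    proof -
      have "C1_on d UNIV (\<lambda>w. if i = j then \<sigma> else w (e + i))" for i by (cases "i = j") (auto intro: C1_const C1_coord)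
      then show ?thesis unfolding R_def by (intro polyC1_sum polyC1_monom)
    qed
    have C1: "C1_on d UNIV (\<lambda>w. g j \<sigma> w i)" for i
      unfolding g_def by (rule normalized_C1) (use Fnz Fdeg polyC1_mult[OF U C1R] in \<open>auto simp: F_def\<close>)
    have indep: "F j \<sigma> (w(e + j := s)) = F j \<sigma> w" for w s
    proof -
      have "U (w(e + j := s)) = U w" by (rule dep) auto
      moreover have "R j \<sigma> (w(e + j := s)) = R j \<sigma> w" by (rule poly_eqI) (simp add: coeffR)
      ultimately show ?thesis by (simp add: F_def)
    qed
    have "pder (e + j) (\<lambda>w. g j \<sigma> w i) z = 0" for i z
      unfolding pder_def g_def indep by simp
    \<comment> \<open>The unit vector of the ignored variable is a null vector of the Gram
      matrix.\<close>
    then have q0: "qform d (gram S d (g j \<sigma>) z) (\<lambda>a. if a = e + j then 1 else 0) = 0" for z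
      unfolding qform_gram by (subst qform_zero) (auto simp: if_distrib sum.If_cases cong: if_cong)
    have "J S d (g j \<sigma>) z = 0" for z
    proof (rule ccontr)
      assume "J S d (g j \<sigma>) z \<noteq> 0"
      then have "pd d (gram S d (g j \<sigma>) z)" by (intro gram_pd_if_det) (auto simp: J_eq)
      from pd_zero[OF this q0 ej] show False by simp
    qed
    then have "(\<integral>\<^sup>+y\<in>UNIV. ennreal (J S d (g j \<sigma>) y) \<partial>lb d) = 0" by simp
    then show ?thesis using area_upper[where g="g j \<sigma>", OF d open_UNIV C1] by simp
  qed
  have "?X \<subseteq> (\<Union>p\<in>{..<K} \<times> {1, -1}. g (fst p) (snd p) ` (UNIV \<inter> space (lb d)))"
  proof
    fix c assume "c \<in> ?X"
    then obtain z r where c: "c \<in> unit_sphere S" "degree r < K" "c = coeff (U z * r)" by blast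
    have "r \<noteq> 0"
    proof
      assume "r = 0"
      then have "norm_inv S c = 0" by (simp add: c(3) norm_inv_eq_qnorm qnorm_def qform_def)
      then show False using c(1) by (simp add: unit_sphere_iff)
    qed
    define j where "j = degree r"
    \<comment> \<open>Dividing r by the absolute value of its leading coefficient leaves the point
      of the sphere unchanged and makes that coefficient 1 or -1.\<close>
    define \<alpha> where "\<alpha> = \<bar>coeff r j\<bar>"
    define \<sigma> where "\<sigma> = sgn (coeff r j)"
    have j: "j < K" "coeff r j \<noteq> 0" using c(2) \<open>r \<noteq> 0\<close> by (auto simp: j_def)
    then have \<alpha>: "0 < \<alpha>" "coeff r j = \<alpha> * \<sigma>" "\<sigma> \<in> {1, -1}" by (auto simp: \<alpha>_def \<sigma>_def abs_sgn sgn_if mult.commute)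
    define w where "w = (\<lambda>i\<in>{..<d}. if i < e then z i else coeff r (i - e) / \<alpha>)"
    have eKd: "e + K \<le> d" using eK j by auto
    have "U w = U z" by (rule dep) (use eKd in \<open>auto simp: w_def\<close>)
    moreover have "Polynomial.smult \<alpha> (R j \<sigma> w) = r"
    proof (rule poly_eqI)
      fix i show "coeff (Polynomial.smult \<alpha> (R j \<sigma> w)) i = coeff r i"
        using \<alpha> eKd c(2) by (auto simp: coeffR w_def coeff_eq_0)
    qed
    ultimately have "U z * r = Polynomial.smult \<alpha> (F j \<sigma> w)" unfolding F_def by (metis mult_smult_right)
    then have "c = normalized S (coeff (Polynomial.smult \<alpha> (F j \<sigma> w)))" using unit_sphere_normalized[OF c(1)] c(3) by simp
    then have "c = g j \<sigma> w" unfolding g_def using \<alpha>(1) by (simp only: normalized_smult)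
    moreover have "w \<in> UNIV \<inter> space (lb d)" by (simp add: w_def space_PiM)
    ultimately show "c \<in> (\<Union>p\<in>{..<K} \<times> {1, -1}. g (fst p) (snd p) ` (UNIV \<inter> space (lb d)))"
      using j(1) \<alpha>(3) by (intro UN_I[of "(j, \<sigma>)"]) auto
  qed
  then have "?H ?X \<le> ?H (\<Union>p\<in>{..<K} \<times> {1, -1}. g (fst p) (snd p) ` (UNIV \<inter> space (lb d)))" by (rule hausdorff_mono)
  also have "\<dots> = 0" by (rule hausdorff_UN_null) (use null in auto)
  finally show ?thesis by simp
qed

end

subsection \<open>The boundary of the cone\<close>

definition nonneg_on :: "poly_domain \<Rightarrow> real poly \<Rightarrow> bool" where
  "nonneg_on T p \<longleftrightarrow> (\<forall>t\<in>points T. 0 \<le> poly p t)"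

lemma coeff_function_poly:
  assumes "\<And>i. n < i \<Longrightarrow> c i = (0::real)"
  obtains p where "coeff p = c" "degree p \<le> n"
proof -
  define p where "p = (\<Sum>i\<le>n. monom (c i) i)"
  have "coeff p i = c i" for i using assms[of i] by (auto simp: p_def coeff_sum not_le)
  moreover from this have "degree p \<le> n" using assms by (intro degree_le) auto
  ultimately show ?thesis by (intro that[of p]) auto
qed

lemma nonneg_cone_iff:
  "c \<in> nonneg_cone n T \<longleftrightarrow> (\<exists>p. c = coeff p \<and> degree p \<le> n \<and> nonneg_on T p)"
proof
  assume c: "c \<in> nonneg_cone n T"
  then have "c i = 0" if "n < i" for i using that by (simp add: nonneg_cone_def topspace_Euclidean_space)
  then obtain p where p: "coeff p = c" "degree p \<le> n" by (rule coeff_function_poly)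
  then show "\<exists>p. c = coeff p \<and> degree p \<le> n \<and> nonneg_on T p"
    using c by (intro exI[of _ p]) (auto simp: nonneg_cone_def nonneg_on_def poly_sum_coeff)
next
  assume "\<exists>p. c = coeff p \<and> degree p \<le> n \<and> nonneg_on T p"
  then show "c \<in> nonneg_cone n T"
    by (auto simp: nonneg_cone_def nonneg_on_def poly_sum_coeff topspace_Euclidean_space coeff_eq_0)
qed

lemma unbounded_points:
  assumes "\<forall>a b. T \<noteq> Segment a b" shows "\<exists>A. \<forall>t\<ge>A. t \<in> points T"
  using assms by (cases T) auto

lemma nonneg_coeff:
  assumes T: "\<forall>a b. T \<noteq> Segment a b" and p: "degree p \<le> n" "nonneg_on T p"
  shows "0 \<le> coeff p n"
proof (rule ccontr)
  assume neg: "\<not> 0 \<le> coeff p n"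
  then have "degree p = n" using p(1) by (intro antisym le_degree) auto
  then have "0 < lead_coeff (- p)" using neg by simp
  then obtain m where m: "\<And>x. m \<le> x \<Longrightarrow> lead_coeff (- p) \<le> poly (- p) x" using poly_pinfty_gt_lc by blast
  obtain A where A: "\<And>t. A \<le> t \<Longrightarrow> t \<in> points T" using unbounded_points[OF T] by blast
  have "0 \<le> poly p (max m A)" using p(2) A by (simp add: nonneg_on_def)
  then show False using m[of "max m A"] \<open>0 < lead_coeff (- p)\<close> by simp
qed

lemma spos_nonneg: "spos T n p \<Longrightarrow> nonneg_on T p"
  by (auto simp: spos_def nonneg_on_def intro: less_imp_le)

lemma not_spos_cases:
  assumes "degree p \<le> n" "nonneg_on T p" "\<not> spos T n p"
  obtains t where "t \<in> points T" "poly p t = 0" | "\<forall>a b. T \<noteq> Segment a b" "coeff p n = 0"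
proof (cases "\<exists>t\<in>points T. poly p t = 0")
  case False
  then have "\<forall>t\<in>points T. 0 < poly p t" using assms(2) by (auto simp: nonneg_on_def less_le)
  then have "\<forall>a b. T \<noteq> Segment a b" "\<not> 0 < coeff p n" using assms(1,3) by (cases T; auto simp: spos_def)+
  then show ?thesis using that(2) nonneg_coeff[OF _ assms(1,2)] by fastforce
qed (use that(1) in blast)

text \<open>Beyond \<open>R\<close> the leading term is at least twice the sum of the others. There
  t^n = |t|^n on T, since t is positive on the half line and n is even on the full line.\<close>

lemma spos_growth:
  assumes adm: "admissible n T" and p: "spos T n p"
  shows "\<exists>R\<ge>1. \<exists>l>0. \<forall>t\<in>points T. R \<le> \<bar>t\<bar> \<longrightarrow> l * \<bar>t\<bar> ^ n \<le> poly p t"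
proof (cases "\<exists>a b. T = Segment a b")
  case True
  then obtain a b where T: "T = Segment a b" by blast
  \<comment> \<open>\<open>R\<close> exceeds the absolute value of every point of the segment, so
    nothing remains to be bounded.\<close>
  show ?thesis by (intro exI[of _ "\<bar>a\<bar> + \<bar>b\<bar> + 1"] conjI exI[of _ 1]) (auto simp: T)
next
  case False
  have l: "0 < coeff p n" using p False by (cases T) (auto simp: spos_def)
  have dp: "degree p \<le> n" using p by (simp add: spos_def)
  obtain a where a: "\<And>t. t \<in> points T \<Longrightarrow> \<bar>a\<bar> < \<bar>t\<bar> \<Longrightarrow> t ^ n = \<bar>t\<bar> ^ n"
  proof (cases T)
    case (Half_line a)
    show ?thesis by (rule that[of a]) (auto simp: Half_line abs_if split: if_splits)
  next
    case Full_line
    then have "even n" using adm by simp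
    then show ?thesis by (intro that[of 0]) (simp add: power_even_abs)
  qed (use False in auto)
  define C where "C = (\<Sum>i<n. \<bar>coeff p i\<bar>)"
  have C: "0 \<le> C" unfolding C_def by (intro sum_nonneg) auto
  define R where "R = 1 + \<bar>a\<bar> + 2 * C / coeff p n"
  have R: "1 \<le> R" "\<bar>a\<bar> < R" "2 * C / coeff p n \<le> R"
  proof -
    have "0 \<le> 2 * C / coeff p n" using C l by simp
    then show "1 \<le> R" "\<bar>a\<bar> < R" "2 * C / coeff p n \<le> R" unfolding R_def by linarith+
  qed
  have "coeff p n / 2 * \<bar>t\<bar> ^ n \<le> poly p t" if t: "t \<in> points T" "R \<le> \<bar>t\<bar>" for t
  proof -
    have t1: "1 \<le> \<bar>t\<bar>" using R t by linarith
    have "\<bar>\<Sum>i<n. coeff p i * t ^ i\<bar> \<le> (\<Sum>i<n. \<bar>coeff p i\<bar> * \<bar>t\<bar> ^ (n - 1))"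
    proof (rule order_trans[OF sum_abs], intro sum_mono)
      fix i assume "i \<in> {..<n}"
      then have "\<bar>t\<bar> ^ i \<le> \<bar>t\<bar> ^ (n - 1)" using t1 by (intro power_increasing) auto
      then show "\<bar>coeff p i * t ^ i\<bar> \<le> \<bar>coeff p i\<bar> * \<bar>t\<bar> ^ (n - 1)"
        by (simp add: abs_mult power_abs mult_left_mono)
    qed
    also have "\<dots> = C * \<bar>t\<bar> ^ (n - 1)" by (simp add: C_def sum_distrib_right)
    also have "\<dots> \<le> coeff p n / 2 * \<bar>t\<bar> ^ n"
    proof (cases n)
      case (Suc m)
      have "2 * C / coeff p n \<le> \<bar>t\<bar>" using R t by linarith
      then have "C \<le> coeff p n / 2 * \<bar>t\<bar>" using l by (simp add: field_simps)
      then have "C * \<bar>t\<bar> ^ m \<le> coeff p n / 2 * \<bar>t\<bar> * \<bar>t\<bar> ^ m" by (intro mult_right_mono) auto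
      then show ?thesis by (simp add: Suc mult.assoc)
    qed (use l in \<open>simp add: C_def\<close>)
    finally have "\<bar>\<Sum>i<n. coeff p i * t ^ i\<bar> \<le> coeff p n / 2 * \<bar>t\<bar> ^ n" .
    moreover have "poly p t = (\<Sum>i<n. coeff p i * t ^ i) + coeff p n * \<bar>t\<bar> ^ n"
      unfolding poly_sum_coeff[OF dp] lessThan_Suc_atMost[symmetric] using a[OF t(1)] R t by simp
    ultimately show ?thesis by linarith
  qed
  then show ?thesis using R(1) l by (intro exI[of _ R] conjI exI[of _ "coeff p n / 2"]) auto
qed

lemma closed_points: "closed (points T)" by (cases T) auto

text \<open>On T within distance \<open>R\<close> of 0 compactness gives a positive lower bound m,
  and farther out the polynomial exceeds l |t|^n. Changing the coefficients by less than
  \<open>e\<close> changes the value by at most e (n + 1) X^n, where X is at least 1 and at least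
  |t|; the two entries of the minimum defining \<open>e\<close> serve the two regions.\<close>

lemma spos_perturb:
  assumes adm: "admissible n T" and p: "spos T n p"
  shows "\<exists>e>0. \<forall>q. degree q \<le> n \<and> (\<forall>i\<le>n. \<bar>coeff q i - coeff p i\<bar> < e) \<longrightarrow> nonneg_on T q"
proof -
  obtain R l where R: "1 \<le> R" "0 < l" "\<And>t. t \<in> points T \<Longrightarrow> R \<le> \<bar>t\<bar> \<Longrightarrow> l * \<bar>t\<bar> ^ n \<le> poly p t"
    using spos_growth[OF adm p] by blast
  have dp: "degree p \<le> n" using p by (simp add: spos_def)
  obtain m where m: "0 < m" "\<And>t. t \<in> points T \<Longrightarrow> \<bar>t\<bar> \<le> R \<Longrightarrow> m \<le> poly p t"
  proof (cases "points T \<inter> {-R..R} = {}")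
    case True
    then show ?thesis by (intro that[of 1]) (auto simp: abs_le_iff)
  next
    case False
    have "compact (points T \<inter> {-R..R})" by (intro closed_Int_compact closed_points) auto
    moreover have "continuous_on (points T \<inter> {-R..R}) (poly p)" by (intro continuous_intros)
    ultimately obtain s where s: "s \<in> points T \<inter> {-R..R}" "\<forall>t\<in>points T \<inter> {-R..R}. poly p s \<le> poly p t"
      using continuous_attains_inf[of "points T \<inter> {-R..R}" "poly p"] False by blast
    then show ?thesis using p by (intro that[of "poly p s"]) (auto simp: spos_def abs_le_iff)
  qed
  define e where "e = min (l / (n + 1)) (m / ((n + 1) * R ^ n))"
  have e: "0 < e" "e * (n + 1) \<le> l" "e * (n + 1) * R ^ n \<le> m"
  proof -
    show "0 < e" using R m by (simp add: e_def)
    have "e \<le> l / (n + 1)" "e \<le> m / ((n + 1) * R ^ n)" by (simp_all add: e_def)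
    then show "e * (n + 1) \<le> l" "e * (n + 1) * R ^ n \<le> m" using R(1) by (simp_all add: pos_le_divide_eq mult.assoc)
  qed
  have "nonneg_on T q" if q: "degree q \<le> n" "\<forall>i\<le>n. \<bar>coeff q i - coeff p i\<bar> < e" for q
    unfolding nonneg_on_def
  proof
    fix t assume t: "t \<in> points T"
    have bound: "\<bar>poly q t - poly p t\<bar> \<le> e * (n + 1) * X ^ n" if X: "1 \<le> X" "\<bar>t\<bar> \<le> X" for X
    proof -
      have "poly q t - poly p t = (\<Sum>i\<le>n. (coeff q i - coeff p i) * t ^ i)"
        by (simp add: poly_sum_coeff[OF dp] poly_sum_coeff[OF q(1)] sum_subtractf left_diff_distrib)
      also have "\<bar>\<dots>\<bar> \<le> (\<Sum>i\<le>n. e * X ^ n)"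
      proof (rule order_trans[OF sum_abs], intro sum_mono)
        fix i assume i: "i \<in> {..n}"
        have "\<bar>t\<bar> ^ i \<le> X ^ i" using X by (intro power_mono) auto
        also have "\<dots> \<le> X ^ n" using X i by (intro power_increasing) auto
        finally have "\<bar>t\<bar> ^ i \<le> X ^ n" .
        then show "\<bar>(coeff q i - coeff p i) * t ^ i\<bar> \<le> e * X ^ n"
          unfolding abs_mult power_abs using q(2) i e(1) by (intro mult_mono) (auto intro: less_imp_le)
      qed
      finally show ?thesis by (simp add: algebra_simps)
    qed
    show "0 \<le> poly q t"
    proof (cases "R \<le> \<bar>t\<bar>")
      case True
      have "e * (n + 1) * \<bar>t\<bar> ^ n \<le> l * \<bar>t\<bar> ^ n" using e by (intro mult_right_mono) auto
      then show ?thesis using bound[of "\<bar>t\<bar>"] R(1) R(3)[OF t True] True by linarith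
    next
      case False
      then show ?thesis using bound[of R] R(1) m(2)[OF t] e(3) by linarith
    qed
  qed
  then show ?thesis using e(1) by blast
qed

lemma closed_nonneg_cone: "closed (nonneg_cone n T)"
proof -
  have cc: "continuous_on UNIV (\<lambda>c::nat \<Rightarrow> real. c i)" for i by (rule continuous_on_product_coordinates)
  have "nonneg_cone n T = (\<Inter>i\<in>{n + 1..}. {c. c i = 0}) \<inter> (\<Inter>t\<in>points T. {c. 0 \<le> (\<Sum>i\<le>n. c i * t ^ i)})"
    by (auto simp: nonneg_cone_def topspace_Euclidean_space)
  moreover have "closed {c::nat \<Rightarrow> real. c i = 0}" for i by (intro closed_Collect_eq cc continuous_on_const)
  moreover have "closed {c::nat \<Rightarrow> real. 0 \<le> (\<Sum>i\<le>n. c i * t ^ i)}" for t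
    by (intro closed_Collect_le continuous_on_sum continuous_on_mult cc continuous_on_const)
  ultimately show ?thesis by (auto intro!: closed_Int closed_INT)
qed

lemma openin_Euclidean_space_iff:
  "openin (Euclidean_space m) W \<longleftrightarrow> (\<exists>V. open V \<and> W = V \<inter> topspace (Euclidean_space m))"
proof -
  have "topspace (Euclidean_space m) = {x. \<forall>i\<ge>m. x i = 0}" by (rule topspace_Euclidean_space)
  then show ?thesis
    by (simp only: Euclidean_space_def openin_subtopology euclidean_product_topology open_openin)
qed

text \<open>The cone is closed, so its frontier consists of its non-interior points. Strictly
  positive polynomials are interior by perturbation. Otherwise a small multiple of 1, for a zero in
  T, or of t^n, for a zero at infinity, can be subtracted to leave the cone.\<close>

lemma frontier_nonneg_cone:
  assumes adm: "admissible n T"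
  shows "Euclidean_space (n + 1) frontier_of nonneg_cone n T = {coeff p | p. degree p \<le> n \<and> nonneg_on T p \<and> \<not> spos T n p}"
proof -
  let ?X = "Euclidean_space (n + 1)" and ?C = "nonneg_cone n T"
  have sub: "?C \<subseteq> topspace ?X" by (auto simp: nonneg_cone_def)
  have "closedin ?X ?C" unfolding closedin_Euclidean_space_iff using sub closed_nonneg_cone by simp
  then have fr: "?X frontier_of ?C = ?C - ?X interior_of ?C" by (simp add: frontier_of_def closure_of_closedin)
  have top: "coeff p \<in> topspace ?X \<longleftrightarrow> degree p \<le> n" for p :: "real poly"
    by (auto simp: topspace_Euclidean_space coeff_eq_0 intro: degree_le)
  have 1: "coeff p \<in> ?X interior_of ?C" if p: "spos T n p" for p
  proof -
    obtain e where e: "0 < e" "\<And>q. degree q \<le> n \<Longrightarrow> (\<forall>i\<le>n. \<bar>coeff q i - coeff p i\<bar> < e) \<Longrightarrow> nonneg_on T q"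
      using spos_perturb[OF adm p] by blast
    define W where "W = (\<Inter>i\<in>{..n}. {c::nat \<Rightarrow> real. \<bar>c i - coeff p i\<bar> < e})"
    have "open W" unfolding W_def
      by (intro open_INT ballI open_Collect_less continuous_on_rabs continuous_on_diff continuous_on_const continuous_on_product_coordinates) auto
    then have oW: "openin ?X (W \<inter> topspace ?X)"
      unfolding openin_Euclidean_space_iff by (intro exI[of _ W] conjI refl)
    have "W \<inter> topspace ?X \<subseteq> ?C"
    proof
      fix c assume c: "c \<in> W \<inter> topspace ?X"
      then have "c i = 0" if "n < i" for i using that by (simp add: topspace_Euclidean_space)
      then obtain q where q: "coeff q = c" "degree q \<le> n" by (rule coeff_function_poly)
      then have "nonneg_on T q" using c by (intro e(2)) (auto simp: W_def)
      then show "c \<in> ?C" using q nonneg_cone_iff by blast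
    qed
    moreover have "coeff p \<in> W \<inter> topspace ?X" using e(1) p top by (auto simp: W_def spos_def)
    ultimately show ?thesis using oW unfolding interior_of_def by blast
  qed
  have 2: "spos T n p" if p: "degree p \<le> n" "nonneg_on T p" and int: "coeff p \<in> ?X interior_of ?C" for p
  proof (rule ccontr)
    assume ns: "\<not> spos T n p"
    from int obtain W where W: "openin ?X W" "coeff p \<in> W" "W \<subseteq> ?C" by (auto simp: interior_of_def)
    then obtain V where V: "open V" "W = V \<inter> topspace ?X"
      unfolding openin_Euclidean_space_iff by (elim exE conjE)
    have small: "\<exists>s>0. nonneg_on T (p - Polynomial.smult s q)" if q: "degree q \<le> n" for q
    proof -
      define \<phi> where "\<phi> s = (\<lambda>i. coeff p i - s * coeff q i)" for s
      have "continuous_on UNIV \<phi>" unfolding \<phi>_def by (intro continuous_on_coordinatewise_then_product continuous_intros)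
      then have "open (\<phi> -` V)" using V(1) by (rule open_vimage[rotated])
      moreover have "0 \<in> \<phi> -` V" using W(2) V(2) by (simp add: \<phi>_def)
      ultimately obtain d where d: "0 < d" "ball 0 d \<subseteq> \<phi> -` V" using open_contains_ball by blast
      have "d / 2 \<in> ball 0 d" using d(1) by (simp add: dist_real_def)
      then have "\<phi> (d / 2) \<in> V" using d(2) by blast
      moreover have eq: "\<phi> (d / 2) = coeff (p - Polynomial.smult (d / 2) q)" by (auto simp: \<phi>_def)
      moreover have dg: "degree (p - Polynomial.smult (d / 2) q) \<le> n"
        using p(1) q by (intro degree_diff_le order_trans[OF degree_smult_le])
      ultimately have "coeff (p - Polynomial.smult (d / 2) q) \<in> W" using V(2) top by simp
      then have "coeff (p - Polynomial.smult (d / 2) q) \<in> ?C" using W(3) by blast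
      then show ?thesis using d(1) unfolding nonneg_cone_iff coeff_inject by (intro exI[of _ "d / 2"]) auto
    qed
    from not_spos_cases[OF p ns] show False
    proof cases
      case (1 t)
      obtain s where s: "0 < s" "nonneg_on T (p - Polynomial.smult s 1)" using small[of 1] by auto
      have "0 \<le> poly (p - Polynomial.smult s 1) t" using s(2) 1(1) unfolding nonneg_on_def by blast
      then show False using 1(2) s(1) by simp
    next
      case 2
      have dm: "degree (monom (1::real) n) \<le> n" by (rule degree_monom_le)
      then obtain s where s: "0 < s" "nonneg_on T (p - Polynomial.smult s (monom 1 n))" using small by blast
      have "0 \<le> coeff (p - Polynomial.smult s (monom 1 n)) n"
        by (rule nonneg_coeff[OF 2(1) _ s(2)]) (intro degree_diff_le p order_trans[OF degree_smult_le] dm)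
      then show False using 2(2) s(1) by simp
    qed
  qed
  show ?thesis
  proof (intro equalityI subsetI)
    fix c assume "c \<in> ?X frontier_of ?C"
    then have c: "c \<in> ?C" "c \<notin> ?X interior_of ?C" using fr by auto
    then obtain p where p: "c = coeff p" "degree p \<le> n" "nonneg_on T p" unfolding nonneg_cone_iff by blast
    moreover from this have "\<not> spos T n p" using 1 c(2) by blast
    ultimately show "c \<in> {coeff p | p. degree p \<le> n \<and> nonneg_on T p \<and> \<not> spos T n p}" by blast
  next
    fix c assume "c \<in> {coeff p | p. degree p \<le> n \<and> nonneg_on T p \<and> \<not> spos T n p}"
    then obtain p where p: "c = coeff p" "degree p \<le> n" "nonneg_on T p" "\<not> spos T n p" by blast
    then have "c \<in> ?C" unfolding nonneg_cone_iff by blast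
    moreover have "c \<notin> ?X interior_of ?C" using 2[OF p(2,3)] p(1,4) by blast
    ultimately show "c \<in> ?X frontier_of ?C" using fr by simp
  qed
qed

section \<open>Splitting off the zeros of nonnegative polynomials\<close>

lemma near_point:
  assumes "admissible n T" "\<tau> \<in> points T" "0 < \<delta>"
  shows "\<exists>t\<in>points T. t \<noteq> \<tau> \<and> \<bar>t - \<tau>\<bar> < \<delta>"
proof (cases T)
  case (Segment a b)
  then show ?thesis
  proof (cases "\<tau> < b")
    case True
    then show ?thesis using assms Segment by (intro bexI[of _ "\<tau> + min (\<delta> / 2) (b - \<tau>)"]) (auto simp: min_def)
  next
    case False
    then show ?thesis using assms Segment by (intro bexI[of _ "\<tau> - min (\<delta> / 2) (b - a)"]) (auto simp: min_def)
  qed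
next
  case (Half_line a)
  then show ?thesis using assms by (intro bexI[of _ "\<tau> + \<delta> / 2"]) auto
next
  case Full_line
  then show ?thesis using assms by (intro bexI[of _ "\<tau> + \<delta> / 2"]) auto
qed

lemma poly_neg_ball: "poly p \<tau> < 0 \<Longrightarrow> \<exists>\<delta>>0. \<forall>t. \<bar>t - \<tau>\<bar> < \<delta> \<longrightarrow> poly p t < (0::real)"
proof -
  assume neg: "poly p \<tau> < 0"
  have "open {t. poly p t < 0}" by (intro open_Collect_less continuous_intros)
  then obtain \<delta> where "0 < \<delta>" "ball \<tau> \<delta> \<subseteq> {t. poly p t < 0}" using neg unfolding open_contains_ball by blast
  then show ?thesis by (intro exI[of _ \<delta>]) (auto simp: subset_iff dist_real_def abs_minus_commute)
qed

text \<open>Away from \<tau> the sign is read off the product; at \<tau> itself it follows by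
  continuity, because T has points arbitrarily close to \<tau>.\<close>

lemma nonneg_quotient:
  assumes adm: "admissible n T" and u: "\<And>t. t \<in> points T \<Longrightarrow> t \<noteq> \<tau> \<Longrightarrow> 0 < poly u t" and p: "nonneg_on T (u * q)"
  shows "nonneg_on T q"
proof -
  have *: "0 \<le> poly q t" if "t \<in> points T" "t \<noteq> \<tau>" for t
    using p u[OF that] that by (auto simp: nonneg_on_def zero_le_mult_iff)
  have "0 \<le> poly q \<tau>" if \<tau>: "\<tau> \<in> points T"
  proof (rule ccontr)
    assume "\<not> ?thesis"
    then obtain \<delta> where d: "0 < \<delta>" "\<forall>t. \<bar>t - \<tau>\<bar> < \<delta> \<longrightarrow> poly q t < 0" using poly_neg_ball[of q \<tau>] by auto
    obtain t where "t \<in> points T" "t \<noteq> \<tau>" "\<bar>t - \<tau>\<bar> < \<delta>" using near_point[OF adm \<tau> d(1)] by blast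
    then show False using *[of t] d(2) by fastforce
  qed
  then show ?thesis using * unfolding nonneg_on_def by metis
qed

text \<open>If the quotient by t - \<tau> did not vanish at \<tau>, then p would be negative on one
  side of \<tau>, and both sides belong to T.\<close>

lemma interior_double_zero:
  assumes adm: "admissible n T" and p: "nonneg_on T p" and \<tau>: "\<tau> \<in> interior (points T)" "poly p \<tau> = 0"
  obtains q where "p = lin \<tau> ^ 2 * q" "nonneg_on T q"
proof -
  obtain s where s: "p = lin \<tau> * s" using \<tau>(2) by (metis dvdE poly_eq_0_iff_dvd)
  obtain e where e: "0 < e" "ball \<tau> e \<subseteq> points T" using \<tau>(1) mem_interior by blast
  have pt: "0 \<le> (t - \<tau>) * poly s t" if "\<bar>t - \<tau>\<bar> < e" for t
  proof -
    have "t \<in> points T" using that e(2) by (auto simp: dist_real_def abs_minus_commute subset_iff)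
    then show ?thesis using p s by (simp add: nonneg_on_def algebra_simps)
  qed
  have "\<not> poly s \<tau> < 0"
  proof
    assume "poly s \<tau> < 0"
    then obtain \<delta> where d: "0 < \<delta>" "\<forall>t. \<bar>t - \<tau>\<bar> < \<delta> \<longrightarrow> poly s t < 0" using poly_neg_ball by blast
    define h where "h = min e \<delta> / 2"
    have h: "0 < h" "h < e" "h < \<delta>" using e d by (auto simp: h_def min_def)
    then have "poly s (\<tau> + h) < 0" using d by simp
    then show False using pt[of "\<tau> + h"] h by (simp add: zero_le_mult_iff)
  qed
  moreover have "\<not> 0 < poly s \<tau>"
  proof
    assume "0 < poly s \<tau>"
    then have "poly (- s) \<tau> < 0" by simp
    then obtain \<delta> where d: "0 < \<delta>" "\<forall>t. \<bar>t - \<tau>\<bar> < \<delta> \<longrightarrow> poly (- s) t < 0" using poly_neg_ball by blast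
    define h where "h = min e \<delta> / 2"
    have h: "0 < h" "h < e" "h < \<delta>" using e d by (auto simp: h_def min_def)
    then have "0 < poly s (\<tau> - h)" using d by simp
    then have "0 < h * poly s (\<tau> - h)" using h by simp
    then show False using pt[of "\<tau> - h"] h by simp
  qed
  ultimately have "poly s \<tau> = 0" by linarith
  then obtain q where q: "s = lin \<tau> * q" by (metis dvdE poly_eq_0_iff_dvd)
  have pq: "p = lin \<tau> ^ 2 * q" unfolding s q power2_eq_square by (simp only: mult.assoc)
  moreover have "nonneg_on T q"
  proof (rule nonneg_quotient[OF adm])
    show "nonneg_on T (lin \<tau> ^ 2 * q)" using p pq by simp
    fix t assume "t \<noteq> \<tau>" then show "0 < poly (lin \<tau> ^ 2) t" by (simp add: poly_power)
  qed
  ultimately show ?thesis by (rule that)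
qed

text \<open>An end e comes with the sign \<sigma> for which \<sigma> (t - e) is nonnegative on
  T.\<close>

fun ends :: "poly_domain \<Rightarrow> (real \<times> real) set" where
  "ends (Segment a b) = {(a, 1), (b, - 1)}"
| "ends (Half_line a) = {(a, 1)}"
| "ends Full_line = {}"

lemma points_cases: "t \<in> points T \<Longrightarrow> t \<in> interior (points T) \<or> (\<exists>\<sigma>. (t, \<sigma>) \<in> ends T)"
  by (cases T) (auto simp: interior_points simp del: points.simps, auto)

lemma end_factor:
  assumes adm: "admissible n T" and p: "nonneg_on T p" and e: "(e, \<sigma>) \<in> ends T" "poly p e = 0"
  obtains q where "p = Polynomial.smult \<sigma> (lin e) * q" "nonneg_on T q"
proof -
  have \<sigma>: "\<sigma> * \<sigma> = 1" using e by (cases T) auto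
  obtain s where s: "p = lin e * s" using e(2) by (metis dvdE poly_eq_0_iff_dvd)
  have pq: "p = Polynomial.smult \<sigma> (lin e) * Polynomial.smult \<sigma> s" unfolding s mult_smult_left mult_smult_right smult_smult \<sigma> by simp
  moreover have "nonneg_on T (Polynomial.smult \<sigma> s)"
  proof (rule nonneg_quotient[OF adm])
    show "nonneg_on T (Polynomial.smult \<sigma> (lin e) * Polynomial.smult \<sigma> s)" using p pq by simp
    fix t assume "t \<in> points T" "t \<noteq> e"
    then show "0 < poly (Polynomial.smult \<sigma> (lin e)) t" using e(1) by (cases T) auto
  qed
  ultimately show ?thesis by (rule that)
qed

text \<open>Replacing t by - t would reverse the sign of the leading coefficient in odd degree. So
  on the full line the degree drops by two at once, and such polynomials form a null family instead
  of contributing an integral.\<close>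

lemma degree_full_line_drop:
  assumes "nonneg_on Full_line p" "p \<noteq> 0" shows "even (degree p)"
proof (rule ccontr)
  assume odd: "odd (degree p)"
  define r where "r = pcompose p [:0, -1:]"
  have ev: "poly r t = poly p (- t)" for t by (simp add: r_def poly_pcompose)
  have "nonneg_on Full_line r" using assms(1) by (simp add: nonneg_on_def ev)
  moreover have dr: "degree r = degree p" by (simp add: r_def degree_pcompose)
  ultimately have "0 \<le> coeff r (degree p)" by (intro nonneg_coeff) auto
  moreover have "lead_coeff r = - lead_coeff p" unfolding r_def using odd by (subst lead_coeff_comp) auto
  moreover have "0 \<le> coeff p (degree p)" using assms(1) by (intro nonneg_coeff[of Full_line]) auto
  ultimately show False using assms(2) dr by simp
qed

lemma boundary_cases:
  assumes adm: "admissible n T" and p: "p \<noteq> 0" "degree p \<le> n" "nonneg_on T p" "\<not> spos T n p"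
  obtains (double) \<tau> q where "\<tau> \<in> interior (points T)" "p = lin \<tau> ^ 2 * q" "q \<noteq> 0" "degree q + 2 \<le> n" "nonneg_on T q"
  | (endpoint) e \<sigma> q where "(e, \<sigma>) \<in> ends T" "p = Polynomial.smult \<sigma> (lin e) * q" "q \<noteq> 0" "degree q + 1 \<le> n" "nonneg_on T q"
  | (half) a where "T = Half_line a" "degree p + 1 \<le> n"
  | (full) "T = Full_line" "degree p + 2 \<le> n"
  using p(2-4)
proof (cases rule: not_spos_cases)
  case (1 t)
  from points_cases[OF 1(1)] show ?thesis
  proof
    assume t: "t \<in> interior (points T)"
    obtain q where q: "p = lin t ^ 2 * q" "nonneg_on T q" using interior_double_zero[OF adm p(3) t 1(2)] .
    have "q \<noteq> 0" using q p(1) by auto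
    moreover have "degree p = degree (lin t ^ 2) + degree q" unfolding q(1) using \<open>q \<noteq> 0\<close> by (intro degree_mult_eq) auto
    ultimately show ?thesis using q t p(2) degree_lin_power2[of t] by (intro double) auto
  next
    assume "\<exists>\<sigma>. (t, \<sigma>) \<in> ends T"
    then obtain \<sigma> where \<sigma>: "(t, \<sigma>) \<in> ends T" by blast
    obtain q where q: "p = Polynomial.smult \<sigma> (lin t) * q" "nonneg_on T q" using end_factor[OF adm p(3) \<sigma> 1(2)] .
    have "q \<noteq> 0" "\<sigma> \<noteq> 0" using q p(1) by auto
    moreover have "degree p = degree (Polynomial.smult \<sigma> (lin t)) + degree q" unfolding q(1) using \<open>q \<noteq> 0\<close> \<open>\<sigma> \<noteq> 0\<close> by (intro degree_mult_eq) auto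
    ultimately show ?thesis using q \<sigma> p(2) by (intro endpoint) auto
  qed
next
  case 2
  have lt: "degree p < n" using 2(2) p(1,2) by (metis leading_coeff_0_iff le_neq_implies_less)
  show ?thesis
  proof (cases T)
    case (Half_line a)
    then show ?thesis using lt by (intro half) auto
  next
    case Full_line
    then have "even (degree p)" "even n" using degree_full_line_drop[of p] p(1,3) adm by auto
    then have "degree p + 2 \<le> n" using lt by presburger
    then show ?thesis using Full_line by (intro full)
  qed (use 2 in auto)
qed

subsection \<open>Parametrization of the cone and of its boundary\<close>

definition kdom :: "poly_domain \<Rightarrow> nat \<Rightarrow> (nat \<Rightarrow> real) set" where
  "kdom T k = {z. z 0 \<in> {0<..<pi/2} \<and> z \<in> Delta T (k - 1)}"

definition kpar :: "poly_domain \<Rightarrow> nat \<Rightarrow> (nat \<Rightarrow> real) \<Rightarrow> real poly" where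
  "kpar T k z = par_poly T k (cos (z 0)) (sin (z 0)) z"

lemma kpar_eq:
  assumes "admissible k T"
  shows "kpar T k z = kpoly T k (if even k then cos (z 0) else sin (z 0)) (if even k then sin (z 0) else cos (z 0)) z"
  unfolding kpar_def by (rule par_poly_eq_kpoly) (use assms in auto)

lemma smult_kpoly: "Polynomial.smult c (kpoly T k x y \<gamma>) = kpoly T k (c * x) (c * y) \<gamma>"
  by (simp only: kpoly_def smult_add_right smult_smult)

lemma kpoly_cong:
  assumes "\<And>j. j \<in> {1..<k} \<Longrightarrow> \<gamma> j = \<gamma>' j" shows "kpoly T k x y \<gamma> = kpoly T k x y \<gamma>'"
proof -
  have "Pod k \<gamma> = Pod k \<gamma>'" "Pev k \<gamma> = Pev k \<gamma>'"
    unfolding Pod_def Pev_def using assms by (auto intro!: prod.cong simp del: power2_eq_square)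
  then show ?thesis by (simp only: kpoly_def)
qed

lemma Delta_cong:
  assumes "\<And>j. j \<in> {1..m} \<Longrightarrow> \<gamma> j = \<gamma>' j" "\<gamma> \<in> Delta T m" shows "\<gamma>' \<in> Delta T m"
  using assms unfolding Delta_def by (auto simp: strict_mono_on_def)

lemma kdom_trig: "z \<in> kdom T k \<Longrightarrow> 0 < cos (z 0) \<and> 0 < sin (z 0)"
  by (auto simp: kdom_def intro!: cos_gt_zero_pi sin_gt_zero)

lemma kpar_spos:
  assumes "admissible k T" "1 \<le> k" "z \<in> kdom T k" shows "spos T k (kpar T k z)"
  unfolding kpar_eq[OF assms(1)] using kdom_trig[OF assms(3)] assms(3)
  by (intro kpoly_spos assms(1,2)) (auto simp: kdom_def)

lemma spos_nz: assumes "admissible m T" "spos T n p" shows "p \<noteq> 0"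
proof -
  have "\<exists>t. t \<in> points T" using assms(1) by (cases T) (auto intro: exI[of _ "a" for a] less_imp_le)
  then show ?thesis using assms(2) by (auto simp: spos_def)
qed

text \<open>Uniqueness of the canonical form gives \<alpha> = c \<alpha>'. Both vectors lie on the
  unit circle, so c = 1, and the cosine determines the angle.\<close>

lemma kpar_unique:
  assumes adm: "admissible k T" "1 \<le> k" and z: "z \<in> kdom T k" "z' \<in> kdom T k"
    and c: "0 < c" "kpar T k z = Polynomial.smult c (kpar T k z')" and j: "j < k"
  shows "z j = z' j"
proof -
  note t = kdom_trig[OF z(1)] kdom_trig[OF z(2)]
  let ?x = "\<lambda>z. if even k then cos (z 0) else sin (z 0)" and ?y = "\<lambda>z. if even k then sin (z 0) else cos (z 0)"
  have "kpoly T k (?x z) (?y z) z = kpoly T k (c * ?x z') (c * ?y z') z'"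
    using c(2) unfolding kpar_eq[OF adm(1)] smult_kpoly .
  then have u: "?x z = c * ?x z' \<and> ?y z = c * ?y z' \<and> (\<forall>j\<in>{1..<k}. z j = z' j)"
    by (intro kpoly_unique[OF adm]) (use t c(1) z in \<open>auto simp: kdom_def\<close>)
  then have cs: "cos (z 0) = c * cos (z' 0)" "sin (z 0) = c * sin (z' 0)" by (auto split: if_splits)
  have "(cos (z 0))\<^sup>2 + (sin (z 0))\<^sup>2 = c\<^sup>2 * ((cos (z' 0))\<^sup>2 + (sin (z' 0))\<^sup>2)"
    unfolding cs by (simp only: power_mult_distrib distrib_left)
  then have "c\<^sup>2 = 1" by (simp add: add.commute[of "(cos _)\<^sup>2"])
  then have "c = 1" using c(1) by (simp add: power2_eq_1_iff)
  then have ceq: "cos (z 0) = cos (z' 0)" using cs by simp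
  have zb: "0 \<le> z 0" "z 0 \<le> pi" "0 \<le> z' 0" "z' 0 \<le> pi" using z unfolding kdom_def by simp_all
  have "z 0 = z' 0" by (rule cos_inj_pi[OF zb ceq])
  then show ?thesis using u j by (cases "j = 0") auto
qed

text \<open>Polar coordinates in the open quadrant, by the arctangent. The function \<open>w\<close>
  prescribes the coordinates from k on, which can hold a double zero and then
  \<open>undefined\<close>, so that the point lies in the product space.\<close>

lemma kpar_exists:
  assumes adm: "admissible k T" "1 \<le> k" and p: "spos T k p"
  shows "\<exists>z\<in>kdom T k. (\<forall>i\<ge>k. z i = w i) \<and> (\<exists>c>0. p = Polynomial.smult c (kpar T k z))"
proof -
  obtain x y \<gamma> where xy: "0 < x" "0 < y" "\<gamma> \<in> Delta T (k - 1)" "p = kpoly T k x y \<gamma>"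
    using kpoly_exists[OF adm(2,1) p] by blast
  define u v where "u = (if even k then x else y)" and "v = (if even k then y else x)"
  have uv: "0 < u" "0 < v" using xy by (auto simp: u_def v_def)
  define t where "t = v / u"
  define c where "c = u * sqrt (1 + t\<^sup>2)"
  have t: "0 < t" "u * t = v" using uv by (auto simp: t_def)
  have s: "0 < sqrt (1 + t\<^sup>2)" by (simp add: add_pos_nonneg)
  then have c: "0 < c" "c * cos (arctan t) = u" "c * sin (arctan t) = v"
    using uv t by (auto simp: c_def cos_arctan sin_arctan)
  define z where "z = (\<lambda>i. if i = 0 then arctan t else if i < k then \<gamma> i else w i)"
  have "z \<in> Delta T (k - 1)" by (rule Delta_cong[OF _ xy(3)]) (auto simp: z_def)
  moreover have "z 0 \<in> {0<..<pi/2}" using t arctan_ubound by (auto simp: z_def)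
  ultimately have z: "z \<in> kdom T k" by (simp add: kdom_def)
  have "p = kpoly T k x y z" unfolding xy(4) by (rule kpoly_cong) (auto simp: z_def)
  also have "\<dots> = Polynomial.smult c (kpar T k z)"
    unfolding kpar_eq[OF adm(1)] smult_kpoly using c by (simp add: z_def u_def v_def split: if_splits)
  finally show ?thesis using z c(1) adm(2) by (intro bexI[of _ z] conjI exI[of _ c]) (auto simp: z_def)
qed

lemma polyC1_kpar:
  assumes "admissible k T" shows "polyC1 d D (kpar T k)"
proof -
  have "C1_on d D (\<lambda>z. if even k then cos (z 0) else sin (z 0))" "C1_on d D (\<lambda>z. if even k then sin (z 0) else cos (z 0))"
    by (cases "even k"; simp add: C1_cos C1_sin C1_coord)+
  then have "polyC1 d D (\<lambda>z. kpoly T k (if even k then cos (z 0) else sin (z 0)) (if even k then sin (z 0) else cos (z 0)) z)"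
    by (rule polyC1_kpoly)
  then show ?thesis by (simp only: kpar_eq[OF assms, symmetric])
qed

lemma open_coord: "open U \<Longrightarrow> open {z::nat \<Rightarrow> real. z i \<in> U}"
  using open_vimage[OF _ continuous_on_coord[of UNIV i], of U] by (simp add: vimage_def)

lemma open_Delta: "open (Delta T m)"
proof -
  have eq: "z \<in> Delta T m \<longleftrightarrow> z \<in> (\<Inter>j\<in>{1..m}. {z. z j \<in> interior (points T)}) \<inter> (\<Inter>i\<in>{1..m}. \<Inter>j\<in>{1..m}. {z. i < j \<longrightarrow> z i < z j})" for z
    unfolding Delta_def monotone_on_def by blast
  have "Delta T m = (\<Inter>j\<in>{1..m}. {z. z j \<in> interior (points T)}) \<inter> (\<Inter>i\<in>{1..m}. \<Inter>j\<in>{1..m}. {z. i < j \<longrightarrow> z i < z j})"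
    by (rule Set.set_eqI, rule eq)
  moreover have "open {z::nat \<Rightarrow> real. i < j \<longrightarrow> z i < z j}" for i j :: nat
    by (cases "i < j") (auto intro!: open_Collect_less continuous_on_coord)
  ultimately show ?thesis by (simp only:) (intro open_Int open_INT ballI open_coord open_interior finite_atLeastAtMost)
qed

lemma open_kdom: "open (kdom T k)"
proof -
  have "kdom T k = {z. z 0 \<in> {0<..<pi/2}} \<inter> Delta T (k - 1)" by (auto simp: kdom_def)
  then show ?thesis by (simp only:) (intro open_Int open_Delta open_coord open_greaterThanLessThan)
qed

text \<open>A triple \<open>(U, e, K)\<close> stands for the polynomials \<open>U z * r\<close> with \<open>U\<close> depending on the first \<open>e\<close>
  variables and \<open>degree r < K\<close>; because of the normalization it has \<open>e + K - 1\<close> parameters.\<close>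

definition null_fam :: "nat \<Rightarrow> nat \<Rightarrow> ((nat \<Rightarrow> real) \<Rightarrow> real poly) \<times> nat \<times> nat \<Rightarrow> bool" where
  "null_fam d N = (\<lambda>(U, e, K). polyC1 d UNIV U \<and> (\<forall>z z'. (\<forall>i<e. z i = z' i) \<longrightarrow> U z = U z') \<and>
     (\<forall>z. U z \<noteq> 0 \<and> degree (U z) + K \<le> N) \<and> (K = 0 \<or> e + K \<le> d))"

definition in_fam :: "((nat \<Rightarrow> real) \<Rightarrow> real poly) \<times> nat \<times> nat \<Rightarrow> real poly \<Rightarrow> bool" where
  "in_fam = (\<lambda>(U, e, K) p. \<exists>z r. degree r < K \<and> p = U z * r)"

context metric_mat
begin

text \<open>The common form of both halves of the theorem: \<open>Q\<close> describes the cone or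
  its boundary, and the pieces parametrize it up to positive factors and null families. The upper
  bound needs the covering, the lower one the joint injectivity of the pieces.\<close>

lemma cone_volume:
  assumes d: "0 < d" and I: "finite I" and D: "\<And>i. i \<in> I \<Longrightarrow> open (D i)"
    and P: "\<And>i. i \<in> I \<Longrightarrow> polyC1 d (D i) (P i)"
    and deg: "\<And>p. Q p \<Longrightarrow> degree p < N" and scale: "\<And>p c. 0 < c \<Longrightarrow> Q p \<Longrightarrow> Q (Polynomial.smult c p)"
    and sub: "\<And>i z. i \<in> I \<Longrightarrow> z \<in> D i \<Longrightarrow> P i z \<noteq> 0 \<and> Q (P i z)"
    and inj: "\<And>i j x y c. i \<in> I \<Longrightarrow> j \<in> I \<Longrightarrow> x \<in> D i \<inter> space (lb d) \<Longrightarrow> y \<in> D j \<inter> space (lb d) \<Longrightarrow> 0 < c \<Longrightarrow>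
      P i x = Polynomial.smult c (P j y) \<Longrightarrow> i = j \<and> x = y"
    and F: "finite F" "\<And>f. f \<in> F \<Longrightarrow> null_fam d N f"
    and cover: "\<And>p. Q p \<Longrightarrow> p \<noteq> 0 \<Longrightarrow> (\<exists>i\<in>I. \<exists>z\<in>D i \<inter> space (lb d). \<exists>c>0. p = Polynomial.smult c (P i z)) \<or> (\<exists>f\<in>F. in_fam f p)"
  shows "Vol S d ({coeff p | p. Q p} \<inter> unit_sphere S)
    = (\<Sum>i\<in>I. J_integral S d (D i) (\<lambda>z. normalized S (coeff (P i z))))"
proof (rule antisym)
  let ?X = "{coeff p | p. Q p} \<inter> unit_sphere S"
  let ?H = "hausdorff_measure dS d"
  define g where "g i z = normalized S (coeff (P i z))" for i z
  define A where "A i = g i ` (D i \<inter> space (lb d))" for i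
  define Z where "Z f = {c \<in> unit_sphere S. \<exists>p. in_fam f p \<and> c = coeff p}" for f
  have PN: "P i z \<noteq> 0 \<and> degree (P i z) < N" if "i \<in> I" "z \<in> D i" for i z using sub[OF that] deg by blast
  have C1: "C1_on d (D i) (\<lambda>z. g i z l)" if "i \<in> I" for i l
    unfolding g_def by (rule normalized_C1[OF P[OF that] PN[OF that]])
  have Z0: "?H (Z f) = 0" if f: "f \<in> F" for f
  proof -
    obtain U e K where fe: "f = (U, e, K)" by (cases f)
    have nf: "polyC1 d UNIV U" "\<And>z z'. (\<forall>i<e. z i = z' i) \<Longrightarrow> U z = U z'" "\<And>z. U z \<noteq> 0"
      "\<And>z. degree (U z) + K \<le> N" "K = 0 \<or> e + K \<le> d"
      using F(2)[OF f] unfolding fe null_fam_def by blast+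
    have "Z f = {c \<in> unit_sphere S. \<exists>z r. degree r < K \<and> c = coeff (U z * r)}"
      unfolding Z_def fe in_fam_def by auto
    then show ?thesis using null_family[OF d nf] by simp
  qed
  have XA: "?X \<subseteq> (\<Union>i\<in>I. A i) \<union> (\<Union>f\<in>F. Z f)"
  proof
    fix c assume "c \<in> ?X"
    then obtain p where p: "c = coeff p" "Q p" "c \<in> unit_sphere S" by blast
    have "p \<noteq> 0"
    proof
      assume "p = 0"
      then show False using p(1,3) by (simp add: unit_sphere_iff norm_inv_eq_qnorm qnorm_def qform_def)
    qed
    from cover[OF p(2) this] show "c \<in> (\<Union>i\<in>I. A i) \<union> (\<Union>f\<in>F. Z f)"
    proof
      assume "\<exists>i\<in>I. \<exists>z\<in>D i \<inter> space (lb d). \<exists>c>0. p = Polynomial.smult c (P i z)"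
      then obtain i z b where z: "i \<in> I" "z \<in> D i \<inter> space (lb d)" "0 < b" "p = Polynomial.smult b (P i z)" by blast
      have "c = normalized S (coeff p)" using unit_sphere_normalized[OF p(3)] p(1) by simp
      also have "\<dots> = g i z" unfolding g_def z(4) by (rule normalized_smult[OF z(3)])
      finally show ?thesis using z(1,2) unfolding A_def by blast
    next
      assume "\<exists>f\<in>F. in_fam f p"
      then show ?thesis using p(1,3) unfolding Z_def by blast
    qed
  qed
  have "?H (\<Union>i\<in>I. A i) \<le> (\<Sum>i\<in>I. ?H (A i))" using I
  proof (induction I)
    case (insert i I)
    have "?H (A i \<union> (\<Union>i\<in>I. A i)) \<le> ?H (A i) + ?H (\<Union>i\<in>I. A i)" by (rule hausdorff_Un)
    also have "\<dots> \<le> ?H (A i) + (\<Sum>i\<in>I. ?H (A i))" by (intro add_left_mono insert.IH)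
    finally show ?case using insert.hyps by simp
  qed simp
  also have "\<dots> \<le> (\<Sum>i\<in>I. J_integral S d (D i) (g i))"
    unfolding A_def J_integral_def by (intro sum_mono area_upper[OF d D C1])
  finally have up: "?H (\<Union>i\<in>I. A i) \<le> (\<Sum>i\<in>I. J_integral S d (D i) (g i))" .
  have "?H ?X \<le> ?H ((\<Union>i\<in>I. A i) \<union> (\<Union>f\<in>F. Z f))" using XA by (rule hausdorff_mono)
  also have "\<dots> \<le> ?H (\<Union>i\<in>I. A i) + ?H (\<Union>f\<in>F. Z f)" by (rule hausdorff_Un)
  also have "?H (\<Union>f\<in>F. Z f) = 0" by (rule hausdorff_UN_null[OF F(1) Z0])
  finally show "Vol S d ?X \<le> (\<Sum>i\<in>I. J_integral S d (D i) (\<lambda>z. normalized S (coeff (P i z))))"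
    using up unfolding Vol_def g_def[abs_def] by simp
  have AX: "(\<Union>i\<in>I. A i) \<subseteq> ?X"
  proof
    fix c assume "c \<in> (\<Union>i\<in>I. A i)"
    then obtain i z where iz: "i \<in> I" "z \<in> D i" "c = g i z" unfolding A_def by blast
    define b where "b = inverse (norm_inv S (coeff (P i z)))"
    have "0 < b" using norm_inv_poly_pos[of "P i z"] PN[OF iz(1,2)] by (simp add: b_def)
    then have "Q (Polynomial.smult b (P i z))" using scale sub[OF iz(1,2)] by blast
    moreover have "c = coeff (Polynomial.smult b (P i z))"
      unfolding iz(3) g_def normalized_eq b_def by (simp add: fun_eq_iff)
    moreover have "c \<in> unit_sphere S" unfolding iz(3) g_def using PN[OF iz(1,2)] by (intro normalized_in_sphere) auto
    ultimately show "c \<in> ?X" by blast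
  qed
  have L: "(\<Sum>i\<in>I. J_integral S d (D i) (g i)) \<le> ?H (\<Union>i\<in>I. A i)"
    unfolding A_def J_integral_def
  proof (rule area_lower_pieces[where g=g, OF d I D C1])
    fix i j x y
    assume ij: "i \<in> I" "j \<in> I" "x \<in> D i \<inter> space (lb d)" "y \<in> D j \<inter> space (lb d)" and eq: "\<forall>l<N. g i x l = g j y l"
    have "\<exists>c>0. P i x = Polynomial.smult c (P j y)"
      using PN[of i x] PN[of j y] ij eq unfolding g_def by (intro normalized_eqD) auto
    then show "i = j \<and> x = y" using inj[OF ij] by blast
  qed
  have gi: "(\<lambda>z. normalized S (coeff (P i z))) = g i" for i by (simp add: g_def fun_eq_iff)
  show "(\<Sum>i\<in>I. J_integral S d (D i) (\<lambda>z. normalized S (coeff (P i z)))) \<le> Vol S d ?X"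
    unfolding Vol_def gi by (rule order_trans[OF L hausdorff_mono[OF AX]])
qed

text \<open>The sign cancels in the Gram matrix. This removes the sign at the right end of a
  segment.\<close>

lemma J_minus:
  assumes "\<And>i. i < N \<Longrightarrow> C1_on d D (\<lambda>w. g w i)" "z \<in> D"
  shows "J S d (\<lambda>w i. - g w i) z = J S d g z"
proof -
  have p: "pder j (\<lambda>w. - g w i) z = - pder j (\<lambda>w. g w i) z" if "i < N" "j < d" for i j
    using DERIV_minus[OF C1_onD(3)[OF assms(1)[OF that(1)] that(2) assms(2)]] unfolding pder_def by (rule DERIV_imp_deriv)
  have "gram S d (\<lambda>w i. - g w i) z = gram S d g z"
  proof (rule eq_matI)
    fix a b assume "a < dim_row (gram S d g z)" "b < dim_col (gram S d g z)"
    then have ab: "a < d" "b < d" using gram_carrier[of d g z] by auto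
    then show "gram S d (\<lambda>w i. - g w i) z $$ (a, b) = gram S d g z $$ (a, b)"
      by (simp add: gram_index p)
  qed (use gram_carrier[of d g z] gram_carrier[of d "\<lambda>w i. - g w i" z] in auto)
  then show ?thesis by (simp add: J_eq)
qed

end

text \<open>\<open>Double\<close>, \<open>End\<close> and \<open>Drop\<close> belong to \<open>I1\<close>, to \<open>I2\<close> and \<open>I3\<close>, and to \<open>I4\<close>. The sign \<open>\<sigma>\<close> makes
  \<open>\<sigma> (t - e)\<close> nonnegative on \<open>T\<close>; it does not change the Jacobian.\<close>

datatype piece = Double | End real real | Drop

definition pieces :: "poly_domain \<Rightarrow> piece set" where
  "pieces T = {Double} \<union> (\<lambda>(e, \<sigma>). End e \<sigma>) ` ends T \<union> (case T of Half_line a \<Rightarrow> {Drop} | _ \<Rightarrow> {})"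

text \<open>The double zero ranges over the interior only, which keeps the domain open; the ends of
  T, included in \<open>I1\<close>, are a null set. For n = 2 the cofactor is a constant and there
  is no angle.\<close>

fun pdom :: "poly_domain \<Rightarrow> nat \<Rightarrow> piece \<Rightarrow> (nat \<Rightarrow> real) set" where
  "pdom T n Double = {z. (n \<noteq> 2 \<longrightarrow> z \<in> kdom T (n - 2)) \<and> z (n - 2) \<in> interior (points T)}"
| "pdom T n (End e \<sigma>) = kdom T (n - 1)"
| "pdom T n Drop = kdom T (n - 1)"

fun ppol :: "poly_domain \<Rightarrow> nat \<Rightarrow> piece \<Rightarrow> (nat \<Rightarrow> real) \<Rightarrow> real poly" where
  "ppol T n Double z = lin (z (n - 2)) ^ 2 * (if n = 2 then 1 else kpar T (n - 2) z)"
| "ppol T n (End e \<sigma>) z = Polynomial.smult \<sigma> (lin e) * kpar T (n - 1) z"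
| "ppol T n Drop z = kpar T (n - 1) z"

text \<open>One family for each way of not being strictly positive: a double zero, a smaller degree,
  a zero at an end. Each has n - 1 effective parameters, one less than the dimension n.\<close>

definition fams :: "poly_domain \<Rightarrow> nat \<Rightarrow> (((nat \<Rightarrow> real) \<Rightarrow> real poly) \<times> nat \<times> nat) set" where
  "fams T n = {(\<lambda>z. lin (z 0) ^ 2, 1, n - 1), (\<lambda>z. 1, 0, n)} \<union> (\<lambda>e. (\<lambda>z. lin (fst e), 0, n)) ` ends T"

text \<open>One family for each pair of defects among double zeros, zeros at ends and loss of
  degree, so each has at most n - 2 effective parameters. Two double zeros require degree 4.\<close>

definition fams2 :: "poly_domain \<Rightarrow> nat \<Rightarrow> (((nat \<Rightarrow> real) \<Rightarrow> real poly) \<times> nat \<times> nat) set" where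
  "fams2 T n = (if 4 \<le> n then {(\<lambda>z. lin (z 0) ^ 2 * lin (z 1) ^ 2, 2, n - 3)} else {})
     \<union> (\<lambda>e. (\<lambda>z. lin (z 0) ^ 2 * lin (fst e), 1, n - 2)) ` ends T
     \<union> (\<lambda>(e, e'). (\<lambda>z. lin (fst e) * lin (fst e'), 0, n - 1)) ` (ends T \<times> ends T)
     \<union> {(\<lambda>z. lin (z 0) ^ 2, 1, n - 2), (\<lambda>z. 1, 0, n - 1)} \<union> (\<lambda>e. (\<lambda>z. lin (fst e), 0, n - 1)) ` ends T"

section \<open>Covering the cone and its boundary up to null families\<close>

lemma ends_pair_fams2:
  assumes "u \<in> ends T" "v \<in> ends T" shows "(\<lambda>z. lin (fst u) * lin (fst v), 0, n - 1) \<in> fams2 T n"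
proof -
  have "(\<lambda>z. lin (fst u) * lin (fst v), 0, n - 1) \<in>
      (\<lambda>(e, e'). (\<lambda>z::nat \<Rightarrow> real. lin (fst e) * lin (fst e'), 0::nat, n - 1)) ` (ends T \<times> ends T)"
    by (rule image_eqI[of _ _ "(u, v)"]) (simp_all only: prod.case mem_Times_iff fst_conv snd_conv assms simp_thms)
  then show ?thesis unfolding fams2_def by (simp only: Un_iff simp_thms)
qed

lemma finite_ends: "finite (ends T)" by (cases T) auto

lemma finite_pieces: "finite (pieces T)"
  unfolding pieces_def by (cases T) auto

lemma lin_sq_nz: "lin c ^ 2 \<noteq> 0" by simp

lemma null_famI:
  assumes "polyC1 d UNIV U" "\<And>z z'. (\<forall>i<e. z i = z' i) \<Longrightarrow> U z = U z'" "\<And>z. U z \<noteq> 0" "\<And>z. degree (U z) + K \<le> N"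
    "K = 0 \<or> e + K \<le> d"
  shows "null_fam d N (U, e, K)"
  unfolding null_fam_def prod.case
proof (intro conjI allI impI)
  fix z z' :: "nat \<Rightarrow> real" assume "\<forall>i<e. z i = z' i" then show "U z = U z'" by (rule assms(2))
qed (rule assms)+

lemma null_fam_lin_sq: "0 < d \<Longrightarrow> K + 2 \<le> N \<Longrightarrow> 1 + K \<le> d \<Longrightarrow> null_fam d N (\<lambda>z. lin (z 0) ^ 2, 1, K)"
proof (rule null_famI)
  show "polyC1 d UNIV (\<lambda>z. lin (z 0) ^ 2)" by (intro polyC1_power polyC1_lin)
  show "degree (lin (z 0) ^ 2) + K \<le> N" if "K + 2 \<le> N" for z :: "nat \<Rightarrow> real" unfolding degree_lin_power2 using that by simp
  show "lin (z 0) ^ 2 \<noteq> 0" for z :: "nat \<Rightarrow> real" by (rule lin_sq_nz)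
qed simp_all

lemma null_fams:
  assumes n: "1 \<le> n" and f: "f \<in> fams T n" shows "null_fam n (n + 1) f"
proof -
  consider "f = (\<lambda>z. lin (z 0) ^ 2, 1, n - 1)" | "f = (\<lambda>z. 1, 0, n)" | e where "f = (\<lambda>z. lin e, 0, n)"
    using f unfolding fams_def by blast
  then show ?thesis
  proof cases
    case 1
    show ?thesis unfolding 1 by (rule null_fam_lin_sq) (use n in auto)
  next
    case 2
    show ?thesis unfolding 2 by (rule null_famI) (auto intro: polyC1_const)
  next
    case (3 e)
    show ?thesis unfolding 3 by (rule null_famI) (auto intro: polyC1_const)
  qed
qed

lemma degree_lin2_lin: "degree (lin c ^ 2 * lin e) = 3"
  by (subst degree_mult_eq) (simp_all add: degree_lin_power2 del: power2_eq_square)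

lemma degree_lin2_lin2: "degree (lin c ^ 2 * lin e ^ 2) = 4"
  by (subst degree_mult_eq) (simp_all add: degree_lin_power2 del: power2_eq_square)

lemma degree_lin_lin: "degree (lin c * lin e) = 2"
  by (subst degree_mult_eq) (simp_all del: mult_pCons_left mult_pCons_right)

lemma null_fams2:
  assumes n: "2 \<le> n" and f: "f \<in> fams2 T n" shows "null_fam (n - 1) (n + 1) f"
proof -
  consider "4 \<le> n" "f = (\<lambda>z. lin (z 0) ^ 2 * lin (z 1) ^ 2, 2, n - 3)" | e where "f = (\<lambda>z. lin (z 0) ^ 2 * lin e, 1, n - 2)"
    | e e' where "f = (\<lambda>z. lin e * lin e', 0, n - 1)" | "f = (\<lambda>z. lin (z 0) ^ 2, 1, n - 2)" | "f = (\<lambda>z. 1, 0, n - 1)"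
    | e where "f = (\<lambda>z. lin e, 0, n - 1)"
    using f unfolding fams2_def by (auto split: if_splits)
  then show ?thesis
  proof cases
    case 1
    show ?thesis unfolding 1(2)
    proof (rule null_famI)
      show "polyC1 (n - 1) UNIV (\<lambda>z. lin (z 0) ^ 2 * lin (z 1) ^ 2)" by (intro polyC1_mult polyC1_power polyC1_lin)
      show "degree (lin (z 0) ^ 2 * lin (z 1) ^ 2) + (n - 3) \<le> n + 1" for z :: "nat \<Rightarrow> real"
        unfolding degree_lin2_lin2 using 1(1) by simp
    qed (use 1(1) in auto)
  next
    case (2 e)
    show ?thesis unfolding 2
    proof (rule null_famI)
      show "polyC1 (n - 1) UNIV (\<lambda>z. lin (z 0) ^ 2 * lin e)" by (intro polyC1_mult polyC1_power polyC1_lin polyC1_const)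
      show "degree (lin (z 0) ^ 2 * lin e) + (n - 2) \<le> n + 1" for z :: "nat \<Rightarrow> real"
        unfolding degree_lin2_lin using n by simp
    qed (use n in \<open>auto simp del: mult_pCons_left mult_pCons_right\<close>)
  next
    case (3 e e')
    show ?thesis unfolding 3
    proof (rule null_famI)
      show "degree (lin e * lin e') + (n - 1) \<le> n + 1" unfolding degree_lin_lin using n by simp
    qed (use n in \<open>auto intro: polyC1_const simp del: mult_pCons_left mult_pCons_right\<close>)
  next
    case 4
    show ?thesis unfolding 4 by (rule null_fam_lin_sq) (use n in auto)
  next
    case 5
    show ?thesis unfolding 5 by (rule null_famI) (auto intro: polyC1_const)
  next
    case (6 e)
    show ?thesis unfolding 6 by (rule null_famI) (auto intro: polyC1_const)
  qed
qed

lemma in_famI: "degree r < K \<Longrightarrow> p = U z * r \<Longrightarrow> in_fam (U, e, K) p"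
  unfolding in_fam_def by auto

lemma nonneg_on_smult: "0 < c \<Longrightarrow> nonneg_on T (Polynomial.smult c p) \<longleftrightarrow> nonneg_on T p"
  by (simp add: nonneg_on_def zero_le_mult_iff)

lemma spos_smult: "0 < c \<Longrightarrow> spos T n (Polynomial.smult c p) \<longleftrightarrow> spos T n p"
  by (cases T) (simp_all add: spos_def zero_less_mult_iff)

lemma admissible_minus2: "admissible n T \<Longrightarrow> 2 \<le> n \<Longrightarrow> admissible (n - 2) T"
  by (cases T) auto

lemma admissible_not_full: "admissible n T \<Longrightarrow> T \<noteq> Full_line \<Longrightarrow> admissible m T"
  by (cases T) auto

lemma interior_cover:
  assumes n: "1 \<le> n" and adm: "admissible n T" and p: "degree p \<le> n" "nonneg_on T p" "p \<noteq> 0"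
  shows "(\<exists>z\<in>kdom T n \<inter> space (lb n). \<exists>c>0. p = Polynomial.smult c (kpar T n z)) \<or> (\<exists>f\<in>fams T n. in_fam f p)"
proof (cases "spos T n p")
  case True
  obtain z where z: "z \<in> kdom T n" "\<forall>i\<ge>n. z i = undefined" "\<exists>c>0. p = Polynomial.smult c (kpar T n z)"
    using kpar_exists[OF adm n True, of "\<lambda>_. undefined"] by blast
  have "z \<in> space (lb n)" unfolding space_lb using z(2) by (auto simp: PiE_def extensional_def)
  then show ?thesis using z(1,3) by blast
next
  case False
  have "\<exists>f\<in>fams T n. in_fam f p"
    using adm p(3,1,2) False
  proof (cases rule: boundary_cases)
    case (double \<tau> q)
    have "in_fam (\<lambda>z. lin (z 0) ^ 2, 1, n - 1) p"
      by (rule in_famI[of q _ _ _ "\<lambda>_. \<tau>"]) (use double in auto)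
    then show ?thesis unfolding fams_def by blast
  next
    case (endpoint e \<sigma> q)
    have "in_fam (\<lambda>z. lin (fst (e, \<sigma>)), 0, n) p"
    proof (rule in_famI)
      show "degree (Polynomial.smult \<sigma> q) < n" using degree_smult_le[of \<sigma> q] endpoint(4) by linarith
      show "p = lin (fst (e, \<sigma>)) * Polynomial.smult \<sigma> q" unfolding endpoint(2) fst_conv by (simp only: mult_smult_left mult_smult_right)
    qed
    then show ?thesis using endpoint(1) unfolding fams_def by blast
  next
    case (half a)
    have "in_fam (\<lambda>z. 1, 0, n) p" by (rule in_famI[of p]) (use half in auto)
    then show ?thesis unfolding fams_def by blast
  next
    case full
    have "in_fam (\<lambda>z. 1, 0, n) p" by (rule in_famI[of p]) (use full in auto)
    then show ?thesis unfolding fams_def by blast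
  qed
  then show ?thesis ..
qed

lemma kpar_exists_lb:
  assumes adm: "admissible k T" "1 \<le> k" and p: "spos T k p" and kd: "k \<le> d"
  obtains z c where "z \<in> kdom T k" "z \<in> space (lb d)" "k < d \<longrightarrow> z k = \<tau>" "0 < c" "p = Polynomial.smult c (kpar T k z)"
proof -
  obtain z c where z: "z \<in> kdom T k" "\<forall>i\<ge>k. z i = (if i < d then \<tau> else undefined)" "0 < c" "p = Polynomial.smult c (kpar T k z)"
    using kpar_exists[OF adm p, of "\<lambda>i. if i < d then \<tau> else undefined"] by blast
  have "z \<in> space (lb d)" unfolding space_lb using z(2) kd by (auto simp: PiE_def extensional_def)
  then show ?thesis using z by (intro that[of z c]) auto
qed

text \<open>The analysis of the defects is applied twice: first to p, which determines the piece,
  and then to the remaining factor, if that is not strictly positive. A second defect places p in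
  one of the families of \<open>fams2\<close>.\<close>

lemma boundary_cover:
  assumes n: "2 \<le> n" and adm: "admissible n T" and p: "p \<noteq> 0" "degree p \<le> n" "nonneg_on T p" "\<not> spos T n p"
  shows "(\<exists>i\<in>pieces T. \<exists>z\<in>pdom T n i \<inter> space (lb (n - 1)). \<exists>c>0. p = Polynomial.smult c (ppol T n i z)) \<or> (\<exists>f\<in>fams2 T n. in_fam f p)"
    (is "?P \<or> ?F")
proof -
  have piece: ?P if "i \<in> pieces T" "z \<in> pdom T n i" "z \<in> space (lb (n - 1))" "0 < c" "p = Polynomial.smult c (ppol T n i z)" for i z c
    using that by blast
  from adm p show ?thesis
  proof (cases rule: boundary_cases)
    case (double \<tau> q)
    show ?thesis
    proof (cases "n = 2")
      case True
      define z where "z = (\<lambda>i\<in>{..<1::nat}. \<tau>)"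
      from double(4) True obtain c where q: "q = [:c:]" using degree_eq_zeroE[of q] by auto
      have "0 < c"
      proof -
        have "\<tau> \<in> points T" using double(1) interior_subset by blast
        then have "0 \<le> c" using double(5) unfolding nonneg_on_def q by auto
        then show ?thesis using double(3) q by (cases "c = 0") auto
      qed
      moreover have "p = Polynomial.smult c (ppol T n Double z)"
        unfolding double(2) q by (simp add: True z_def del: power2_eq_square)
      ultimately have ?P using double(1) by (intro piece[of Double z c]) (auto simp: pieces_def True z_def space_PiM)
      then show ?thesis ..
    next
      case False
      then have n3: "1 \<le> n - 2" and adm2: "admissible (n - 2) T" using n admissible_minus2[OF adm n] by auto
      show ?thesis
      proof (cases "spos T (n - 2) q")
        case True
        have le: "n - 2 \<le> n - 1" by simp
        obtain z c where z: "z \<in> kdom T (n - 2)" "z \<in> space (lb (n - 1))" "n - 2 < n - 1 \<longrightarrow> z (n - 2) = \<tau>" "0 < c"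
          "q = Polynomial.smult c (kpar T (n - 2) z)"
          by (rule kpar_exists_lb[where \<tau>=\<tau>, OF adm2 n3 True le])
        have zt: "z (n - 2) = \<tau>" using z(3) n by simp
        have "p = Polynomial.smult c (ppol T n Double z)"
          using \<open>n \<noteq> 2\<close> unfolding double(2) by (simp add: zt z(5) del: power2_eq_square)
        then have ?P using double(1) z zt by (intro piece[of Double z c]) (auto simp: pieces_def)
        then show ?thesis ..
      next
        case ns: False
        have "degree q \<le> n - 2" using double(4) by simp
        from adm2 double(3) this double(5) ns have ?F
        proof (cases rule: boundary_cases)
          case d2: (double \<tau>' q')
          have "in_fam (\<lambda>z. lin (z 0) ^ 2 * lin (z 1) ^ 2, 2, n - 3) p"
          proof (rule in_famI[of q' _ _ _ "\<lambda>i. if i = 0 then \<tau> else \<tau>'"])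
            show "degree q' < n - 3" using d2(4) by linarith
            show "p = lin (if (0::nat) = 0 then \<tau> else \<tau>') ^ 2 * lin (if (1::nat) = 0 then \<tau> else \<tau>') ^ 2 * q'"
              unfolding double(2) d2(2) by (simp only: mult.assoc simp_thms if_True if_False one_neq_zero)
          qed
          moreover have "4 \<le> n" using d2(4) by linarith
          ultimately show ?thesis unfolding fams2_def by auto
        next
          case (endpoint e \<sigma> q')
          have "in_fam (\<lambda>z. lin (z 0) ^ 2 * lin (fst (e, \<sigma>)), 1, n - 2) p"
          proof (rule in_famI[of "Polynomial.smult \<sigma> q'" _ _ _ "\<lambda>_. \<tau>"])
            show "degree (Polynomial.smult \<sigma> q') < n - 2" using degree_smult_le[of \<sigma> q'] endpoint(4) by linarith
            show "p = lin \<tau> ^ 2 * lin (fst (e, \<sigma>)) * Polynomial.smult \<sigma> q'"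
              unfolding double(2) endpoint(2) fst_conv by (simp only: mult_smult_left mult_smult_right mult.assoc)
          qed
          then show ?thesis using endpoint(1) unfolding fams2_def by blast
        next
          case (half a)
          have "in_fam (\<lambda>z. lin (z 0) ^ 2, 1, n - 2) p"
            by (rule in_famI[of q _ _ _ "\<lambda>_. \<tau>"]) (use half double(2) in auto)
          then show ?thesis unfolding fams2_def by blast
        next
          case full
          have "in_fam (\<lambda>z. lin (z 0) ^ 2, 1, n - 2) p"
            by (rule in_famI[of q _ _ _ "\<lambda>_. \<tau>"]) (use full double(2) in auto)
          then show ?thesis unfolding fams2_def by blast
        qed
        then show ?thesis ..
      qed
    qed
  next
    case (endpoint e \<sigma> q)
    have "T \<noteq> Full_line" using endpoint(1) by auto
    then have adm1: "admissible (n - 1) T" by (rule admissible_not_full[OF adm])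
    have n1: "1 \<le> n - 1" using n by simp
    show ?thesis
    proof (cases "spos T (n - 1) q")
      case True
      obtain z c where z: "z \<in> kdom T (n - 1)" "z \<in> space (lb (n - 1))" "0 < c" "q = Polynomial.smult c (kpar T (n - 1) z)"
        using kpar_exists_lb[OF adm1 n1 True, of "n - 1" 0] by auto
      have "p = Polynomial.smult c (ppol T n (End e \<sigma>) z)"
        unfolding endpoint(2) z(4) ppol.simps by (simp only: mult_smult_right)
      then have ?P using endpoint(1) z by (intro piece[of "End e \<sigma>" z c]) (auto simp: pieces_def)
      then show ?thesis ..
    next
      case ns: False
      have "degree q \<le> n - 1" using endpoint(4) by simp
      from adm1 endpoint(3) this endpoint(5) ns have ?F
      proof (cases rule: boundary_cases)
        case (double \<tau> q')
        have "in_fam (\<lambda>z. lin (z 0) ^ 2 * lin (fst (e, \<sigma>)), 1, n - 2) p"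
        proof (rule in_famI[of "Polynomial.smult \<sigma> q'" _ _ _ "\<lambda>_. \<tau>"])
          show "degree (Polynomial.smult \<sigma> q') < n - 2" using degree_smult_le[of \<sigma> q'] double(4) by linarith
          show "p = lin \<tau> ^ 2 * lin (fst (e, \<sigma>)) * Polynomial.smult \<sigma> q'"
            unfolding double(2) endpoint(2) fst_conv by (simp only: mult_smult_left mult_smult_right mult.assoc mult.left_commute)
        qed
        then show ?thesis using endpoint(1) unfolding fams2_def by blast
      next
        case e2: (endpoint e' \<sigma>' q')
        have "in_fam (\<lambda>z. lin (fst (e, \<sigma>)) * lin (fst (e', \<sigma>')), 0, n - 1) p"
        proof (rule in_famI[of "Polynomial.smult \<sigma>' (Polynomial.smult \<sigma> q')"])
          show "degree (Polynomial.smult \<sigma>' (Polynomial.smult \<sigma> q')) < n - 1"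
            using degree_smult_le[of \<sigma> q'] degree_smult_le[of \<sigma>' "Polynomial.smult \<sigma> q'"] e2(4) by linarith
          show "p = lin (fst (e, \<sigma>)) * lin (fst (e', \<sigma>')) * Polynomial.smult \<sigma>' (Polynomial.smult \<sigma> q')"
            unfolding e2(2) endpoint(2) fst_conv
            by (simp only: mult_smult_left mult_smult_right mult.assoc)
        qed
        then show ?thesis using ends_pair_fams2[OF endpoint(1) e2(1)] by (rule bexI)
      next
        case (half a)
        have "in_fam (\<lambda>z. lin (fst (e, \<sigma>)), 0, n - 1) p"
        proof (rule in_famI)
          show "degree (Polynomial.smult \<sigma> q) < n - 1" using degree_smult_le[of \<sigma> q] half(2) by linarith
          show "p = lin (fst (e, \<sigma>)) * Polynomial.smult \<sigma> q" unfolding endpoint(2) fst_conv by (simp only: mult_smult_left mult_smult_right)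
        qed
        then show ?thesis using endpoint(1) unfolding fams2_def by blast
      next
        case full
        then show ?thesis using \<open>T \<noteq> Full_line\<close> by simp
      qed
      then show ?thesis ..
    qed
  next
    case (half a)
    then have adm1: "admissible (n - 1) T" by simp
    have n1: "1 \<le> n - 1" using n by simp
    show ?thesis
    proof (cases "spos T (n - 1) p")
      case True
      obtain z c where z: "z \<in> kdom T (n - 1)" "z \<in> space (lb (n - 1))" "0 < c" "p = Polynomial.smult c (kpar T (n - 1) z)"
        using kpar_exists_lb[OF adm1 n1 True, of "n - 1" 0] by auto
      have ?P using half(1) z by (intro piece[of Drop z c]) (auto simp: pieces_def)
      then show ?thesis ..
    next
      case ns: False
      have "degree p \<le> n - 1" using half(2) by simp
      from adm1 p(1) this p(3) ns have ?F
      proof (cases rule: boundary_cases)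
        case (double \<tau> q')
        have "in_fam (\<lambda>z. lin (z 0) ^ 2, 1, n - 2) p"
          by (rule in_famI[of q' _ _ _ "\<lambda>_. \<tau>"]) (use double in auto)
        then show ?thesis unfolding fams2_def by blast
      next
        case (endpoint e \<sigma> q)
        have "in_fam (\<lambda>z. lin (fst (e, \<sigma>)), 0, n - 1) p"
        proof (rule in_famI)
          show "degree (Polynomial.smult \<sigma> q) < n - 1" using degree_smult_le[of \<sigma> q] endpoint(4) by linarith
          show "p = lin (fst (e, \<sigma>)) * Polynomial.smult \<sigma> q" unfolding endpoint(2) fst_conv by (simp only: mult_smult_left mult_smult_right)
        qed
        then show ?thesis using endpoint(1) unfolding fams2_def by blast
      next
        case h2: (half a')
        have "in_fam (\<lambda>z. 1, 0, n - 1) p" by (rule in_famI[of p]) (use h2 in auto)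
        then show ?thesis unfolding fams2_def by blast
      next
        case full
        then show ?thesis using half(1) by simp
      qed
      then show ?thesis ..
    qed
  next
    case full
    have "in_fam (\<lambda>z. 1, 0, n - 1) p" by (rule in_famI[of p]) (use full in auto)
    then have ?F unfolding fams2_def by blast
    then show ?thesis ..
  qed
qed

section \<open>Joint injectivity of the boundary pieces\<close>

lemma pdom_Double_zero: "z \<in> pdom T n Double \<Longrightarrow> z (n - 2) \<in> interior (points T) \<and> z (n - 2) \<in> points T"
  using interior_subset[of "points T"] by auto

lemma ends_points: "(e, \<sigma>) \<in> ends T \<Longrightarrow> admissible n T \<Longrightarrow> e \<in> points T \<and> e \<notin> interior (points T) \<and> \<sigma> \<noteq> 0"
  by (cases T) auto

lemma ends_unique: "(e, \<sigma>) \<in> ends T \<Longrightarrow> (e, \<sigma>') \<in> ends T \<Longrightarrow> admissible n T \<Longrightarrow> \<sigma> = \<sigma>'"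
  by (cases T) auto

lemma pieces_cases:
  assumes "i \<in> pieces T"
  obtains "i = Double" | e \<sigma> where "i = End e \<sigma>" "(e, \<sigma>) \<in> ends T" | a where "i = Drop" "T = Half_line a"
  using assms unfolding pieces_def by (auto split: poly_domain.splits)

text \<open>The remaining factor is strictly positive on T, so the zeros in T are exactly those of
  the factor that was split off. This zero set is what tells the pieces apart.\<close>

lemma piece_props:
  assumes n: "2 \<le> n" and adm: "admissible n T" and i: "i \<in> pieces T" and z: "z \<in> pdom T n i"
  shows "ppol T n i z \<noteq> 0 \<and> degree (ppol T n i z) \<le> n \<and> nonneg_on T (ppol T n i z) \<and> \<not> spos T n (ppol T n i z) \<and>
    {t \<in> points T. poly (ppol T n i z) t = 0} = (case i of Double \<Rightarrow> {z (n - 2)} | End e \<sigma> \<Rightarrow> {e} | Drop \<Rightarrow> {})"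
  using i
proof (cases rule: pieces_cases)
  case 1
  define q where "q = (if n = 2 then 1 else kpar T (n - 2) z)"
  have q: "spos T (n - 2) q"
  proof (cases "n = 2")
    case True
    then show ?thesis by (cases T) (auto simp: q_def spos_def)
  next
    case False
    then show ?thesis unfolding q_def using n z 1 admissible_minus2[OF adm n] by (auto intro!: kpar_spos)
  qed
  have P: "ppol T n i z = lin (z (n - 2)) ^ 2 * q" by (simp only: 1 ppol.simps q_def)
  have zt: "z (n - 2) \<in> points T" using pdom_Double_zero z unfolding 1 by blast
  have q0: "q \<noteq> 0" using spos_nz[OF adm q] .
  have ev: "poly (ppol T n i z) t = (t - z (n - 2))\<^sup>2 * poly q t" for t by (simp add: P poly_power)
  have qpos: "0 < poly q t" if "t \<in> points T" for t using q that by (simp add: spos_def)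
  have Z: "{t \<in> points T. poly (ppol T n i z) t = 0} = {z (n - 2)}" unfolding ev using zt qpos by fastforce
  have "degree (ppol T n i z) \<le> n"
    unfolding P using degree_mult_le[of "lin (z (n - 2)) ^ 2" q] degree_lin_power2[of "z (n - 2)"] q n unfolding spos_def by linarith
  moreover have "nonneg_on T (ppol T n i z)" unfolding nonneg_on_def ev by (intro ballI mult_nonneg_nonneg zero_le_power2 less_imp_le qpos)
  moreover have "\<not> spos T n (ppol T n i z)"
  proof
    assume "spos T n (ppol T n i z)"
    then have "0 < poly (ppol T n i z) (z (n - 2))" using zt by (simp add: spos_def)
    then show False by (simp add: ev)
  qed
  moreover have "ppol T n i z \<noteq> 0" unfolding P using q0 by simp
  ultimately show ?thesis using Z by (simp add: 1)
next
  case (2 e \<sigma>)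
  define q where "q = kpar T (n - 1) z"
  have "T \<noteq> Full_line" using 2(2) by auto
  then have "admissible (n - 1) T" by (rule admissible_not_full[OF adm])
  then have q: "spos T (n - 1) q" unfolding q_def using n z 2 by (intro kpar_spos) auto
  have P: "ppol T n i z = Polynomial.smult \<sigma> (lin e) * q" by (simp only: 2 ppol.simps q_def)
  have e: "e \<in> points T" "\<sigma> \<noteq> 0" using ends_points[OF 2(2) adm] by auto
  have q0: "q \<noteq> 0" using spos_nz[OF adm q] .
  have ev: "poly (ppol T n i z) t = \<sigma> * (t - e) * poly q t" for t by (simp add: P algebra_simps)
  have sg: "0 \<le> \<sigma> * (t - e)" if "t \<in> points T" for t using 2(2) that by (cases T) auto
  have qpos: "0 < poly q t" if "t \<in> points T" for t using q that by (simp add: spos_def)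
  have Z: "{t \<in> points T. poly (ppol T n i z) t = 0} = {e}" unfolding ev using e qpos by fastforce
  have "degree (Polynomial.smult \<sigma> (lin e)) \<le> 1" by simp
  then have "degree (ppol T n i z) \<le> n"
    unfolding P using degree_mult_le[of "Polynomial.smult \<sigma> (lin e)" q] q n unfolding spos_def by linarith
  moreover have "nonneg_on T (ppol T n i z)" unfolding nonneg_on_def ev by (intro ballI mult_nonneg_nonneg[OF sg less_imp_le[OF qpos]])
  moreover have "\<not> spos T n (ppol T n i z)"
  proof
    assume "spos T n (ppol T n i z)"
    then have "0 < poly (ppol T n i z) e" using e by (simp add: spos_def)
    then show False by (simp add: ev)
  qed
  moreover have "ppol T n i z \<noteq> 0" unfolding P using q0 e by (simp del: mult_pCons_left mult_pCons_right mult_smult_left)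
  ultimately show ?thesis using Z by (simp add: 2)
next
  case (3 a)
  then have q: "spos T (n - 1) (ppol T n i z)" using n z by (auto intro!: kpar_spos)
  have dg: "degree (ppol T n i z) < n" using q n unfolding spos_def by linarith
  then have "coeff (ppol T n i z) n = 0" by (rule coeff_eq_0)
  then have "\<not> spos T n (ppol T n i z)" by (simp add: spos_def 3)
  moreover have "ppol T n i z \<noteq> 0" using spos_nz[OF adm q] .
  moreover have "{t \<in> points T. poly (ppol T n i z) t = 0} = {}" using q by (auto simp: spos_def)
  ultimately show ?thesis using dg spos_nonneg[OF q] by (simp add: 3)
qed

lemma space_lb_eqI: "x \<in> space (lb d) \<Longrightarrow> y \<in> space (lb d) \<Longrightarrow> (\<And>i. i < d \<Longrightarrow> x i = y i) \<Longrightarrow> x = y"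
  unfolding space_lb by (rule PiE_ext) auto

text \<open>The zero set in T is an interior point, an end or empty, according to the piece, and it
  reveals the position of a double zero. Cancelling the common factor leaves the uniqueness of the
  strictly positive part.\<close>

lemma piece_inj:
  assumes n: "2 \<le> n" and adm: "admissible n T" and ij: "i \<in> pieces T" "j \<in> pieces T"
    and x: "x \<in> pdom T n i \<inter> space (lb (n - 1))" and y: "y \<in> pdom T n j \<inter> space (lb (n - 1))"
    and c: "0 < c" "ppol T n i x = Polynomial.smult c (ppol T n j y)"
  shows "i = j \<and> x = y"
proof -
  let ?Z = "\<lambda>i z. case i of Double \<Rightarrow> {z (n - 2)} | End e \<sigma> \<Rightarrow> {e} | Drop \<Rightarrow> ({} :: real set)"
  have "{t \<in> points T. poly (ppol T n i x) t = 0} = {t \<in> points T. poly (ppol T n j y) t = 0}"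
    unfolding c(2) using c(1) by simp
  then have Z: "?Z i x = ?Z j y" using piece_props[OF n adm ij(1), of x] piece_props[OF n adm ij(2), of y] x y by simp
  have xs: "x \<in> space (lb (n - 1))" "y \<in> space (lb (n - 1))" using x y by auto
  from ij(1) show ?thesis
  proof (cases rule: pieces_cases)
    case 1
    from ij(2) have j: "j = Double"
    proof (cases rule: pieces_cases)
      case (2 e \<sigma>)
      then show ?thesis using Z x ends_points[OF 2(2) adm] by (simp add: 1)
    qed (use Z 1 in auto)
    have eq: "x (n - 2) = y (n - 2)" using Z by (simp add: 1 j)
    have "x l = y l" if l: "l < n - 1" for l
    proof (cases "l = n - 2")
      case False
      then have n2: "n \<noteq> 2" and l2: "l < n - 2" using l by auto
      have "lin (y (n - 2)) ^ 2 * kpar T (n - 2) x = lin (y (n - 2)) ^ 2 * Polynomial.smult c (kpar T (n - 2) y)"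
        using c(2) n2 by (simp only: 1 j ppol.simps eq mult_smult_right if_False)
      then have "kpar T (n - 2) x = Polynomial.smult c (kpar T (n - 2) y)" by (simp only: mult_cancel_left lin_sq_nz simp_thms)
      then show ?thesis using x y n2 n l2 by (intro kpar_unique[OF admissible_minus2[OF adm n] _ _ _ c(1)]) (auto simp: 1 j)
    qed (use eq in simp)
    then show ?thesis using space_lb_eqI[OF xs] 1 j by simp
  next
    case (2 e \<sigma>)
    from ij(2) have "\<exists>\<sigma>'. j = End e \<sigma>' \<and> (e, \<sigma>') \<in> ends T"
    proof (cases rule: pieces_cases)
      case 1
      then show ?thesis using Z y ends_points[OF 2(2) adm] by (simp add: 2(1))
    qed (use Z 2 in auto)
    then have j: "j = End e \<sigma>" using ends_unique[OF 2(2) _ adm] by blast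
    have "T \<noteq> Full_line" using 2(2) by auto
    then have adm1: "admissible (n - 1) T" by (rule admissible_not_full[OF adm])
    have nz: "Polynomial.smult \<sigma> (lin e) \<noteq> 0" using ends_points[OF 2(2) adm] by simp
    have "Polynomial.smult \<sigma> (lin e) * kpar T (n - 1) x = Polynomial.smult \<sigma> (lin e) * Polynomial.smult c (kpar T (n - 1) y)"
      using c(2) by (simp only: 2(1) j ppol.simps mult_smult_right)
    then have "kpar T (n - 1) x = Polynomial.smult c (kpar T (n - 1) y)" using nz by (simp only: mult_cancel_left simp_thms)
    then have "x l = y l" if "l < n - 1" for l
      using x y n that by (intro kpar_unique[OF adm1 _ _ _ c(1)]) (auto simp: 2(1) j)
    then show ?thesis using space_lb_eqI[OF xs] 2(1) j by simp
  next
    case (3 a)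
    from ij(2) have j: "j = Drop" by (cases rule: pieces_cases) (use Z 3 in auto)
    have adm1: "admissible (n - 1) T" using 3 by simp
    have "x l = y l" if "l < n - 1" for l
      using x y n that c(2) by (intro kpar_unique[OF adm1 _ _ _ c(1)]) (auto simp: 3(1) j)
    then show ?thesis using space_lb_eqI[OF xs] 3(1) j by simp
  qed
qed

lemma open_pdom: "open (pdom T n i)"
proof (cases i)
  case Double
  have "pdom T n i = (if n = 2 then UNIV else kdom T (n - 2)) \<inter> {z. z (n - 2) \<in> interior (points T)}" by (auto simp: Double)
  moreover have "open (if n = 2 then UNIV else kdom T (n - 2))" by (simp add: open_kdom)
  ultimately show ?thesis by (simp only:) (intro open_Int open_coord open_interior)
qed (simp_all add: open_kdom)

lemma polyC1_ppol:
  assumes n: "2 \<le> n" and adm: "admissible n T" and i: "i \<in> pieces T"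
  shows "polyC1 d D (ppol T n i)"
  using i
proof (cases rule: pieces_cases)
  case 1
  have "polyC1 d D (\<lambda>z. if n = 2 then 1 else kpar T (n - 2) z)"
    by (cases "n = 2") (simp_all add: polyC1_const polyC1_kpar admissible_minus2[OF adm n])
  then have "polyC1 d D (\<lambda>z. lin (z (n - 2)) ^ 2 * (if n = 2 then 1 else kpar T (n - 2) z))"
    by (intro polyC1_mult polyC1_power polyC1_lin)
  then show ?thesis unfolding polyC1_def 1 ppol.simps .
next
  case (2 e \<sigma>)
  have "T \<noteq> Full_line" using 2(2) by auto
  then have "polyC1 d D (\<lambda>z. Polynomial.smult \<sigma> (lin e) * kpar T (n - 1) z)"
    by (intro polyC1_mult polyC1_const polyC1_kpar admissible_not_full[OF adm])
  then show ?thesis unfolding polyC1_def 2(1) ppol.simps .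
next
  case (3 a)
  have "polyC1 d D (\<lambda>z. kpar T (n - 1) z)" using 3 by (intro polyC1_kpar) simp
  then show ?thesis unfolding polyC1_def 3(1) ppol.simps .
qed

lemma AE_coord_neq:
  assumes "i < d" shows "AE z in lb d. z i \<noteq> c"
proof -
  have eq: "{z \<in> space (lb d). z i = c} = PiE {..<d} (\<lambda>j. if j = i then {c} else UNIV)"
  proof (intro equalityI subsetI)
    fix z assume "z \<in> {z \<in> space (lb d). z i = c}"
    then show "z \<in> PiE {..<d} (\<lambda>j. if j = i then {c} else UNIV)" unfolding space_lb by (auto simp: PiE_iff)
  next
    fix z assume "z \<in> PiE {..<d} (\<lambda>j. if j = i then {c} else UNIV)"
    then have "z \<in> extensional {..<d}" "\<And>j. j < d \<Longrightarrow> z j \<in> (if j = i then {c} else UNIV)" by (auto simp: PiE_iff)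
    from this(1) this(2)[OF assms] show "z \<in> {z \<in> space (lb d). z i = c}" unfolding space_lb by (simp add: PiE_iff)
  qed
  have "emeasure (lb d) {z \<in> space (lb d). z i = c} = (\<Prod>j<d. emeasure lborel (if j = i then {c} else UNIV))"
    unfolding eq by (subst lbP.emeasure_PiM) auto
  also have "\<dots> = 0" using assms by (intro prod_zero) (auto intro!: bexI[of _ i])
  finally have "{z \<in> space (lb d). z i = c} \<in> null_sets (lb d)"
    unfolding null_sets_def eq by (auto intro!: sets_PiM_I_finite)
  from AE_not_in[OF this] AE_space[of "lb d"] show ?thesis by eventually_elim blast
qed

context metric_mat
begin

lemma I1_eq:
  assumes N: "N = n + 1" and n: "2 \<le> n"
  shows "J_integral S (n - 1) (pdom T n Double) (\<lambda>z. normalized S (coeff (ppol T n Double z))) = I1 S n T"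
proof -
  define D where "D = {z. (n \<noteq> 2 \<longrightarrow> z \<in> kdom T (n - 2)) \<and> z (n - 2) \<in> points T}"
  \<comment> \<open>The two domains differ only where the last variable is an end of T, that is on
    finitely many hyperplanes.\<close>
  have "AE z in lb (n - 1). \<forall>e\<in>fst ` ends T. z (n - 2) \<noteq> e"
    using finite_ends n by (intro AE_finite_allI AE_coord_neq) auto
  then have "J_integral S (n - 1) (pdom T n Double) g = J_integral S (n - 1) D g" for g
    unfolding J_integral_def
  proof (intro nn_integral_cong_AE, eventually_elim)
    case (elim z)
    then have "z (n - 2) \<in> points T \<longleftrightarrow> z (n - 2) \<in> interior (points T)"
      using points_cases[of "z (n - 2)" T] interior_subset[of "points T"] by force
    then have "z \<in> pdom T n Double \<longleftrightarrow> z \<in> D" by (simp add: D_def)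
    then show ?case by (simp add: indicator_def)
  qed
  then have 1: "J_integral S (n - 1) (pdom T n Double) (\<lambda>z. normalized S (coeff (ppol T n Double z)))
      = J_integral S (n - 1) D (\<lambda>z. normalized S (coeff (ppol T n Double z)))" .
  show ?thesis
  proof (cases "n = 2")
    case True
    have "D = {z. z 0 \<in> points T}" by (simp add: D_def True)
    moreover have "coeff (ppol T n Double z) = phi2_double 1 (z 0)" for z
      by (simp add: phi2_double_def True del: power2_eq_square)
    ultimately show ?thesis unfolding 1 I1_def using True by simp
  next
    case False
    have "n - 2 - 1 = n - 3" by simp
    then have "D = {z. z 0 \<in> {0<..<pi/2} \<and> z \<in> Delta T (n - 3) \<and> z (n - 2) \<in> points T}"
      using False unfolding D_def kdom_def by auto
    moreover have "coeff (ppol T n Double z) = phi_zero T 2 n (cos (z 0)) (sin (z 0)) z (z (n - 2))" for z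
      using False by (simp only: phi_zero_def ppol.simps kpar_def if_False)
    ultimately show ?thesis unfolding 1 I1_def using False by simp
  qed
qed

text \<open>For \<sigma> = -1, which happens at the right end of a segment, the normalized vector
  changes its sign, and the Jacobian does not.\<close>

lemma I_end_eq:
  assumes N: "N = n + 1" and n: "2 \<le> n" and adm: "admissible n T" and e: "(e, \<sigma>) \<in> ends T"
  shows "J_integral S (n - 1) (pdom T n (End e \<sigma>)) (\<lambda>z. normalized S (coeff (ppol T n (End e \<sigma>) z))) = I_end S n T e"
proof -
  define g where "g z = normalized S (phi_zero T 1 n (cos (z 0)) (sin (z 0)) z e)" for z
  have g: "g z = normalized S (coeff (lin e * kpar T (n - 1) z))" for z
    by (simp only: g_def phi_zero_def kpar_def power_one_right)
  have \<sigma>: "\<sigma> = 1 \<or> \<sigma> = - 1" using e by (cases T) auto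
  have full: "T \<noteq> Full_line" using e by auto
  then have adm1: "admissible (n - 1) T" by (rule admissible_not_full[OF adm])
  have C1: "C1_on (n - 1) (kdom T (n - 1)) (\<lambda>z. g z i)" for i
    unfolding g
  proof (rule normalized_C1)
    show "polyC1 (n - 1) (kdom T (n - 1)) (\<lambda>z. lin e * kpar T (n - 1) z)"
      by (intro polyC1_mult polyC1_const polyC1_kpar adm1)
    fix z assume z: "z \<in> kdom T (n - 1)"
    have q: "spos T (n - 1) (kpar T (n - 1) z)" using n by (intro kpar_spos adm1 z) simp
    have "degree (lin e) \<le> 1" by simp
    then have "degree (lin e * kpar T (n - 1) z) < N"
      using degree_mult_le[of "lin e" "kpar T (n - 1) z"] q n N unfolding spos_def by linarith
    then show "lin e * kpar T (n - 1) z \<noteq> 0 \<and> degree (lin e * kpar T (n - 1) z) < N"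
      using spos_nz[OF adm q] by (simp del: mult_pCons_left mult_pCons_right)
  qed
  have "J S (n - 1) (\<lambda>z. normalized S (coeff (ppol T n (End e \<sigma>) z))) z = J S (n - 1) g z" if z: "z \<in> kdom T (n - 1)" for z
    using \<sigma>
  proof
    assume "\<sigma> = 1"
    then have "(\<lambda>z. normalized S (coeff (ppol T n (End e \<sigma>) z))) = g"
      by (intro ext) (simp only: g ppol.simps smult_1_left)
    then show ?thesis by simp
  next
    assume s: "\<sigma> = - 1"
    have nc: "normalized S (\<lambda>i. (- 1) * v i) = (\<lambda>i. - normalized S v i)" for v
      unfolding normalized_def norm_inv_scale by simp
    have c: "coeff (ppol T n (End e \<sigma>) z) = (\<lambda>i. (- 1) * coeff (lin e * kpar T (n - 1) z) i)" for z
      unfolding s ppol.simps mult_smult_left by (intro ext) (simp only: coeff_smult)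
    have "(\<lambda>z. normalized S (coeff (ppol T n (End e \<sigma>) z))) = (\<lambda>z i. - g z i)"
      by (intro ext) (simp only: c nc g)
    then show ?thesis using J_minus[where g=g, OF C1 z] by simp
  qed
  then show ?thesis
    unfolding I_end_def J_integral_def g_def[abs_def, symmetric]
    by (intro nn_integral_cong) (auto simp: indicator_def kdom_def numeral_2_eq_2)
qed

end

theorem proposition3p6:
  fixes n :: nat and T :: poly_domain and \<Sigma> :: "real mat"
  assumes "n \<ge> 1" and "admissible n T" and "pos_def_mat (n + 1) \<Sigma>"
  shows "Vol \<Sigma> n (nonneg_cone n T \<inter> unit_sphere \<Sigma>)
      = J_integral \<Sigma> n {z. z 0 \<in> {0<..<pi/2} \<and> z \<in> Delta T (n - 1)}
          (\<lambda>z. normalized \<Sigma> (phi T n (cos (z 0)) (sin (z 0)) z))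
    \<and> (n \<ge> 2 \<longrightarrow>
        Vol \<Sigma> (n - 1) ((Euclidean_space (n + 1) frontier_of nonneg_cone n T) \<inter> unit_sphere \<Sigma>)
          = I1 \<Sigma> n T + I2 \<Sigma> n T + I3 \<Sigma> n T + I4 \<Sigma> n T)"
proof (intro conjI impI)
  interpret metric_mat \<Sigma> "n + 1" by (rule pos_def_metric_mat[OF assms(3)])
  have cone: "nonneg_cone n T = {coeff p | p. degree p \<le> n \<and> nonneg_on T p}" using nonneg_cone_iff by blast
  have "Vol \<Sigma> n ({coeff p | p. degree p \<le> n \<and> nonneg_on T p} \<inter> unit_sphere \<Sigma>)
      = (\<Sum>i\<in>{()}. J_integral \<Sigma> n (kdom T n) (\<lambda>z. normalized \<Sigma> (coeff (kpar T n z))))"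
  \<comment> \<open>The full-dimensional volume is the case of a single piece, indexed by the unit
    type.\<close>
  proof (rule cone_volume[where F="fams T n" and D="\<lambda>_. kdom T n" and P="\<lambda>_. kpar T n"])
    show "open (kdom T n)" by (rule open_kdom)
    show "polyC1 n (kdom T n) (kpar T n)" by (rule polyC1_kpar[OF assms(2)])
    show "kpar T n z \<noteq> 0 \<and> degree (kpar T n z) \<le> n \<and> nonneg_on T (kpar T n z)" if "z \<in> kdom T n" for z
      using kpar_spos[OF assms(2,1) that] spos_nz[OF assms(2)] spos_nonneg by (auto simp: spos_def)
    show "finite (fams T n)" unfolding fams_def using finite_ends by simp
    show "null_fam n (n + 1) f" if "f \<in> fams T n" for f by (rule null_fams[OF assms(1) that])
    fix i j :: unit and x y c
    assume "x \<in> kdom T n \<inter> space (lb n)" "y \<in> kdom T n \<inter> space (lb n)" "0 < c" "kpar T n x = Polynomial.smult c (kpar T n y)"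
    then show "i = j \<and> x = y" using kpar_unique[OF assms(2,1), of x y c] space_lb_eqI[of x n y] by auto
  next
    fix p assume "degree p \<le> n \<and> nonneg_on T p" "p \<noteq> 0"
    then show "(\<exists>i\<in>{()}. \<exists>z\<in>kdom T n \<inter> space (lb n). \<exists>c>0. p = Polynomial.smult c (kpar T n z)) \<or> (\<exists>f\<in>fams T n. in_fam f p)"
      using interior_cover[OF assms(1,2), of p] by simp
  next
    fix p :: "real poly" and c :: real
    assume "0 < c" "degree p \<le> n \<and> nonneg_on T p"
    then show "degree (Polynomial.smult c p) \<le> n \<and> nonneg_on T (Polynomial.smult c p)" by (simp add: nonneg_on_smult)
  qed (use assms(1) in auto)
  then show "Vol \<Sigma> n (nonneg_cone n T \<inter> unit_sphere \<Sigma>)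
      = J_integral \<Sigma> n {z. z 0 \<in> {0<..<pi/2} \<and> z \<in> Delta T (n - 1)}
          (\<lambda>z. normalized \<Sigma> (phi T n (cos (z 0)) (sin (z 0)) z))"
    unfolding cone by (simp add: kdom_def kpar_def phi_def)
  assume n: "2 \<le> n"
  let ?Q = "\<lambda>p. degree p \<le> n \<and> nonneg_on T p \<and> \<not> spos T n p"
  let ?J = "\<lambda>i. J_integral \<Sigma> (n - 1) (pdom T n i) (\<lambda>z. normalized \<Sigma> (coeff (ppol T n i z)))"
  have "Vol \<Sigma> (n - 1) ({coeff p | p. ?Q p} \<inter> unit_sphere \<Sigma>) = (\<Sum>i\<in>pieces T. ?J i)"
  proof (rule cone_volume[where F="fams2 T n"])
    show "0 < n - 1" using n by simp
    show "finite (fams2 T n)" unfolding fams2_def using finite_ends by simp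
    show "null_fam (n - 1) (n + 1) f" if "f \<in> fams2 T n" for f by (rule null_fams2[OF n that])
    show "open (pdom T n i)" for i by (rule open_pdom)
    show "polyC1 (n - 1) (pdom T n i) (ppol T n i)" if "i \<in> pieces T" for i by (rule polyC1_ppol[OF n assms(2) that])
    show "ppol T n i z \<noteq> 0 \<and> ?Q (ppol T n i z)" if "i \<in> pieces T" "z \<in> pdom T n i" for i z
      using piece_props[OF n assms(2) that] by simp
    show "(\<exists>i\<in>pieces T. \<exists>z\<in>pdom T n i \<inter> space (lb (n - 1)). \<exists>c>0. p = Polynomial.smult c (ppol T n i z)) \<or> (\<exists>f\<in>fams2 T n. in_fam f p)"
      if "?Q p" "p \<noteq> 0" for p using boundary_cover[OF n assms(2), of p] that by simp
    show "?Q (Polynomial.smult c p)" if "0 < c" "?Q p" for p c using that by (simp add: nonneg_on_smult spos_smult)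
    show "i = j \<and> x = y"
      if "i \<in> pieces T" "j \<in> pieces T" "x \<in> pdom T n i \<inter> space (lb (n - 1))" "y \<in> pdom T n j \<inter> space (lb (n - 1))" "0 < c"
        "ppol T n i x = Polynomial.smult c (ppol T n j y)" for i j x y c
      by (rule piece_inj[OF n assms(2) that])
  qed (auto simp: finite_pieces)
  also have "\<dots> = I1 \<Sigma> n T + I2 \<Sigma> n T + I3 \<Sigma> n T + I4 \<Sigma> n T"
  proof (cases T)
    case (Segment a b)
    then have "a \<noteq> b" and p: "pieces T = {Double, End a 1, End b (- 1)}" using assms(2) by (auto simp: pieces_def)
    then have "(\<Sum>i\<in>pieces T. ?J i) = ?J Double + (?J (End a 1) + ?J (End b (- 1)))" by simp
    also have "?J Double = I1 \<Sigma> n T" by (rule I1_eq[OF refl n])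
    also have "?J (End a 1) = I_end \<Sigma> n T a" by (rule I_end_eq[OF refl n assms(2)]) (simp add: Segment)
    also have "?J (End b (- 1)) = I_end \<Sigma> n T b" by (rule I_end_eq[OF refl n assms(2)]) (simp add: Segment)
    finally show ?thesis by (simp add: I2_def I3_def I4_def Segment add.assoc)
  next
    case (Half_line a)
    then have p: "pieces T = {Double, End a 1, Drop}" by (auto simp: pieces_def)
    then have "(\<Sum>i\<in>pieces T. ?J i) = ?J Double + (?J (End a 1) + ?J Drop)" by simp
    also have "?J Double = I1 \<Sigma> n T" by (rule I1_eq[OF refl n])
    also have "?J (End a 1) = I_end \<Sigma> n T a" by (rule I_end_eq[OF refl n assms(2)]) (simp add: Half_line)
    also have "?J Drop = I4 \<Sigma> n T" by (simp add: I4_def Half_line kdom_def kpar_def phi_def numeral_2_eq_2)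
    finally show ?thesis by (simp add: I2_def I3_def Half_line add.assoc)
  next
    case Full_line
    then have "(\<Sum>i\<in>pieces T. ?J i) = ?J Double" by (simp add: pieces_def)
    also have "\<dots> = I1 \<Sigma> n T" by (rule I1_eq[OF refl n])
    finally show ?thesis by (simp add: I2_def I3_def I4_def Full_line)
  qed
  finally show "Vol \<Sigma> (n - 1) ((Euclidean_space (n + 1) frontier_of nonneg_cone n T) \<inter> unit_sphere \<Sigma>)
      = I1 \<Sigma> n T + I2 \<Sigma> n T + I3 \<Sigma> n T + I4 \<Sigma> n T"
    unfolding frontier_nonneg_cone[OF assms(2)] .
qed

end
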